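(* Let $A$ be a periodic abelian group. Then there is a subgroup $\Delta$ of $\mathrm{IAut}(A)$ which is a direct product of finite abelian groups and such that $$\mathrm{IAut}(A)=\mathrm{PAut}(A)\cdot \mathrm{FAut}(A)\cdot \Delta,$$ where $\Delta$ is trivial if $A$ is reduced. Moreover, there are a set $\pi$ of primes and subgroups $\Sigma$, $\Psi$ of $\mathrm{IAut}(A)$ such that $\Sigma$ is an abelian $\pi'$-group with bounded primary components and $$\mathrm{FAut}(A)\cdot\Delta=\mathrm{FAut}(A_\pi)\times(\Sigma\rtimes\Psi),$$ where the automorphisms induced by $\Psi$ via conjugation on $\Sigma$ are inertial and this action is faithful.
   Context: Abelian groups $A$ are written additively; endomorphisms act on the right. An automorphism $\gamma$ of an abelian group $A$ is called inertial if $(H+H\gamma)/H$ is finite for each subgroup $H\le A$. $\mathrm{IAut}(A)$ denotes the subgroup of $\mathrm{Aut}(A)$ generated by all inertial automorphisms of $A$. An automorphism $\gamma$ is finitary if it acts as the identity on a subgroup of finite index of $A$ (equivalently, $A(\gamma-1)$ is finite); $\mathrm{FAut}(A)$ is the group of finitary automorphisms of $A$. A power automorphism is an automorphism leaving every subgroup invariant; $\mathrm{PAut}(A)$ is the group of power automorphisms of $A$. Direct products of infinitely many groups are restricted direct products. For a set of primes $\pi$, $\pi'$ is the complementary set of primes and $A_\pi$ is the unique maximum $\pi$-subgroup of $A$; $\mathrm{FAut}(A_\pi)$ is regarded as naturally embedded in $\mathrm{FAut}(A)$ via $\varphi\mapsto\varphi\oplus 1$ with respect to $A=A_\pi\oplus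 A_{\pi'}$. A group is reduced if its maximal divisible subgroup is trivial; bounded means of finite exponent. *)

theory Defs
  imports "HOL-Algebra.Group_Action" "HOL-Algebra.Product_Groups" "HOL-Algebra.Multiplicative_Group"
    "HOL-Computational_Algebra.Primes"
begin

text \<open>
  Abelian groups are written multiplicatively, as in \<open>HOL-Algebra\<close>. A subgroup \<open>H\<close> of
  \<open>G\<close>, regarded as a group, is \<open>G\<lparr>carrier := H\<rparr>\<close>.

  The multiplication of \<^const>\<open>AutoGroup\<close> is composition of maps acting on the left, so
  \<^term>\<open>AutoGroup A\<close> is the opposite of the group of automorphisms acting on the right.
  Inversion is an isomorphism between the two which maps every subgroup to itself and
  transports products of subgroups, direct and semidirect products unchanged.
\<close>

section \<open>Periodic, bounded and \<open>\<pi>\<close>-groups\<close>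

definition periodic :: "('a, 'b) monoid_scheme \<Rightarrow> bool" where
  "periodic G \<longleftrightarrow> (\<forall>x\<in>carrier G. group.ord G x \<noteq> 0)"

definition bounded_group :: "('a, 'b) monoid_scheme \<Rightarrow> bool" where
  "bounded_group G \<longleftrightarrow> (\<exists>n::nat. n > 0 \<and> (\<forall>x\<in>carrier G. x [^]\<^bsub>G\<^esub> n = \<one>\<^bsub>G\<^esub>))"

definition pi_group :: "nat set \<Rightarrow> ('a, 'b) monoid_scheme \<Rightarrow> bool" where
  "pi_group \<pi> G \<longleftrightarrow>
     (\<forall>x\<in>carrier G. group.ord G x \<noteq> 0 \<and> (\<forall>p. prime p \<and> p dvd group.ord G x \<longrightarrow> p \<in> \<pi>))"

definition primes :: "nat set" where
  "primes = {p. prime p}"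

text \<open>The greatest \<open>\<pi>\<close>-subgroup; it exists for abelian groups, see \<open>pi_part_eq\<close>.\<close>

definition pi_part :: "('a, 'b) monoid_scheme \<Rightarrow> nat set \<Rightarrow> 'a set" where
  "pi_part G \<pi> = (GREATEST H. subgroup H G \<and> pi_group \<pi> (G\<lparr>carrier := H\<rparr>))"

definition bounded_primary_components :: "('a, 'b) monoid_scheme \<Rightarrow> bool" where
  "bounded_primary_components G \<longleftrightarrow>
     (\<forall>p\<in>primes. bounded_group (G\<lparr>carrier := pi_part G {p}\<rparr>))"

section \<open>Divisible subgroups\<close>

definition divisible :: "('a, 'b) monoid_scheme \<Rightarrow> bool" where
  "divisible G \<longleftrightarrow> (\<forall>n::nat. n > 0 \<longrightarrow> (\<forall>x\<in>carrier G. \<exists>y\<in>carrier G. y [^]\<^bsub>G\<^esub> n = x))"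

text \<open>The greatest divisible subgroup exists for abelian groups, see \<open>max_divisible_eq\<close>.\<close>

definition max_divisible :: "('a, 'b) monoid_scheme \<Rightarrow> 'a set" where
  "max_divisible G = (GREATEST D. subgroup D G \<and> divisible (G\<lparr>carrier := D\<rparr>))"

definition reduced :: "('a, 'b) monoid_scheme \<Rightarrow> bool" where
  "reduced G \<longleftrightarrow> max_divisible G = {\<one>\<^bsub>G\<^esub>}"

section \<open>Groups of automorphisms\<close>

definition inertial :: "('a, 'b) monoid_scheme \<Rightarrow> ('a \<Rightarrow> 'a) \<Rightarrow> bool" where
  "inertial A \<gamma> \<longleftrightarrow> \<gamma> \<in> auto A \<and>
     (\<forall>H. subgroup H A \<longrightarrow>
        finite (carrier ((A\<lparr>carrier := H <#>\<^bsub>A\<^esub> (\<gamma> ` H)\<rparr>) Mod H)))"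

definition IAut :: "('a, 'b) monoid_scheme \<Rightarrow> ('a \<Rightarrow> 'a) set" where
  "IAut A = generate (AutoGroup A) {\<gamma>. inertial A \<gamma>}"

definition FAut :: "('a, 'b) monoid_scheme \<Rightarrow> ('a \<Rightarrow> 'a) set" where
  "FAut A = {\<gamma> \<in> auto A. \<exists>H. subgroup H A \<and> finite (rcosets\<^bsub>A\<^esub> H) \<and> (\<forall>x\<in>H. \<gamma> x = x)}"

definition PAut :: "('a, 'b) monoid_scheme \<Rightarrow> ('a \<Rightarrow> 'a) set" where
  "PAut A = {\<gamma> \<in> auto A. \<forall>H. subgroup H A \<longrightarrow> \<gamma> ` H = H}"

text \<open>
  The image of \<open>FAut(A\<^sub>\<pi>)\<close> under \<open>\<phi> \<mapsto> \<phi> \<oplus> 1\<close>. For periodic \<open>A\<close> every element is of the form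
  \<open>a \<otimes> b\<close> as below, so that \<open>\<gamma>\<close> is determined by \<open>\<phi>\<close>.
\<close>

definition FAut_part :: "('a, 'b) monoid_scheme \<Rightarrow> nat set \<Rightarrow> ('a \<Rightarrow> 'a) set" where
  "FAut_part A \<pi> = {\<gamma> \<in> auto A. \<exists>\<phi>\<in>FAut (A\<lparr>carrier := pi_part A \<pi>\<rparr>).
     \<forall>a\<in>pi_part A \<pi>. \<forall>b\<in>pi_part A (primes - \<pi>). \<gamma> (a \<otimes>\<^bsub>A\<^esub> b) = \<phi> a \<otimes>\<^bsub>A\<^esub> b}"

section \<open>Direct and semidirect products\<close>

text \<open>
  \<^const>\<open>sum_group\<close> is the restricted direct product. The types of the index set and of the
  factors are no restriction: the nontrivial factors of a direct decomposition of \<open>G\<close>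
  are isomorphic to distinct subgroups of \<open>G\<close>, by which they can be indexed.
\<close>

definition direct_product_of_finite_abelian :: "('g, 'b) monoid_scheme \<Rightarrow> bool" where
  "direct_product_of_finite_abelian G \<longleftrightarrow>
     (\<exists>(I :: 'g set set) (F :: 'g set \<Rightarrow> 'g monoid).
        (\<forall>i\<in>I. comm_group (F i) \<and> finite (carrier (F i))) \<and> G \<cong> sum_group I F)"

definition internal_direct_product ::
    "('g, 'b) monoid_scheme \<Rightarrow> 'g set \<Rightarrow> 'g set \<Rightarrow> 'g set \<Rightarrow> bool" where
  "internal_direct_product G L H K \<longleftrightarrow>
     subgroup L G \<and> H \<lhd> G\<lparr>carrier := L\<rparr> \<and> K \<lhd> G\<lparr>carrier := L\<rparr> \<and>
     H \<inter> K = {\<one>\<^bsub>G\<^esub>} \<and> L = H <#>\<^bsub>G\<^esub> K"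

definition internal_semidirect_product ::
    "('g, 'b) monoid_scheme \<Rightarrow> 'g set \<Rightarrow> 'g set \<Rightarrow> 'g set \<Rightarrow> bool" where
  "internal_semidirect_product G L N K \<longleftrightarrow>
     subgroup L G \<and> N \<lhd> G\<lparr>carrier := L\<rparr> \<and> subgroup K (G\<lparr>carrier := L\<rparr>) \<and>
     N \<inter> K = {\<one>\<^bsub>G\<^esub>} \<and> L = N <#>\<^bsub>G\<^esub> K"

text \<open>
  With maps acting on the left, \<open>g \<otimes> x \<otimes> inv g\<close> is the element \<open>x\<^sup>g = g\<^sup>-\<^sup>1xg\<close> of the group of
  automorphisms acting on the right.
\<close>

definition conj_action :: "('g, 'b) monoid_scheme \<Rightarrow> 'g set \<Rightarrow> 'g \<Rightarrow> 'g \<Rightarrow> 'g" where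
  "conj_action G N g = (\<lambda>x\<in>N. g \<otimes>\<^bsub>G\<^esub> x \<otimes>\<^bsub>G\<^esub> inv\<^bsub>G\<^esub> g)"

section \<open>Existence of the greatest subgroups\<close>

lemma (in group) ord_subgroup:
  "group.ord (G\<lparr>carrier := H\<rparr>) x = ord x" if "subgroup H G"
  using that subgroup.subgroup_is_group[OF that is_group]
  by (simp add: group.ord_def ord_def flip: nat_pow_consistent)

lemma (in comm_group) pi_part_eq:
  fixes \<pi> :: "nat set"
  defines "P \<equiv> {x \<in> carrier G. ord x \<noteq> 0 \<and> (\<forall>p. prime p \<and> p dvd ord x \<longrightarrow> p \<in> \<pi>)}"
  shows "pi_part G \<pi> = P" "subgroup P G" "pi_group \<pi> (G\<lparr>carrier := P\<rparr>)"
proof -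
  show sub: "subgroup P G"
  proof
    show "x \<otimes> y \<in> P" if "x \<in> P" "y \<in> P" for x y
    proof -
      have xy: "x \<in> carrier G" "y \<in> carrier G" using that by (auto simp: P_def)
      have "(x \<otimes> y) [^] (ord x * ord y) = \<one>"
        using xy pow_eq_id[of x "ord x * ord y"] pow_eq_id[of y "ord x * ord y"]
        by (simp add: nat_pow_distrib)
      then have d: "ord (x \<otimes> y) dvd ord x * ord y"
        using xy by (simp add: pow_eq_id)
      have "ord (x \<otimes> y) \<noteq> 0"
        using d that by (intro notI) (simp add: P_def)
      moreover have "p \<in> \<pi>" if "prime p" "p dvd ord (x \<otimes> y)" for p
      proof -
        have "p dvd ord x * ord y" using that d by (blast intro: dvd_trans)
        then have "p dvd ord x \<or> p dvd ord y" using that by (simp add: prime_dvd_mult_iff)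
        then show ?thesis using that \<open>x \<in> P\<close> \<open>y \<in> P\<close> by (auto simp: P_def)
      qed
      ultimately show ?thesis using xy by (auto simp: P_def)
    qed
  qed (auto simp: P_def)
  show pi: "pi_group \<pi> (G\<lparr>carrier := P\<rparr>)"
    using sub by (auto simp: pi_group_def ord_subgroup P_def)
  have "H \<subseteq> P" if "subgroup H G" "pi_group \<pi> (G\<lparr>carrier := H\<rparr>)" for H
    using that subgroup.mem_carrier[OF that(1)]
    by (auto simp: pi_group_def ord_subgroup P_def)
  with sub pi show "pi_part G \<pi> = P"
    unfolding pi_part_def by (intro Greatest_equality) auto
qed

lemma (in comm_group) max_divisible_eq:
  defines "M \<equiv> \<Union>{D. subgroup D G \<and> divisible (G\<lparr>carrier := D\<rparr>)}"
  shows "max_divisible G = M" "subgroup M G" "divisible (G\<lparr>carrier := M\<rparr>)"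
proof -
  have triv: "divisible (G\<lparr>carrier := {\<one>}\<rparr>)"
    by (simp add: divisible_def flip: nat_pow_consistent)
  have mult: "divisible (G\<lparr>carrier := D <#> E\<rparr>)"
    if D: "subgroup D G" "divisible (G\<lparr>carrier := D\<rparr>)"
    and E: "subgroup E G" "divisible (G\<lparr>carrier := E\<rparr>)" for D E
    unfolding divisible_def
  proof (intro allI impI ballI)
    fix n :: nat and z assume n: "n > 0" and z: "z \<in> carrier (G\<lparr>carrier := D <#> E\<rparr>)"
    then obtain x y where xy: "x \<in> D" "y \<in> E" "z = x \<otimes> y" by (auto simp: set_mult_def)
    obtain x' where x': "x' \<in> D" "x' [^] n = x"
      using D(2) n xy(1) by (auto simp: divisible_def simp flip: nat_pow_consistent)
    obtain y' where y': "y' \<in> E" "y' [^] n = y"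
      using E(2) n xy(2) by (auto simp: divisible_def simp flip: nat_pow_consistent)
    have "(x' \<otimes> y') [^] n = z"
      using x' y' xy subgroup.mem_carrier[OF D(1)] subgroup.mem_carrier[OF E(1)]
      by (simp add: nat_pow_distrib)
    with x' y' show "\<exists>w\<in>carrier (G\<lparr>carrier := D <#> E\<rparr>). w [^]\<^bsub>G\<lparr>carrier := D <#> E\<rparr>\<^esub> n = z"
      by (auto simp: set_mult_def simp flip: nat_pow_consistent)
  qed
  show sub: "subgroup M G"
  proof
    show "M \<subseteq> carrier G" by (auto simp: M_def dest: subgroup.mem_carrier)
    show "\<one> \<in> M" using triv triv_subgroup by (auto simp: M_def)
    show "inv x \<in> M" if "x \<in> M" for x
      using that by (auto simp: M_def intro: subgroup.m_inv_closed)
    show "x \<otimes> y \<in> M" if xy: "x \<in> M" "y \<in> M" for x y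
    proof -
      obtain D E where D: "subgroup D G" "divisible (G\<lparr>carrier := D\<rparr>)" "x \<in> D"
        and E: "subgroup E G" "divisible (G\<lparr>carrier := E\<rparr>)" "y \<in> E"
        using xy by (auto simp: M_def)
      have "x \<otimes> y \<in> D <#> E" using D E by (auto simp: set_mult_def)
      moreover have "subgroup (D <#> E) G" using D E by (simp add: mult_subgroups)
      ultimately show ?thesis using mult D E by (auto simp: M_def)
    qed
  qed
  show div: "divisible (G\<lparr>carrier := M\<rparr>)"
    unfolding divisible_def
  proof (intro allI impI ballI)
    fix n :: nat and x assume n: "n > 0" and "x \<in> carrier (G\<lparr>carrier := M\<rparr>)"
    then obtain D where D: "subgroup D G" "divisible (G\<lparr>carrier := D\<rparr>)" "x \<in> D"
      by (auto simp: M_def)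
    then obtain y where "y \<in> D" "y [^] n = x"
      using n by (auto simp: divisible_def simp flip: nat_pow_consistent)
    with D show "\<exists>y\<in>carrier (G\<lparr>carrier := M\<rparr>). y [^]\<^bsub>G\<lparr>carrier := M\<rparr>\<^esub> n = x"
      by (auto simp: M_def simp flip: nat_pow_consistent)
  qed
  show "max_divisible G = M"
    unfolding max_divisible_def by (intro Greatest_equality) (use sub div in \<open>auto simp: M_def\<close>)
qed

end

theory Submission
  imports Defs "HOL-Algebra.SndIsomorphismGrp"
begin

text \<open>
  An inertial automorphism \<open>f\<close> is almost a power map: there is a finite subgroup \<open>F\<close> such that
  \<open>f x\<close> lies in \<open>\<langle>x\<rangle>F\<close> whenever \<open>\<langle>x\<rangle>\<close> meets \<open>F\<close> trivially, since otherwise one picks recursively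
  elements \<open>x\<^sub>i\<close> whose images under \<open>f\<close> are distinct modulo the subgroup generated by the \<open>x\<^sub>i\<close>.
  So \<open>f\<close> is a power map on all but finitely many primary components \<open>A\<^sub>p\<close>. If all the socles of
  the groups \<open>p\<^sup>nA\<^sub>p\<close> are infinite, then comparing \<open>f\<close> at \<open>y\<close> and at \<open>y + k\<close>, where \<open>k\<close> has large order and
  avoids any prescribed finite subgroup, shows that \<open>f\<close> agrees modulo \<open>F\<close> with a \<open>p\<close>-adic multiplication.
  Otherwise some \<open>p\<^sup>MA\<^sub>p\<close> is divisible with finite socle, hence a direct summand \<open>D\<^sub>p\<close>
  with bounded complement \<open>B\<^sub>p\<close>; then \<open>f\<close> is a multiplication on \<open>D\<^sub>p\<close> and, up to a finite subgroup, a
  possibly different one on \<open>B\<^sub>p\<close>. If \<open>D\<^sub>p \<noteq> 0\<close> the prime is called critical, and the discrepancy of the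
  two multiplications is accounted for by \<open>\<Delta>\<close>, the group of automorphisms that act trivially on \<open>D\<close> and
  by a multiplication on each of finitely many \<open>B\<^sub>p\<close>.

  For the second part \<open>\<pi>\<close> is the set of non-critical primes. Finitary automorphisms fix the divisible
  group \<open>D = \<Oplus>D\<^sub>p\<close>. Accordingly \<open>\<Sigma>\<close> consists of the maps \<open>1 + \<theta>\<close> with \<open>\<theta>\<close> a homomorphism
  of finite image from \<open>B = \<Oplus>B\<^sub>p\<close> to \<open>D\<close>, and \<open>\<Psi>\<close> of the elements of \<open>FAut(A)\<Delta>\<close> that act only on \<open>B\<close>; the
  conjugation action is \<open>\<theta> \<mapsto> \<theta>\<psi>\<^sup>-\<^sup>1\<close>.
\<close>

section \<open>Abelian groups and their endomorphisms\<close>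

text \<open>Test elements avoiding a given finite subgroup need an infinite socle. At a critical
  prime the divisible part has finite rank, so its exponent must come from inertia alone: along a
  chain of successive p-th roots of \<open>x\<close> two values of \<open>f\<close> agree modulo the
  group \<open>H\<close> generated by the chain, and since \<open>p ^ n - 1\<close> acts invertibly
  on a p-group, this puts \<open>f x\<close> into \<open>H\<close>. Conversely, finite rank of that
  part and boundedness of \<open>B \<inter> pp {p}\<close> are what make the elements of
  \<open>Delta_at p\<close> inertial. Finitary automorphisms fix \<open>D\<close> because
  \<open>f x \<otimes> inv x\<close> takes finitely many values, hence values of bounded order,
  while \<open>D\<close> is divisible. So conjugation by \<Psi> leaves the values of \<theta> alone.
  Each element of \<Psi> is a finitary map times an element of \<Delta>. The latter acts on \<Sigma>
  by powers, since it acts by powers on each critical \<open>B \<inter> pp {p}\<close>; the former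
  changes elements of \<Sigma> only by factors from a finite set, since \<open>D\<close> has finite
  n-torsion. Faithfulness needs enough homomorphisms of finite image into \<open>D\<close> to
  separate the points of these groups.\<close>

context comm_group
begin

lemma inv_cancel1: "x \<in> carrier G \<Longrightarrow> y \<in> carrier G \<Longrightarrow> x \<otimes> (inv x \<otimes> y) = y"
  by (simp flip: m_assoc)

lemma inv_cancel2: "x \<in> carrier G \<Longrightarrow> y \<in> carrier G \<Longrightarrow> inv x \<otimes> (x \<otimes> y) = y"
  by (simp flip: m_assoc)

text \<open>The attribute makes the method \<open>algebra\<close> decide word problems in abelian groups.\<close>

lemmas comm_group_simprules [algebra comm_group "(\<otimes>)" "m_inv G" "\<one>"] =
  m_closed inv_closed one_closed int_pow_closed nat_pow_closed
  m_assoc l_one l_inv m_comm m_lcomm r_one r_inv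
  inv_mult inv_inv inv_one inv_cancel1 inv_cancel2

lemma eq_iff_quotient: "x \<in> carrier G \<Longrightarrow> y \<in> carrier G \<Longrightarrow> x = y \<longleftrightarrow> x \<otimes> inv y = \<one>"
  by (metis inv_closed inv_equality inv_inv r_inv)

lemma endo_closed: "f \<in> hom G G \<Longrightarrow> x \<in> carrier G \<Longrightarrow> f x \<in> carrier G"
  by (rule hom_in_carrier)

lemma endo_mult:
  "f \<in> hom G G \<Longrightarrow> x \<in> carrier G \<Longrightarrow> y \<in> carrier G \<Longrightarrow> f (x \<otimes> y) = f x \<otimes> f y"
  by (rule hom_mult)

lemma endo_one: "f \<in> hom G G \<Longrightarrow> f \<one> = \<one>"
  using hom_one is_group by blast

lemma endo_inv: "f \<in> hom G G \<Longrightarrow> x \<in> carrier G \<Longrightarrow> f (inv x) = inv (f x)"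
  by (intro group_hom.hom_inv) (auto simp: group_hom_def group_hom_axioms_def)

lemma endo_int_pow: "f \<in> hom G G \<Longrightarrow> x \<in> carrier G \<Longrightarrow> f (x [^] (k::int)) = f x [^] k"
  by (intro group_hom.hom_int_pow) (auto simp: group_hom_def group_hom_axioms_def)

lemma endo_nat_pow: "f \<in> hom G G \<Longrightarrow> x \<in> carrier G \<Longrightarrow> f (x [^] (k::nat)) = f x [^] k"
  by (intro group_hom.hom_nat_pow) (auto simp: group_hom_def group_hom_axioms_def)

lemmas endo_simps = endo_closed endo_mult endo_one endo_inv endo_int_pow endo_nat_pow

lemma ord_endo_dvd: "f \<in> hom G G \<Longrightarrow> x \<in> carrier G \<Longrightarrow> ord (f x) dvd ord x"
  by (metis endo_closed endo_nat_pow endo_one pow_eq_id pow_ord_eq_1)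

lemma autoD:
  assumes "f \<in> auto G"
  shows "f \<in> hom G G" "f \<in> extensional (carrier G)" "bij_betw f (carrier G) (carrier G)"
    "inj_on f (carrier G)" "f ` carrier G = carrier G"
  using assms by (auto simp: auto_def Bij_def bij_betw_def)

lemma ord_auto: "f \<in> auto G \<Longrightarrow> x \<in> carrier G \<Longrightarrow> ord (f x) = ord x"
  by (metis autoD(1,4) dvd_antisym endo_closed endo_nat_pow endo_one inj_on_eq_iff
      nat_pow_closed one_closed ord_endo_dvd pow_eq_id pow_ord_eq_1)

lemma hom_eq_on_subgroup:
  assumes "f \<in> hom G G" "g \<in> hom G G"
  shows "subgroup {x \<in> carrier G. f x = g x} G"
  using assms by unfold_locales (auto simp: endo_simps)

lemma int_pow_cong:
  assumes "x \<in> carrier G" "x [^] (n::nat) = \<one>" "int n dvd i - j"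
  shows "x [^] i = x [^] j"
proof -
  have "int (ord x) dvd i - j"
    using assms pow_eq_id by (meson dvd_trans int_dvd_int_iff)
  then show ?thesis
    using assms by (metis int_pow_eq dvd_minus_iff minus_diff_eq)
qed

lemma r_coset_eq_iff:
  assumes "subgroup H G" "x \<in> carrier G" "y \<in> carrier G"
  shows "H #> x = H #> y \<longleftrightarrow> x \<otimes> inv y \<in> H"
proof -
  interpret subgroup H G by fact
  show ?thesis
    using assms rcos_self[OF assms(2) assms(1)] repr_independence[of x H y]
    by (metis is_group m_comm inv_closed rcos_module rcos_module_imp)
qed

lemma set_multI: "h \<in> H \<Longrightarrow> k \<in> K \<Longrightarrow> h \<otimes> k \<in> H <#> K"
  by (auto simp: set_mult_def)

lemma subset_set_mult_left: "H \<subseteq> carrier G \<Longrightarrow> subgroup K G \<Longrightarrow> H \<subseteq> H <#> K"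
  using set_multI[of _ H \<one> K] by (auto simp: subgroup.one_closed subset_eq)

lemma subset_set_mult_right: "subgroup H G \<Longrightarrow> K \<subseteq> carrier G \<Longrightarrow> K \<subseteq> H <#> K"
  using set_multI[of \<one> H _ K] by (auto simp: subgroup.one_closed subset_eq)

text \<open>Factors from \<open>H\<close> do not change a coset of \<open>H\<close>, so the quotient
  is already filled by the cosets of the images \<open>\<gamma> h\<close>. Later arguments count
  these cosets.\<close>

lemma inertial_iff:
  "inertial G \<gamma> \<longleftrightarrow>
     \<gamma> \<in> auto G \<and> (\<forall>H. subgroup H G \<longrightarrow> finite ((\<lambda>h. H #> \<gamma> h) ` H))"
proof -
  have "carrier ((G\<lparr>carrier := H <#> (\<gamma> ` H)\<rparr>) Mod H) = (\<lambda>h. H #> \<gamma> h) ` H"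
    if H: "subgroup H G" and g: "\<gamma> \<in> auto G" for H
  proof -
    have eq: "H #> (h \<otimes> \<gamma> h') = H #> \<gamma> h'" if "h \<in> H" "h' \<in> H" for h h'
    proof -
      have "h \<in> carrier G" "\<gamma> h' \<in> carrier G"
        using that H g by (auto intro: autoD endo_closed dest: subgroup.mem_carrier)
      then show ?thesis
        using that H by (subst r_coset_eq_iff) (auto simp: m_assoc)
    qed
    have car: "H \<subseteq> carrier G" "\<And>h. h \<in> H \<Longrightarrow> \<gamma> h \<in> carrier G"
      using H g by (auto dest: subgroup.subset intro: autoD endo_closed)
    have "carrier ((G\<lparr>carrier := H <#> (\<gamma> ` H)\<rparr>) Mod H) = (\<lambda>a. H #> a) ` (H <#> \<gamma> ` H)"
      by (auto simp: FactGroup_def RCOSETS_def r_coset_def)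
    also have "\<dots> = (\<lambda>h. H #> \<gamma> h) ` H"
    proof
      show "(\<lambda>a. H #> a) ` (H <#> \<gamma> ` H) \<subseteq> (\<lambda>h. H #> \<gamma> h) ` H"
        using eq by (auto simp: set_mult_def)
      have "\<gamma> h \<in> H <#> \<gamma> ` H" if "h \<in> H" for h
        using that car subset_set_mult_right[OF H, of "\<gamma> ` H"] by blast
      then show "(\<lambda>h. H #> \<gamma> h) ` H \<subseteq> (\<lambda>a. H #> a) ` (H <#> \<gamma> ` H)"
        by blast
    qed
    finally show ?thesis .
  qed
  then show ?thesis
    unfolding inertial_def by auto
qed

lemma mem_generate_iff:
  "x \<in> carrier G \<Longrightarrow> y \<in> generate G {x} \<longleftrightarrow> (\<exists>k::int. y = x [^] k)"
  by (auto simp: generate_pow)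

lemma subgroup_cyclic: "x \<in> carrier G \<Longrightarrow> subgroup (generate G {x}) G"
  by (simp add: generate_is_subgroup)

lemma cyclic_self: "x \<in> carrier G \<Longrightarrow> x \<in> generate G {x}"
  by (simp add: generate.incl)

text \<open>One inclusion of Dedekind's law: the \<open>K\<close>-factor of an element of
  \<open>F\<close> lies in \<open>F\<close> because its \<open>H\<close>-factor does.\<close>

lemma modular_law:
  assumes "subgroup F G" "H \<subseteq> F" "K \<subseteq> carrier G"
  shows "(H <#> K) \<inter> F \<subseteq> H <#> (K \<inter> F)"
proof
  fix z assume "z \<in> (H <#> K) \<inter> F"
  then obtain h k where z: "z = h \<otimes> k" "h \<in> H" "k \<in> K" "z \<in> F"
    by (auto simp: set_mult_def)
  then have "h \<in> F" "h \<in> carrier G" "k \<in> carrier G"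
    using assms subgroup.mem_carrier[OF assms(1)] by auto
  then have "k = inv h \<otimes> z"
    using z inv_cancel2 by simp
  then have "k \<in> F"
    using z(4) \<open>h \<in> F\<close> assms(1) by (metis subgroup.m_closed subgroup.m_inv_closed)
  then show "z \<in> H <#> (K \<inter> F)"
    using z by (auto simp: set_mult_def)
qed

subsection \<open>Complements\<close>

definition complementary :: "'a set \<Rightarrow> 'a set \<Rightarrow> bool" where
  "complementary H K \<longleftrightarrow> subgroup H G \<and> subgroup K G \<and> H \<inter> K = {\<one>} \<and> H <#> K = carrier G"

definition proj :: "'a set \<Rightarrow> 'a set \<Rightarrow> 'a \<Rightarrow> 'a" where
  "proj H K x = (THE h. h \<in> H \<and> (\<exists>k\<in>K. x = h \<otimes> k))"

text \<open>Only the values of \<open>f\<close> on \<open>H\<close> and of \<open>g\<close> on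
  \<open>K\<close> enter. The restriction to the carrier makes the map extensional, as membership in
  \<open>auto\<close> demands.\<close>

definition glue :: "'a set \<Rightarrow> 'a set \<Rightarrow> ('a \<Rightarrow> 'a) \<Rightarrow> ('a \<Rightarrow> 'a) \<Rightarrow> 'a \<Rightarrow> 'a" where
  "glue H K f g = (\<lambda>x\<in>carrier G. f (proj H K x) \<otimes> g (proj K H x))"

lemma complementary_sym: "complementary H K \<Longrightarrow> complementary K H"
proof -
  assume c: "complementary H K"
  then have s: "H \<subseteq> carrier G" "K \<subseteq> carrier G"
    by (auto simp: complementary_def dest: subgroup.subset)
  have "K <#> H = H <#> K"
    unfolding set_mult_def using s by (auto simp: m_comm subset_eq) (metis m_comm)+
  with c show ?thesis
    by (auto simp: complementary_def)
qed

lemma decomposition_unique: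
  assumes c: "complementary H K" and hk: "h \<in> H" "k \<in> K" "h' \<in> H" "k' \<in> K"
    and eq: "h \<otimes> k = h' \<otimes> k'"
  shows "h = h'" "k = k'"
proof -
  have sub: "subgroup H G" "subgroup K G"
    using c by (auto simp: complementary_def)
  have car: "h \<in> carrier G" "k \<in> carrier G" "h' \<in> carrier G" "k' \<in> carrier G"
    using hk sub by (auto dest: subgroup.mem_carrier)
  have e: "inv h' \<otimes> h = k' \<otimes> inv k"
  proof -
    have "inv h' \<otimes> h = inv h' \<otimes> (h \<otimes> k) \<otimes> inv k"
      using car by algebra
    also have "\<dots> = k' \<otimes> inv k"
      unfolding eq using car by algebra
    finally show ?thesis .
  qed
  have "inv h' \<otimes> h \<in> H" "k' \<otimes> inv k \<in> K"
    using hk sub by (auto intro: subgroup.m_closed subgroup.m_inv_closed)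
  then have "inv h' \<otimes> h = \<one>" "k' \<otimes> inv k = \<one>"
    using e c by (auto simp: complementary_def)
  then show "h = h'" "k = k'"
    using car by (metis inv_closed inv_equality inv_inv m_comm)+
qed

lemma proj_eq:
  assumes "complementary H K" "h \<in> H" "k \<in> K"
  shows "proj H K (h \<otimes> k) = h"
  unfolding proj_def using assms decomposition_unique[OF assms(1)] by (intro the_equality) blast+

lemma decompose:
  assumes c: "complementary H K" and x: "x \<in> carrier G"
  shows "proj H K x \<in> H" "proj K H x \<in> K" "x = proj H K x \<otimes> proj K H x"
proof -
  obtain h k where hk: "h \<in> H" "k \<in> K" "x = h \<otimes> k"
    using c x unfolding complementary_def set_mult_def by blast
  have "h \<otimes> k = k \<otimes> h"
    using c hk by (auto simp: complementary_def intro!: m_comm dest: subgroup.mem_carrier)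
  then have "proj H K x = h" "proj K H x = k"
    using hk proj_eq[OF c hk(1,2)] proj_eq[OF complementary_sym[OF c] hk(2,1)] by auto
  then show "proj H K x \<in> H" "proj K H x \<in> K" "x = proj H K x \<otimes> proj K H x"
    using hk by auto
qed

lemma complementary_carrier:
  assumes "complementary H K"
  shows "h \<in> H \<Longrightarrow> h \<in> carrier G" "k \<in> K \<Longrightarrow> k \<in> carrier G"
  using assms by (auto simp: complementary_def dest: subgroup.mem_carrier)

lemma proj_closed: "complementary H K \<Longrightarrow> x \<in> carrier G \<Longrightarrow> proj H K x \<in> carrier G"
  using decompose(1) complementary_carrier(1) by blast

lemma proj_on_left: "complementary H K \<Longrightarrow> h \<in> H \<Longrightarrow> proj H K h = h"
  by (metis complementary_carrier(1) complementary_def proj_eq r_one subgroup.one_closed)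

lemma proj_on_right: "complementary H K \<Longrightarrow> k \<in> K \<Longrightarrow> proj H K k = \<one>"
  by (metis complementary_carrier(2) complementary_def proj_eq l_one subgroup.one_closed)

lemma proj_mult:
  assumes c: "complementary H K" and x: "x \<in> carrier G" and y: "y \<in> carrier G"
  shows "proj H K (x \<otimes> y) = proj H K x \<otimes> proj H K y"
proof -
  have "x \<otimes> y = (proj H K x \<otimes> proj K H x) \<otimes> (proj H K y \<otimes> proj K H y)"
    using decompose(3)[OF c x] decompose(3)[OF c y] by simp
  also have "\<dots> = (proj H K x \<otimes> proj H K y) \<otimes> (proj K H x \<otimes> proj K H y)"
    using proj_closed[OF c x] proj_closed[OF c y] proj_closed[OF complementary_sym[OF c] x]
      proj_closed[OF complementary_sym[OF c] y] by algebra
  finally show ?thesis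
    using decompose[OF c x] decompose[OF c y] c
    by (simp add: proj_eq complementary_def subgroup.m_closed)
qed

lemma proj_hom: "complementary H K \<Longrightarrow> proj H K \<in> hom G G"
  by (auto simp: hom_def proj_closed proj_mult)

context
  fixes H K f g
  assumes c: "complementary H K"
    and f: "\<And>x y. x \<in> H \<Longrightarrow> y \<in> H \<Longrightarrow> f (x \<otimes> y) = f x \<otimes> f y" "f \<in> H \<rightarrow> carrier G"
    and g: "\<And>x y. x \<in> K \<Longrightarrow> y \<in> K \<Longrightarrow> g (x \<otimes> y) = g x \<otimes> g y" "g \<in> K \<rightarrow> carrier G"
begin

lemma glue_hom: "glue H K f g \<in> hom G G"
proof -
  have [simp]: "f (proj H K x) \<in> carrier G" "g (proj K H x) \<in> carrier G" if "x \<in> carrier G" for x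
    using that decompose[OF c] f g by auto
  show ?thesis
    using decompose[OF c] complementary_sym[OF c]
    by (auto simp: glue_def hom_def proj_mult c f g) (simp add: m_assoc m_lcomm)
qed

lemma glue_apply: "h \<in> H \<Longrightarrow> k \<in> K \<Longrightarrow> glue H K f g (h \<otimes> k) = f h \<otimes> g k"
  using proj_eq[OF c, of h k] proj_eq[OF complementary_sym[OF c], of k h]
    complementary_carrier[OF c] by (simp add: glue_def m_comm)

lemma glue_ones: "f \<one> = \<one>" "g \<one> = \<one>"
proof -
  have "\<one> \<in> H" "\<one> \<in> K"
    using c by (auto simp: complementary_def subgroup.one_closed)
  then show "f \<one> = \<one>" "g \<one> = \<one>"
    using f g by (metis PiE l_cancel_one' one_closed r_one)+
qed

lemma glue_left: "h \<in> H \<Longrightarrow> glue H K f g h = f h"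
  using glue_apply[of h \<one>] glue_ones f c complementary_carrier[OF c]
  by (auto simp: complementary_def subgroup.one_closed Pi_iff)

lemma glue_right: "k \<in> K \<Longrightarrow> glue H K f g k = g k"
  using glue_apply[of \<one> k] glue_ones g c complementary_carrier[OF c]
  by (auto simp: complementary_def subgroup.one_closed Pi_iff)

lemma glue_auto:
  assumes bf: "bij_betw f H H" and bg: "bij_betw g K K"
  shows "glue H K f g \<in> auto G"
proof -
  have fH: "f h \<in> H" if "h \<in> H" for h
    using that bf by (auto simp: bij_betw_def)
  have gK: "g k \<in> K" if "k \<in> K" for k
    using that bg by (auto simp: bij_betw_def)
  have "inj_on (glue H K f g) (carrier G)"
  proof (rule inj_onI)
    fix x y assume x: "x \<in> carrier G" and y: "y \<in> carrier G"
      and eq: "glue H K f g x = glue H K f g y"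
    have "f (proj H K x) \<otimes> g (proj K H x) = f (proj H K y) \<otimes> g (proj K H y)"
      using eq x y by (simp add: glue_def)
    then have "f (proj H K x) = f (proj H K y)" "g (proj K H x) = g (proj K H y)"
      using decomposition_unique[OF c fH[OF decompose(1)[OF c x]] gK[OF decompose(2)[OF c x]]
          fH[OF decompose(1)[OF c y]] gK[OF decompose(2)[OF c y]]] by auto
    then have "proj H K x = proj H K y" "proj K H x = proj K H y"
      using bf bg decompose(1,2)[OF c x] decompose(1,2)[OF c y]
      by (auto simp: bij_betw_def inj_on_eq_iff)
    then show "x = y"
      using decompose(3)[OF c x] decompose(3)[OF c y] by simp
  qed
  moreover have "x \<in> glue H K f g ` carrier G" if x: "x \<in> carrier G" for x
  proof -
    obtain h k where "h \<in> H" "k \<in> K" "f h = proj H K x" "g k = proj K H x"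
      using bf bg decompose(1,2)[OF c x] unfolding bij_betw_def by (metis imageE)
    moreover from this have "x = glue H K f g (h \<otimes> k)"
      using glue_apply decompose(3)[OF c x] by metis
    moreover have "h \<otimes> k \<in> carrier G"
      using calculation complementary_carrier[OF c] by blast
    ultimately have "x = glue H K f g (h \<otimes> k)" "h \<otimes> k \<in> carrier G" by auto
    then show ?thesis by blast
  qed
  ultimately have "bij_betw (glue H K f g) (carrier G) (carrier G)"
    using glue_hom by (auto simp: bij_betw_def hom_def)
  then show ?thesis
    using glue_hom by (auto simp: auto_def Bij_def glue_def)
qed

end

end

section \<open>Periodic abelian groups\<close>

locale periodic_comm_group = comm_group +
  assumes periodic: "periodic G"
begin

abbreviation pp :: "nat set \<Rightarrow> 'a set" where
  "pp \<equiv> pi_part G"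

lemma ord_pos: "x \<in> carrier G \<Longrightarrow> ord x > 0"
  using periodic by (auto simp: periodic_def)

lemma mem_pp_iff: "x \<in> pp \<pi> \<longleftrightarrow> x \<in> carrier G \<and> (\<forall>p. prime p \<longrightarrow> p dvd ord x \<longrightarrow> p \<in> \<pi>)"
  using ord_pos by (auto simp: pi_part_eq(1))

lemma subgroup_pp: "subgroup (pp \<pi>) G"
  using pi_part_eq[of \<pi>] by simp

lemma pp_carrier: "x \<in> pp \<pi> \<Longrightarrow> x \<in> carrier G"
  by (simp add: mem_pp_iff)

lemma pp_mono: "\<pi> \<subseteq> \<rho> \<Longrightarrow> pp \<pi> \<subseteq> pp \<rho>"
  unfolding subset_iff mem_pp_iff by blast

lemma pp_endo: "f \<in> hom G G \<Longrightarrow> x \<in> pp \<pi> \<Longrightarrow> f x \<in> pp \<pi>"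
  unfolding mem_pp_iff by (meson dvd_trans endo_closed ord_endo_dvd)

lemma pp_auto_iff: "f \<in> auto G \<Longrightarrow> x \<in> carrier G \<Longrightarrow> f x \<in> pp \<pi> \<longleftrightarrow> x \<in> pp \<pi>"
  by (simp add: mem_pp_iff ord_auto endo_closed autoD)

lemma pp_of_pow:
  assumes "x \<in> carrier G" "x [^] (n::nat) = \<one>" "\<And>p. prime p \<Longrightarrow> p dvd n \<Longrightarrow> p \<in> \<pi>"
  shows "x \<in> pp \<pi>"
  using assms pow_eq_id by (auto simp: mem_pp_iff dest: dvd_trans)

lemma mem_pp_prime_iff:
  assumes p: "prime (p::nat)"
  shows "x \<in> pp {p} \<longleftrightarrow> x \<in> carrier G \<and> (\<exists>n. x [^] (p ^ n) = \<one>)"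
proof
  assume x: "x \<in> pp {p}"
  then have c: "x \<in> carrier G" and d: "\<And>q. prime q \<Longrightarrow> q dvd ord x \<Longrightarrow> q = p"
    by (auto simp: mem_pp_iff)
  obtain k m where km: "ord x = p ^ k * m" "\<not> p dvd m"
    using ord_pos[OF c] p by (metis multiplicity_decompose' not_prime_unit less_numeral_extra(3))
  have "m = 1"
  proof (rule ccontr)
    assume "m \<noteq> 1"
    then obtain q where "prime q" "q dvd m"
      using prime_factor_nat by blast
    with d[of q] km show False by auto
  qed
  with km c show "x \<in> carrier G \<and> (\<exists>n. x [^] (p ^ n) = \<one>)"
    by (metis mult.right_neutral pow_ord_eq_1)
next
  assume "x \<in> carrier G \<and> (\<exists>n. x [^] (p ^ n) = \<one>)"
  then show "x \<in> pp {p}"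
    using p by (metis pp_of_pow prime_dvd_power primes_dvd_imp_eq singletonI)
qed

lemma pp_disjoint:
  assumes "x \<in> pp \<pi>" "x \<in> pp \<rho>" "\<pi> \<inter> \<rho> = {}"
  shows "x = \<one>"
proof (rule ccontr)
  assume "x \<noteq> \<one>"
  then have "ord x \<noteq> 1"
    using assms pp_carrier ord_eq_1 by blast
  then obtain p where "prime p" "p dvd ord x"
    using prime_factor_nat by blast
  with assms show False
    by (auto simp: mem_pp_iff)
qed

text \<open>Each step of the induction moves the full power of one prime to the side prescribed by
  \<pi>, which keeps the two factors coprime.\<close>

lemma nat_pi_split:
  "n > 0 \<Longrightarrow> \<exists>a b. n = a * b \<and> coprime a b \<and> (\<forall>p. prime p \<longrightarrow> p dvd a \<longrightarrow> p \<in> \<pi>)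
    \<and> (\<forall>p. prime p \<longrightarrow> p dvd b \<longrightarrow> p \<notin> \<pi>)" for n :: nat
proof (induction n rule: less_induct)
  case (less n)
  show ?case
  proof (cases "n = 1")
    case True
    then show ?thesis by (intro exI[of _ 1]) auto
  next
    case False
    then obtain p where p: "prime p" "p dvd n"
      using prime_factor_nat by blast
    obtain k m where km: "n = p ^ k * m" "\<not> p dvd m"
      using less.prems p by (metis multiplicity_decompose' not_prime_unit less_numeral_extra(3))
    have k: "k \<noteq> 0" and m: "m > 0"
      using km p less.prems by (auto intro: gr0I)
    have "m < n"
      using km k m p one_less_power[of p k] prime_gt_1_nat[of p] by simp
    from less.IH[OF this m] obtain a b where ab: "m = a * b" "coprime a b"
      "\<And>p. prime p \<Longrightarrow> p dvd a \<Longrightarrow> p \<in> \<pi>" "\<And>p. prime p \<Longrightarrow> p dvd b \<Longrightarrow> p \<notin> \<pi>"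
      by blast
    have "\<not> p dvd a" "\<not> p dvd b"
      using km ab by auto
    then have pab: "coprime p a" "coprime p b"
      using p by (simp_all add: prime_imp_coprime)
    have q: "q = p" if "prime q" "q dvd p ^ k" for q
      using that p prime_dvd_power primes_dvd_imp_eq by blast
    show ?thesis
    proof (cases "p \<in> \<pi>")
      case True
      then show ?thesis
        using ab km pab q by (intro exI[of _ "p ^ k * a"] exI[of _ b]) (auto simp: prime_dvd_mult_iff)
    next
      case False
      then show ?thesis
        using ab km pab q by (intro exI[of _ a] exI[of _ "p ^ k * b"])
          (auto simp: prime_dvd_mult_iff coprime_commute)
    qed
  qed
qed

text \<open>With \<open>ord x = a * b\<close> split along \<pi> and \<open>u * a + v * b = 1\<close>
  by Bezout, the exponent is \<open>v * b\<close>. Both parts of \<open>x\<close> are thus powers of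
  \<open>x\<close> and stay in every subgroup that contains \<open>x\<close>.\<close>

lemma pi_split:
  assumes x: "x \<in> carrier G"
  shows "\<exists>k::int. x [^] k \<in> pp \<pi> \<and> x [^] (1 - k) \<in> pp (primes - \<pi>)"
proof -
  obtain a b where ab: "ord x = a * b" "coprime a b"
    "\<And>p. prime p \<Longrightarrow> p dvd a \<Longrightarrow> p \<in> \<pi>" "\<And>p. prime p \<Longrightarrow> p dvd b \<Longrightarrow> p \<notin> \<pi>"
    using nat_pi_split[OF ord_pos[OF x]] by metis
  then obtain u v where uv: "u * int a + v * int b = 1"
    using bezout_int[of "int a" "int b"] by (auto simp: coprime_iff_gcd_eq_1)
  have 1: "(x [^] (v * int b)) [^] a = \<one>"
  proof -
    have "(x [^] (v * int b)) [^] a = x [^] (v * int b * int a)"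
      using x by (metis int_pow_int int_pow_pow)
    then show ?thesis
      using x ab by (simp add: int_pow_eq_id mult.commute)
  qed
  have 2: "(x [^] (1 - v * int b)) [^] b = \<one>"
  proof -
    have "(x [^] (1 - v * int b)) [^] b = x [^] ((1 - v * int b) * int b)"
      using x by (metis int_pow_int int_pow_pow)
    moreover have "1 - v * int b = u * int a"
      using uv by simp
    ultimately show ?thesis
      using x ab by (simp add: int_pow_eq_id mult.commute)
  qed
  have "x [^] (v * int b) \<in> pp \<pi>" "x [^] (1 - v * int b) \<in> pp (primes - \<pi>)"
    using x ab by (auto intro!: pp_of_pow[OF _ 1] pp_of_pow[OF _ 2] simp: primes_def)
  then show ?thesis by blast
qed

lemma pp_complementary: "complementary (pp \<pi>) (pp (primes - \<pi>))"
proof -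
  have "carrier G \<subseteq> pp \<pi> <#> pp (primes - \<pi>)"
  proof
    fix x assume x: "x \<in> carrier G"
    obtain k :: int where k: "x [^] k \<in> pp \<pi>" "x [^] (1 - k) \<in> pp (primes - \<pi>)"
      using pi_split[OF x] by blast
    have "x = x [^] k \<otimes> x [^] (1 - k)"
      using x by (simp flip: int_pow_mult)
    with k show "x \<in> pp \<pi> <#> pp (primes - \<pi>)"
      by (metis set_multI)
  qed
  moreover have "pp \<pi> \<inter> pp (primes - \<pi>) = {\<one>}"
    using pp_disjoint[of _ \<pi> "primes - \<pi>"] subgroup_pp by (auto intro: subgroup.one_closed)
  moreover have "pp \<pi> <#> pp (primes - \<pi>) \<subseteq> carrier G"
    by (simp add: set_mult_closed subgroup_pp subgroup.subset)
  ultimately show ?thesis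
    unfolding complementary_def using subgroup_pp by blast
qed

text \<open>For one prime \<open>p\<close> dividing \<open>ord x\<close> the p-part is split off;
  the other factor is a power of \<open>x\<close> of smaller order, so induction on the order
  applies.\<close>

lemma primary_induct [consumes 1, case_names primary split]:
  assumes x: "x \<in> carrier G"
    and primary: "\<And>p x. prime p \<Longrightarrow> x \<in> pp {p} \<Longrightarrow> P x"
    and split: "\<And>x (k::int). x \<in> carrier G \<Longrightarrow> P (x [^] k) \<Longrightarrow> P (x [^] (1 - k)) \<Longrightarrow> P x"
  shows "P x"
  using x
proof (induction "ord x" arbitrary: x rule: less_induct)
  case less
  show ?case
  proof (cases "ord x = 1")
    case True
    \<comment> \<open>The identity is primary for every prime; 2 is an arbitrary choice.\<close>
    then have "x \<in> pp {2}"
      using less.prems by (auto simp: mem_pp_iff Suc_0_not_prime_nat)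
    then show ?thesis
      using primary two_is_prime_nat by blast
  next
    case False
    then obtain p where p: "prime p" "p dvd ord x"
      using prime_factor_nat by blast
    obtain k :: int where k: "x [^] k \<in> pp {p}" "x [^] (1 - k) \<in> pp (primes - {p})"
      using pi_split[OF less.prems] by blast
    have "ord (x [^] (1 - k)) dvd ord x"
      using less.prems by (metis int_pow_closed int_pow_int int_pow_one int_pow_pow mult.commute
          pow_eq_id pow_ord_eq_1)
    moreover have "\<not> p dvd ord (x [^] (1 - k))"
      using k(2) p by (auto simp: mem_pp_iff)
    ultimately have "ord (x [^] (1 - k)) < ord x"
      using p(2) ord_pos[OF less.prems] by (metis dvd_imp_le order_le_less)
    then show ?thesis
      using split[of x k] primary[OF p(1) k(1)] less.hyps less.prems by simp
  qed
qed

lemma subgroup_primary: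
  assumes "subgroup H G" "\<And>p. prime p \<Longrightarrow> pp {p} \<subseteq> H"
  shows "H = carrier G"
proof
  show "carrier G \<subseteq> H"
  proof
    fix x assume "x \<in> carrier G"
    then show "x \<in> H"
    proof (induction x rule: primary_induct)
      case (split x k)
      then have "x [^] k \<otimes> x [^] (1 - k) \<in> H"
        using assms by (simp add: subgroup.m_closed)
      then show ?case
        using split(1) by (simp flip: int_pow_mult)
    qed (use assms in auto)
  qed
qed (use assms in \<open>simp add: subgroup.subset\<close>)

lemma hom_eq_primary:
  assumes "f \<in> hom G G" "g \<in> hom G G"
    and "\<And>p x. prime p \<Longrightarrow> x \<in> pp {p} \<Longrightarrow> f x = g x" and "x \<in> carrier G"
  shows "f x = g x"
  using subgroup_primary[OF hom_eq_on_subgroup[OF assms(1,2)]] assms(3,4) pp_carrier by auto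

subsection \<open>Finite subgroups\<close>

lemma finite_cyclic: "x \<in> carrier G \<Longrightarrow> finite (generate G {x})"
proof -
  assume x: "x \<in> carrier G"
  have "generate G {x} \<subseteq> (\<lambda>k. x [^] k) ` {0..<int (ord x)}"
  proof
    fix y assume "y \<in> generate G {x}"
    then obtain k :: int where "y = x [^] k"
      using x by (auto simp: mem_generate_iff)
    also have "\<dots> = x [^] (k mod int (ord x))"
      using x by (simp add: int_pow_eq mod_eq_dvd_iff[symmetric])
    finally show "y \<in> (\<lambda>k. x [^] k) ` {0..<int (ord x)}"
      using ord_pos[OF x] by auto
  qed
  then show ?thesis
    using finite_subset by blast
qed

lemma finite_set_mult: "finite H \<Longrightarrow> finite K \<Longrightarrow> finite (H <#> K)"
  by (auto simp: set_mult_def)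

lemma finite_subgroup_extend:
  assumes "subgroup F G" "finite F" "x \<in> carrier G"
  obtains F' where "subgroup F' G" "finite F'" "F \<subseteq> F'" "x \<in> F'"
proof (rule that[of "F <#> generate G {x}"])
  show "F \<subseteq> F <#> generate G {x}"
    using assms by (intro subset_set_mult_left) (auto simp: subgroup_cyclic subgroup.subset)
  have "generate G {x} \<subseteq> F <#> generate G {x}"
    using assms by (intro subset_set_mult_right) (auto simp: subgroup_cyclic subgroup.subset)
  then show "x \<in> F <#> generate G {x}"
    using assms cyclic_self by blast
qed (use assms in \<open>auto simp: mult_subgroups subgroup_cyclic finite_set_mult finite_cyclic\<close>)

lemma finite_subgroup_of_finite:
  assumes "finite X" "X \<subseteq> carrier G"
  shows "\<exists>F. subgroup F G \<and> finite F \<and> X \<subseteq> F"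
  using assms
proof (induction X)
  case empty
  then show ?case using triv_subgroup by blast
next
  case (insert x X)
  then obtain F where "subgroup F G" "finite F" "X \<subseteq> F" by auto
  moreover from this insert obtain F' where "subgroup F' G" "finite F'" "F \<subseteq> F'" "x \<in> F'"
    using finite_subgroup_extend[of F x] by auto
  ultimately show ?case by blast
qed

subsection \<open>Inertial automorphisms and finite subgroups\<close>

definition avoids :: "'a \<Rightarrow> 'a set \<Rightarrow> bool" where
  "avoids x F \<longleftrightarrow> (\<forall>k::int. x [^] k \<in> F \<longrightarrow> x [^] k = \<one>)"

lemma avoids_mono: "avoids x F \<Longrightarrow> E \<subseteq> F \<Longrightarrow> avoids x E"
  by (auto simp: avoids_def)

text \<open>The exponent may vary with \<open>x\<close>; \<open>uniform_exponent\<close> and its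
  consequences make it uniform.\<close>

definition almost_power :: "('a \<Rightarrow> 'a) \<Rightarrow> 'a set \<Rightarrow> bool" where
  "almost_power f F \<longleftrightarrow> subgroup F G \<and> finite F \<and>
    (\<forall>x\<in>carrier G. avoids x F \<longrightarrow> (\<exists>k::int. f x \<otimes> inv (x [^] k) \<in> F))"

lemma inertial_almost_power:
  assumes "inertial G f"
  shows "\<exists>F. almost_power f F"
proof (rule ccontr)
  assume neg: "\<not> ?thesis"
  have f: "f \<in> hom G G"
    using assms by (auto simp: inertial_def autoD)
  have "\<exists>x\<in>carrier G. avoids x F \<and> (\<forall>k::int. f x \<otimes> inv (x [^] k) \<notin> F)"
    if "subgroup F G" "finite F" for F
    using neg that unfolding almost_power_def by blast
  then obtain sel where sel: "\<And>F. subgroup F G \<Longrightarrow> finite F \<Longrightarrow> sel F \<in> carrier G"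
    "\<And>F. subgroup F G \<Longrightarrow> finite F \<Longrightarrow> avoids (sel F) F"
    "\<And>F k. subgroup F G \<Longrightarrow> finite F \<Longrightarrow> f (sel F) \<otimes> inv (sel F [^] (k::int)) \<notin> F"
    by metis
  have "\<exists>F'. subgroup F' G \<and> finite F' \<and> F \<subseteq> F' \<and> sel F \<in> F' \<and> f (sel F) \<in> F'"
    if F: "subgroup F G" "finite F" for F
  proof -
    obtain F1 where "subgroup F1 G" "finite F1" "F \<subseteq> F1" "sel F \<in> F1"
      using finite_subgroup_extend[OF F sel(1)[OF F]] by blast
    moreover from this obtain F2 where "subgroup F2 G" "finite F2" "F1 \<subseteq> F2" "f (sel F) \<in> F2"
      using finite_subgroup_extend[of F1 "f (sel F)"] endo_closed[OF f sel(1)[OF F]] by blast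
    ultimately show ?thesis by blast
  qed
  then have "\<forall>F. \<exists>F'. subgroup F G \<and> finite F \<longrightarrow>
      subgroup F' G \<and> finite F' \<and> F \<subseteq> F' \<and> sel F \<in> F' \<and> f (sel F) \<in> F'"
    by blast
  from choice[OF this] obtain ext where e: "\<forall>F. subgroup F G \<and> finite F \<longrightarrow>
      subgroup (ext F) G \<and> finite (ext F) \<and> F \<subseteq> ext F \<and> sel F \<in> ext F \<and> f (sel F) \<in> ext F" ..
  have ext: "subgroup (ext F) G" "finite (ext F)" "F \<subseteq> ext F" "sel F \<in> ext F" "f (sel F) \<in> ext F"
    if "subgroup F G" "finite F" for F
    using e that by blast+
  \<comment> \<open>\<open>F\<^sub>n\<^sub>+\<^sub>1\<close> contains \<open>x\<^sub>n\<close> and \<open>f x\<^sub>n\<close>; as \<open>x\<^sub>n\<close> avoids \<open>F\<^sub>n\<close>, the group \<open>H\<close> generated by all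
    \<open>x\<^sub>i\<close> meets \<open>F\<^sub>n\<close> exactly in the subgroup \<open>H\<^sub>n\<close> generated by \<open>x\<^sub>i\<close>, \<open>i < n\<close>.\<close>
  define Fs where "Fs = rec_nat {\<one>} (\<lambda>_. ext)"
  define x where "x n = sel (Fs n)" for n
  define Hs where "Hs = rec_nat {\<one>} (\<lambda>n H. H <#> generate G {x n})"
  have Fs: "subgroup (Fs n) G \<and> finite (Fs n)" for n
    by (induction n) (auto simp: Fs_def triv_subgroup ext)
  have Fs_Suc: "Fs n \<subseteq> Fs (Suc n)" "x n \<in> Fs (Suc n)" "f (x n) \<in> Fs (Suc n)" for n
    using ext Fs by (auto simp: Fs_def x_def)
  have Fs_mono: "Fs m \<subseteq> Fs n" if "m \<le> n" for m n
    using Fs_Suc(1) that by (rule lift_Suc_mono_le)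
  have x: "x n \<in> carrier G" "avoids (x n) (Fs n)"
    "\<And>k::int. f (x n) \<otimes> inv (x n [^] k) \<notin> Fs n" for n
    using sel Fs by (auto simp: x_def)
  have Hs_Suc: "Hs (Suc n) = Hs n <#> generate G {x n}" and Hs_0: "Hs 0 = {\<one>}" for n
    by (simp_all add: Hs_def)
  have Hs: "subgroup (Hs n) G" for n
    by (induction n) (auto simp: Hs_0 Hs_Suc triv_subgroup mult_subgroups subgroup_cyclic x)
  have Hs_mono: "Hs m \<subseteq> Hs n" if "m \<le> n" for m n
    using that
  proof (rule lift_Suc_mono_le[rotated])
    show "Hs n \<subseteq> Hs (Suc n)" for n
      unfolding Hs_Suc using Hs x by (intro subset_set_mult_left) (auto simp: subgroup.subset subgroup_cyclic)
  qed
  have x_Hs: "x n \<in> Hs (Suc n)" for n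
    unfolding Hs_Suc using subset_set_mult_right[OF Hs, of "generate G {x n}"] x cyclic_self
      subgroup.subset[OF subgroup_cyclic] by blast
  have HF: "Hs n \<subseteq> Fs n" for n
  proof (induction n)
    case 0
    then show ?case using Fs by (auto simp: Hs_0 subgroup.one_closed)
  next
    case (Suc n)
    have "generate G {x n} \<subseteq> Fs (Suc n)"
      using Fs Fs_Suc by (intro generate_subgroup_incl) auto
    moreover have "Hs n \<subseteq> Fs (Suc n)"
      using Suc Fs_Suc(1) by blast
    ultimately have "h \<otimes> k \<in> Fs (Suc n)" if "h \<in> Hs n" "k \<in> generate G {x n}" for h k
      using that Fs subgroup.m_closed[of "Fs (Suc n)"] by blast
    then show ?case
      unfolding Hs_Suc set_mult_def by blast
  qed
  have step: "Hs (Suc n) \<inter> Fs n \<subseteq> Hs n" for n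
  proof -
    have "Hs (Suc n) \<inter> Fs n \<subseteq> Hs n <#> (generate G {x n} \<inter> Fs n)"
      unfolding Hs_Suc using Fs HF x subgroup.subset[OF subgroup_cyclic] by (intro modular_law) auto
    also have "generate G {x n} \<inter> Fs n \<subseteq> {\<one>}"
      using x by (auto simp: mem_generate_iff avoids_def)
    then have "Hs n <#> (generate G {x n} \<inter> Fs n) \<subseteq> Hs n <#> {\<one>}"
      by (intro mono_set_mult) auto
    also have "\<dots> \<subseteq> Hs n"
      using subgroup.mem_carrier[OF Hs] by (auto simp: set_mult_def)
    finally show ?thesis .
  qed
  have HFn: "Hs (n + k) \<inter> Fs n \<subseteq> Hs n" for n k
  proof (induction k)
    case (Suc k)
    then show ?case
      using step[of "n + k"] Fs_mono[of n "n + k"] by auto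
  qed auto
  define H where "H = (\<Union>n. Hs n)"
  have H: "subgroup H G"
  proof
    show "H \<subseteq> carrier G" using subgroup.mem_carrier[OF Hs] by (auto simp: H_def)
    show "\<one> \<in> H" using Hs_0 by (auto simp: H_def)
    show "inv y \<in> H" if "y \<in> H" for y
      using that subgroup.m_inv_closed[OF Hs] by (auto simp: H_def)
    show "y \<otimes> z \<in> H" if yz: "y \<in> H" "z \<in> H" for y z
    proof -
      obtain m n where "y \<in> Hs m" "z \<in> Hs n" using yz by (auto simp: H_def)
      then have "y \<in> Hs (max m n)" "z \<in> Hs (max m n)"
        using Hs_mono by (meson max.cobounded1 max.cobounded2 subsetD)+
      then show ?thesis using subgroup.m_closed[OF Hs] by (auto simp: H_def)
    qed
  qed
  have HF2: "H \<inter> Fs n \<subseteq> Hs n" for n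
  proof
    fix y assume y: "y \<in> H \<inter> Fs n"
    then obtain m where "y \<in> Hs m" by (auto simp: H_def)
    then have "y \<in> Hs (n + m)" using Hs_mono[of m "n + m"] by auto
    with y HFn show "y \<in> Hs n" by blast
  qed
  have fx: "f (x n) \<in> carrier G" for n
    using f x by (simp add: endo_closed)
  \<comment> \<open>Equal cosets put \<open>f (x i) \<otimes> inv (f (x j))\<close> into
    \<open>H\<close> and into \<open>Fs (Suc i)\<close>, hence into \<open>Hs (Suc i)\<close>. Since
    \<open>f (x j)\<close> and \<open>Hs i\<close> lie in \<open>Fs i\<close>, this makes
    \<open>f (x i)\<close> congruent to a power of \<open>x i\<close> modulo \<open>Fs i\<close>,
    against the choice of \<open>x i\<close>.\<close>
  have neq: "H #> f (x i) \<noteq> H #> f (x j)" if "j < i" for i j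
  proof
    assume "H #> f (x i) = H #> f (x j)"
    then have d: "f (x i) \<otimes> inv (f (x j)) \<in> H"
      using r_coset_eq_iff[OF H] fx by blast
    have j: "f (x j) \<in> Fs i"
      using Fs_Suc(3)[of j] Fs_mono[of "Suc j" i] that by auto
    have "f (x i) \<otimes> inv (f (x j)) \<in> Fs (Suc i)"
      using Fs Fs_Suc[of i] j by (auto intro!: subgroup.m_closed subgroup.m_inv_closed)
    with d have "f (x i) \<otimes> inv (f (x j)) \<in> Hs (Suc i)"
      using HF2 by blast
    then obtain h k where hk: "h \<in> Hs i" "f (x i) \<otimes> inv (f (x j)) = h \<otimes> x i [^] (k::int)"
      unfolding Hs_Suc set_mult_def using x(1)[of i] by (auto simp: mem_generate_iff)
    have hc: "h \<in> carrier G" using subgroup.mem_carrier[OF Hs hk(1)] .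
    have "f (x i) \<otimes> inv (x i [^] k) = (f (x i) \<otimes> inv (f (x j))) \<otimes> f (x j) \<otimes> inv (x i [^] k)"
      using fx[of i] fx[of j] x(1)[of i] by algebra
    also have "\<dots> = h \<otimes> f (x j)"
      unfolding hk using fx[of j] x(1)[of i] hc by algebra
    also have "\<dots> \<in> Fs i"
      using hk(1) HF[of i] j Fs[of i] by (auto intro!: subgroup.m_closed)
    finally show False using x(3) by blast
  qed
  have "inj (\<lambda>n. H #> f (x n))"
    using neq by (intro injI) (metis nat_neq_iff)
  moreover have "range (\<lambda>n. H #> f (x n)) \<subseteq> (\<lambda>h. H #> f h) ` H"
    using x_Hs by (auto simp: H_def)
  moreover have "finite ((\<lambda>h. H #> f h) ` H)"
    using assms H by (auto simp: inertial_iff)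
  ultimately show False
    using finite_subset range_inj_infinite by blast
qed

end

text \<open>On \<open>A\<close> the map \<open>h\<close> factors through \<open>g\<close>; one
  chosen element in each fibre of \<open>g\<close> suffices to list its values.\<close>

lemma finite_image_factor:
  assumes "finite (g ` A)" "\<And>x y. x \<in> A \<Longrightarrow> y \<in> A \<Longrightarrow> g x = g y \<Longrightarrow> h x = h y"
  shows "finite (h ` A)"
proof -
  have "h ` A \<subseteq> (\<lambda>t. h (SOME x. x \<in> A \<and> g x = t)) ` (g ` A)"
  proof
    fix z assume "z \<in> h ` A"
    then obtain x where x: "x \<in> A" "z = h x" by auto
    define y where "y = (SOME y. y \<in> A \<and> g y = g x)"
    have "y \<in> A \<and> g y = g x"
      unfolding y_def by (rule someI[of _ x]) (use x in auto)
    then have "h y = h x"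
      by (intro assms(2)[OF _ x(1)]) auto
    then show "z \<in> (\<lambda>t. h (SOME x. x \<in> A \<and> g x = t)) ` (g ` A)"
      using x by (intro image_eqI[of _ _ "g x"]) (simp_all flip: y_def)
  qed
  then show ?thesis
    using assms(1) finite_subset by blast
qed

section \<open>Finite images, subgroups of multiples, and complements of divisible subgroups\<close>

context comm_group
begin

lemma hom_int_power: "(\<lambda>x. x [^] (k::int)) \<in> hom G G"
  by (auto simp: hom_def int_pow_distrib)

lemma hom_nat_power: "(\<lambda>x. x [^] (k::nat)) \<in> hom G G"
  by (auto simp: hom_def nat_pow_distrib)

lemma hom_quotient:
  assumes "f \<in> hom G G" "g \<in> hom G G"
  shows "(\<lambda>x. f x \<otimes> inv (g x)) \<in> hom G G"
proof -
  have "f (x \<otimes> y) \<otimes> inv (g (x \<otimes> y)) = (f x \<otimes> inv (g x)) \<otimes> (f y \<otimes> inv (g y))"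
    if "x \<in> carrier G" "y \<in> carrier G" for x y
    using that assms[THEN endo_closed] by (simp add: endo_mult assms m_ac inv_mult)
  then show ?thesis
    using assms by (auto simp: hom_def Pi_iff)
qed

lemma hom_product:
  assumes "f \<in> hom G G" "g \<in> hom G G"
  shows "(\<lambda>x. f x \<otimes> g x) \<in> hom G G"
proof -
  have "f (x \<otimes> y) \<otimes> g (x \<otimes> y) = (f x \<otimes> g x) \<otimes> (f y \<otimes> g y)"
    if "x \<in> carrier G" "y \<in> carrier G" for x y
    using that assms[THEN endo_closed] by (simp add: endo_mult assms m_ac)
  then show ?thesis
    using assms by (auto simp: hom_def Pi_iff)
qed

lemma finite_hom_vimage:
  assumes f: "f \<in> hom G G" and C: "subgroup C G"
    and ker: "finite {x \<in> C. f x = \<one>}" and T: "finite T"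
  shows "finite {x \<in> C. f x \<in> T}"
proof -
  have "finite {x \<in> C. f x = t}" for t
  proof (cases "\<exists>y\<in>C. f y = t")
    case True
    then obtain y where y: "y \<in> C" "f y = t" by blast
    have "{x \<in> C. f x = t} \<subseteq> (\<lambda>k. k \<otimes> y) ` {x \<in> C. f x = \<one>}"
    proof
      fix x assume "x \<in> {x \<in> C. f x = t}"
      then have x: "x \<in> C" "f x = t" by auto
      have c: "x \<in> carrier G" "y \<in> carrier G"
        using x y C by (auto dest: subgroup.mem_carrier)
      have "x \<otimes> inv y \<in> C"
        using x y C by (simp add: subgroup.m_closed subgroup.m_inv_closed)
      moreover have "f (x \<otimes> inv y) = \<one>"
        using c f x y endo_closed[OF f c(2)] by (simp add: endo_simps)
      moreover have "x = (x \<otimes> inv y) \<otimes> y"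
        using c by (simp add: m_assoc)
      ultimately show "x \<in> (\<lambda>k. k \<otimes> y) ` {x \<in> C. f x = \<one>}" by blast
    qed
    then show ?thesis
      using ker finite_subset by blast
  next
    case False
    then have "{x \<in> C. f x = t} = {}" by auto
    then show ?thesis by (metis finite.emptyI)
  qed
  moreover have "{x \<in> C. f x \<in> T} = (\<Union>t\<in>T. {x \<in> C. f x = t})" by auto
  ultimately show ?thesis
    using T by simp
qed

text \<open>The fibres of \<open>g\<close> on \<open>C\<close> are cosets of its kernel, and on such
  a coset \<open>f\<close> takes a translate of the values it takes on the kernel.\<close>

lemma finite_image_extension:
  assumes f: "f \<in> hom G G" and g: "g \<in> hom G G" and C: "subgroup C G"
    and "finite (g ` C)" "finite (f ` {x \<in> C. g x = \<one>})"
  shows "finite (f ` C)"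
proof -
  have c: "x \<in> carrier G" if "x \<in> C" for x
    using that C by (auto dest: subgroup.mem_carrier)
  have "finite (f ` {x \<in> C. g x = t})" for t
  proof (cases "\<exists>y\<in>C. g y = t")
    case True
    then obtain y where y: "y \<in> C" "g y = t" by blast
    have "f ` {x \<in> C. g x = t} \<subseteq> (\<lambda>k. k \<otimes> f y) ` (f ` {x \<in> C. g x = \<one>})"
    proof
      fix z assume "z \<in> f ` {x \<in> C. g x = t}"
      then obtain x where x: "x \<in> C" "g x = t" "z = f x" by auto
      have "x \<otimes> inv y \<in> C"
        using x y C by (simp add: subgroup.m_closed subgroup.m_inv_closed)
      moreover have "g (x \<otimes> inv y) = \<one>"
        using c g x y endo_closed[OF g c[OF y(1)]] by (simp add: endo_simps)
      moreover have "f x = f (x \<otimes> inv y) \<otimes> f y"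
        using c x y f endo_closed[OF f] by (simp add: endo_simps m_assoc)
      ultimately show "z \<in> (\<lambda>k. k \<otimes> f y) ` (f ` {x \<in> C. g x = \<one>})"
        using x by blast
    qed
    then show ?thesis
      using assms(5) finite_subset by blast
  next
    case False
    then have "{x \<in> C. g x = t} = {}" by auto
    then show ?thesis by (metis finite.emptyI image_empty)
  qed
  moreover have eq: "f ` C = (\<Union>t\<in>g ` C. f ` {x \<in> C. g x = t})" by auto
  ultimately show ?thesis
    unfolding eq using assms(4) by (intro finite_UN_I)
qed

lemma finite_torsion_power:
  assumes C: "subgroup C G" and fin: "finite {x \<in> C. x [^] (p::nat) = \<one>}"
  shows "finite {x \<in> C. x [^] (p ^ k) = \<one>}"
proof (induction k)
  case 0
  have "{x \<in> C. x [^] (p ^ 0) = \<one>} \<subseteq> {\<one>}"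
    using C by (auto dest: subgroup.mem_carrier)
  then show ?case
    using finite_subset by blast
next
  case (Suc k)
  have "{x \<in> C. x [^] (p ^ Suc k) = \<one>} \<subseteq> {x \<in> C. x [^] p \<in> {x \<in> C. x [^] (p ^ k) = \<one>}}"
  proof safe
    fix x assume x: "x \<in> C" "x [^] (p ^ Suc k) = \<one>"
    then show "x [^] p \<in> C"
      using C by (metis int_pow_int subgroup_int_pow_closed)
    show "(x [^] p) [^] p ^ k = \<one>"
      using x C by (simp add: nat_pow_pow subgroup.mem_carrier)
  qed
  moreover have "finite {x \<in> C. x [^] p \<in> {x \<in> C. x [^] (p ^ k) = \<one>}}"
    by (rule finite_hom_vimage[OF hom_nat_power C fin Suc])
  ultimately show ?case
    using finite_subset by blast
qed

text \<open>In additive notation this is the subgroup nC.\<close>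

definition powers :: "nat \<Rightarrow> 'a set \<Rightarrow> 'a set" where
  "powers n C = (\<lambda>x. x [^] n) ` C"

lemma subgroup_image:
  assumes "f \<in> hom G G" "subgroup C G"
  shows "subgroup (f ` C) G"
  by (intro group_hom.subgroup_img_is_subgroup)
    (use assms in \<open>auto simp: group_hom_def group_hom_axioms_def\<close>)

lemma subgroup_powers: "subgroup C G \<Longrightarrow> subgroup (powers n C) G"
  unfolding powers_def by (rule subgroup_image[OF hom_nat_power])

lemma nat_pow_mem: "subgroup C G \<Longrightarrow> x \<in> C \<Longrightarrow> x [^] (n::nat) \<in> C"
  by (metis int_pow_int subgroup_int_pow_closed)

lemma powers_subset: "subgroup C G \<Longrightarrow> powers n C \<subseteq> C"
  by (auto simp: powers_def nat_pow_mem)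

lemma powers_powers: "C \<subseteq> carrier G \<Longrightarrow> powers n (powers m C) = powers (m * n) C"
  by (auto simp: powers_def image_image nat_pow_pow subset_iff intro!: image_cong)

lemma powers_antimono:
  assumes "subgroup C G" "m dvd n"
  shows "powers n C \<subseteq> powers m C"
proof -
  obtain d where "n = d * m"
    using assms by (metis dvdE mult.commute)
  then have "powers n C = powers m (powers d C)"
    using powers_powers[of C m d] assms by (simp add: subgroup.subset)
  also have "\<dots> \<subseteq> powers m C"
    using powers_subset[OF assms(1)] by (auto simp: powers_def)
  finally show ?thesis .
qed

text \<open>Here \<open>k\<close> is the order of \<open>x\<close> modulo \<open>H\<close>. The
  remainder of \<open>j\<close> modulo \<open>k\<close> is again an exponent leading into
  \<open>H\<close>, so minimality makes it zero.\<close>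

lemma least_power_in_subgroup:
  assumes H: "subgroup H G" and x: "x \<in> carrier G" and n: "(n::nat) > 0" "x [^] n \<in> H"
  obtains k :: nat where "k > 0" "x [^] k \<in> H" "\<And>j::int. x [^] j \<in> H \<Longrightarrow> int k dvd j"
proof -
  define k where "k = (LEAST k. k > 0 \<and> x [^] (k::nat) \<in> H)"
  have k: "k > 0 \<and> x [^] k \<in> H"
    unfolding k_def by (rule LeastI[of "\<lambda>k. k > 0 \<and> x [^] k \<in> H" n]) (use n in simp)
  have "int k dvd j" if j: "x [^] (j::int) \<in> H" for j
  proof -
    have "x [^] (j mod int k) = x [^] (j - int k * (j div int k))"
      by (simp add: minus_mult_div_eq_mod)
    also have "\<dots> = x [^] j \<otimes> inv ((x [^] k) [^] (j div int k))"
      using x by (simp add: int_pow_diff int_pow_pow flip: int_pow_int)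
    also have "\<dots> \<in> H"
      using j subgroup_int_pow_closed[OF H, of "x [^] k"] k
      by (intro subgroup.m_closed[OF H] subgroup.m_inv_closed[OF H]) auto
    finally have "x [^] nat (j mod int k) \<in> H"
      using k by (simp add: pow_nat)
    moreover have "nat (j mod int k) < k"
      using k by (simp add: nat_less_iff)
    moreover have "\<not> (i > 0 \<and> x [^] i \<in> H)" if "i < k" for i
      using that unfolding k_def by (rule not_less_Least)
    ultimately have "j mod int k \<le> 0"
      by force
    moreover have "j mod int k \<ge> 0"
      using k by simp
    ultimately show ?thesis
      by (simp add: dvd_eq_mod_eq_0)
  qed
  then show thesis
    using that k by blast
qed

text \<open>Injectivity of divisible groups, by Zorn's lemma for the subgroups above
  \<open>C\<close> that meet \<open>D\<close> trivially. The prescribed \<open>C\<close> serves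
  twice: to place all noncritical components in the complement, and to force a complement through a
  chosen element in \<open>Sigma_separates\<close>.\<close>

lemma divisible_complement:
  assumes per: "\<And>x. x \<in> carrier G \<Longrightarrow> ord x > 0"
    and D: "subgroup D G" "\<And>n x. n > (0::nat) \<Longrightarrow> x \<in> D \<Longrightarrow> \<exists>y\<in>D. y [^] n = x"
    and C: "subgroup C G" "C \<inter> D \<subseteq> {\<one>}"
  shows "\<exists>B. C \<subseteq> B \<and> complementary D B"
proof -
  define Z where "Z = {B. subgroup B G \<and> C \<subseteq> B \<and> B \<inter> D \<subseteq> {\<one>}}"
  have "\<exists>M\<in>Z. \<forall>X\<in>Z. M \<subseteq> X \<longrightarrow> X = M"
  proof (rule subset_Zorn_nonempty)
    show "Z \<noteq> {}" using C by (auto simp: Z_def)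
  next
    fix \<C> assume ne: "\<C> \<noteq> {}" and ch: "subset.chain Z \<C>"
    have sub: "subgroup B G" "C \<subseteq> B" "B \<inter> D \<subseteq> {\<one>}" if "B \<in> \<C>" for B
      using ch that by (auto simp: subset.chain_def Z_def)
    have "subgroup (\<Union>\<C>) G"
    proof
      show "\<Union>\<C> \<subseteq> carrier G" using sub(1) by (auto dest: subgroup.mem_carrier)
      show "\<one> \<in> \<Union>\<C>" using sub(1) ne by (auto dest: subgroup.one_closed)
      show "inv x \<in> \<Union>\<C>" if "x \<in> \<Union>\<C>" for x
        using sub(1) that by (auto intro: subgroup.m_inv_closed)
      show "x \<otimes> y \<in> \<Union>\<C>" if xy: "x \<in> \<Union>\<C>" "y \<in> \<Union>\<C>" for x y
      proof -
        obtain X Y where XY: "X \<in> \<C>" "Y \<in> \<C>" "x \<in> X" "y \<in> Y" using xy by blast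
        then have "X \<subseteq> Y \<or> Y \<subseteq> X"
          using ch by (auto simp: subset.chain_def)
        then show ?thesis
          using XY sub(1) by (meson UnionI subgroup.m_closed subsetD)
      qed
    qed
    moreover have "C \<subseteq> \<Union>\<C>" "\<Union>\<C> \<inter> D \<subseteq> {\<one>}"
      using sub ne by blast+
    ultimately show "\<Union>\<C> \<in> Z"
      by (simp add: Z_def)
  qed
  then obtain B where B: "subgroup B G" "C \<subseteq> B" "B \<inter> D \<subseteq> {\<one>}"
    and max: "\<And>X. subgroup X G \<Longrightarrow> C \<subseteq> X \<Longrightarrow> X \<inter> D \<subseteq> {\<one>} \<Longrightarrow> B \<subseteq> X \<Longrightarrow> X = B"
    by (auto simp: Z_def)
  have BD: "subgroup (D <#> B) G"
    using B D by (simp add: mult_subgroups)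
  have DB: "D \<subseteq> D <#> B" "B \<subseteq> D <#> B"
    using B(1) D(1) by (simp_all add: subset_set_mult_left subset_set_mult_right subgroup.subset)
  have "x \<in> D <#> B" if x: "x \<in> carrier G" for x
  proof -
    have "x [^] ord x \<in> D <#> B"
      using x BD by (simp add: subgroup.one_closed)
    then obtain k :: nat where k: "k > 0" "x [^] k \<in> D <#> B"
      and kdvd: "\<And>j::int. x [^] j \<in> D <#> B \<Longrightarrow> int k dvd j"
      using least_power_in_subgroup[OF BD x per[OF x]] by blast
    obtain d b where db: "x [^] k = d \<otimes> b" "d \<in> D" "b \<in> B"
      using k by (auto simp: set_mult_def)
    obtain e where e: "e \<in> D" "e [^] k = d"
      using D(2)[OF k(1) db(2)] by blast
    \<comment> \<open>\<open>k\<close> is the order of \<open>x\<close> modulo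
      \<open>D <#> B\<close>. Dividing by the k-th root \<open>e\<close> of the
      \<open>D\<close>-factor moves the k-th power into \<open>B\<close>, so every power of
      \<open>y\<close> in \<open>D <#> B\<close> already lies in \<open>B\<close>. Adjoining
      \<open>y\<close> to \<open>B\<close> therefore keeps the intersection with \<open>D\<close>
      trivial, and maximality gives \<open>y \<in> B\<close>.\<close>
    define y where "y = x \<otimes> inv e"
    have c: "x \<in> carrier G" "e \<in> carrier G" "d \<in> carrier G" "b \<in> carrier G" "y \<in> carrier G"
      using x db e B(1) D(1) by (auto simp: y_def dest: subgroup.mem_carrier)
    have yk: "y [^] k = b"
      using c db e by (simp add: y_def nat_pow_distrib nat_pow_inv m_ac)
    have xy: "x = e \<otimes> y"
      using c unfolding y_def by algebra
    have yj: "y [^] j \<in> B" if "y [^] j \<in> D <#> B" for j :: int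
    proof -
      have "x [^] j = e [^] j \<otimes> y [^] j"
        using c xy by (simp add: int_pow_distrib)
      moreover have "e [^] j \<in> D <#> B"
        using e D(1) DB by (auto intro: subgroup_int_pow_closed)
      ultimately have "x [^] j \<in> D <#> B"
        using BD that by (simp add: subgroup.m_closed)
      then obtain l where "j = int k * l"
        using kdvd by blast
      then have "y [^] j = b [^] l"
        using c yk by (metis int_pow_int int_pow_pow)
      then show ?thesis
        using db B by (simp add: subgroup_int_pow_closed)
    qed
    define X where "X = B <#> generate G {y}"
    have "X = B"
    proof (rule max)
      show X: "subgroup X G"
        unfolding X_def using B c by (simp add: mult_subgroups subgroup_cyclic)
      show BX: "B \<subseteq> X"
        unfolding X_def using B c by (intro subset_set_mult_left) (auto simp: subgroup.subset subgroup_cyclic)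
      show "C \<subseteq> X" using B BX by auto
      show "X \<inter> D \<subseteq> {\<one>}"
      proof
        fix z assume z: "z \<in> X \<inter> D"
        then obtain b' j where bj: "b' \<in> B" "z = b' \<otimes> y [^] (j::int)"
          using c by (auto simp: X_def set_mult_def mem_generate_iff)
        have b'c: "b' \<in> carrier G" using bj B by (auto dest: subgroup.mem_carrier)
        have "y [^] j = z \<otimes> inv b'"
          unfolding bj(2) using b'c c(5) by algebra
        also have "\<dots> \<in> D <#> B"
          using z bj B by (intro set_multI) (auto intro: subgroup.m_inv_closed)
        finally have "y [^] j \<in> B" by (rule yj)
        then have "z \<in> B"
          using bj B by (simp add: subgroup.m_closed)
        then show "z \<in> {\<one>}" using z B by auto
      qed
    qed
    moreover have "y \<in> X"
      unfolding X_def using subset_set_mult_right[OF B(1) subgroup.subset[OF subgroup_cyclic[OF c(5)]]]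
        cyclic_self[OF c(5)] by blast
    ultimately have "y \<in> B" by simp
    then show ?thesis
      using xy e by (auto intro: set_multI)
  qed
  then have "D <#> B = carrier G"
    using BD subgroup.subset by blast
  moreover have "D \<inter> B = {\<one>}"
    using B D subgroup.one_closed by blast
  ultimately have "complementary D B"
    using B D by (simp add: complementary_def)
  then show ?thesis using B by blast
qed

end

context periodic_comm_group
begin

subsection \<open>Power and finitary automorphisms\<close>

text \<open>The cyclic subgroups of \<open>H\<close> are finite and mapped into themselves, so
  injectivity makes \<open>f\<close> onto each of them, and they cover \<open>H\<close>.\<close>

lemma inj_on_seteq:
  assumes f: "f \<in> hom G G" "inj_on f (carrier G)" and H: "subgroup H G"
    and pow: "\<And>x. x \<in> H \<Longrightarrow> \<exists>k::int. f x = x [^] k"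
  shows "f ` H = H"
proof
  show "f ` H \<subseteq> H"
  proof
    fix y assume "y \<in> f ` H"
    then obtain x where x: "x \<in> H" "y = f x" by blast
    with pow obtain k :: int where "y = x [^] k" by blast
    then show "y \<in> H"
      using subgroup_int_pow_closed[OF H x(1)] by simp
  qed
  show "H \<subseteq> f ` H"
  proof
    fix x assume x: "x \<in> H"
    then have xc: "x \<in> carrier G" using H by (auto dest: subgroup.mem_carrier)
    have sub: "generate G {x} \<subseteq> H"
      using x H by (intro generate_subgroup_incl) auto
    have "f ` generate G {x} \<subseteq> generate G {x}"
    proof
      fix y assume "y \<in> f ` generate G {x}"
      then obtain z where z: "z \<in> generate G {x}" "y = f z" by blast
      with pow sub obtain k :: int where "y = z [^] k" by blast
      then show "y \<in> generate G {x}"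
        using z subgroup_int_pow_closed[OF subgroup_cyclic[OF xc]] by blast
    qed
    moreover have "inj_on f (generate G {x})"
      using f(2) subgroup.subset[OF subgroup_cyclic[OF xc]] inj_on_subset by blast
    ultimately have "f ` generate G {x} = generate G {x}"
      using finite_cyclic[OF xc] endo_inj_surj by blast
    then have "x \<in> f ` generate G {x}"
      using cyclic_self[OF xc] by simp
    then show "x \<in> f ` H" using sub by blast
  qed
qed

lemma inj_onI_kernel:
  assumes "f \<in> hom G G" "\<And>x. x \<in> carrier G \<Longrightarrow> f x = \<one> \<Longrightarrow> x = \<one>"
  shows "inj_on f (carrier G)"
proof (rule inj_onI)
  fix x y assume xy: "x \<in> carrier G" "y \<in> carrier G" "f x = f y"
  then have "f (x \<otimes> inv y) = \<one>"
    using assms endo_closed[OF assms(1)] by (simp add: endo_simps)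
  then have "x \<otimes> inv y = \<one>"
    using assms xy by simp
  then show "x = y"
    using xy eq_iff_quotient by blast
qed

text \<open>Exponents on the primary components suffice: exponents \<open>i\<close> at
  \<open>x [^] k\<close> and \<open>j\<close> at \<open>x [^] (1 - k)\<close> combine to the
  exponent \<open>k * i + (1 - k) * j\<close> at \<open>x\<close>.\<close>

lemma PAutI:
  assumes f: "f \<in> hom G G" "f \<in> extensional (carrier G)"
    and ker: "\<And>x. x \<in> carrier G \<Longrightarrow> f x = \<one> \<Longrightarrow> x = \<one>"
    and pow: "\<And>p x. prime p \<Longrightarrow> x \<in> pp {p} \<Longrightarrow> \<exists>k::int. f x = x [^] k"
  shows "f \<in> PAut G"
proof -
  have pow': "\<exists>k::int. f x = x [^] k" if "x \<in> carrier G" for x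
    using that
  proof (induction x rule: primary_induct)
    case (split x k)
    then obtain i j :: int where "f (x [^] k) = (x [^] k) [^] i" "f (x [^] (1 - k)) = (x [^] (1 - k)) [^] j"
      by blast
    moreover have "f x = f (x [^] k) \<otimes> f (x [^] (1 - k))"
      using split(1) f(1) by (simp flip: endo_mult int_pow_mult)
    ultimately have "f x = x [^] (k * i + (1 - k) * j)"
      using split(1) by (simp add: int_pow_pow int_pow_mult)
    then show ?case by blast
  qed (use pow in auto)
  have inj: "inj_on f (carrier G)"
    using f(1) ker by (rule inj_onI_kernel)
  have "f ` H = H" if "subgroup H G" for H
    using inj_on_seteq[OF f(1) inj that] pow' subgroup.mem_carrier[OF that] by blast
  moreover from this[OF subgroup_self] have "f \<in> auto G"
    using f inj by (auto simp: auto_def Bij_def bij_betw_def)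
  ultimately show ?thesis by (simp add: PAut_def)
qed

lemma PAut_power:
  assumes "f \<in> PAut G" "x \<in> carrier G"
  shows "\<exists>k::int. f x = x [^] k"
proof -
  have "f ` generate G {x} = generate G {x}"
    using assms subgroup_cyclic by (auto simp: PAut_def)
  then have "f x \<in> generate G {x}"
    using cyclic_self[OF assms(2)] by blast
  then show ?thesis
    using assms by (simp add: mem_generate_iff)
qed

text \<open>An exponent valid at \<open>y\<close> carries over to every \<open>z\<close> killed by
  \<open>ord y\<close>. The hypothesis \<open>pow\<close> speaks only of products of powers of
  \<open>y\<close> and \<open>z\<close>, so the lemma also applies to maps that act by powers on a
  subgroup, such as the divisible part in \<open>scalar_on_D\<close>.\<close>

lemma power_common_exponent:
  assumes f: "f \<in> hom G G" and y: "y \<in> carrier G" and z: "z \<in> carrier G"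
    and pow: "\<And>(i::int) (j::int). \<exists>k::int. f (y [^] i \<otimes> z [^] j) = (y [^] i \<otimes> z [^] j) [^] k"
    and zn: "z [^] ord y = \<one>" and fy: "f y = y [^] (s::int)"
  shows "f z = z [^] s"
proof -
  define Y where "Y = generate G {y}"
  have Y: "subgroup Y G" using y by (simp add: Y_def subgroup_cyclic)
  have memY: "u \<in> Y \<longleftrightarrow> (\<exists>k::int. u = y [^] k)" for u
    using y by (simp add: Y_def mem_generate_iff)
  have "z [^] ord y \<in> Y"
    using zn Y by (simp add: subgroup.one_closed)
  then obtain k :: nat where k: "k > 0" "z [^] k \<in> Y"
    and kdvd: "\<And>j::int. z [^] j \<in> Y \<Longrightarrow> int k dvd j"
    using least_power_in_subgroup[OF Y z ord_pos[OF y]] by blast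
  \<comment> \<open>Dividing \<open>z\<close> by a power of \<open>y\<close> gives \<open>w\<close> with \<open>\<langle>w\<rangle> \<inter> \<langle>y\<rangle> = 1\<close>; then the exponents of \<open>f\<close> at
    \<open>w\<close>, \<open>y\<close> and \<open>w \<otimes> y\<close> can be compared.\<close>
  obtain c :: int where c: "z [^] k = y [^] c" using k memY by blast
  have "z [^] int (ord y) \<in> Y" using zn Y by (simp add: int_pow_int subgroup.one_closed)
  then obtain m where m: "int (ord y) = int k * m" using kdvd by blast
  have "y [^] (c * m) = (z [^] k) [^] m" using c y by (simp add: int_pow_pow)
  also have "\<dots> = z [^] (int k * m)" using z by (simp add: int_pow_pow flip: int_pow_int)
  also have "\<dots> = \<one>" using zn m by (metis int_pow_int)
  finally have "int (ord y) dvd c * m" using y by (simp add: int_pow_eq_id)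
  moreover have "m \<noteq> 0" using m ord_pos[OF y] by auto
  ultimately have "int k dvd c" using m by simp
  then obtain c' where c': "c = int k * c'" by blast
  define w where "w = z \<otimes> inv (y [^] c')"
  have wc: "w \<in> carrier G" using y z by (simp add: w_def)
  have w: "w = y [^] (-c') \<otimes> z [^] (1::int)" using y z by (simp add: w_def int_pow_neg m_comm)
  have zw: "z = w \<otimes> y [^] c'" using y z by (simp add: w_def m_assoc)
  have wpow: "w [^] j = z [^] j \<otimes> inv (y [^] (c' * j))" for j :: int
    using y z by (simp add: w_def int_pow_distrib int_pow_inv int_pow_pow)
  have wY: "w [^] j = \<one>" if "w [^] j \<in> Y" for j :: int
  proof -
    have "z [^] j = w [^] j \<otimes> y [^] (c' * j)"
      using y z by (simp add: wpow m_assoc)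
    also have "\<dots> \<in> Y"
      using that Y memY by (blast intro: subgroup.m_closed)
    finally obtain l where l: "j = int k * l" using kdvd by blast
    then have "z [^] j = (z [^] k) [^] l" using z by (metis int_pow_int int_pow_pow)
    also have "\<dots> = y [^] (c' * j)" using y c c' l by (simp add: int_pow_pow mult_ac)
    finally show ?thesis using y by (simp add: wpow)
  qed
  obtain a :: int where a: "f w = w [^] a"
    using pow[of "-c'" 1] w by metis
  have wy: "w \<otimes> y = y [^] (1 - c') \<otimes> z [^] (1::int)"
    using y z by (simp add: w_def int_pow_diff m_ac)
  obtain b :: int where b: "f (w \<otimes> y) = (w \<otimes> y) [^] b"
    using pow[of "1 - c'" 1] wy by metis
  have e: "w [^] a \<otimes> y [^] s = w [^] b \<otimes> y [^] b"
    using a b fy f wc y by (simp add: endo_mult int_pow_distrib)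
  \<comment> \<open>Both sides lie in the trivial intersection of the cyclic groups of
    \<open>w\<close> and \<open>y\<close>. So \<open>b\<close> agrees with \<open>s\<close> modulo
    \<open>ord y\<close>; as \<open>ord y\<close> also kills \<open>w\<close>, the exponent
    \<open>s\<close> is valid at \<open>w\<close> too.\<close>
  have e2: "w [^] (a - b) = y [^] (b - s)"
  proof -
    have "w [^] (a - b) = (w [^] a \<otimes> y [^] s) \<otimes> inv (w [^] b) \<otimes> inv (y [^] s)"
      unfolding int_pow_diff[OF wc] using wc y by algebra
    also have "\<dots> = y [^] (b - s)"
      unfolding e int_pow_diff[OF y] using wc y by algebra
    finally show ?thesis .
  qed
  then have "w [^] (a - b) \<in> Y" using memY by blast
  then have 1: "w [^] (a - b) = \<one>" by (rule wY)
  with e2 have "y [^] (b - s) = \<one>" by simp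
  then have 2: "int (ord y) dvd b - s" using int_pow_eq_id[OF y] by blast
  have wn: "w [^] ord y = \<one>"
  proof -
    have "y [^] (c' * int (ord y)) = \<one>" using y by (simp add: int_pow_eq_id)
    then show ?thesis using wpow[of "int (ord y)"] zn by (simp add: int_pow_int)
  qed
  have "w [^] a = w [^] b"
    using 1 wc by (metis eq_iff_quotient int_pow_closed int_pow_diff)
  also have "\<dots> = w [^] s"
    using wc wn 2 by (rule int_pow_cong)
  finally have "f w = w [^] s" using a by simp
  moreover have "f z = f w \<otimes> f y [^] c'"
    using f wc y by (subst zw) (simp add: endo_simps)
  ultimately have "f z = w [^] s \<otimes> (y [^] s) [^] c'" using fy by simp
  also have "\<dots> = (w \<otimes> y [^] c') [^] s"
    using wc y by (simp add: int_pow_distrib int_pow_pow mult.commute)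
  finally show ?thesis using zw by simp
qed

text \<open>Power automorphisms are central: \<open>\<sigma> x\<close> is killed by
  \<open>ord x\<close>, so the exponent of \<alpha> at \<open>x\<close> is also valid at
  \<open>\<sigma> x\<close>.\<close>

lemma PAut_commute:
  assumes a: "\<alpha> \<in> PAut G" and s: "\<sigma> \<in> auto G" and x: "x \<in> carrier G"
  shows "\<alpha> (\<sigma> x) = \<sigma> (\<alpha> x)"
proof -
  have ah: "\<alpha> \<in> hom G G" using a by (auto simp: PAut_def autoD)
  have sh: "\<sigma> \<in> hom G G" using s by (auto simp: autoD)
  obtain k :: int where k: "\<alpha> x = x [^] k" using PAut_power[OF a x] by blast
  have "\<alpha> (\<sigma> x) = (\<sigma> x) [^] k"
  proof (rule power_common_exponent[OF ah x endo_closed[OF sh x] _ _ k])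
    show "\<sigma> x [^] ord x = \<one>"
      using x sh by (metis endo_nat_pow endo_one pow_ord_eq_1)
    show "\<exists>k::int. \<alpha> (x [^] i \<otimes> \<sigma> x [^] j) = (x [^] i \<otimes> \<sigma> x [^] j) [^] k" for i j :: int
      using PAut_power[OF a] x sh by (simp add: endo_closed)
  qed
  then show ?thesis using k x sh by (simp add: endo_int_pow)
qed

text \<open>The fibres of the displacement \<open>f x \<otimes> inv x\<close> are the cosets of the
  subgroup of fixed points, so a finite image means finite index. From here on finitary maps are
  handled through their displacements.\<close>

lemma FAutI:
  assumes f: "f \<in> auto G" and fin: "finite ((\<lambda>x. f x \<otimes> inv x) ` carrier G)"
  shows "f \<in> FAut G"
proof -
  have h: "f \<in> hom G G" using f by (rule autoD)
  define H where "H = {x \<in> carrier G. f x = x}"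
  have H: "subgroup H G"
    unfolding H_def using hom_eq_on_subgroup[OF h, of "\<lambda>x. x"] by (simp add: hom_def)
  have "finite ((\<lambda>x. H #> x) ` carrier G)"
  proof (rule finite_image_factor[OF fin])
    fix x y assume x: "x \<in> carrier G" and y: "y \<in> carrier G"
      and eq: "f x \<otimes> inv x = f y \<otimes> inv y"
    have fc: "f x \<in> carrier G" "f y \<in> carrier G" using h x y by (simp_all add: endo_closed)
    have "f x \<otimes> inv (f y) = (f x \<otimes> inv x) \<otimes> x \<otimes> inv (f y)"
      using fc x y by algebra
    also have "\<dots> = x \<otimes> inv y"
      unfolding eq using fc x y by algebra
    finally have "x \<otimes> inv y \<in> H"
      using x y h by (simp add: H_def endo_simps)
    then show "H #> x = H #> y"
      using H x y r_coset_eq_iff by blast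
  qed
  moreover have "rcosets H = (\<lambda>x. H #> x) ` carrier G" by (auto simp: RCOSETS_def)
  ultimately have "finite (rcosets H)" by simp
  then show ?thesis
    using f H by (auto simp: FAut_def H_def intro!: exI[of _ H])
qed

lemma FAutD:
  assumes "f \<in> FAut G"
  shows "f \<in> auto G" "finite ((\<lambda>x. f x \<otimes> inv x) ` carrier G)"
proof -
  show a: "f \<in> auto G" using assms by (simp add: FAut_def)
  then have h: "f \<in> hom G G" by (rule autoD)
  obtain H where H: "subgroup H G" "finite (rcosets H)" "\<And>x. x \<in> H \<Longrightarrow> f x = x"
    using assms by (auto simp: FAut_def)
  have "rcosets H = (\<lambda>x. H #> x) ` carrier G" by (auto simp: RCOSETS_def)
  then have fin: "finite ((\<lambda>x. H #> x) ` carrier G)" using H by simp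
  show "finite ((\<lambda>x. f x \<otimes> inv x) ` carrier G)"
  proof (rule finite_image_factor[OF fin])
    fix x y assume x: "x \<in> carrier G" and y: "y \<in> carrier G" and eq: "H #> x = H #> y"
    have fc: "f x \<in> carrier G" "f y \<in> carrier G" using h x y by (simp_all add: endo_closed)
    have "f (x \<otimes> inv y) = x \<otimes> inv y" using eq H x y r_coset_eq_iff by blast
    then have e: "f x \<otimes> inv (f y) = x \<otimes> inv y" using x y h by (simp add: endo_simps)
    have "f x \<otimes> inv x = (f x \<otimes> inv (f y)) \<otimes> f y \<otimes> inv x" using fc x y by algebra
    also have "\<dots> = f y \<otimes> inv y" unfolding e using fc x y by algebra
    finally show "f x \<otimes> inv x = f y \<otimes> inv y" .
  qed
qed

end

context periodic_comm_group
begin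

section \<open>Primary components\<close>

text \<open>Once the socles are constant, each socle element has roots of every p-power degree in
  \<open>C\<close>. Dividing \<open>x\<close> by a p-th power built from such a root lowers its
  order, so by induction \<open>x\<close> is itself a p-th power in the subgroup reached.\<close>

lemma powers_eventually_divisible:
  assumes p: "prime (p::nat)" and C: "subgroup C G" "C \<subseteq> pp {p}"
    and fin: "finite {x \<in> powers (p ^ n) C. x [^] p = \<one>}"
  shows "\<exists>M. powers p (powers (p ^ M) C) = powers (p ^ M) C
    \<and> finite {x \<in> powers (p ^ M) C. x [^] p = \<one>}"
proof -
  \<comment> \<open>The socles \<open>S i\<close> decrease, so they are constant from some \<open>M\<close> on.\<close>
  define S where "S i = {x \<in> powers (p ^ i) C. x [^] p = \<one>}" for i
  have anti: "S j \<subseteq> S i" if "i \<le> j" for i j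
    using powers_antimono[OF C(1) le_imp_power_dvd[OF that]] by (auto simp: S_def)
  \<comment> \<open>The minimum is taken over \<open>j \<ge> n\<close>, where the socles are finite;
    an infinite one would have \<open>card\<close> equal to 0.\<close>
  obtain M where M: "M \<ge> n" "\<And>j. j \<ge> n \<Longrightarrow> card (S M) \<le> card (S j)"
    using ex_has_least_nat[of "\<lambda>j. j \<ge> n" n "\<lambda>j. card (S j)"] by auto
  have "finite (S n)" using fin by (simp add: S_def)
  then have finM: "finite (S M)"
    using anti[OF M(1)] finite_subset by blast
  have S_eq: "S j = S M" if "j \<ge> M" for j
    using anti[OF that] M(2)[of j] M(1) that finM by (intro card_seteq) auto
  define E where "E = powers (p ^ M) C"
  have E: "subgroup E G" unfolding E_def by (rule subgroup_powers[OF C(1)])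
  have Cc: "C \<subseteq> carrier G" using C(1) by (rule subgroup.subset)
  have "x \<in> powers p E" if "x \<in> E" "x [^] (p ^ i) = \<one>" for x i
    using that
  proof (induction i arbitrary: x)
    case 0
    then have "x = \<one>" using E by (simp add: subgroup.mem_carrier)
    then have "x = \<one> [^] p" by simp
    then show ?case
      unfolding powers_def using subgroup.one_closed[OF E] by blast
  next
    case (Suc i)
    have xc: "x \<in> carrier G" using Suc.prems E by (simp add: subgroup.mem_carrier)
    have "x [^] (p ^ i) \<in> S M"
      using Suc.prems xc nat_pow_mem[OF E Suc.prems(1)]
      by (simp add: S_def E_def[symmetric] nat_pow_pow mult.commute)
    \<comment> \<open>The level \<open>M + Suc i\<close> leaves one factor \<open>p\<close> beyond
      \<open>p ^ M\<close> and \<open>p ^ i\<close>: so \<open>x\<close> and \<open>e [^] p\<close>,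
      with \<open>e\<close> in \<open>E\<close>, have the same power with exponent
      \<open>p ^ i\<close>, and their quotient \<open>y\<close> falls under the induction
      hypothesis.\<close>
    then have "x [^] (p ^ i) \<in> S (M + Suc i)" using S_eq[of "M + Suc i"] by simp
    then obtain a where a: "a \<in> C" "x [^] (p ^ i) = a [^] (p ^ (M + Suc i))"
      by (auto simp: S_def powers_def)
    define e where "e = a [^] (p ^ M)"
    have ac: "a \<in> carrier G" using a Cc by auto
    have e: "e \<in> E" "e \<in> carrier G"
      using a ac by (auto simp: e_def E_def powers_def)
    have xe: "x [^] (p ^ i) = (e [^] p) [^] (p ^ i)"
      using a ac by (simp add: e_def nat_pow_pow power_add mult_ac)
    define y where "y = x \<otimes> inv (e [^] p)"
    have "y \<in> E"
      unfolding y_def using Suc.prems e nat_pow_mem[OF E] E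
      by (simp add: subgroup.m_closed subgroup.m_inv_closed)
    moreover have "y [^] (p ^ i) = \<one>"
      unfolding y_def using xc e xe by (simp add: nat_pow_distrib nat_pow_inv)
    ultimately obtain z where z: "z \<in> E" "y = z [^] p"
      using Suc.IH by (auto simp: powers_def)
    have "x = (z \<otimes> e) [^] p"
    proof -
      have "x = y \<otimes> e [^] p"
        unfolding y_def using xc e by (simp add: m_assoc)
      then show ?thesis
        using z e E by (simp add: nat_pow_distrib subgroup.mem_carrier)
    qed
    moreover have "z \<otimes> e \<in> E" using z e E by (simp add: subgroup.m_closed)
    ultimately show ?case unfolding powers_def by blast
  qed
  moreover have "\<exists>i. x [^] (p ^ i) = \<one>" if "x \<in> E" for x
    using that powers_subset[OF C(1)] C(2) mem_pp_prime_iff[OF p] unfolding E_def by blast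
  ultimately have "E \<subseteq> powers p E" by blast
  then have "powers p E = E" using powers_subset[OF E] by blast
  then show ?thesis using finM by (auto simp: E_def S_def)
qed

lemma inverse_mod_prime_power:
  assumes "prime (p::nat)" "\<not> int p dvd s"
  obtains u :: int where "int (p ^ n) dvd u * s - 1"
proof -
  have "coprime (int p) s" using assms by (simp add: prime_imp_coprime)
  then have "coprime (int (p ^ n)) s" by simp
  then obtain v u where "v * int (p ^ n) + u * s = 1"
    using bezout_int[of "int (p ^ n)" s] by (auto simp: coprime_iff_gcd_eq_1)
  then have "u * s - 1 = int (p ^ n) * (- v)" by (simp add: algebra_simps)
  then show thesis using that[of u] by simp
qed

lemma coprime_root:
  assumes x: "x \<in> carrier G" "x [^] (n::nat) = \<one>" and cop: "coprime (int n) s"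
  obtains u :: int where "x [^] (u * s) = x"
proof -
  obtain v u where "v * int n + u * s = 1"
    using bezout_int[of "int n" s] cop by (auto simp: coprime_iff_gcd_eq_1)
  then have "u * s - 1 = int n * (- v)" by (simp add: algebra_simps)
  then have d: "int n dvd u * s - 1" by simp
  then have "x [^] (u * s) = x [^] (1::int)"
    using x by (intro int_pow_cong) auto
  then show thesis using that[of u] x by simp
qed

text \<open>For \<open>n = p ^ k * m\<close> the p-power root comes from iterating
  \<open>powers p E = E\<close>, and \<open>m\<close>, being prime to \<open>p\<close>, is
  invertible modulo the order of that root.\<close>

lemma p_divisible_imp_divisible:
  assumes p: "prime (p::nat)" and E: "subgroup E G" "E \<subseteq> pp {p}" "powers p E = E"
    and n: "n > (0::nat)" and x: "x \<in> E"
  shows "\<exists>y\<in>E. y [^] n = x"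
proof -
  have c: "y \<in> carrier G" if "y \<in> E" for y using that E by (simp add: subgroup.mem_carrier)
  have pk: "\<exists>y\<in>E. y [^] (p ^ k) = x" if "x \<in> E" for k x
    using that
  proof (induction k arbitrary: x)
    case 0
    then show ?case using c by auto
  next
    case (Suc k)
    then obtain y where y: "y \<in> E" "y [^] (p ^ k) = x" by blast
    then obtain z where "z \<in> E" "y = z [^] p" using E(3) by (auto simp: powers_def)
    then have "z [^] (p ^ Suc k) = x" using y c by (simp add: nat_pow_pow)
    then show ?case using \<open>z \<in> E\<close> by blast
  qed
  obtain k m where km: "n = p ^ k * m" "\<not> p dvd m"
    using n p by (metis multiplicity_decompose' not_prime_unit less_numeral_extra(3))
  obtain y where y: "y \<in> E" "y [^] (p ^ k) = x" using pk[OF x] by blast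
  obtain a where a: "y [^] (p ^ a) = \<one>" using y E(2) mem_pp_prime_iff[OF p] by auto
  have "coprime p m" using km(2) p by (simp add: prime_imp_coprime)
  then have "coprime (int (p ^ a)) (int m)" by simp
  then obtain u :: int where u: "y [^] (u * int m) = y"
    using coprime_root[OF c[OF y(1)] a] by blast
  have "(y [^] u) [^] n = (y [^] (u * int m)) [^] (p ^ k)"
    using c[OF y(1)] km by (simp add: int_pow_pow mult_ac flip: int_pow_int)
  also have "\<dots> = x" using u y by simp
  finally show ?thesis using subgroup_int_pow_closed[OF E(1) y(1)] by blast
qed

lemma ord_prime_power:
  assumes p: "prime (p::nat)" and x: "x \<in> pp {p}"
  obtains k where "ord x = p ^ k"
proof -
  obtain n where "x [^] (p ^ n) = \<one>" and "x \<in> carrier G" using x mem_pp_prime_iff[OF p] by auto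
  then have "ord x dvd p ^ n" by (simp add: pow_eq_id)
  then show thesis using that divides_primepow_nat[OF p] by auto
qed

lemma ord_eq_prime_power:
  assumes p: "prime (p::nat)" and x: "x \<in> carrier G" "x [^] (p ^ Suc n) = \<one>" "x [^] (p ^ n) \<noteq> \<one>"
  shows "ord x = p ^ Suc n"
proof -
  have "ord x dvd p ^ Suc n" using x pow_eq_id by blast
  then obtain i where i: "i \<le> Suc n" "ord x = p ^ i" using divides_primepow_nat[OF p] by blast
  have "\<not> i \<le> n" using x i pow_eq_id le_imp_power_dvd by metis
  then show ?thesis using i by (simp add: le_Suc_eq)
qed

lemma nontrivial_ord:
  assumes p: "prime (p::nat)" and x: "x \<in> pp {p}" "x \<noteq> \<one>"
  obtains l where "ord x = p ^ Suc l"
proof -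
  obtain k where k: "ord x = p ^ k" using ord_prime_power[OF p x(1)] by blast
  have "k \<noteq> 0" using k x(2) ord_eq_1[OF pp_carrier[OF x(1)]] by (intro notI) simp
  then obtain l where "k = Suc l" by (cases k) auto
  then show thesis using that k by blast
qed

text \<open>If \<open>p\<close> divided \<open>w\<close>, the element \<open>c [^] (p ^ l)\<close>
  of order \<open>p\<close> would be mapped to the identity.\<close>

lemma exponent_unit:
  assumes f: "f \<in> hom G G" "inj_on f (carrier G)" and p: "prime (p::nat)"
    and c: "c \<in> carrier G" "ord c = p ^ Suc l" and w: "f c = c [^] (w::int)"
  shows "\<not> int p dvd w"
proof
  assume "int p dvd w"
  then obtain v where v: "w = int p * v" by blast
  have "f (c [^] (p ^ l)) = (c [^] w) [^] (p ^ l)" using c(1) f(1) by (simp add: endo_nat_pow w)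
  also have "\<dots> = c [^] (w * int (p ^ l))" using c(1) by (metis int_pow_int int_pow_pow)
  also have "w * int (p ^ l) = int (ord c) * v" by (simp add: v c(2))
  also have "c [^] (int (ord c) * v) = (c [^] ord c) [^] v" using c(1) by (metis int_pow_int int_pow_pow)
  also have "\<dots> = f \<one>" using c(1) endo_one[OF f(1)] by simp
  finally have "c [^] (p ^ l) = \<one>" using inj_onD[OF f(2)] c(1) by blast
  then have "p ^ Suc l dvd p ^ l" using c pow_eq_id by metis
  then show False
    using p by (auto dest!: dvd_imp_le simp: prime_gt_0_nat prime_gt_1_nat not_le)
qed

lemma powers_p_power: "C \<subseteq> carrier G \<Longrightarrow> powers p C = C \<Longrightarrow> powers (p ^ j) C = C"
proof (induction j)
  case 0
  then show ?case by (auto simp: powers_def subset_iff image_iff)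
next
  case (Suc j)
  have "powers (p ^ Suc j) C = powers (p ^ j) (powers p C)"
    using powers_powers[OF Suc.prems(1), of "p ^ j" p] by simp
  then show ?case using Suc by simp
qed

text \<open>A finite \<open>F\<close> misses some socle element \<open>k [^] (p ^ n)\<close>. As
  every nontrivial subgroup of the cyclic p-group of \<open>k\<close> contains this element, none of
  its nontrivial elements lies in \<open>F\<close>.\<close>

lemma infinite_socle_avoids:
  assumes p: "prime (p::nat)" and C: "subgroup C G"
    and inf: "infinite {x \<in> powers (p ^ n) C. x [^] p = \<one>}"
    and F: "subgroup F G" "finite F"
  obtains k where "k \<in> C" "ord k = p ^ Suc n" "avoids k F"
proof -
  have "\<not> {x \<in> powers (p ^ n) C. x [^] p = \<one>} \<subseteq> F"
    using inf F(2) finite_subset by blast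
  then obtain k where k: "k \<in> C" "k [^] (p ^ n) \<notin> F" "(k [^] (p ^ n)) [^] p = \<one>"
    by (auto simp: powers_def)
  have kc: "k \<in> carrier G" using k C by (simp add: subgroup.mem_carrier)
  have ks: "k [^] (p ^ Suc n) = \<one>" using k kc by (simp add: nat_pow_pow mult.commute)
  have main: "i = Suc n" if i: "i \<le> Suc n" and ki: "k [^] (p ^ i) \<in> F" for i
  proof (rule ccontr)
    assume "i \<noteq> Suc n"
    then have "k [^] (p ^ n) = (k [^] (p ^ i)) [^] (p ^ (n - i))"
      using i kc by (simp add: nat_pow_pow flip: power_add)
    then show False using k nat_pow_mem[OF F(1) ki] by simp
  qed
  have "ord k dvd p ^ Suc n" using ks kc pow_eq_id by blast
  then obtain i where i: "i \<le> Suc n" "ord k = p ^ i" using divides_primepow_nat[OF p] by blast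
  then have "k [^] (p ^ i) = \<one>" using kc by (metis pow_ord_eq_1)
  then have ordk: "ord k = p ^ Suc n" using main[OF i(1)] i F(1) by (simp add: subgroup.one_closed)
  have "k [^] j = \<one>" if j: "k [^] j \<in> F" for j :: int
  proof -
    define g where "g = gcd j (int (p ^ Suc n))"
    have "g \<ge> 0" "g dvd int (p ^ Suc n)" by (simp_all add: g_def del: power_Suc)
    then have "nat g dvd p ^ Suc n" by (metis int_nat_eq int_dvd_int_iff)
    then obtain i where i: "i \<le> Suc n" "nat g = p ^ i" using divides_primepow_nat[OF p] by blast
    have gi: "g = int (p ^ i)" using i(2) \<open>g \<ge> 0\<close> by linarith
    obtain u v where uv: "u * j + v * int (p ^ Suc n) = g"
      unfolding g_def using bezout_int by blast
    have "k [^] (p ^ i) = k [^] g" unfolding gi by (rule int_pow_int[symmetric])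
    also have "\<dots> = k [^] (j * u)"
      using kc ks uv by (intro int_pow_cong) (auto simp: algebra_simps simp del: power_Suc)
    also have "\<dots> = (k [^] j) [^] u" using kc by (simp add: int_pow_pow)
    also have "\<dots> \<in> F" using j F(1) by (rule subgroup_int_pow_closed[rotated])
    finally have "i = Suc n" by (rule main[OF i(1)])
    then have "int (ord k) dvd j" using gi ordk by (metis g_def gcd_dvd1)
    then show ?thesis using kc by (simp add: int_pow_eq_id)
  qed
  then have "avoids k F" by (simp add: avoids_def)
  then show thesis using that k(1) ordk by blast
qed

section \<open>From exponents at single elements to uniform exponents\<close>

lemma quotient_mem_trans:
  assumes F: "subgroup F G" and c: "x \<in> carrier G" "y \<in> carrier G" "z \<in> carrier G"
    and m: "x \<otimes> inv y \<in> F" "x \<otimes> inv z \<in> F"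
  shows "y \<otimes> inv z \<in> F"
proof -
  have "y \<otimes> inv z = inv (x \<otimes> inv y) \<otimes> (x \<otimes> inv z)" using c by algebra
  also have "\<dots> \<in> F" using F m by (simp add: subgroup.m_closed subgroup.m_inv_closed)
  finally show ?thesis .
qed

text \<open>The finite group \<open>F2\<close> contains \<open>z\<close> and its image, so
  \<open>k\<close> is independent of both and \<open>z \<otimes> k\<close> avoids \<open>F\<close>.
  Its exponent \<open>t\<close> modulo \<open>F\<close>, compared with \<open>s\<close> on the
  \<open>k\<close>-factor, gives \<open>k [^] (t - s) \<in> F2\<close>, hence \<open>t\<close> and
  \<open>s\<close> agree modulo \<open>ord k\<close>, which kills \<open>z\<close>.\<close>

lemma almost_power_transfer:
  assumes f: "f \<in> hom G G" and F: "almost_power f F" and F2: "subgroup F2 G" "F \<subseteq> F2"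
    and z: "z \<in> F2" "f z \<in> F2" and k: "k \<in> carrier G" "avoids k F2"
    and zk: "z [^] ord k = \<one>" and fk: "f k \<otimes> inv (k [^] (s::int)) \<in> F"
  shows "f z \<otimes> inv (z [^] s) \<in> F"
proof -
  have FG: "subgroup F G" using F by (simp add: almost_power_def)
  have zc: "z \<in> carrier G" "f z \<in> carrier G" "f k \<in> carrier G"
    using z F2 k f by (auto simp: subgroup.mem_carrier endo_closed)
  have "avoids (z \<otimes> k) F"
    unfolding avoids_def
  proof (intro allI impI)
    fix j :: int assume j: "(z \<otimes> k) [^] j \<in> F"
    have "k [^] j = inv (z [^] j) \<otimes> (z \<otimes> k) [^] j"
      using zc k by (simp add: int_pow_distrib inv_cancel2)
    also have "\<dots> \<in> F2"
      using j F2 subgroup_int_pow_closed[OF F2(1) z(1)]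
      by (intro subgroup.m_closed subgroup.m_inv_closed) auto
    finally have kj: "k [^] j = \<one>" using k by (simp add: avoids_def)
    then have "int (ord k) dvd j" using k by (simp add: int_pow_eq_id)
    then have "z [^] j = z [^] (0::int)" using zc zk by (intro int_pow_cong) auto
    then show "(z \<otimes> k) [^] j = \<one>" using zc k kj by (simp add: int_pow_distrib)
  qed
  then obtain t :: int where t: "f (z \<otimes> k) \<otimes> inv ((z \<otimes> k) [^] t) \<in> F"
    using F zc k unfolding almost_power_def by blast
  define u where "u = f k \<otimes> inv (k [^] s)"
  define v where "v = f (z \<otimes> k) \<otimes> inv ((z \<otimes> k) [^] t)"
  have uv: "u \<in> F" "v \<in> F" using t fk by (auto simp: u_def v_def)
  have uvc: "u \<in> carrier G" "v \<in> carrier G" using uv FG by (auto simp: subgroup.mem_carrier)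
  have zt: "z [^] t \<in> F2" using subgroup_int_pow_closed[OF F2(1) z(1)] .
  have veq: "v = f z \<otimes> f k \<otimes> inv (z [^] t) \<otimes> inv (k [^] t)"
    using zc k f by (simp add: v_def endo_mult int_pow_distrib inv_mult m_assoc)
  have "k [^] (t - s) = k [^] t \<otimes> inv (k [^] s)" using k by (simp add: int_pow_diff)
  also have "\<dots> = u \<otimes> inv v \<otimes> f z \<otimes> inv (z [^] t)"
    unfolding veq u_def using zc k by algebra
  also have "\<dots> \<in> F2"
    using uv z zt F2 by (auto intro!: subgroup.m_closed subgroup.m_inv_closed)
  finally have kts: "k [^] (t - s) = \<one>" using k by (simp add: avoids_def)
  then have "int (ord k) dvd t - s" using int_pow_eq_id[OF k(1)] by blast
  then have zts: "z [^] t = z [^] s" using zc zk int_pow_cong by blast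
  have ktseq: "k [^] t = k [^] s"
    using kts k by (metis eq_iff_quotient int_pow_closed int_pow_diff)
  have "f z \<otimes> inv (z [^] s) = v \<otimes> inv u"
    unfolding veq u_def zts ktseq using zc k by algebra
  also have "\<dots> \<in> F" using uv FG by (simp add: subgroup.m_closed subgroup.m_inv_closed)
  finally show ?thesis .
qed

text \<open>The exponent \<open>r\<close> is read off at a single \<open>k\<close>, which need not
  be independent of a given \<open>y\<close>. A third element \<open>l\<close>, independent of both,
  links them: its exponent is valid at \<open>y\<close> and at \<open>k\<close>, and since
  \<open>k\<close> avoids \<open>F\<close> it agrees with \<open>r\<close> modulo
  \<open>p ^ Suc n\<close>.\<close>

lemma uniform_exponent:
  assumes f: "f \<in> auto G" and F: "almost_power f F" and p: "prime (p::nat)"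
    and C: "subgroup C G" and inf: "infinite {x \<in> powers (p ^ n) C. x [^] p = \<one>}"
  shows "\<exists>r::int. \<not> int p dvd r \<and>
    (\<forall>y\<in>C. y [^] (p ^ Suc n) = \<one> \<longrightarrow> f y \<otimes> inv (y [^] r) \<in> F)"
proof -
  have FG: "subgroup F G" "finite F" using F by (auto simp: almost_power_def)
  have h: "f \<in> hom G G" using f by (rule autoD)
  \<comment> \<open>\<open>F1\<close> will also contain the preimage of \<open>F\<close>. If
    \<open>p\<close> divided \<open>r\<close>, then \<open>f\<close> would send
    \<open>k [^] (p ^ n)\<close> into \<open>F\<close>, so this nontrivial power of \<open>k\<close>
    would lie in \<open>F1\<close>.\<close>
  have "finite {x \<in> carrier G. f x \<in> F}"
  proof (rule finite_hom_vimage[OF h subgroup_self _ FG(2)])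
    have "{x \<in> carrier G. f x = \<one>} \<subseteq> {\<one>}"
      using inj_onD[OF autoD(4)[OF f], of _ \<one>] endo_one[OF h] by auto
    then show "finite {x \<in> carrier G. f x = \<one>}" using finite_subset by blast
  qed
  then obtain F1 where F1: "subgroup F1 G" "finite F1" "F \<union> {x \<in> carrier G. f x \<in> F} \<subseteq> F1"
    using finite_subgroup_of_finite[of "F \<union> {x \<in> carrier G. f x \<in> F}"] FG subgroup.subset by auto
  obtain k where k: "k \<in> C" "ord k = p ^ Suc n" "avoids k F1"
    using infinite_socle_avoids[OF p C inf F1(1,2)] by blast
  have kc: "k \<in> carrier G" using k C by (simp add: subgroup.mem_carrier)
  have kF: "avoids k F" using k(3) F1(3) avoids_mono by blast
  then obtain r :: int where r: "f k \<otimes> inv (k [^] r) \<in> F"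
    using F kc by (auto simp: almost_power_def)
  have ordk: "k [^] (p ^ Suc n) = \<one>" using kc k(2) by (metis pow_ord_eq_1)
  have np: "\<not> int p dvd r"
  proof
    assume "int p dvd r"
    then have "k [^] (r * int (p ^ n)) = k [^] (0::int)"
      using kc ordk by (intro int_pow_cong) (auto simp: mult.commute intro: mult_dvd_mono)
    then have kr: "(k [^] r) [^] (p ^ n) = \<one>" using kc by (simp add: int_pow_pow flip: int_pow_int)
    have "(f k \<otimes> inv (k [^] r)) [^] (p ^ n) = f (k [^] (p ^ n))"
      using kc h kr by (simp add: nat_pow_distrib nat_pow_inv endo_closed endo_nat_pow)
    then have "f (k [^] (p ^ n)) \<in> F" using nat_pow_mem[OF FG(1) r] by metis
    then have "k [^] (p ^ n) \<in> F1" using F1(3) kc by auto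
    then have "k [^] (p ^ n) = \<one>" using k(3) by (metis avoids_def int_pow_int)
    then have "p ^ Suc n dvd p ^ n" using kc k(2) pow_eq_id by metis
    then show False using p by (simp add: power_dvd_imp_le prime_gt_1_nat dvd_power_iff_le prime_ge_2_nat)
  qed
  have "f y \<otimes> inv (y [^] r) \<in> F" if y: "y \<in> C" "y [^] (p ^ Suc n) = \<one>" for y
  proof -
    have yc: "y \<in> carrier G" using y C by (simp add: subgroup.mem_carrier)
    obtain F2 where F2: "subgroup F2 G" "finite F2" "F \<union> {y, f y, k, f k} \<subseteq> F2"
      using finite_subgroup_of_finite[of "F \<union> {y, f y, k, f k}"] FG subgroup.subset[OF FG(1)] yc kc h
      by (auto simp: endo_closed)
    obtain l where l: "l \<in> C" "ord l = p ^ Suc n" "avoids l F2"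
      using infinite_socle_avoids[OF p C inf F2(1,2)] by blast
    have lc: "l \<in> carrier G" using l C by (simp add: subgroup.mem_carrier)
    have "avoids l F" using l(3) F2(3) avoids_mono by blast
    then obtain s :: int where s: "f l \<otimes> inv (l [^] s) \<in> F"
      using F lc by (auto simp: almost_power_def)
    have ys: "f y \<otimes> inv (y [^] s) \<in> F"
      using almost_power_transfer[OF h F F2(1) _ _ _ lc l(3) _ s] F2(3) y l(2) by auto
    have ks: "f k \<otimes> inv (k [^] s) \<in> F"
      using almost_power_transfer[OF h F F2(1) _ _ _ lc l(3) _ s] F2(3) ordk l(2) by auto
    have "k [^] r \<otimes> inv (k [^] s) \<in> F"
      using quotient_mem_trans[OF FG(1) _ _ _ r ks] kc h by (simp add: endo_closed)
    then have "k [^] (r - s) = \<one>"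
      using kF kc by (simp add: avoids_def flip: int_pow_diff)
    then have "int (p ^ Suc n) dvd r - s" using int_pow_eq_id[OF kc] k(2) by metis
    then have "y [^] r = y [^] s" using int_pow_cong[OF yc y(2)] by blast
    then show ?thesis using ys by simp
  qed
  then show ?thesis using np by blast
qed

text \<open>Successive p-th roots of \<open>x\<close> generate a locally cyclic p-group
  \<open>H\<close>. Inertia makes two of the values \<open>f (xs i)\<close> congruent modulo
  \<open>H\<close>, which forces \<open>f x \<in> H\<close>; and in \<open>H\<close> the elements
  killed by the order of \<open>x\<close> are powers of \<open>x\<close>.\<close>

lemma inertial_divisible_power:
  assumes f: "inertial G f" and p: "prime (p::nat)"
    and E: "subgroup E G" "E \<subseteq> pp {p}" "powers p E = E" and x: "x \<in> E"
  shows "\<exists>k::int. f x = x [^] k"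
proof -
  have h: "f \<in> hom G G" using f by (auto simp: inertial_def autoD)
  have c: "y \<in> carrier G" if "y \<in> E" for y using that E by (simp add: subgroup.mem_carrier)
  have "\<forall>y\<in>E. \<exists>z\<in>E. z [^] p = y" using E(3) unfolding powers_def by (metis imageE)
  then obtain rt where rt: "\<And>y. y \<in> E \<Longrightarrow> rt y \<in> E" "\<And>y. y \<in> E \<Longrightarrow> rt y [^] p = y" by metis
  define xs where "xs i = (rt ^^ i) x" for i
  have xs: "xs i \<in> E" for i by (induction i) (auto simp: xs_def x rt)
  have xc: "xs i \<in> carrier G" for i using xs c by blast
  have xs_Suc: "xs (Suc i) [^] p = xs i" for i using rt xs by (simp add: xs_def)
  have xs_add: "xs (i + j) [^] (p ^ j) = xs i" for i j
  proof (induction j)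
    case (Suc j)
    have "xs (i + Suc j) [^] (p ^ Suc j) = (xs (Suc (i + j)) [^] p) [^] (p ^ j)"
      using xc by (simp add: nat_pow_pow)
    then show ?case using xs_Suc Suc by simp
  qed (use xc in simp)
  define H where "H = (\<Union>i. generate G {xs i})"
  have memH: "u \<in> H \<longleftrightarrow> (\<exists>i. \<exists>k::int. u = xs i [^] k)" for u
    using xc by (auto simp: H_def mem_generate_iff)
  have common: "\<exists>k::int. xs i [^] l = xs (i + j) [^] k" for i j and l :: int
  proof -
    have "xs i [^] l = (xs (i + j) [^] (p ^ j)) [^] l" using xs_add by simp
    also have "\<dots> = xs (i + j) [^] (int (p ^ j) * l)" using xc by (metis int_pow_int int_pow_pow)
    finally show ?thesis by blast
  qed
  have H: "subgroup H G"
  proof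
    show "H \<subseteq> carrier G" using xc memH by auto
    show "\<one> \<in> H" using memH int_pow_0 by metis
    show "inv u \<in> H" if u: "u \<in> H" for u
    proof -
      obtain i and k :: int where "u = xs i [^] k" using u memH by blast
      then have "inv u = xs i [^] (- k)" using xc by (simp add: int_pow_neg)
      then show ?thesis using memH by blast
    qed
    show "u \<otimes> v \<in> H" if uv: "u \<in> H" "v \<in> H" for u v
    proof -
      obtain i j and k l :: int where "u = xs i [^] k" "v = xs j [^] l" using uv memH by blast
      then obtain k' l' :: int where "u = xs (i + j) [^] k'" "v = xs (j + i) [^] l'"
        using common by metis
      then have "u \<otimes> v = xs (i + j) [^] (k' + l')" using xc by (simp add: int_pow_mult add.commute)
      then show ?thesis using memH by blast
    qed
  qed
  have xsH: "xs i \<in> H" for i using memH xc int_pow_1 by metis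
  have "finite ((\<lambda>h. H #> f h) ` H)" using f H by (simp add: inertial_iff)
  then have "finite (range (\<lambda>i. H #> f (xs i)))"
    by (rule rev_finite_subset) (use xsH in auto)
  then have "\<not> inj (\<lambda>i. H #> f (xs i))" using range_inj_infinite by blast
  then obtain i' j' where ij': "i' \<noteq> j'" "H #> f (xs i') = H #> f (xs j')"
    unfolding inj_def by blast
  have "\<exists>i j. i < j \<and> H #> f (xs i) = H #> f (xs j)"
  proof (cases "i' < j'")
    case False
    with ij' show ?thesis by (intro exI[of _ j'] exI[of _ i']) simp
  qed (use ij' in blast)
  then obtain i j where ij: "i < j" "H #> f (xs i) = H #> f (xs j)" by blast
  obtain d where d: "j = i + Suc d" using ij(1) less_imp_Suc_add by auto
  \<comment> \<open>This is \<open>xs i \<otimes> inv (xs j)\<close>, so \<open>f w \<in> H\<close>.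
    Its exponent is prime to \<open>p\<close>, hence \<open>xs j\<close> is a power of
    \<open>w\<close>, and \<open>f (xs j) \<in> H\<close> follows.\<close>
  define w where "w = xs j [^] (int (p ^ Suc d) - 1)"
  have fc: "f (xs i) \<in> carrier G" for i using xc h by (simp add: endo_closed)
  have "f (xs i) \<otimes> inv (f (xs j)) \<in> H" using ij(2) H fc r_coset_eq_iff by blast
  moreover have "f (xs i) \<otimes> inv (f (xs j)) = f w"
  proof -
    have "w = xs j [^] (p ^ Suc d) \<otimes> inv (xs j)"
      using xc by (simp add: w_def int_pow_diff int_pow_int del: power_Suc of_nat_power)
    also have "\<dots> = xs i \<otimes> inv (xs j)" using xs_add[of i "Suc d"] d by simp
    finally show ?thesis using xc h fc by (simp add: endo_simps)
  qed
  ultimately have fw: "f w \<in> H" by simp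
  obtain a where a: "xs j [^] (p ^ a) = \<one>" using xs E(2) mem_pp_prime_iff[OF p] by blast
  have "coprime (int p) (int (p ^ Suc d) - 1)"
  proof (rule prime_imp_coprime)
    show "prime (int p)" using p by simp
    show "\<not> int p dvd int (p ^ Suc d) - 1"
    proof
      assume "int p dvd int (p ^ Suc d) - 1"
      moreover have "int p dvd int (p ^ Suc d)" by simp
      ultimately have "int p dvd 1" by (metis dvd_diff_right_iff)
      then show False using p by auto
    qed
  qed
  then have "coprime (int (p ^ a)) (int (p ^ Suc d) - 1)" by simp
  then obtain u :: int where u: "xs j [^] (u * (int (p ^ Suc d) - 1)) = xs j"
    using coprime_root[OF xc a] by blast
  have "w [^] u = xs j" using xc u by (simp add: w_def int_pow_pow mult.commute)
  then have "f (xs j) = f w [^] u" using h xc by (metis endo_int_pow int_pow_closed w_def)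
  then have "f (xs j) \<in> H" using subgroup_int_pow_closed[OF H fw] by simp
  moreover have x0: "x = xs 0" by (simp add: xs_def)
  moreover have "xs j [^] (p ^ j) = xs 0" using xs_add[of 0 j] by simp
  ultimately have "f x \<in> H" using nat_pow_mem[OF H] h xc by (metis endo_nat_pow)
  then obtain i and m :: int where im: "f x = xs i [^] m" using memH by blast
  have xi: "x = xs i [^] (p ^ i)" using xs_add[of 0 i] x0 by simp
  have "xs i \<in> pp {p}" using xs E(2) by blast
  then obtain b where b: "ord (xs i) = p ^ b" using ord_prime_power[OF p] by blast
  \<comment> \<open>For \<open>b > i\<close> the element \<open>x = xs i [^] (p ^ i)\<close> has
    order \<open>p ^ (b - i)\<close>, which also kills \<open>f x = xs i [^] m\<close>; so
    \<open>p ^ i\<close> divides \<open>m\<close>. For \<open>b \<le> i\<close>, where the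
    subtraction would truncate, \<open>x\<close> is trivial.\<close>
  show ?thesis
  proof (cases "b \<le> i")
    case True
    then have "x = \<one>"
      using xi b xc pow_eq_id by (metis le_imp_power_dvd)
    then show ?thesis using h by (intro exI[of _ 0]) (simp add: endo_one)
  next
    case False
    then have e: "b = i + (b - i)" by simp
    have "ord x = p ^ (b - i)"
      unfolding xi using xc b False p
      by (subst ord_pow) (auto simp: le_imp_power_dvd power_diff prime_gt_0_nat)
    then have "f x [^] (p ^ (b - i)) = \<one>"
      using x c h by (metis endo_nat_pow endo_one pow_ord_eq_1)
    then have "xs i [^] (m * int (p ^ (b - i))) = \<one>"
      using im xc by (metis int_pow_int int_pow_pow)
    then have "int (p ^ b) dvd m * int (p ^ (b - i))" using xc b int_pow_eq_id by metis
    moreover have "int (p ^ b) = int (p ^ i) * int (p ^ (b - i))" by (metis e of_nat_mult power_add)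
    ultimately have "int (p ^ i) dvd m" using p by (simp add: prime_gt_0_nat)
    then obtain m' where "m = int (p ^ i) * m'" by blast
    then have "f x = x [^] m'" using im xi xc by (metis int_pow_int int_pow_pow)
    then show ?thesis by blast
  qed
qed

text \<open>The coherent sequence \<open>s\<close> is a p-adic unit. It acts on a p-group since an
  element killed by \<open>p ^ n\<close> sees only \<open>s n\<close> modulo
  \<open>p ^ n\<close>.\<close>

lemma p_adic_power_automorphism:
  fixes s :: "nat \<Rightarrow> int"
  assumes p: "prime (p::nat)" and unit: "\<And>n. \<not> int p dvd s n"
    and cong: "\<And>n. int (p ^ n) dvd s (Suc n) - s n"
  shows "\<exists>\<alpha>\<in>PAut G. (\<forall>n. \<forall>x\<in>pp {p}. x [^] (p ^ n) = \<one> \<longrightarrow> \<alpha> x = x [^] s n) \<and>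
    (\<forall>x\<in>pp (primes - {p}). \<alpha> x = x)"
proof -
  have cong': "int (p ^ n) dvd s m - s n" if "n \<le> m" for m n
    using that
  proof (induction m rule: dec_induct)
    case (step m)
    have "int (p ^ n) dvd int (p ^ m)" using step by (simp add: le_imp_power_dvd)
    then have "int (p ^ n) dvd s (Suc m) - s m" using cong dvd_trans by blast
    then have "int (p ^ n) dvd (s (Suc m) - s m) + (s m - s n)" using step.IH by (rule dvd_add)
    then show ?case by simp
  qed simp
  \<comment> \<open>Any \<open>n\<close> with \<open>x [^] (p ^ n) = \<one>\<close> would give the
    same power; the least one makes the map well defined as a function of \<open>x\<close>.\<close>
  define e where "e x = (LEAST n. x [^] (p ^ n) = \<one>)" for x
  define a where "a x = x [^] s (e x)" for x
  have a_eq: "a x = x [^] s n" if x: "x \<in> pp {p}" and n: "x [^] (p ^ n) = \<one>" for x n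
  proof -
    have "x [^] (p ^ e x) = \<one>" unfolding e_def using n by (rule LeastI)
    moreover have "e x \<le> n" unfolding e_def using n by (rule Least_le)
    ultimately have "x [^] s n = x [^] s (e x)"
      using cong' x pp_carrier by (intro int_pow_cong) auto
    then show ?thesis by (simp add: a_def)
  qed
  have ex: "\<exists>n. x [^] (p ^ n) = \<one>" if "x \<in> pp {p}" for x
    using that mem_pp_prime_iff[OF p] by blast
  have pow_le: "x [^] (p ^ m) = \<one>" if "x \<in> carrier G" "x [^] (p ^ n) = \<one>" "n \<le> m" for x m n
    using that pow_eq_id by (meson dvd_trans le_imp_power_dvd)
  have c: "complementary (pp {p}) (pp (primes - {p}))" by (rule pp_complementary)
  have a_mult: "a (x \<otimes> y) = a x \<otimes> a y" if x: "x \<in> pp {p}" and y: "y \<in> pp {p}" for x y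
  proof -
    obtain m n where mn: "x [^] (p ^ m) = \<one>" "y [^] (p ^ n) = \<one>" using ex x y by blast
    have xy: "x \<in> carrier G" "y \<in> carrier G" using x y pp_carrier by auto
    let ?k = "max m n"
    have k: "x [^] (p ^ ?k) = \<one>" "y [^] (p ^ ?k) = \<one>"
      using pow_le[OF xy(1) mn(1)] pow_le[OF xy(2) mn(2)] by auto
    then have "(x \<otimes> y) [^] (p ^ ?k) = \<one>" using xy by (simp add: nat_pow_distrib)
    moreover have "x \<otimes> y \<in> pp {p}" using x y subgroup_pp by (simp add: subgroup.m_closed)
    ultimately show ?thesis using a_eq k x y xy by (simp add: int_pow_distrib)
  qed
  have a_closed: "a \<in> pp {p} \<rightarrow> carrier G" using pp_carrier by (auto simp: a_def)
  define \<alpha> where "\<alpha> = glue (pp {p}) (pp (primes - {p})) a (\<lambda>x. x)"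
  have id: "(\<lambda>x. x) \<in> pp (primes - {p}) \<rightarrow> carrier G" using pp_carrier by auto
  have hom: "\<alpha> \<in> hom G G"
    unfolding \<alpha>_def by (rule glue_hom[OF c a_mult a_closed _ id]) auto
  have left: "\<alpha> x = a x" if "x \<in> pp {p}" for x
    unfolding \<alpha>_def by (rule glue_left[OF c a_mult a_closed _ id that]) auto
  have right: "\<alpha> x = x" if "x \<in> pp (primes - {p})" for x
    unfolding \<alpha>_def by (rule glue_right[OF c a_mult a_closed _ id that]) auto
  have a_one: "x = \<one>" if x: "x \<in> pp {p}" "a x = \<one>" for x
  proof -
    obtain n where n: "x [^] (p ^ n) = \<one>" using ex x by blast
    have xc: "x \<in> carrier G" using x pp_carrier by blast
    have "coprime (int p) (s n)" using unit p by (simp add: prime_imp_coprime)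
    then obtain u :: int where u: "x [^] (u * s n) = x"
      using coprime_root[OF xc n, of "s n"] by auto
    have "x [^] s n = \<one>" using a_eq[OF x(1) n] x(2) by simp
    then show ?thesis using u xc by (metis int_pow_one int_pow_pow mult.commute)
  qed
  have "\<alpha> \<in> PAut G"
  proof (rule PAutI[OF hom])
    show "\<alpha> \<in> extensional (carrier G)" by (simp add: \<alpha>_def glue_def)
    show "x = \<one>" if x: "x \<in> carrier G" "\<alpha> x = \<one>" for x
    proof -
      let ?u = "proj (pp {p}) (pp (primes - {p})) x" and ?v = "proj (pp (primes - {p})) (pp {p}) x"
      note d = decompose[OF c x(1)]
      have au: "a ?u \<in> pp {p}"
        using d(1) subgroup_int_pow_closed[OF subgroup_pp] by (simp add: a_def)
      have "a ?u \<otimes> ?v = \<one> \<otimes> \<one>"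
        using x by (simp add: \<alpha>_def glue_def)
      then have "a ?u = \<one>" "?v = \<one>"
        using decomposition_unique[OF c au d(2)] subgroup.one_closed[OF subgroup_pp] by blast+
      then have "?u = \<one>" using a_one d(1) by blast
      then show ?thesis using d(3) \<open>?v = \<one>\<close> by simp
    qed
    show "\<exists>k::int. \<alpha> x = x [^] k" if q: "prime q" "x \<in> pp {q}" for q x
    proof (cases "q = p")
      case True
      then show ?thesis using left q by (auto simp: a_def)
    next
      case False
      then have "pp {q} \<subseteq> pp (primes - {p})" using q by (intro pp_mono) (auto simp: primes_def)
      then have "\<alpha> x = x [^] (1::int)" using right q pp_carrier by auto
      then show ?thesis by blast
    qed
  qed
  moreover have "\<alpha> x = x [^] s n" if "x \<in> pp {p}" "x [^] (p ^ n) = \<one>" for x n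
    using left a_eq that by metis
  ultimately show ?thesis using right by (intro bexI[of _ \<alpha>]) blast+
qed

end

section \<open>Groups of automorphisms\<close>

context comm_group
begin

abbreviation AG :: "('a \<Rightarrow> 'a) monoid" where
  "AG \<equiv> AutoGroup G"

lemma carrier_AG [simp]: "carrier AG = auto G"
  by (simp add: AutoGroup_def)

lemma group_AG: "group AG"
  by (rule AutoGroup)

lemma AG_mult_apply:
  "f \<in> auto G \<Longrightarrow> g \<in> auto G \<Longrightarrow> x \<in> carrier G \<Longrightarrow> (f \<otimes>\<^bsub>AG\<^esub> g) x = f (g x)"
  by (simp add: AutoGroup_def BijGroup_def auto_def compose_eq)

lemma AG_one_apply: "x \<in> carrier G \<Longrightarrow> \<one>\<^bsub>AG\<^esub> x = x"
  by (simp add: AutoGroup_def BijGroup_def)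

lemma AG_mult_closed: "f \<in> auto G \<Longrightarrow> g \<in> auto G \<Longrightarrow> f \<otimes>\<^bsub>AG\<^esub> g \<in> auto G"
  using monoid.m_closed[OF group.is_monoid[OF group_AG]] by simp

lemma AG_inv_closed: "f \<in> auto G \<Longrightarrow> inv\<^bsub>AG\<^esub> f \<in> auto G"
  using group.inv_closed[OF group_AG] by simp

lemma AG_one_closed: "\<one>\<^bsub>AG\<^esub> \<in> auto G"
  using monoid.one_closed[OF group.is_monoid[OF group_AG]] by simp

lemma auto_closed: "f \<in> auto G \<Longrightarrow> x \<in> carrier G \<Longrightarrow> f x \<in> carrier G"
  using autoD(1) endo_closed by blast

lemma AG_inv_left: "f \<in> auto G \<Longrightarrow> x \<in> carrier G \<Longrightarrow> (inv\<^bsub>AG\<^esub> f) (f x) = x"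
  using AG_mult_apply[OF AG_inv_closed] group.l_inv[OF group_AG] AG_one_apply by (metis carrier_AG)

lemma AG_inv_right: "f \<in> auto G \<Longrightarrow> x \<in> carrier G \<Longrightarrow> f ((inv\<^bsub>AG\<^esub> f) x) = x"
  using AG_mult_apply[OF _ AG_inv_closed] group.r_inv[OF group_AG] AG_one_apply by (metis carrier_AG)

lemma AG_inv_eq_iff:
  "f \<in> auto G \<Longrightarrow> x \<in> carrier G \<Longrightarrow> y \<in> carrier G \<Longrightarrow> (inv\<^bsub>AG\<^esub> f) x = y \<longleftrightarrow> x = f y"
  using AG_inv_left AG_inv_right by metis

lemma AG_eqI:
  assumes "f \<in> auto G" "g \<in> auto G" "\<And>x. x \<in> carrier G \<Longrightarrow> f x = g x"
  shows "f = g"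
  using assms autoD(2) extensionalityI by metis

lemma AG_subgroupI:
  assumes "S \<subseteq> auto G" "\<one>\<^bsub>AG\<^esub> \<in> S" "\<And>f. f \<in> S \<Longrightarrow> inv\<^bsub>AG\<^esub> f \<in> S"
    "\<And>f g. f \<in> S \<Longrightarrow> g \<in> S \<Longrightarrow> f \<otimes>\<^bsub>AG\<^esub> g \<in> S"
  shows "subgroup S AG"
  using assms by (intro subgroup.intro) auto

lemma AG_inv_fixes: "f \<in> auto G \<Longrightarrow> x \<in> carrier G \<Longrightarrow> f x = x \<Longrightarrow> (inv\<^bsub>AG\<^esub> f) x = x"
  using AG_inv_eq_iff by metis

lemma AG_subgroup_fixing:
  assumes S: "subgroup S AG" and X: "X \<subseteq> carrier G"
  shows "subgroup {f \<in> S. \<forall>x\<in>X. f x = x} AG"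
proof -
  have a: "f \<in> auto G" if "f \<in> S" for f using subgroup.mem_carrier[OF S that] by simp
  have Xc: "x \<in> carrier G" if "x \<in> X" for x using X that by blast
  show ?thesis
    by (rule AG_subgroupI)
      (use a Xc subgroup.one_closed[OF S] subgroup.m_inv_closed[OF S] subgroup.m_closed[OF S] in
        \<open>auto simp: AG_one_apply AG_inv_fixes AG_mult_apply\<close>)
qed

lemma PAut_auto: "f \<in> PAut G \<Longrightarrow> f \<in> auto G"
  by (simp add: PAut_def)

lemma FAut_auto: "f \<in> FAut G \<Longrightarrow> f \<in> auto G"
  by (simp add: FAut_def)

lemma subgroup_PAut: "subgroup (PAut G) AG"
proof (rule AG_subgroupI)
  show "PAut G \<subseteq> auto G" by (auto simp: PAut_def)
  have "\<one>\<^bsub>AG\<^esub> ` H = H" if "subgroup H G" for H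
    using subgroup.mem_carrier[OF that] AG_one_apply by (auto simp: image_iff)
  then show "\<one>\<^bsub>AG\<^esub> \<in> PAut G" by (simp add: PAut_def AG_one_closed)
next
  fix f assume f: "f \<in> PAut G"
  have fa: "f \<in> auto G" using f by (rule PAut_auto)
  have "(inv\<^bsub>AG\<^esub> f) ` H = H" if H: "subgroup H G" for H
  proof -
    have "(inv\<^bsub>AG\<^esub> f) ` H = (inv\<^bsub>AG\<^esub> f) ` (f ` H)" using f H by (simp add: PAut_def)
    also have "\<dots> = (\<lambda>x. x) ` H"
      unfolding image_image using AG_inv_left[OF fa] subgroup.mem_carrier[OF H]
      by (intro image_cong) auto
    finally show ?thesis by simp
  qed
  then show "inv\<^bsub>AG\<^esub> f \<in> PAut G" using fa by (simp add: PAut_def AG_inv_closed)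
next
  fix f g assume f: "f \<in> PAut G" and g: "g \<in> PAut G"
  have a: "f \<in> auto G" "g \<in> auto G" using f g by (auto intro: PAut_auto)
  have "(f \<otimes>\<^bsub>AG\<^esub> g) ` H = H" if H: "subgroup H G" for H
  proof -
    have "(f \<otimes>\<^bsub>AG\<^esub> g) ` H = f ` (g ` H)"
      unfolding image_image using AG_mult_apply[OF a] subgroup.mem_carrier[OF H]
      by (intro image_cong) auto
    then show ?thesis using f g H by (simp add: PAut_def)
  qed
  then show "f \<otimes>\<^bsub>AG\<^esub> g \<in> PAut G" using a by (simp add: PAut_def AG_mult_closed)
qed

end

context periodic_comm_group
begin

text \<open>Substituting \<open>g y\<close> for the argument turns the displacement of the composite
  into the quotient of \<open>f y\<close> by \<open>g y\<close>.\<close>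

lemma FAutI_quotient:
  assumes f: "f \<in> auto G" and g: "g \<in> auto G"
    and fin: "finite ((\<lambda>x. f x \<otimes> inv (g x)) ` carrier G)"
  shows "f \<otimes>\<^bsub>AG\<^esub> inv\<^bsub>AG\<^esub> g \<in> FAut G"
proof (rule FAutI)
  show "f \<otimes>\<^bsub>AG\<^esub> inv\<^bsub>AG\<^esub> g \<in> auto G" using f g by (simp add: AG_mult_closed AG_inv_closed)
  have "(\<lambda>x. (f \<otimes>\<^bsub>AG\<^esub> inv\<^bsub>AG\<^esub> g) x \<otimes> inv x) ` carrier G \<subseteq> (\<lambda>x. f x \<otimes> inv (g x)) ` carrier G"
  proof
    fix z assume "z \<in> (\<lambda>x. (f \<otimes>\<^bsub>AG\<^esub> inv\<^bsub>AG\<^esub> g) x \<otimes> inv x) ` carrier G"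
    then obtain x where x: "x \<in> carrier G" "z = (f \<otimes>\<^bsub>AG\<^esub> inv\<^bsub>AG\<^esub> g) x \<otimes> inv x" by blast
    have "z = f ((inv\<^bsub>AG\<^esub> g) x) \<otimes> inv (g ((inv\<^bsub>AG\<^esub> g) x))"
      using x f g by (simp add: AG_mult_apply AG_inv_closed AG_inv_right)
    then show "z \<in> (\<lambda>x. f x \<otimes> inv (g x)) ` carrier G"
      using x g auto_closed[OF AG_inv_closed] by blast
  qed
  then show "finite ((\<lambda>x. (f \<otimes>\<^bsub>AG\<^esub> inv\<^bsub>AG\<^esub> g) x \<otimes> inv x) ` carrier G)"
    using fin finite_subset by blast
qed

lemma subgroup_FAut: "subgroup (FAut G) AG"
proof (rule AG_subgroupI)
  show "FAut G \<subseteq> auto G" by (auto simp: FAut_def)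
  have "(\<lambda>x. \<one>\<^bsub>AG\<^esub> x \<otimes> inv x) ` carrier G \<subseteq> {\<one>}" by (auto simp: AG_one_apply)
  then show one: "\<one>\<^bsub>AG\<^esub> \<in> FAut G"
    using finite_subset by (intro FAutI AG_one_closed) blast
  fix f assume f: "f \<in> FAut G"
  have a: "f \<in> auto G" using f by (rule FAut_auto)
  have "finite ((\<lambda>x. \<one>\<^bsub>AG\<^esub> x \<otimes> inv (f x)) ` carrier G)"
  proof (rule finite_subset)
    show "(\<lambda>x. \<one>\<^bsub>AG\<^esub> x \<otimes> inv (f x)) ` carrier G \<subseteq> (\<lambda>z. inv z) ` (\<lambda>x. f x \<otimes> inv x) ` carrier G"
      using auto_closed[OF a] by (auto simp: image_image AG_one_apply inv_mult m_comm)
  qed (use FAutD(2)[OF f] in blast)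
  then have "\<one>\<^bsub>AG\<^esub> \<otimes>\<^bsub>AG\<^esub> inv\<^bsub>AG\<^esub> f \<in> FAut G"
    using a by (intro FAutI_quotient AG_one_closed)
  then show "inv\<^bsub>AG\<^esub> f \<in> FAut G"
    using a AG_inv_closed[OF a] monoid.l_one[OF group.is_monoid[OF group_AG]] by simp
next
  fix f g assume f: "f \<in> FAut G" and g: "g \<in> FAut G"
  have a: "f \<in> auto G" "g \<in> auto G" using f g by (auto intro: FAut_auto)
  show "f \<otimes>\<^bsub>AG\<^esub> g \<in> FAut G"
  proof (rule FAutI)
    show "f \<otimes>\<^bsub>AG\<^esub> g \<in> auto G" using a by (rule AG_mult_closed)
    have "(\<lambda>x. (f \<otimes>\<^bsub>AG\<^esub> g) x \<otimes> inv x) ` carrier G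
      \<subseteq> (\<lambda>x. f x \<otimes> inv x) ` carrier G <#> (\<lambda>x. g x \<otimes> inv x) ` carrier G"
    proof
      fix z assume "z \<in> (\<lambda>x. (f \<otimes>\<^bsub>AG\<^esub> g) x \<otimes> inv x) ` carrier G"
      then obtain x where x: "x \<in> carrier G" "z = f (g x) \<otimes> inv x" using a by (auto simp: AG_mult_apply)
      have c: "g x \<in> carrier G" "f (g x) \<in> carrier G" using a x by (auto intro: auto_closed)
      have "z = (f (g x) \<otimes> inv (g x)) \<otimes> (g x \<otimes> inv x)" unfolding x using c x(1) by algebra
      then show "z \<in> (\<lambda>x. f x \<otimes> inv x) ` carrier G <#> (\<lambda>x. g x \<otimes> inv x) ` carrier G"
        using c x(1) by (metis (no_types, lifting) imageI set_multI)
    qed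
    then show "finite ((\<lambda>x. (f \<otimes>\<^bsub>AG\<^esub> g) x \<otimes> inv x) ` carrier G)"
      using finite_set_mult[OF FAutD(2)[OF f] FAutD(2)[OF g]] finite_subset by blast
  qed
qed

lemma AG_conj_apply:
  "f \<in> auto G \<Longrightarrow> g \<in> auto G \<Longrightarrow> x \<in> carrier G \<Longrightarrow>
    (g \<otimes>\<^bsub>AG\<^esub> f \<otimes>\<^bsub>AG\<^esub> inv\<^bsub>AG\<^esub> g) x = g (f ((inv\<^bsub>AG\<^esub> g) x))"
  by (simp add: AG_mult_apply AG_mult_closed AG_inv_closed auto_closed)

lemma FAut_conj:
  assumes f: "f \<in> FAut G" and g: "g \<in> auto G"
  shows "g \<otimes>\<^bsub>AG\<^esub> f \<otimes>\<^bsub>AG\<^esub> inv\<^bsub>AG\<^esub> g \<in> FAut G"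
proof (rule FAutI)
  have a: "f \<in> auto G" using f by (rule FAut_auto)
  have gh: "g \<in> hom G G" using g by (rule autoD)
  show "g \<otimes>\<^bsub>AG\<^esub> f \<otimes>\<^bsub>AG\<^esub> inv\<^bsub>AG\<^esub> g \<in> auto G"
    using a g by (simp add: AG_mult_closed AG_inv_closed)
  have "(\<lambda>x. (g \<otimes>\<^bsub>AG\<^esub> f \<otimes>\<^bsub>AG\<^esub> inv\<^bsub>AG\<^esub> g) x \<otimes> inv x) ` carrier G \<subseteq> g ` (\<lambda>x. f x \<otimes> inv x) ` carrier G"
  proof
    fix z assume "z \<in> (\<lambda>x. (g \<otimes>\<^bsub>AG\<^esub> f \<otimes>\<^bsub>AG\<^esub> inv\<^bsub>AG\<^esub> g) x \<otimes> inv x) ` carrier G"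
    then obtain x where x: "x \<in> carrier G" "z = g (f ((inv\<^bsub>AG\<^esub> g) x)) \<otimes> inv x"
      using a g by (auto simp: AG_conj_apply)
    define y where "y = (inv\<^bsub>AG\<^esub> g) x"
    have y: "y \<in> carrier G" "g y = x" using x g by (auto simp: y_def AG_inv_right auto_closed AG_inv_closed)
    have "z = g (f y \<otimes> inv y)"
      using x y a gh auto_closed[OF a y(1)] by (simp add: y_def[symmetric] endo_mult endo_inv)
    then show "z \<in> g ` (\<lambda>x. f x \<otimes> inv x) ` carrier G" using y by blast
  qed
  then show "finite ((\<lambda>x. (g \<otimes>\<^bsub>AG\<^esub> f \<otimes>\<^bsub>AG\<^esub> inv\<^bsub>AG\<^esub> g) x \<otimes> inv x) ` carrier G)"
    using FAutD(2)[OF f] finite_subset by blast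
qed

lemma normal_FAut: "FAut G \<lhd> AG"
  using group.normal_inv_iff[OF group_AG] subgroup_FAut FAut_conj by auto

text \<open>By \<open>PAut_commute\<close> conjugation fixes each power automorphism. Normality
  makes the product with any subgroup a subgroup again.\<close>

lemma normal_PAut: "PAut G \<lhd> AG"
proof -
  have "g \<otimes>\<^bsub>AG\<^esub> f \<otimes>\<^bsub>AG\<^esub> inv\<^bsub>AG\<^esub> g = f" if f: "f \<in> PAut G" and g: "g \<in> auto G" for f g
  proof (rule AG_eqI)
    have a: "f \<in> auto G" using f by (rule PAut_auto)
    show "f \<in> auto G" by fact
    show "g \<otimes>\<^bsub>AG\<^esub> f \<otimes>\<^bsub>AG\<^esub> inv\<^bsub>AG\<^esub> g \<in> auto G"
      using a g by (simp add: AG_mult_closed AG_inv_closed)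
    fix x assume x: "x \<in> carrier G"
    have y: "(inv\<^bsub>AG\<^esub> g) x \<in> carrier G" using x g by (simp add: auto_closed AG_inv_closed)
    show "(g \<otimes>\<^bsub>AG\<^esub> f \<otimes>\<^bsub>AG\<^esub> inv\<^bsub>AG\<^esub> g) x = f x"
      using AG_conj_apply[OF a g x] PAut_commute[OF f g y] AG_inv_right[OF g x] by simp
  qed
  then show ?thesis
    using group.normal_inv_iff[OF group_AG] subgroup_PAut by auto
qed

lemma inertial_PAut:
  assumes f: "f \<in> PAut G"
  shows "inertial G f"
proof -
  have "finite ((\<lambda>h. H #> f h) ` H)" if H: "subgroup H G" for H
  proof (rule finite_subset)
    have "f h \<in> H" if "h \<in> H" for h using f H that unfolding PAut_def by blast
    then show "(\<lambda>h. H #> f h) ` H \<subseteq> {H}"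
      using subgroup.rcos_const[OF H is_group] by auto
  qed simp
  then show ?thesis using PAut_auto[OF f] by (simp add: inertial_iff)
qed

lemma inertial_FAut:
  assumes f: "f \<in> FAut G"
  shows "inertial G f"
proof -
  have a: "f \<in> auto G" using f by (rule FAut_auto)
  have "finite ((\<lambda>h. H #> f h) ` H)" if H: "subgroup H G" for H
  proof (rule finite_subset)
    show "(\<lambda>h. H #> f h) ` H \<subseteq> (\<lambda>z. H #> z) ` (\<lambda>x. f x \<otimes> inv x) ` carrier G"
    proof
      fix z assume "z \<in> (\<lambda>h. H #> f h) ` H"
      then obtain h where h: "h \<in> H" "z = H #> f h" by blast
      have c: "h \<in> carrier G" "f h \<in> carrier G"
        using subgroup.mem_carrier[OF H h(1)] auto_closed[OF a] by auto
      have "f h \<otimes> inv (f h \<otimes> inv h) = h" using c by algebra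
      then have "H #> f h = H #> (f h \<otimes> inv h)"
        using r_coset_eq_iff[OF H c(2), of "f h \<otimes> inv h"] c h by simp
      then show "z \<in> (\<lambda>z. H #> z) ` (\<lambda>x. f x \<otimes> inv x) ` carrier G" using h c by blast
    qed
  qed (use FAutD(2)[OF f] in blast)
  then show ?thesis using a by (simp add: inertial_iff)
qed

subsection \<open>Critical primes\<close>

text \<open>
  A prime is critical if the divisible part of its primary component is a nontrivial group of finite
  rank with bounded quotient. Contrary to the usual terminology the quotient may be finite.
\<close>

definition critical :: "nat set" where
  "critical = {p. prime p \<and> (\<exists>M. powers p (powers (p ^ M) (pp {p})) = powers (p ^ M) (pp {p}) \<and>
     finite {x \<in> powers (p ^ M) (pp {p}). x [^] p = \<one>} \<and> powers (p ^ M) (pp {p}) \<noteq> {\<one>})}"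

lemma pp_proj_power:
  assumes x: "x \<in> carrier G"
  shows "\<exists>k::int. proj (pp \<pi>) (pp (primes - \<pi>)) x = x [^] k"
proof -
  obtain k :: int where k: "x [^] k \<in> pp \<pi>" "x [^] (1 - k) \<in> pp (primes - \<pi>)"
    using pi_split[OF x] by blast
  have "x = x [^] k \<otimes> x [^] (1 - k)" using x by (simp flip: int_pow_mult)
  then show ?thesis using proj_eq[OF pp_complementary k] by auto
qed

lemma max_divisible_facts:
  "subgroup (max_divisible G) G"
  "n > (0::nat) \<Longrightarrow> x \<in> max_divisible G \<Longrightarrow> \<exists>y\<in>max_divisible G. y [^] n = x"
  "subgroup E G \<Longrightarrow> (\<And>n x. n > (0::nat) \<Longrightarrow> x \<in> E \<Longrightarrow> \<exists>y\<in>E. y [^] n = x) \<Longrightarrow> E \<subseteq> max_divisible G"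
proof -
  note m = max_divisible_eq
  show sub: "subgroup (max_divisible G) G" using m(1,2) by simp
  show "\<exists>y\<in>max_divisible G. y [^] n = x" if "n > (0::nat)" "x \<in> max_divisible G"
  proof -
    have "divisible (G\<lparr>carrier := max_divisible G\<rparr>)" using m(1,3) by simp
    then show ?thesis using that by (auto simp: divisible_def simp flip: nat_pow_consistent)
  qed
  show "E \<subseteq> max_divisible G" if "subgroup E G" "\<And>n x. n > (0::nat) \<Longrightarrow> x \<in> E \<Longrightarrow> \<exists>y\<in>E. y [^] n = x"
  proof -
    have "divisible (G\<lparr>carrier := E\<rparr>)"
      using that(2) by (auto simp: divisible_def simp flip: nat_pow_consistent)
    then show ?thesis using that(1) unfolding m(1) by blast
  qed
qed

end

text \<open>\<open>D\<close> is the sum of the divisible parts at the critical primes only;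
  divisible parts of infinite rank or with unbounded quotient stay in \<open>B\<close>. Hence
  \<open>D_max\<close> is a mere inclusion. The complement \<open>B\<close> is not canonical; it is
  fixed so that all noncritical components lie in it.\<close>

locale critical_setting = periodic_comm_group +
  fixes D B
  assumes compl: "complementary D B"
    and D_pp: "D \<subseteq> pp critical"
    and noncritical: "pp (primes - critical) \<subseteq> B"
    and D_divisible: "\<And>n x. n > (0::nat) \<Longrightarrow> x \<in> D \<Longrightarrow> \<exists>y\<in>D. y [^] n = x"
    and D_primary: "\<And>p. p \<in> critical \<Longrightarrow> D \<inter> pp {p} \<noteq> {\<one>} \<and>
      finite {x \<in> D \<inter> pp {p}. x [^] p = \<one>} \<and> (\<exists>M. D \<inter> pp {p} = powers (p ^ M) (pp {p}))"
    and D_max: "D \<subseteq> max_divisible G"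

lemma (in periodic_comm_group) critical_setting_exists: "\<exists>D B. critical_setting G D B"
proof -
  let ?M = "max_divisible G"
  define D where "D = ?M \<inter> pp critical"
  have D: "subgroup D G"
    unfolding D_def using max_divisible_facts(1) subgroup_pp by (rule subgroups_Inter_pair)
  \<comment> \<open>A root \<open>y\<close> taken in \<open>?M\<close> may leave
    \<open>pp \<pi>\<close>. Its projection to \<open>pp \<pi>\<close> is still a root of
    \<open>x\<close>, and being a power of \<open>y\<close> it stays in \<open>?M\<close>.\<close>
  have root: "\<exists>y\<in>?M \<inter> pp \<pi>. y [^] n = x" if n: "n > (0::nat)" and x: "x \<in> ?M" "x \<in> pp \<pi>" for n x \<pi>
  proof -
    obtain y where y: "y \<in> ?M" "y [^] n = x" using max_divisible_facts(2)[OF n x(1)] by blast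
    have yc: "y \<in> carrier G" using subgroup.mem_carrier[OF max_divisible_facts(1) y(1)] .
    let ?e = "proj (pp \<pi>) (pp (primes - \<pi>))"
    obtain k :: int where k: "?e y = y [^] k" using pp_proj_power[OF yc] by blast
    have "?e y \<in> ?M" using subgroup_int_pow_closed[OF max_divisible_facts(1) y(1)] k by simp
    moreover have "?e y \<in> pp \<pi>" using decompose(1)[OF pp_complementary yc] .
    moreover have "?e y [^] n = x"
      using endo_nat_pow[OF proj_hom[OF pp_complementary] yc] y(2) proj_on_left[OF pp_complementary x(2)]
      by metis
    ultimately show ?thesis by blast
  qed
  have D_div: "\<exists>y\<in>D. y [^] n = x" if "n > (0::nat)" "x \<in> D" for n x
    using root[OF that(1)] that(2) unfolding D_def by blast
  have "pp (primes - critical) \<inter> D \<subseteq> {\<one>}"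
    using pp_disjoint[of _ "primes - critical" critical] by (auto simp: D_def)
  then obtain B where B: "pp (primes - critical) \<subseteq> B" "complementary D B"
    using divisible_complement[OF ord_pos D D_div subgroup_pp] by blast
  have "D \<inter> pp {p} \<noteq> {\<one>} \<and> finite {x \<in> D \<inter> pp {p}. x [^] p = \<one>} \<and>
      (\<exists>M. D \<inter> pp {p} = powers (p ^ M) (pp {p}))" if p: "p \<in> critical" for p
  proof -
    obtain M where M: "prime p" "powers p (powers (p ^ M) (pp {p})) = powers (p ^ M) (pp {p})"
      "finite {x \<in> powers (p ^ M) (pp {p}). x [^] p = \<one>}" "powers (p ^ M) (pp {p}) \<noteq> {\<one>}"
      using p by (auto simp: critical_def)
    define E where "E = powers (p ^ M) (pp {p})"
    have E: "subgroup E G" "E \<subseteq> pp {p}"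
      unfolding E_def by (simp_all add: subgroup_powers subgroup_pp powers_subset)
    have "E \<subseteq> ?M"
      using max_divisible_facts(3)[OF E(1)] p_divisible_imp_divisible[OF M(1) E] M(2)
      unfolding E_def by blast
    moreover have "pp {p} \<subseteq> pp critical" using p by (intro pp_mono) auto
    ultimately have "E \<subseteq> D \<inter> pp {p}" using E(2) by (auto simp: D_def)
    moreover have "D \<inter> pp {p} \<subseteq> E"
    proof
      fix x assume x: "x \<in> D \<inter> pp {p}"
      have "p ^ M > 0" using M(1) by (simp add: prime_gt_0_nat)
      then obtain y where "y \<in> pp {p}" "y [^] (p ^ M) = x" using root[of "p ^ M" x "{p}"] x by (auto simp: D_def)
      then show "x \<in> E" by (auto simp: E_def powers_def)
    qed
    ultimately have "D \<inter> pp {p} = E" by blast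
    then show ?thesis using M(3,4) unfolding E_def by auto
  qed
  then have "critical_setting G D B"
    using B D_div by unfold_locales (auto simp: D_def)
  then show ?thesis by blast
qed

context critical_setting
begin

lemma D_subgroup: "subgroup D G" and B_subgroup: "subgroup B G"
  using compl by (auto simp: complementary_def)

lemma critical_prime: "p \<in> critical \<Longrightarrow> prime p"
  by (simp add: critical_def)

abbreviation eD :: "'a \<Rightarrow> 'a" where "eD \<equiv> proj D B"
abbreviation eB :: "'a \<Rightarrow> 'a" where "eB \<equiv> proj B D"
abbreviation eP :: "nat \<Rightarrow> 'a \<Rightarrow> 'a" where "eP p \<equiv> proj (pp {p}) (pp (primes - {p}))"

lemmas compl' = complementary_sym[OF compl]

lemma DB_trivial: "x \<in> D \<Longrightarrow> x \<in> B \<Longrightarrow> x = \<one>"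
  using compl by (auto simp: complementary_def)

lemma D_carrier: "x \<in> D \<Longrightarrow> x \<in> carrier G" and B_carrier: "x \<in> B \<Longrightarrow> x \<in> carrier G"
  using complementary_carrier[OF compl] by auto

lemma eD: "x \<in> carrier G \<Longrightarrow> eD x \<in> D" and eB: "x \<in> carrier G \<Longrightarrow> eB x \<in> B"
  and eDB: "x \<in> carrier G \<Longrightarrow> x = eD x \<otimes> eB x"
  using decompose[OF compl] by auto

lemma eD_pp: "x \<in> pp \<pi> \<Longrightarrow> eD x \<in> pp \<pi>" and eB_pp: "x \<in> pp \<pi> \<Longrightarrow> eB x \<in> pp \<pi>"
  using pp_endo[OF proj_hom[OF compl]] pp_endo[OF proj_hom[OF compl']] by auto

lemma B_bounded:
  assumes p: "p \<in> critical"
  shows "\<exists>m. \<forall>b\<in>B \<inter> pp {p}. b [^] (p ^ m) = \<one>"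
proof -
  obtain M where M: "D \<inter> pp {p} = powers (p ^ M) (pp {p})" using D_primary[OF p] by blast
  have "b [^] (p ^ M) = \<one>" if "b \<in> B \<inter> pp {p}" for b
  proof -
    have "b [^] (p ^ M) \<in> D" using M that by (auto simp: powers_def)
    then show ?thesis using DB_trivial nat_pow_mem[OF B_subgroup] that by blast
  qed
  then show ?thesis by blast
qed

text \<open>The socle of \<open>D\<close> is finite at a critical prime and trivial at any other;
  induction removes one prime factor of \<open>n\<close> at a time. This finite rank is used for
  inertia of \<Delta> and for the action on \<Sigma>.\<close>

lemma D_finite_torsion: "n > (0::nat) \<Longrightarrow> finite {x \<in> D. x [^] n = \<one>}"
proof (induction n rule: less_induct)
  case (less n)
  show ?case
  proof (cases "n = 1")
    case True
    have "{x \<in> D. x [^] n = \<one>} \<subseteq> {\<one>}" using True D_carrier by auto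
    then show ?thesis using finite_subset by blast
  next
    case False
    then obtain p where p: "prime p" "p dvd n" using prime_factor_nat by blast
    then obtain m where m: "n = p * m" by blast
    have m0: "m > 0" "m < n" using m less.prems p prime_gt_1_nat[of p] by auto
    have "{x \<in> D. x [^] p = \<one>} \<subseteq> {x \<in> D \<inter> pp {p}. x [^] p = \<one>}"
      using D_carrier mem_pp_prime_iff[OF p(1)] by (auto intro!: exI[of _ 1])
    moreover have "finite {x \<in> D \<inter> pp {p}. x [^] p = \<one>}"
    proof (cases "p \<in> critical")
      case False
      have "{x \<in> D \<inter> pp {p}. x [^] p = \<one>} \<subseteq> {\<one>}"
        using pp_disjoint[of _ critical "{p}"] D_pp False by auto
      then show ?thesis using finite_subset by blast
    qed (use D_primary in blast)
    ultimately have "finite {x \<in> D. x [^] p = \<one>}" using finite_subset by blast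
    then have "finite {x \<in> D. x [^] p \<in> {x \<in> D. x [^] m = \<one>}}"
      by (rule finite_hom_vimage[OF hom_nat_power D_subgroup _ less.IH[OF m0(2,1)]])
    moreover have "{x \<in> D. x [^] n = \<one>} \<subseteq> {x \<in> D. x [^] p \<in> {x \<in> D. x [^] m = \<one>}}"
      using D_carrier nat_pow_mem[OF D_subgroup] by (auto simp: m nat_pow_pow)
    ultimately show ?thesis using finite_subset by blast
  qed
qed

text \<open>A socle element of the nontrivial divisible group has roots of every p-power degree.
  Such elements detect exponents modulo every power of \<open>p\<close>.\<close>

lemma D_element_of_order:
  assumes p: "p \<in> critical"
  shows "\<exists>d\<in>D \<inter> pp {p}. ord d = p ^ Suc n"
proof -
  have pr: "prime p" using p by (rule critical_prime)
  have "\<one> \<in> D \<inter> pp {p}"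
    using subgroup.one_closed[OF D_subgroup] subgroup.one_closed[OF subgroup_pp] by blast
  then obtain x where x: "x \<in> D" "x \<in> pp {p}" "x \<noteq> \<one>" using D_primary[OF p] by blast
  have xc: "x \<in> carrier G" using x D_carrier by blast
  obtain l where l: "ord x = p ^ Suc l" using nontrivial_ord[OF pr x(2,3)] by blast
  define d where "d = x [^] (p ^ l)"
  have d: "d \<in> D" "d \<noteq> \<one>" "d [^] p = \<one>"
  proof -
    show "d \<in> D" using nat_pow_mem[OF D_subgroup x(1)] by (simp add: d_def)
    have "\<not> p ^ Suc l dvd p ^ l"
      using pr by (auto dest!: dvd_imp_le simp: prime_gt_0_nat prime_gt_1_nat not_le)
    then show "d \<noteq> \<one>" using l xc by (simp add: d_def pow_eq_id)
    have "x [^] (p ^ Suc l) = \<one>" using l xc by (metis pow_ord_eq_1)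
    then show "d [^] p = \<one>" using xc by (simp add: d_def nat_pow_pow mult.commute)
  qed
  have "p ^ n > 0" using pr by (simp add: prime_gt_0_nat)
  then obtain y where y: "y \<in> D" "y [^] (p ^ n) = d" using D_divisible[of "p ^ n" d] d(1) by auto
  have yc: "y \<in> carrier G" using y D_carrier by blast
  have yp: "y [^] (p ^ Suc n) = \<one>" using y(2) d(3) yc by (metis nat_pow_pow power_Suc2)
  then have "ord y = p ^ Suc n" using ord_eq_prime_power[OF pr yc] y d by simp
  moreover have "y \<in> pp {p}" using mem_pp_prime_iff[OF pr] yc yp by blast
  ultimately show ?thesis using y by blast
qed

end

section \<open>Inertial automorphisms\<close>

context periodic_comm_group
begin

lemma endo_comp: "f \<in> hom G G \<Longrightarrow> g \<in> hom G G \<Longrightarrow> (\<lambda>x. f (g x)) \<in> hom G G"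
  by (auto simp: hom_def Pi_iff)

lemma prime_power_Suc_torsion:
  assumes "x \<in> carrier G" "x [^] ((p::nat) ^ n) = \<one>"
  shows "x [^] (p ^ Suc n) = \<one>"
  using assms by (simp add: pow_eq_id)

lemma bounded_uniform_exponent:
  assumes f: "f \<in> auto G" and F: "almost_power f F" and p: "prime (p::nat)"
    and C: "subgroup C G" "C \<subseteq> pp {p}" and bd: "\<And>x. x \<in> C \<Longrightarrow> x [^] (p ^ m) = \<one>"
  shows "\<exists>r::int. \<not> int p dvd r \<and> finite ((\<lambda>y. f y \<otimes> inv (y [^] r)) ` C)"
proof -
  have h: "f \<in> hom G G" using f by (rule autoD)
  define S where "S n = {x \<in> powers (p ^ n) C. x [^] p = \<one>}" for n
  have "powers (p ^ m) C \<subseteq> {\<one>}" using bd by (auto simp: powers_def)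
  then have "S m \<subseteq> {\<one>}" by (auto simp: S_def)
  then have Sm: "finite (S m)" using finite_subset by blast
  \<comment> \<open>With this \<open>N\<close> the group \<open>powers (p ^ N) C\<close> is finite, being bounded with finite socle.\<close>
  define N where "N = (LEAST n. finite (S n))"
  have N: "finite (S N)" unfolding N_def using Sm by (rule LeastI)
  have "finite {x \<in> powers (p ^ N) C. x [^] (p ^ m) = \<one>}"
    using finite_torsion_power[OF subgroup_powers[OF C(1)]] N by (simp add: S_def)
  moreover have "powers (p ^ N) C \<subseteq> {x \<in> powers (p ^ N) C. x [^] (p ^ m) = \<one>}"
    using bd powers_subset[OF C(1)] by blast
  ultimately have finN: "finite (powers (p ^ N) C)" using finite_subset by blast
  show ?thesis
  proof (cases N)
    case 0
    then have "powers (p ^ N) C = C"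
      using subgroup.mem_carrier[OF C(1)] by (auto simp: powers_def image_iff)
    then have "finite ((\<lambda>y. f y \<otimes> inv (y [^] (1::int))) ` C)" using finN by simp
    moreover have "\<not> int p dvd 1" using p by auto
    ultimately show ?thesis by blast
  next
    \<comment> \<open>By minimality of \<open>N\<close> the socle at \<open>n = N - 1\<close> is
      infinite, and \<open>uniform_exponent\<close> at this level covers exactly the elements killed
      by \<open>p ^ N\<close>. The rest of \<open>C\<close> is controlled by the finite image under
      this power.\<close>
    case (Suc n)
    have "infinite (S n)" using not_less_Least[of n "\<lambda>n. finite (S n)"] Suc by (simp add: N_def)
    then obtain r :: int where r: "\<not> int p dvd r"
      "\<And>y. y \<in> C \<Longrightarrow> y [^] (p ^ Suc n) = \<one> \<Longrightarrow> f y \<otimes> inv (y [^] r) \<in> F"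
      using uniform_exponent[OF f F p C(1), of n] by (auto simp: S_def)
    have "finite ((\<lambda>y. f y \<otimes> inv (y [^] r)) ` C)"
    proof (rule finite_image_extension[OF hom_quotient[OF h hom_int_power] hom_nat_power C(1)])
      show "finite ((\<lambda>x. x [^] (p ^ N)) ` C)" using finN by (simp add: powers_def)
      have "(\<lambda>y. f y \<otimes> inv (y [^] r)) ` {x \<in> C. x [^] (p ^ N) = \<one>} \<subseteq> F"
        using r(2) Suc by auto
      moreover have "finite F" using F by (simp add: almost_power_def)
      ultimately show "finite ((\<lambda>y. f y \<otimes> inv (y [^] r)) ` {x \<in> C. x [^] (p ^ N) = \<one>})"
        using finite_subset by blast
    qed
    then show ?thesis using r(1) by blast
  qed
qed

lemma unbounded_power_part:
  assumes f: "f \<in> auto G" and F: "almost_power f F" and p: "prime (p::nat)"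
    and inf: "\<And>n. infinite {x \<in> powers (p ^ n) (pp {p}). x [^] p = \<one>}"
  shows "\<exists>\<alpha>\<in>PAut G. (\<forall>x\<in>pp (primes - {p}). \<alpha> x = x) \<and>
    (\<forall>x\<in>pp {p}. f x \<otimes> inv (\<alpha> x) \<in> F)"
proof -
  have FG: "subgroup F G" "finite F" using F by (auto simp: almost_power_def)
  have "\<exists>r::int. \<not> int p dvd r \<and>
      (\<forall>y\<in>pp {p}. y [^] (p ^ Suc n) = \<one> \<longrightarrow> f y \<otimes> inv (y [^] r) \<in> F)" for n
    using uniform_exponent[OF f F p subgroup_pp inf] .
  then obtain s :: "nat \<Rightarrow> int" where s: "\<And>n. \<not> int p dvd s n"
    "\<And>n y. y \<in> pp {p} \<Longrightarrow> y [^] (p ^ Suc n) = \<one> \<Longrightarrow> f y \<otimes> inv (y [^] s n) \<in> F"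
    by metis
  \<comment> \<open>\<open>s n\<close> is valid modulo \<open>F\<close> on elements killed by
    \<open>p ^ Suc n\<close>, one power more than its index. At \<open>k\<close> of that order both
    exponents are valid, and as \<open>k\<close> avoids \<open>F\<close> they agree even modulo
    \<open>p ^ Suc n\<close>.\<close>
  have "int (p ^ n) dvd s (Suc n) - s n" for n
  proof -
    obtain k where k: "k \<in> pp {p}" "ord k = p ^ Suc n" "avoids k F"
      using infinite_socle_avoids[OF p subgroup_pp inf FG] by blast
    have kc: "k \<in> carrier G" using k pp_carrier by blast
    have k1: "k [^] (p ^ Suc n) = \<one>" "k [^] (p ^ Suc (Suc n)) = \<one>"
      using kc k(2) by (simp_all add: pow_eq_id del: power_Suc add: le_imp_power_dvd)
    have "k [^] s (Suc n) \<otimes> inv (k [^] s n) \<in> F"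
      using quotient_mem_trans[OF FG(1) _ _ _ s(2)[OF k(1) k1(2)] s(2)[OF k(1) k1(1)]]
        kc auto_closed[OF f kc] by simp
    then have "k [^] (s (Suc n) - s n) = \<one>" using k(3) kc by (simp add: avoids_def flip: int_pow_diff)
    then have "int (p ^ Suc n) dvd s (Suc n) - s n" using int_pow_eq_id[OF kc] k(2) by metis
    moreover have "int (p ^ n) dvd int (p ^ Suc n)" by simp
    ultimately show ?thesis using dvd_trans by blast
  qed
  then obtain \<alpha> where \<alpha>: "\<alpha> \<in> PAut G" "\<And>x. x \<in> pp (primes - {p}) \<Longrightarrow> \<alpha> x = x"
    "\<And>n x. x \<in> pp {p} \<Longrightarrow> x [^] (p ^ n) = \<one> \<Longrightarrow> \<alpha> x = x [^] s n"
    using p_adic_power_automorphism[OF p, of s] s(1) by blast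
  have "f x \<otimes> inv (\<alpha> x) \<in> F" if x: "x \<in> pp {p}" for x
  proof -
    obtain n where n: "x [^] (p ^ n) = \<one>" using mem_pp_prime_iff[OF p] x by blast
    then have "x [^] (p ^ Suc n) = \<one>"
      by (rule prime_power_Suc_torsion[OF pp_carrier[OF x]])
    then show ?thesis using s(2)[OF x] \<alpha>(3)[OF x n] by simp
  qed
  then show ?thesis using \<alpha> by blast
qed

definition restrict_pp :: "nat set \<Rightarrow> ('a \<Rightarrow> 'a) \<Rightarrow> 'a \<Rightarrow> 'a" where
  "restrict_pp \<pi> f = glue (pp \<pi>) (pp (primes - \<pi>)) f (\<lambda>x. x)"

lemma restrict_pp:
  assumes f: "f \<in> auto G"
  shows "restrict_pp \<pi> f \<in> auto G"
    and "x \<in> pp \<pi> \<Longrightarrow> restrict_pp \<pi> f x = f x"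
    and "x \<in> pp (primes - \<pi>) \<Longrightarrow> restrict_pp \<pi> f x = x"
proof -
  have h: "f \<in> hom G G" using f by (rule autoD)
  have m: "f (x \<otimes> y) = f x \<otimes> f y" if "x \<in> pp \<pi>" "y \<in> pp \<pi>" for x y
    using that endo_mult[OF h] pp_carrier by blast
  have fc: "f \<in> pp \<pi> \<rightarrow> carrier G" using auto_closed[OF f] pp_carrier by blast
  have id: "(\<lambda>x. x) \<in> pp (primes - \<pi>) \<rightarrow> carrier G" using pp_carrier by auto
  have bij: "bij_betw f (pp \<pi>) (pp \<pi>)"
  proof (rule bij_betw_imageI)
    show "inj_on f (pp \<pi>)" using autoD(4)[OF f] pp_carrier by (meson inj_on_subset subsetI)
    show "f ` pp \<pi> = pp \<pi>"
    proof
      show "f ` pp \<pi> \<subseteq> pp \<pi>" using pp_endo[OF h] by blast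
      show "pp \<pi> \<subseteq> f ` pp \<pi>"
      proof
        fix y assume y: "y \<in> pp \<pi>"
        then obtain x where "x \<in> carrier G" "y = f x"
          using autoD(5)[OF f] pp_carrier by (metis imageE)
        then show "y \<in> f ` pp \<pi>" using y pp_auto_iff[OF f] by blast
      qed
    qed
  qed
  note c = pp_complementary[of \<pi>]
  show "restrict_pp \<pi> f \<in> auto G"
    unfolding restrict_pp_def by (rule glue_auto[OF c m fc _ id bij bij_betw_id[unfolded id_def]]) auto
  show "restrict_pp \<pi> f x = f x" if "x \<in> pp \<pi>"
    unfolding restrict_pp_def by (rule glue_left[OF c m fc _ id that]) auto
  show "restrict_pp \<pi> f x = x" if "x \<in> pp (primes - \<pi>)"
    unfolding restrict_pp_def by (rule glue_right[OF c m fc _ id that]) auto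
qed

lemma other_prime: "prime q \<Longrightarrow> q \<notin> \<pi> \<Longrightarrow> pp {q} \<subseteq> pp (primes - \<pi>)"
  by (intro pp_mono) (auto simp: primes_def)

end

section \<open>The group \<Delta> of scalings of the bounded complements\<close>

context critical_setting
begin

text \<open>For an automorphism the exponent is prime to \<open>p\<close> as soon as
  \<open>B \<inter> pp {p}\<close> is nontrivial. On a trivial component every \<open>r\<close>
  qualifies, a case that \<open>Delta_inv\<close> treats separately.\<close>

definition scales :: "nat \<Rightarrow> ('a \<Rightarrow> 'a) \<Rightarrow> bool" where
  "scales p \<epsilon> \<longleftrightarrow> (\<exists>r::int. \<forall>b\<in>B \<inter> pp {p}. \<epsilon> b = b [^] r)"

definition moved :: "('a \<Rightarrow> 'a) \<Rightarrow> nat set" where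
  "moved \<epsilon> = {p \<in> critical. \<exists>b\<in>B \<inter> pp {p}. \<epsilon> b \<noteq> b}"

definition Delta :: "('a \<Rightarrow> 'a) set" where
  "Delta = {\<epsilon> \<in> auto G. (\<forall>x\<in>D. \<epsilon> x = x) \<and> (\<forall>x\<in>pp (primes - critical). \<epsilon> x = x) \<and>
     (\<forall>p\<in>critical. scales p \<epsilon>) \<and> finite (moved \<epsilon>)}"

definition Delta_at :: "nat \<Rightarrow> ('a \<Rightarrow> 'a) set" where
  "Delta_at p = {\<epsilon> \<in> Delta. \<forall>x\<in>pp (primes - {p}). \<epsilon> x = x}"

lemma Delta_auto: "\<epsilon> \<in> Delta \<Longrightarrow> \<epsilon> \<in> auto G"
  by (simp add: Delta_def)

text \<open>\<open>D\<close>, the noncritical components and the critical groups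
  \<open>B \<inter> pp {p}\<close> generate the whole group. The criterion holds for arbitrary
  automorphisms and serves \<Psi> as well as \<Delta>.\<close>

lemma Delta_eqI:
  assumes f: "f \<in> auto G" and g: "g \<in> auto G"
    and D: "\<And>x. x \<in> D \<Longrightarrow> f x = g x" and nc: "\<And>x. x \<in> pp (primes - critical) \<Longrightarrow> f x = g x"
    and B: "\<And>p b. p \<in> critical \<Longrightarrow> b \<in> B \<inter> pp {p} \<Longrightarrow> f b = g b"
  shows "f = g"
proof (rule AG_eqI[OF f g])
  have h: "f \<in> hom G G" "g \<in> hom G G" using f g by (auto intro: autoD)
  fix x assume "x \<in> carrier G"
  then show "f x = g x"
  proof (rule hom_eq_primary[OF h, rotated])
    fix p x assume p: "prime (p::nat)" and x: "x \<in> pp {p}"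
    have xc: "x \<in> carrier G" using x pp_carrier by blast
    show "f x = g x"
    proof (cases "p \<in> critical")
      case True
      have "f (eD x) = g (eD x)" "f (eB x) = g (eB x)"
        using D eD[OF xc] B[OF True, of "eB x"] eB[OF xc] eB_pp[OF x] by auto
      then have "f (eD x \<otimes> eB x) = g (eD x \<otimes> eB x)"
        using h eD[OF xc] eB[OF xc] by (simp add: endo_mult D_carrier B_carrier)
      then show ?thesis using eDB[OF xc] by simp
    next
      case False
      then show ?thesis using nc other_prime[OF p False] x by blast
    qed
  qed
qed

lemma Delta_scales:
  assumes "\<epsilon> \<in> Delta" "p \<in> critical"
  obtains r :: int where "\<And>b. b \<in> B \<inter> pp {p} \<Longrightarrow> \<epsilon> b = b [^] r"
proof -
  have "scales p \<epsilon>" using assms by (simp add: Delta_def)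
  then show thesis unfolding scales_def using that by blast
qed

lemma Delta_B:
  assumes "\<epsilon> \<in> Delta" "p \<in> critical" "b \<in> B \<inter> pp {p}"
  shows "\<epsilon> b \<in> B \<inter> pp {p}"
proof -
  obtain r :: int where "\<epsilon> b = b [^] r" using Delta_scales[OF assms(1,2)] assms(3) by metis
  then show ?thesis
    using subgroup_int_pow_closed[OF B_subgroup] subgroup_int_pow_closed[OF subgroup_pp] assms(3) by auto
qed

lemma Delta_commute:
  assumes e: "\<epsilon> \<in> Delta" and f: "\<delta> \<in> Delta"
  shows "\<epsilon> \<otimes>\<^bsub>AG\<^esub> \<delta> = \<delta> \<otimes>\<^bsub>AG\<^esub> \<epsilon>"
proof (rule Delta_eqI)
  have a: "\<epsilon> \<in> auto G" "\<delta> \<in> auto G" using e f by (auto intro: Delta_auto)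
  show "\<epsilon> \<otimes>\<^bsub>AG\<^esub> \<delta> \<in> auto G" "\<delta> \<otimes>\<^bsub>AG\<^esub> \<epsilon> \<in> auto G" using a by (auto intro: AG_mult_closed)
  show "(\<epsilon> \<otimes>\<^bsub>AG\<^esub> \<delta>) x = (\<delta> \<otimes>\<^bsub>AG\<^esub> \<epsilon>) x" if "x \<in> D" for x
    using that e f D_carrier[OF that] AG_mult_apply[OF a] AG_mult_apply[OF a(2,1)] by (simp add: Delta_def)
  show "(\<epsilon> \<otimes>\<^bsub>AG\<^esub> \<delta>) x = (\<delta> \<otimes>\<^bsub>AG\<^esub> \<epsilon>) x" if "x \<in> pp (primes - critical)" for x
    using that e f pp_carrier[OF that] AG_mult_apply[OF a] AG_mult_apply[OF a(2,1)] by (simp add: Delta_def)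
  show "(\<epsilon> \<otimes>\<^bsub>AG\<^esub> \<delta>) b = (\<delta> \<otimes>\<^bsub>AG\<^esub> \<epsilon>) b" if pb: "p \<in> critical" "b \<in> B \<inter> pp {p}" for p b
  proof -
    obtain r :: int where r: "\<And>b. b \<in> B \<inter> pp {p} \<Longrightarrow> \<epsilon> b = b [^] r"
      using Delta_scales[OF e pb(1)] by blast
    obtain s :: int where s: "\<And>b. b \<in> B \<inter> pp {p} \<Longrightarrow> \<delta> b = b [^] s"
      using Delta_scales[OF f pb(1)] by blast
    have bc: "b \<in> carrier G" using pb B_carrier by blast
    have "(\<epsilon> \<otimes>\<^bsub>AG\<^esub> \<delta>) b = (b [^] s) [^] r"
      using AG_mult_apply[OF a bc] r[OF Delta_B[OF f pb]] by (simp only: s[OF pb(2)])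
    moreover have "(\<delta> \<otimes>\<^bsub>AG\<^esub> \<epsilon>) b = (b [^] r) [^] s"
      using AG_mult_apply[OF a(2,1) bc] s[OF Delta_B[OF e pb]] by (simp only: r[OF pb(2)])
    ultimately show ?thesis using bc by (simp add: int_pow_pow mult.commute)
  qed
qed

lemma Delta_inv:
  assumes e: "\<epsilon> \<in> Delta"
  shows "inv\<^bsub>AG\<^esub> \<epsilon> \<in> Delta"
proof -
  have a: "\<epsilon> \<in> auto G" using e by (rule Delta_auto)
  have ia: "inv\<^bsub>AG\<^esub> \<epsilon> \<in> auto G" using a by (rule AG_inv_closed)
  have fixed: "(inv\<^bsub>AG\<^esub> \<epsilon>) x = x" if "\<epsilon> x = x" "x \<in> carrier G" for x
    using AG_inv_left[OF a that(2)] that(1) by simp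
  have "scales p (inv\<^bsub>AG\<^esub> \<epsilon>)" if p: "p \<in> critical" for p
  proof -
    have pr: "prime p" using p by (rule critical_prime)
    obtain r :: int where r: "\<And>b. b \<in> B \<inter> pp {p} \<Longrightarrow> \<epsilon> b = b [^] r"
      using Delta_scales[OF e p] by blast
    obtain m where m: "\<And>b. b \<in> B \<inter> pp {p} \<Longrightarrow> b [^] (p ^ m) = \<one>" using B_bounded[OF p] by blast
    show ?thesis
    proof (cases "int p dvd r")
      \<comment> \<open>A nontrivial element of the component would make the exponent prime to
        \<open>p\<close> by \<open>exponent_unit\<close>, so the component is trivial.\<close>
      case True
      have "b = \<one>" if b: "b \<in> B \<inter> pp {p}" for b
      proof (rule ccontr)
        assume "b \<noteq> \<one>"
        then obtain l where "ord b = p ^ Suc l" using nontrivial_ord[OF pr, of b] b by blast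
        then show False
          using exponent_unit[OF autoD(1,4)[OF a] pr _ _ r[OF b]] b B_carrier True by blast
      qed
      then have "\<forall>b\<in>B \<inter> pp {p}. (inv\<^bsub>AG\<^esub> \<epsilon>) b = b [^] (0::int)"
        using endo_one[OF autoD(1)[OF ia]] by auto
      then show ?thesis unfolding scales_def by blast
    next
      case False
      then obtain u where u: "int (p ^ m) dvd u * r - 1" using inverse_mod_prime_power[OF pr] by blast
      have "(inv\<^bsub>AG\<^esub> \<epsilon>) b = b [^] u" if b: "b \<in> B \<inter> pp {p}" for b
      proof -
        have bc: "b \<in> carrier G" using b B_carrier by blast
        have bu: "b [^] u \<in> B \<inter> pp {p}"
          using subgroup_int_pow_closed[OF B_subgroup] subgroup_int_pow_closed[OF subgroup_pp] b by auto
        have "b [^] (u * r) = b [^] (1::int)" by (rule int_pow_cong[OF bc m[OF b] u])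
        then have "\<epsilon> (b [^] u) = b" using r[OF bu] bc by (simp add: int_pow_pow)
        then show ?thesis using AG_inv_eq_iff[OF a bc] bc by simp
      qed
      then show ?thesis unfolding scales_def by blast
    qed
  qed
  moreover have "moved (inv\<^bsub>AG\<^esub> \<epsilon>) \<subseteq> moved \<epsilon>"
    using fixed B_carrier by (auto simp: moved_def)
  then have "finite (moved (inv\<^bsub>AG\<^esub> \<epsilon>))" using e finite_subset by (auto simp: Delta_def)
  ultimately show ?thesis
    using e ia fixed D_carrier pp_carrier by (auto simp: Delta_def)
qed

lemma subgroup_Delta: "subgroup Delta AG"
proof (rule AG_subgroupI)
  show "Delta \<subseteq> auto G" by (auto simp: Delta_def)
  have "scales p \<one>\<^bsub>AG\<^esub>" for p
    unfolding scales_def using AG_one_apply B_carrier by (intro exI[of _ 1]) auto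
  moreover have "moved \<one>\<^bsub>AG\<^esub> = {}" using AG_one_apply B_carrier by (auto simp: moved_def)
  ultimately show "\<one>\<^bsub>AG\<^esub> \<in> Delta"
    using AG_one_closed AG_one_apply D_carrier pp_carrier by (simp add: Delta_def)
  show "inv\<^bsub>AG\<^esub> \<epsilon> \<in> Delta" if "\<epsilon> \<in> Delta" for \<epsilon> using that by (rule Delta_inv)
next
  fix \<epsilon> \<delta> assume e: "\<epsilon> \<in> Delta" and d: "\<delta> \<in> Delta"
  have a: "\<epsilon> \<in> auto G" "\<delta> \<in> auto G" using e d by (auto intro: Delta_auto)
  note app = AG_mult_apply[OF a]
  have "scales p (\<epsilon> \<otimes>\<^bsub>AG\<^esub> \<delta>)" if p: "p \<in> critical" for p
  proof -
    obtain r :: int where r: "\<And>b. b \<in> B \<inter> pp {p} \<Longrightarrow> \<epsilon> b = b [^] r"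
      using Delta_scales[OF e p] by blast
    obtain s :: int where s: "\<And>b. b \<in> B \<inter> pp {p} \<Longrightarrow> \<delta> b = b [^] s"
      using Delta_scales[OF d p] by blast
    have "(\<epsilon> \<otimes>\<^bsub>AG\<^esub> \<delta>) b = b [^] (s * r)" if b: "b \<in> B \<inter> pp {p}" for b
    proof -
      have bc: "b \<in> carrier G" using b B_carrier by blast
      show ?thesis
        using app[OF bc] r[OF Delta_B[OF d p b]] by (simp only: s[OF b] int_pow_pow[OF bc])
    qed
    then show ?thesis unfolding scales_def by blast
  qed
  moreover have "moved (\<epsilon> \<otimes>\<^bsub>AG\<^esub> \<delta>) \<subseteq> moved \<epsilon> \<union> moved \<delta>"
  proof
    fix p assume "p \<in> moved (\<epsilon> \<otimes>\<^bsub>AG\<^esub> \<delta>)"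
    then obtain b where b: "p \<in> critical" "b \<in> B \<inter> pp {p}" "(\<epsilon> \<otimes>\<^bsub>AG\<^esub> \<delta>) b \<noteq> b" by (auto simp: moved_def)
    then have "\<epsilon> b \<noteq> b \<or> \<delta> b \<noteq> b" using app[of b] B_carrier by auto
    then show "p \<in> moved \<epsilon> \<union> moved \<delta>" using b by (auto simp: moved_def)
  qed
  then have "finite (moved (\<epsilon> \<otimes>\<^bsub>AG\<^esub> \<delta>))" using e d finite_subset by (auto simp: Delta_def)
  ultimately show "\<epsilon> \<otimes>\<^bsub>AG\<^esub> \<delta> \<in> Delta"
    using e d a app D_carrier pp_carrier by (auto simp: Delta_def AG_mult_closed)
qed

text \<open>The projection onto \<open>B \<inter> pp {p}\<close> whose kernel is generated by
  \<open>D\<close> and the other primary components.\<close>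

definition bpart :: "nat \<Rightarrow> 'a \<Rightarrow> 'a" where
  "bpart p x = eB (eP p x)"

lemma bpart_hom: "bpart p \<in> hom G G"
  unfolding bpart_def[abs_def] by (rule endo_comp[OF proj_hom[OF compl'] proj_hom[OF pp_complementary]])

lemma bpart_mem: "x \<in> carrier G \<Longrightarrow> bpart p x \<in> B \<inter> pp {p}"
  unfolding bpart_def using decompose(1)[OF pp_complementary] eB_pp eB pp_carrier by blast

lemma bpart_closed: "x \<in> carrier G \<Longrightarrow> bpart p x \<in> carrier G"
  using endo_closed[OF bpart_hom] .

lemma bpart_id: "b \<in> B \<inter> pp {p} \<Longrightarrow> bpart p b = b"
  unfolding bpart_def using proj_on_left[OF pp_complementary] proj_on_left[OF compl'] by simp

lemma bpart_D:
  assumes x: "x \<in> D"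
  shows "bpart p x = \<one>"
proof -
  obtain k :: int where "eP p x = x [^] k" using pp_proj_power[OF D_carrier[OF x]] by blast
  then have "eP p x \<in> D" using subgroup_int_pow_closed[OF D_subgroup x] by simp
  then show ?thesis unfolding bpart_def by (rule proj_on_right[OF compl'])
qed

lemma bpart_off: "x \<in> pp (primes - {p}) \<Longrightarrow> bpart p x = \<one>"
  unfolding bpart_def using proj_on_right[OF pp_complementary] endo_one[OF proj_hom[OF compl']] by simp

lemma Delta_scaling_exists:
  assumes p: "p \<in> critical" and t: "\<not> int p dvd t"
  shows "\<exists>\<epsilon>\<in>Delta_at p. \<forall>b\<in>B \<inter> pp {p}. \<epsilon> b = b [^] t"
proof -
  have pr: "prime p" using p by (rule critical_prime)
  obtain m where m: "\<And>b. b \<in> B \<inter> pp {p} \<Longrightarrow> b [^] (p ^ m) = \<one>" using B_bounded[OF p] by blast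
    \<comment> \<open>The exponent is \<open>s - 1\<close> because the factor \<open>x\<close>
      already contributes one copy of its part in \<open>B \<inter> pp {p}\<close>: there
      \<open>\<sigma> s\<close> is the power \<open>s\<close>, on the kernel of
      \<open>bpart p\<close> it is the identity. Exponents inverse modulo \<open>p ^ m\<close> give
      inverse maps.\<close>
    define \<sigma> where "\<sigma> s = (\<lambda>x\<in>carrier G. x \<otimes> bpart p x [^] (s - 1 :: int))" for s
  have \<sigma>_hom: "\<sigma> s \<in> hom G G" for s
  proof -
    have "(\<lambda>x. x \<otimes> bpart p x [^] (s - 1)) \<in> hom G G"
      by (rule hom_product[OF _ endo_comp[OF hom_int_power bpart_hom]]) (simp add: hom_def)
    then show ?thesis by (auto simp: \<sigma>_def hom_def)
  qed
  have \<sigma>\<sigma>: "\<sigma> s (\<sigma> r x) = x" if x: "x \<in> carrier G" and rs: "int (p ^ m) dvd s * r - 1" for x s r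
  proof -
    have bx: "bpart p x \<in> carrier G" using bpart_closed x by blast
    have "bpart p (bpart p x [^] (r - 1)) = bpart p x [^] (r - 1)"
      using bpart_id[OF bpart_mem[OF x]] bx endo_int_pow[OF bpart_hom] by simp
    then have "bpart p (\<sigma> r x) = bpart p x \<otimes> bpart p x [^] (r - 1)"
      using x bx by (simp add: \<sigma>_def endo_mult[OF bpart_hom])
    also have "\<dots> = bpart p x [^] (1 + (r - 1))" using bx by (subst int_pow_mult) auto
    finally have b: "bpart p (\<sigma> r x) = bpart p x [^] r" by simp
    have "\<sigma> s (\<sigma> r x) = x \<otimes> bpart p x [^] (r - 1) \<otimes> bpart p (\<sigma> r x) [^] (s - 1)"
      using x bx by (simp add: \<sigma>_def)
    also have "\<dots> = x \<otimes> (bpart p x [^] (r - 1) \<otimes> bpart p x [^] (r * (s - 1)))"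
      unfolding b using x bx by (simp add: m_assoc int_pow_pow)
    also have "bpart p x [^] (r - 1) \<otimes> bpart p x [^] (r * (s - 1)) = bpart p x [^] (s * r - 1)"
      using bx by (simp add: algebra_simps flip: int_pow_mult)
    also have "\<dots> = bpart p x [^] (0::int)" using rs by (intro int_pow_cong[OF bx m[OF bpart_mem[OF x]]]) simp
    finally show ?thesis using x by simp
  qed
  obtain u where u: "int (p ^ m) dvd u * t - 1" using inverse_mod_prime_power[OF pr t] by blast
  then have d: "int (p ^ m) dvd u * t - 1" "int (p ^ m) dvd t * u - 1"
    by (simp_all add: mult.commute)
  have "bij_betw (\<sigma> t) (carrier G) (carrier G)"
    by (rule bij_betw_byWitness[where f' = "\<sigma> u"])
      (use \<sigma>\<sigma>[OF _ d(1)] \<sigma>\<sigma>[OF _ d(2)] endo_closed[OF \<sigma>_hom] in auto)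
  then have auto: "\<sigma> t \<in> auto G" using \<sigma>_hom by (auto simp: auto_def Bij_def \<sigma>_def)
  have on_B: "\<sigma> t b = b [^] t" if b: "b \<in> B \<inter> pp {p}" for b
  proof -
    have bc: "b \<in> carrier G" using b B_carrier by blast
    have "\<sigma> t b = b [^] (1 + (t - 1))"
      using bc bpart_id[OF b] by (subst int_pow_mult) (auto simp: \<sigma>_def)
    then show ?thesis by simp
  qed
  have off: "\<sigma> t x = x" if "x \<in> carrier G" "bpart p x = \<one>" for x using that by (simp add: \<sigma>_def)
  have offp: "\<sigma> t x = x" if "x \<in> pp (primes - {p})" for x using off bpart_off pp_carrier that by blast
  have q: "\<sigma> t b = b" if "q \<in> critical" "q \<noteq> p" "b \<in> B \<inter> pp {q}" for q b
    using other_prime[OF critical_prime[OF that(1)], of "{p}"] that offp by blast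
  have "scales q (\<sigma> t)" if "q \<in> critical" for q
  proof (cases "q = p")
    case True
    then show ?thesis unfolding scales_def using on_B by blast
  next
    case False
    then show ?thesis unfolding scales_def using q[OF that False] B_carrier
      by (intro exI[of _ 1]) auto
  qed
  moreover have "moved (\<sigma> t) \<subseteq> {p}" using q by (auto simp: moved_def)
  then have "finite (moved (\<sigma> t))" using finite_subset by blast
  moreover have "pp (primes - critical) \<subseteq> pp (primes - {p})" using p by (intro pp_mono) auto
  ultimately have "\<sigma> t \<in> Delta"
    using auto off bpart_D D_carrier offp by (auto simp: Delta_def)
  then show ?thesis using on_B offp by (auto simp: Delta_at_def)
qed

text \<open>\<open>inertial_divisible_power\<close> gives an exponent at each element. Those at
  elements \<open>d n\<close> of order \<open>p ^ Suc n\<close> extend by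
  \<open>power_common_exponent\<close> to everything killed by \<open>p ^ Suc n\<close>; so they are
  coherent and define a p-adic unit.\<close>

lemma scalar_on_D:
  assumes f: "inertial G f" and p: "p \<in> critical"
  shows "\<exists>\<alpha>\<in>PAut G. (\<forall>x\<in>pp (primes - {p}). \<alpha> x = x) \<and> (\<forall>x\<in>D \<inter> pp {p}. \<alpha> x = f x)"
proof -
  have pr: "prime p" using p by (rule critical_prime)
  have a: "f \<in> auto G" using f by (simp add: inertial_def)
  have h: "f \<in> hom G G" using a by (rule autoD)
  define E where "E = D \<inter> pp {p}"
  have E: "subgroup E G" "E \<subseteq> pp {p}"
    unfolding E_def using D_subgroup subgroup_pp by (auto intro: subgroups_Inter_pair)
  have pE: "powers p E = E"
  proof
    show "powers p E \<subseteq> E" using powers_subset[OF E(1)] .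
    show "E \<subseteq> powers p E"
    proof
      fix x assume x: "x \<in> E"
      obtain y where y: "y \<in> D" "y [^] p = x"
        using D_divisible[of p x] x pr by (auto simp: E_def prime_gt_0_nat)
      obtain n where n: "x [^] (p ^ n) = \<one>" using x E(2) mem_pp_prime_iff[OF pr] by blast
      have "y [^] (p ^ Suc n) = \<one>" using n y D_carrier[OF y(1)] by (metis nat_pow_pow power_Suc)
      then have "y \<in> E" using y D_carrier mem_pp_prime_iff[OF pr] unfolding E_def by blast
      then show "x \<in> powers p E" using y unfolding powers_def by blast
    qed
  qed
  have fE: "\<exists>k::int. f x = x [^] k" if "x \<in> E" for x
    using inertial_divisible_power[OF f pr E pE that] .
  obtain d where d: "\<And>n. d n \<in> E" "\<And>n. ord (d n) = p ^ Suc n"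
    using D_element_of_order[OF p] unfolding E_def by metis
  have dc: "d n \<in> carrier G" for n using d(1) subgroup.mem_carrier[OF E(1)] by blast
  obtain s :: "nat \<Rightarrow> int" where s: "\<And>n. f (d n) = d n [^] s n"
  proof -
    have "\<forall>n. \<exists>k::int. f (d n) = d n [^] k" using fE d(1) by blast
    from choice[OF this] show thesis using that by blast
  qed
  have scal: "f z = z [^] s n" if z: "z \<in> E" "z [^] (p ^ Suc n) = \<one>" for z n
  proof (rule power_common_exponent[OF h dc subgroup.mem_carrier[OF E(1) z(1)] _ _ s])
    show "z [^] ord (d n) = \<one>" using z d by simp
    fix i j :: int
    have "d n [^] i \<otimes> z [^] j \<in> E"
      using subgroup_int_pow_closed[OF E(1)] d(1) z(1) by (intro subgroup.m_closed[OF E(1)]) auto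
    then show "\<exists>k::int. f (d n [^] i \<otimes> z [^] j) = (d n [^] i \<otimes> z [^] j) [^] k" by (rule fE)
  qed
  have unit: "\<not> int p dvd s n" for n
    by (rule exponent_unit[OF h autoD(4)[OF a] pr dc d(2) s])
  have cong: "int (p ^ n) dvd s (Suc n) - s n" for n
  proof -
    have d1: "d n [^] (p ^ Suc n) = \<one>" using d(2)[of n] pow_ord_eq_1[OF dc, of n] by simp
    then have d2: "d n [^] (p ^ Suc (Suc n)) = \<one>" by (rule prime_power_Suc_torsion[OF dc])
    have "d n [^] s n = d n [^] s (Suc n)" using scal[OF d(1) d2] s by simp
    then have "int (p ^ Suc n) dvd s (Suc n) - s n" using int_pow_eq[OF dc] d(2) by metis
    moreover have "int (p ^ n) dvd int (p ^ Suc n)" by simp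
    ultimately show ?thesis using dvd_trans by blast
  qed
  obtain \<alpha> where \<alpha>: "\<alpha> \<in> PAut G" "\<And>x. x \<in> pp (primes - {p}) \<Longrightarrow> \<alpha> x = x"
    "\<And>n x. x \<in> pp {p} \<Longrightarrow> x [^] (p ^ n) = \<one> \<Longrightarrow> \<alpha> x = x [^] s n"
    using p_adic_power_automorphism[OF pr, of s] unit cong by blast
  have "\<alpha> x = f x" if x: "x \<in> E" for x
  proof -
    obtain n where n: "x [^] (p ^ n) = \<one>" using x E(2) mem_pp_prime_iff[OF pr] by blast
    then have "x [^] (p ^ Suc n) = \<one>"
      by (rule prime_power_Suc_torsion[OF subgroup.mem_carrier[OF E(1) x]])
    then show ?thesis using scal[OF x] \<alpha>(3)[OF _ n] x E(2) by auto
  qed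
  then show ?thesis using \<alpha> by (auto simp: E_def)
qed

text \<open>The p-adic unit is the constant sequence \<open>t\<close>.\<close>

lemma power_trivial_off:
  assumes p: "prime (p::nat)" and t: "\<not> int p dvd t"
  shows "\<exists>\<alpha>\<in>PAut G. (\<forall>x\<in>pp {p}. \<alpha> x = x [^] t) \<and> (\<forall>x\<in>pp (primes - {p}). \<alpha> x = x)"
proof -
  have "\<exists>\<alpha>\<in>PAut G. (\<forall>n. \<forall>x\<in>pp {p}. x [^] (p ^ n) = \<one> \<longrightarrow> \<alpha> x = x [^] t) \<and>
    (\<forall>x\<in>pp (primes - {p}). \<alpha> x = x)"
    by (rule p_adic_power_automorphism[OF p]) (use t in simp_all)
  then obtain \<alpha> where \<alpha>: "\<alpha> \<in> PAut G" "\<forall>x\<in>pp (primes - {p}). \<alpha> x = x"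
    "\<And>n x. x \<in> pp {p} \<Longrightarrow> x [^] (p ^ n) = \<one> \<Longrightarrow> \<alpha> x = x [^] t" by blast
  have "\<alpha> x = x [^] t" if x: "x \<in> pp {p}" for x
  proof -
    obtain n where "x [^] (p ^ n) = \<one>" using mem_pp_prime_iff[OF p] x by blast
    then show ?thesis by (rule \<alpha>(3)[OF x])
  qed
  then show ?thesis using \<alpha>(1,2) by blast
qed

text \<open>At a critical prime \<alpha> is fitted to \<open>f\<close> on \<open>D\<close> and
  \<epsilon> repairs the exponent on the bounded complement; at a noncritical prime \<alpha> alone
  suffices.\<close>

lemma inertial_primary:
  assumes f: "inertial G f" and p: "prime (p::nat)"
  shows "\<exists>\<alpha>\<in>PAut G. \<exists>\<epsilon>\<in>Delta. (\<forall>x\<in>pp (primes - {p}). \<alpha> x = x \<and> \<epsilon> x = x) \<and>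
    finite ((\<lambda>y. f y \<otimes> inv (\<alpha> (\<epsilon> y))) ` pp {p})"
proof -
  have a: "f \<in> auto G" using f by (simp add: inertial_def)
  have h: "f \<in> hom G G" using a by (rule autoD)
  obtain F where F: "almost_power f F"
    using inertial_almost_power[OF f] by blast
  have one: "\<one>\<^bsub>AG\<^esub> \<in> Delta" using subgroup.one_closed[OF subgroup_Delta] .
  show ?thesis
  proof (cases "p \<in> critical")
    case True
    obtain \<alpha> where \<alpha>: "\<alpha> \<in> PAut G" "\<And>x. x \<in> pp (primes - {p}) \<Longrightarrow> \<alpha> x = x"
      "\<And>x. x \<in> D \<inter> pp {p} \<Longrightarrow> \<alpha> x = f x" using scalar_on_D[OF f True] by blast
    have \<alpha>h: "\<alpha> \<in> hom G G" using PAut_auto[OF \<alpha>(1)] by (rule autoD)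
    obtain m0 where m0: "\<And>b. b \<in> B \<inter> pp {p} \<Longrightarrow> b [^] (p ^ m0) = \<one>" using B_bounded[OF True] by blast
    define C where "C = B \<inter> pp {p}"
    have C: "subgroup C G" "C \<subseteq> pp {p}"
      unfolding C_def using B_subgroup subgroup_pp by (auto intro: subgroups_Inter_pair)
    have bd: "x [^] (p ^ m0) = \<one>" if "x \<in> C" for x using m0 that by (simp add: C_def)
    obtain r :: int where r: "\<not> int p dvd r" "finite ((\<lambda>y. f y \<otimes> inv (y [^] r)) ` C)"
      using bounded_uniform_exponent[OF a F p C bd] by blast
    \<comment> \<open>An element of maximal order: all orders are powers of \<open>p\<close> bounded
      by \<open>p ^ m0\<close>, so this one kills \<open>C\<close>. The exponent of \<alpha> at
      \<open>c\<close> is then valid on all of \<open>C\<close>.\<close>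
    have "\<exists>c. c \<in> C \<and> (\<forall>x\<in>C. x [^] ord c = \<one>)"
    proof -
      have ne: "\<one> \<in> C" using subgroup.one_closed[OF C(1)] .
      have bnd: "ord x \<le> p ^ m0" if "x \<in> C" for x
        using bd[OF that] subgroup.mem_carrier[OF C(1) that] p
        by (simp add: pow_eq_id dvd_imp_le prime_gt_0_nat)
      obtain c where c: "c \<in> C" "\<And>x. x \<in> C \<Longrightarrow> ord x \<le> ord c"
        using ex_has_greatest_nat[of "\<lambda>x. x \<in> C" \<one> ord "p ^ m0 + 1"] ne bnd by (metis le_imp_less_Suc Suc_eq_plus1)
      have "x [^] ord c = \<one>" if x: "x \<in> C" for x
      proof -
        obtain i j where "ord x = p ^ i" "ord c = p ^ j" using ord_prime_power[OF p] x c(1) C(2) by (metis subsetD)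
        moreover from this have "i \<le> j" using c(2)[OF x] prime_gt_1_nat[OF p] by simp
        ultimately have "ord x dvd ord c" by (simp add: le_imp_power_dvd)
        then show ?thesis using subgroup.mem_carrier[OF C(1) x] pow_eq_id by blast
      qed
      then show ?thesis using c(1) by blast
    qed
    then obtain c where c: "c \<in> C" "\<And>x. x \<in> C \<Longrightarrow> x [^] ord c = \<one>" by blast
    have cc: "c \<in> carrier G" using subgroup.mem_carrier[OF C(1) c(1)] .
    obtain w :: int where w: "\<alpha> c = c [^] w" using PAut_power[OF \<alpha>(1) cc] by blast
    have \<alpha>C: "\<alpha> x = x [^] w" if x: "x \<in> C" for x
      using power_common_exponent[OF \<alpha>h cc subgroup.mem_carrier[OF C(1) x] _ c(2)[OF x] w]
        PAut_power[OF \<alpha>(1)] cc subgroup.mem_carrier[OF C(1) x] by simp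
    show ?thesis
    proof (cases "c = \<one>")
      case True
      then have "x = \<one>" if "x \<in> C" for x
        using c(2)[OF that] subgroup.mem_carrier[OF C(1) that] by simp
      then have eB1: "eB x = \<one>" if "x \<in> pp {p}" for x
        using that eB_pp eB pp_carrier by (auto simp: C_def)
      have "f x \<otimes> inv (\<alpha> (\<one>\<^bsub>AG\<^esub> x)) = \<one>" if x: "x \<in> pp {p}" for x
      proof -
        have xc: "x \<in> carrier G" using x pp_carrier by blast
        have "x = eD x" using eDB[OF xc] eB1[OF x] D_carrier[OF eD[OF xc]] by simp
        then have "x \<in> D \<inter> pp {p}" using eD[OF xc] x by auto
        then show ?thesis using \<alpha>(3) xc h by (simp add: AG_one_apply endo_closed)
      qed
      then have "(\<lambda>y. f y \<otimes> inv (\<alpha> (\<one>\<^bsub>AG\<^esub> y))) ` pp {p} \<subseteq> {\<one>}" by auto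
      then have "finite ((\<lambda>y. f y \<otimes> inv (\<alpha> (\<one>\<^bsub>AG\<^esub> y))) ` pp {p})" using finite_subset by blast
      then show ?thesis using \<alpha>(1,2) one AG_one_apply pp_carrier by blast
    next
      case False
      obtain l where l: "ord c = p ^ Suc l" using nontrivial_ord[OF p, of c] c(1) C(2) False by blast
      have "\<not> int p dvd w"
        by (rule exponent_unit[OF \<alpha>h autoD(4)[OF PAut_auto[OF \<alpha>(1)]] p cc l w])
      \<comment> \<open>\<alpha> matches \<open>f\<close> on the divisible part but is the power
        \<open>w\<close> on \<open>C\<close>. Scaling \<open>C\<close> by \<open>u * r\<close>, with
        \<open>u\<close> inverse to \<open>w\<close> modulo \<open>ord c\<close>, makes \<alpha>
        after \<epsilon> the power \<open>r\<close> there, which is \<open>f\<close> up to a finite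
        image.\<close>
      then obtain u where u: "int (p ^ Suc l) dvd u * w - 1" using inverse_mod_prime_power[OF p] by blast
      have "\<not> int p dvd u"
      proof
        assume "int p dvd u"
        moreover have "int p dvd u * w - 1" using u by (metis dvd_trans dvd_triv_left of_nat_mult power_Suc)
        ultimately have "int p dvd 1" by (metis dvd_diff_right_iff dvd_mult2)
        then show False using p by auto
      qed
      then have "\<not> int p dvd u * r" using r(1) p by (simp add: prime_dvd_mult_iff)
      then obtain \<epsilon> where \<epsilon>: "\<epsilon> \<in> Delta_at p" "\<And>b. b \<in> C \<Longrightarrow> \<epsilon> b = b [^] (u * r)"
        using Delta_scaling_exists[OF \<open>p \<in> critical\<close>] unfolding C_def by blast
      have \<epsilon>\<Delta>: "\<epsilon> \<in> Delta" "\<And>x. x \<in> pp (primes - {p}) \<Longrightarrow> \<epsilon> x = x" "\<And>x. x \<in> D \<Longrightarrow> \<epsilon> x = x"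
        using \<epsilon>(1) by (auto simp: Delta_at_def Delta_def)
      have \<epsilon>h: "\<epsilon> \<in> hom G G" using Delta_auto[OF \<epsilon>\<Delta>(1)] by (rule autoD)
      have eq: "f x \<otimes> inv (\<alpha> (\<epsilon> x)) = f (eB x) \<otimes> inv (eB x [^] r)" if x: "x \<in> pp {p}" for x
      proof -
        have xc: "x \<in> carrier G" using x pp_carrier by blast
        have d: "eD x \<in> D \<inter> pp {p}" using eD[OF xc] eD_pp[OF x] by blast
        have b: "eB x \<in> C" using eB[OF xc] eB_pp[OF x] by (simp add: C_def)
        have car: "eD x \<in> carrier G" "eB x \<in> carrier G" using d b D_carrier B_carrier by (auto simp: C_def)
        have "\<alpha> (\<epsilon> (eB x)) = (eB x [^] (u * r)) [^] w"
          using \<epsilon>(2)[OF b] \<alpha>C subgroup_int_pow_closed[OF C(1) b] by simp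
        also have "\<dots> = eB x [^] (u * r * w)" using car by (simp add: int_pow_pow)
        also have "\<dots> = eB x [^] r"
        proof (rule int_pow_cong[OF car(2) c(2)[OF b]])
          have "u * r * w - r = (u * w - 1) * r" by (simp add: algebra_simps)
          then show "int (ord c) dvd u * r * w - r" unfolding l using u by simp
        qed
        finally have 1: "\<alpha> (\<epsilon> (eB x)) = eB x [^] r" .
        have 2: "\<alpha> (\<epsilon> (eD x)) = f (eD x)" using \<epsilon>\<Delta>(3) \<alpha>(3) d by auto
        have "\<alpha> (\<epsilon> x) = \<alpha> (\<epsilon> (eD x \<otimes> eB x))" using eDB[OF xc] by simp
        also have "\<dots> = f (eD x) \<otimes> eB x [^] r"
          using car 1 2 by (simp add: endo_mult[OF \<epsilon>h] endo_mult[OF \<alpha>h] endo_closed[OF \<epsilon>h])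
        finally have 3: "\<alpha> (\<epsilon> x) = f (eD x) \<otimes> eB x [^] r" .
        have "f x = f (eD x \<otimes> eB x)" using eDB[OF xc] by simp
        then have 4: "f x = f (eD x) \<otimes> f (eB x)" using car by (simp add: endo_mult[OF h])
        show ?thesis
          unfolding 3 4 using car endo_closed[OF h car(1)] endo_closed[OF h car(2)]
            int_pow_closed[OF car(2), of r] by algebra
      qed
      have "(\<lambda>y. f y \<otimes> inv (\<alpha> (\<epsilon> y))) ` pp {p} \<subseteq> (\<lambda>y. f y \<otimes> inv (y [^] r)) ` C"
        using eq eB_pp eB pp_carrier by (auto simp: C_def)
      then have "finite ((\<lambda>y. f y \<otimes> inv (\<alpha> (\<epsilon> y))) ` pp {p})" using r(2) finite_subset by blast
      then show ?thesis using \<alpha>(1,2) \<epsilon>\<Delta>(1,2) by blast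
    qed
  next
    case False
    have "\<exists>\<alpha>\<in>PAut G. (\<forall>x\<in>pp (primes - {p}). \<alpha> x = x) \<and> finite ((\<lambda>y. f y \<otimes> inv (\<alpha> y)) ` pp {p})"
    proof (cases "\<forall>n. infinite {x \<in> powers (p ^ n) (pp {p}). x [^] p = \<one>}")
      case True
      then obtain \<alpha> where \<alpha>: "\<alpha> \<in> PAut G" "\<And>x. x \<in> pp (primes - {p}) \<Longrightarrow> \<alpha> x = x"
        "\<And>x. x \<in> pp {p} \<Longrightarrow> f x \<otimes> inv (\<alpha> x) \<in> F"
        using unbounded_power_part[OF a F p] by blast
      have "(\<lambda>y. f y \<otimes> inv (\<alpha> y)) ` pp {p} \<subseteq> F" using \<alpha>(3) by blast
      moreover have "finite F" using F by (simp add: almost_power_def)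
      ultimately have "finite ((\<lambda>y. f y \<otimes> inv (\<alpha> y)) ` pp {p})" by (rule finite_subset)
      then show ?thesis using \<alpha>(1,2) by blast
    next
      case f2: False
      then obtain M where M: "powers p (powers (p ^ M) (pp {p})) = powers (p ^ M) (pp {p})"
        "finite {x \<in> powers (p ^ M) (pp {p}). x [^] p = \<one>}"
        using powers_eventually_divisible[OF p subgroup_pp subset_refl] by blast
      \<comment> \<open>If nontrivial, this p-divisible group with finite socle would make
        \<open>p\<close> critical. So the whole component is bounded.\<close>
      then have "powers (p ^ M) (pp {p}) = {\<one>}" using False p by (auto simp: critical_def)
      then have bd: "x [^] (p ^ M) = \<one>" if "x \<in> pp {p}" for x using that by (auto simp: powers_def)
      obtain r :: int where r: "\<not> int p dvd r" "finite ((\<lambda>y. f y \<otimes> inv (y [^] r)) ` pp {p})"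
        using bounded_uniform_exponent[OF a F p subgroup_pp subset_refl bd] by blast
      obtain \<alpha> where \<alpha>: "\<alpha> \<in> PAut G" "\<And>x. x \<in> pp {p} \<Longrightarrow> \<alpha> x = x [^] r"
        "\<And>x. x \<in> pp (primes - {p}) \<Longrightarrow> \<alpha> x = x"
        using power_trivial_off[OF p r(1)] by blast
      have "(\<lambda>y. f y \<otimes> inv (\<alpha> y)) ` pp {p} = (\<lambda>y. f y \<otimes> inv (y [^] r)) ` pp {p}"
        using \<alpha>(2) by auto
      then have "finite ((\<lambda>y. f y \<otimes> inv (\<alpha> y)) ` pp {p})" using r(2) by simp
      then show ?thesis using \<alpha>(1,3) by blast
    qed
    then obtain \<alpha> where \<alpha>: "\<alpha> \<in> PAut G" "\<And>x. x \<in> pp (primes - {p}) \<Longrightarrow> \<alpha> x = x"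
      "finite ((\<lambda>y. f y \<otimes> inv (\<alpha> y)) ` pp {p})" by blast
    have "(\<lambda>y. f y \<otimes> inv (\<alpha> (\<one>\<^bsub>AG\<^esub> y))) ` pp {p} = (\<lambda>y. f y \<otimes> inv (\<alpha> y)) ` pp {p}"
      using AG_one_apply pp_carrier by auto
    then have "finite ((\<lambda>y. f y \<otimes> inv (\<alpha> (\<one>\<^bsub>AG\<^esub> y))) ` pp {p})" using \<alpha>(3) by simp
    then show ?thesis using \<alpha>(1,2) one AG_one_apply pp_carrier by blast
  qed
qed

end

context periodic_comm_group
begin

lemma hom_fix_primary_parts:
  assumes f: "f \<in> hom G G" and x: "x \<in> carrier G"
    and u: "f (proj (pp \<pi>) (pp (primes - \<pi>)) x) = proj (pp \<pi>) (pp (primes - \<pi>)) x"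
    and v: "f (proj (pp (primes - \<pi>)) (pp \<pi>) x) = proj (pp (primes - \<pi>)) (pp \<pi>) x"
  shows "f x = x"
proof -
  note c = pp_complementary[of \<pi>]
  have "f (proj (pp \<pi>) (pp (primes - \<pi>)) x \<otimes> proj (pp (primes - \<pi>)) (pp \<pi>) x)
    = proj (pp \<pi>) (pp (primes - \<pi>)) x \<otimes> proj (pp (primes - \<pi>)) (pp \<pi>) x"
    using endo_mult[OF f proj_closed[OF c x] proj_closed[OF complementary_sym[OF c] x]] u v by simp
  then show ?thesis using decompose(3)[OF c x] by simp
qed

lemma proj_in_subgroup:
  assumes H: "subgroup H G" and x: "x \<in> H"
  shows "proj (pp \<pi>) (pp (primes - \<pi>)) x \<in> H" "proj (pp (primes - \<pi>)) (pp \<pi>) x \<in> H"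
proof -
  have xc: "x \<in> carrier G" using subgroup.mem_carrier[OF H x] .
  note c = pp_complementary[of \<pi>]
  let ?u = "proj (pp \<pi>) (pp (primes - \<pi>)) x" and ?v = "proj (pp (primes - \<pi>)) (pp \<pi>) x"
  obtain k :: int where "?u = x [^] k" using pp_proj_power[OF xc] by blast
  then show u: "?u \<in> H" using subgroup_int_pow_closed[OF H x] by simp
  have uc: "?u \<in> carrier G" "?v \<in> carrier G"
    using proj_closed[OF c xc] proj_closed[OF complementary_sym[OF c] xc] by auto
  have "inv ?u \<otimes> x = inv ?u \<otimes> (?u \<otimes> ?v)" using decompose(3)[OF c xc] by simp
  then have "?v = inv ?u \<otimes> x" using uc by (simp add: inv_cancel2)
  then show "?v \<in> H"
    using subgroup.m_closed[OF H subgroup.m_inv_closed[OF H u] x] by simp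
qed

end

context critical_setting
begin

lemma restrict_Delta:
  assumes e: "\<epsilon> \<in> Delta" and p: "p \<in> critical"
  shows "restrict_pp {p} \<epsilon> \<in> Delta_at p"
proof -
  have a: "\<epsilon> \<in> auto G" using e by (rule Delta_auto)
  note r = restrict_pp[OF a, where \<pi> = "{p}"]
  have onD: "restrict_pp {p} \<epsilon> x = x" if x: "x \<in> D" for x
  proof (rule hom_fix_primary_parts[OF autoD(1)[OF r(1)] D_carrier[OF x], where \<pi> = "{p}"])
    note c = pp_complementary[of "{p}"]
    have xc: "x \<in> carrier G" using x by (rule D_carrier)
    note d = decompose[OF c xc] and m = proj_in_subgroup[OF D_subgroup x, of "{p}"]
    show "restrict_pp {p} \<epsilon> (eP p x) = eP p x" using r(2)[OF d(1)] m(1) e by (simp add: Delta_def)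
    show "restrict_pp {p} \<epsilon> (proj (pp (primes - {p})) (pp {p}) x) = proj (pp (primes - {p})) (pp {p}) x"
      using r(3)[OF d(2)] .
  qed
  have off: "restrict_pp {p} \<epsilon> b = b" if "q \<in> critical" "q \<noteq> p" "b \<in> B \<inter> pp {q}" for q b
    using other_prime[OF critical_prime[OF that(1)], of "{p}"] that r(3) by blast
  have "scales q (restrict_pp {p} \<epsilon>)" if q: "q \<in> critical" for q
  proof (cases "q = p")
    case True
    obtain s :: int where "\<And>b. b \<in> B \<inter> pp {p} \<Longrightarrow> \<epsilon> b = b [^] s" using Delta_scales[OF e p] by blast
    then have "\<forall>b\<in>B \<inter> pp {p}. restrict_pp {p} \<epsilon> b = b [^] s" using r(2) by simp
    then show ?thesis using True unfolding scales_def by blast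
  next
    case False
    then have "\<forall>b\<in>B \<inter> pp {q}. restrict_pp {p} \<epsilon> b = b [^] (1::int)" using off[OF q] B_carrier by simp
    then show ?thesis unfolding scales_def by blast
  qed
  moreover have "moved (restrict_pp {p} \<epsilon>) \<subseteq> {p}" using off by (auto simp: moved_def)
  then have "finite (moved (restrict_pp {p} \<epsilon>))" using finite_subset by blast
  moreover have "pp (primes - critical) \<subseteq> pp (primes - {p})" using p by (intro pp_mono) auto
  ultimately show ?thesis using r(1,3) onD by (auto simp: Delta_def Delta_at_def)
qed

text \<open>Induction on the number of moved primes: the restriction of \<epsilon> to one moved
  prime is divided off. Membership of \<Delta> in \<open>IAut\<close> is thereby reduced to a single
  prime.\<close>

lemma Delta_generated:
  assumes S: "subgroup S AG" and at: "\<And>p. p \<in> critical \<Longrightarrow> Delta_at p \<subseteq> S"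
  shows "Delta \<subseteq> S"
proof
  fix \<epsilon> assume "\<epsilon> \<in> Delta"
  then show "\<epsilon> \<in> S"
  proof (induction "card (moved \<epsilon>)" arbitrary: \<epsilon> rule: less_induct)
    case less
    have a: "\<epsilon> \<in> auto G" using less.prems by (rule Delta_auto)
    have fin: "finite (moved \<epsilon>)" using less.prems by (simp add: Delta_def)
    show ?case
    proof (cases "moved \<epsilon> = {}")
      case True
      have "\<epsilon> = \<one>\<^bsub>AG\<^esub>"
      proof (rule Delta_eqI[OF a AG_one_closed])
        show "\<epsilon> x = \<one>\<^bsub>AG\<^esub> x" if "x \<in> D" for x
          using that less.prems AG_one_apply[OF D_carrier[OF that]] by (simp add: Delta_def)
        show "\<epsilon> x = \<one>\<^bsub>AG\<^esub> x" if "x \<in> pp (primes - critical)" for x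
          using that less.prems AG_one_apply[OF pp_carrier[OF that]] by (simp add: Delta_def)
        show "\<epsilon> b = \<one>\<^bsub>AG\<^esub> b" if "p \<in> critical" "b \<in> B \<inter> pp {p}" for p b
          using that True AG_one_apply B_carrier by (auto simp: moved_def)
      qed
      then show ?thesis using subgroup.one_closed[OF S] by simp
    next
      case False
      then obtain p where p: "p \<in> moved \<epsilon>" by blast
      then have pc: "p \<in> critical" by (simp add: moved_def)
      define \<rho> where "\<rho> = restrict_pp {p} \<epsilon>"
      have \<rho>: "\<rho> \<in> Delta_at p" unfolding \<rho>_def by (rule restrict_Delta[OF less.prems pc])
      then have \<rho>\<Delta>: "\<rho> \<in> Delta" by (simp add: Delta_at_def)
      have \<rho>a: "\<rho> \<in> auto G" using \<rho>\<Delta> by (rule Delta_auto)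
      define \<delta> where "\<delta> = inv\<^bsub>AG\<^esub> \<rho> \<otimes>\<^bsub>AG\<^esub> \<epsilon>"
      have \<delta>: "\<delta> \<in> Delta"
        unfolding \<delta>_def using subgroup.m_closed[OF subgroup_Delta Delta_inv[OF \<rho>\<Delta>] less.prems] .
      have app: "\<delta> x = (inv\<^bsub>AG\<^esub> \<rho>) (\<epsilon> x)" if "x \<in> carrier G" for x
        unfolding \<delta>_def using AG_mult_apply[OF AG_inv_closed[OF \<rho>a] a that] .
      have "moved \<delta> \<subseteq> moved \<epsilon> - {p}"
      proof
        fix q assume "q \<in> moved \<delta>"
        then obtain b where b: "q \<in> critical" "b \<in> B \<inter> pp {q}" "\<delta> b \<noteq> b" by (auto simp: moved_def)
        have bc: "b \<in> carrier G" using b B_carrier by blast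
        have "q \<noteq> p"
        proof
          assume "q = p"
          then have "\<rho> b = \<epsilon> b" unfolding \<rho>_def using restrict_pp(2)[OF a] b(2) by simp
          then show False using b(3) app[OF bc] AG_inv_left[OF \<rho>a bc] by simp
        qed
        moreover from this have "\<rho> b = b"
          unfolding \<rho>_def using restrict_pp(3)[OF a] other_prime[OF critical_prime[OF b(1)], of "{p}"] b(2) by blast
        then have "(inv\<^bsub>AG\<^esub> \<rho>) b = b" using AG_inv_left[OF \<rho>a bc] by simp
        then have "\<epsilon> b \<noteq> b" using b(3) app[OF bc] by auto
        ultimately show "q \<in> moved \<epsilon> - {p}" using b by (auto simp: moved_def)
      qed
      then have "moved \<delta> \<subset> moved \<epsilon>" using p by blast
      then have "\<delta> \<in> S" using less.hyps[OF psubset_card_mono[OF fin] \<delta>] by blast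
      moreover have "\<rho> \<in> S" using at[OF pc] \<rho> by blast
      moreover have "\<epsilon> = \<rho> \<otimes>\<^bsub>AG\<^esub> \<delta>"
        unfolding \<delta>_def using group.inv_solve_left[OF group_AG] \<rho>a a AG_inv_closed[OF \<rho>a] AG_mult_closed
        by (metis carrier_AG)
      ultimately show ?thesis using subgroup.m_closed[OF S] by simp
    qed
  qed
qed

text \<open>Modulo \<open>H\<close> only the factor \<open>d [^] (1 - r)\<close> of
  \<open>\<epsilon> x\<close> survives, where \<open>d\<close> is the \<open>D\<close>-part of the
  p-component of \<open>x\<close>. Up to a factor in \<open>H\<close>, \<open>d\<close> comes from a
  finite group: finite rank of \<open>D\<close> makes \<open>Z\<close> finite, and boundedness of
  \<open>B \<inter> pp {p}\<close> puts \<open>E\<close> into \<open>H\<close>.\<close>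

lemma inertial_Delta_at:
  assumes p: "p \<in> critical" and e: "\<epsilon> \<in> Delta_at p"
  shows "inertial G \<epsilon>"
proof -
  have pr: "prime p" using p by (rule critical_prime)
  have ed: "\<epsilon> \<in> Delta" "\<And>x. x \<in> pp (primes - {p}) \<Longrightarrow> \<epsilon> x = x" "\<And>x. x \<in> D \<Longrightarrow> \<epsilon> x = x"
    using e by (auto simp: Delta_at_def Delta_def)
  have a: "\<epsilon> \<in> auto G" using ed(1) by (rule Delta_auto)
  have h: "\<epsilon> \<in> hom G G" using a by (rule autoD)
  obtain r :: int where r: "\<And>b. b \<in> B \<inter> pp {p} \<Longrightarrow> \<epsilon> b = b [^] r" using Delta_scales[OF ed(1) p] by blast
  obtain m where m: "\<And>b. b \<in> B \<inter> pp {p} \<Longrightarrow> b [^] (p ^ m) = \<one>" using B_bounded[OF p] by blast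
  note c = pp_complementary[of "{p}"]
  have "finite ((\<lambda>h. H #> \<epsilon> h) ` H)" if H: "subgroup H G" for H
  proof -
    define f where "f x = eD (eP p x)" for x
    have fh: "f \<in> hom G G"
      unfolding f_def by (rule endo_comp[OF proj_hom[OF compl] proj_hom[OF c]])
    define K where "K = f ` H"
    have K: "subgroup K G" unfolding K_def by (rule subgroup_image[OF fh H])
    have Hc: "x \<in> carrier G" if "x \<in> H" for x using subgroup.mem_carrier[OF H that] .
    have fD: "f x \<in> D \<inter> pp {p}" if "x \<in> H" for x
      unfolding f_def using decompose(1)[OF c Hc[OF that]] eD_pp eD pp_carrier by blast
    have KD: "K \<subseteq> D" "K \<subseteq> pp {p}" using fD by (auto simp: K_def)
    have finK: "finite {x \<in> K. x [^] n = \<one>}" if "n > (0::nat)" for n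
    proof (rule finite_subset)
      show "{x \<in> K. x [^] n = \<one>} \<subseteq> {x \<in> D. x [^] n = \<one>}" using KD by blast
      show "finite {x \<in> D. x [^] n = \<one>}" using D_finite_torsion[OF that] .
    qed
    have "{x \<in> powers (p ^ 0) K. x [^] p = \<one>} \<subseteq> {x \<in> K. x [^] p = \<one>}"
      using powers_subset[OF K] by blast
    then have "finite {x \<in> powers (p ^ 0) K. x [^] p = \<one>}"
      using finK[of p] pr finite_subset by (metis prime_gt_0_nat)
    then obtain M where M: "powers p (powers (p ^ M) K) = powers (p ^ M) K"
      using powers_eventually_divisible[OF pr K KD(2)] by blast
    \<comment> \<open>\<open>E\<close> is divisible and \<open>p\<^sup>m K \<subseteq> H\<close>, so \<open>E \<subseteq> H\<close>; moreover \<open>K = ZE\<close> for the finite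
      group \<open>Z\<close> below.\<close>
    define E where "E = powers (p ^ M) K"
    have E: "subgroup E G" "E \<subseteq> K"
      unfolding E_def using subgroup_powers[OF K] powers_subset[OF K] by auto
    have Ec: "E \<subseteq> carrier G" using subgroup.subset[OF E(1)] .
    have Ep: "powers (p ^ j) E = E" for j
      using powers_p_power[OF Ec] M by (simp add: E_def)
    have EH: "E \<subseteq> H"
    proof
      fix x assume "x \<in> E"
      then obtain y where "y \<in> K" "x = y [^] (p ^ m)" using Ep[of m] E(2) by (auto simp: powers_def)
      then obtain z where z: "z \<in> H" "x = f z [^] (p ^ m)" by (auto simp: K_def)
      have zp: "eP p z \<in> pp {p}" "eP p z \<in> H"
        using decompose(1)[OF c Hc[OF z(1)]] proj_in_subgroup(1)[OF H z(1)] by auto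
      have zc: "eP p z \<in> carrier G" using zp pp_carrier by blast
      have b: "eB (eP p z) [^] (p ^ m) = \<one>" using m eB[OF zc] eB_pp[OF zp(1)] by blast
      \<comment> \<open>The exponent \<open>p ^ m\<close> kills the \<open>B\<close>-part, so the
        power of \<open>f z\<close> equals that of \<open>eP p z\<close>, which belongs to
        \<open>H\<close>.\<close>
      have "eP p z [^] (p ^ m) = (f z \<otimes> eB (eP p z)) [^] (p ^ m)"
        using eDB[OF zc] by (simp add: f_def)
      also have "\<dots> = x" using b z(2) D_carrier[OF eD[OF zc]] B_carrier[OF eB[OF zc]]
        by (simp add: nat_pow_distrib f_def)
      finally show "x \<in> H" using nat_pow_mem[OF H zp(2)] by metis
    qed
    define Z where "Z = {z \<in> K. z [^] (p ^ M) = \<one>}"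
    have finZ: "finite Z" unfolding Z_def using finK[of "p ^ M"] pr by (simp add: prime_gt_0_nat)
    have "(\<lambda>h. H #> \<epsilon> h) ` H \<subseteq> (\<lambda>z. H #> z [^] (1 - r)) ` Z"
    proof
      fix X assume "X \<in> (\<lambda>h. H #> \<epsilon> h) ` H"
      then obtain x where x: "x \<in> H" "X = H #> \<epsilon> x" by blast
      have xc: "x \<in> carrier G" using Hc x by blast
      define u where "u = eP p x"
      define v where "v = proj (pp (primes - {p})) (pp {p}) x"
      have uv: "u \<in> pp {p}" "v \<in> pp (primes - {p})" "x = u \<otimes> v" "u \<in> H" "v \<in> H"
        unfolding u_def v_def using decompose[OF c xc] proj_in_subgroup[OF H x(1)] by auto
      have uc: "u \<in> carrier G" "v \<in> carrier G" using uv pp_carrier by auto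
      define d b where "d = eD u" and "b = eB u"
      have db: "d \<in> D" "b \<in> B \<inter> pp {p}" "u = d \<otimes> b" "d \<in> K"
        unfolding d_def b_def using eD[OF uc(1)] eB[OF uc(1)] eB_pp[OF uv(1)] eDB[OF uc(1)] x(1)
        by (auto simp: K_def f_def u_def)
      have dbc: "d \<in> carrier G" "b \<in> carrier G" using db D_carrier B_carrier by auto
      have "\<epsilon> x = \<epsilon> d \<otimes> \<epsilon> b \<otimes> \<epsilon> v" using uv(3) db(3) dbc uc h by (simp add: endo_mult)
      also have "\<dots> = d \<otimes> b [^] r \<otimes> v" using ed(2)[OF uv(2)] ed(3)[OF db(1)] r[OF db(2)] by simp
      also have "\<dots> = v \<otimes> u [^] r \<otimes> d [^] (1 - r)"
      proof -
        have "d [^] (1 - r) = d \<otimes> inv (d [^] r)" using dbc by (simp add: int_pow_diff)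
        moreover have "u [^] r = d [^] r \<otimes> b [^] r" using db(3) dbc by (simp add: int_pow_distrib)
        ultimately show ?thesis using dbc uc(2) int_pow_closed[OF dbc(1), of r]
            int_pow_closed[OF dbc(2), of r] by algebra
      qed
      finally have ex: "\<epsilon> x = v \<otimes> u [^] r \<otimes> d [^] (1 - r)" .
      have "d [^] (p ^ M) \<in> E" using db(4) by (auto simp: E_def powers_def)
      then have "d [^] (p ^ M) \<in> powers (p ^ M) E" unfolding Ep .
      then obtain y where y: "y \<in> E" "d [^] (p ^ M) = y [^] (p ^ M)"
        unfolding powers_def by blast
      have yc: "y \<in> carrier G" using y Ec by blast
      define z where "z = d \<otimes> inv y"
      have zK: "z \<in> K"
        unfolding z_def using subgroup.m_closed[OF K db(4) subgroup.m_inv_closed[OF K]] y(1) E(2) by blast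
      have zc: "z \<in> carrier G" using dbc yc by (simp add: z_def)
      have "z [^] (p ^ M) = \<one>"
        unfolding z_def using dbc yc y(2) by (simp add: nat_pow_distrib nat_pow_inv)
      then have zZ: "z \<in> Z" using zK by (simp add: Z_def)
      have dz: "d = z \<otimes> y" unfolding z_def using dbc yc by algebra
      have "\<epsilon> x \<otimes> inv (z [^] (1 - r)) = v \<otimes> u [^] r \<otimes> y [^] (1 - r)"
      proof -
        have "d [^] (1 - r) = z [^] (1 - r) \<otimes> y [^] (1 - r)" using dz zc yc by (simp add: int_pow_distrib)
        then show ?thesis unfolding ex using uc(2) int_pow_closed[OF uc(1), of r]
            int_pow_closed[OF zc, of "1 - r"] int_pow_closed[OF yc, of "1 - r"] by algebra
      qed
      also have "\<dots> \<in> H"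
        using uv(4,5) y(1) EH subgroup_int_pow_closed[OF H]
        by (intro subgroup.m_closed[OF H]) auto
      finally have "X = H #> z [^] (1 - r)"
        using r_coset_eq_iff[OF H auto_closed[OF a xc] int_pow_closed[OF zc, of "1 - r"]] x(2) by simp
      then show "X \<in> (\<lambda>z. H #> z [^] (1 - r)) ` Z" using zZ by blast
    qed
    then show ?thesis using finZ finite_subset by blast
  qed
  then show ?thesis using a by (simp add: inertial_iff)
qed

section \<open>The product of \<open>FAut\<close> and \<Delta>, and the factorization of
  \<open>IAut\<close>\<close>

definition FD :: "('a \<Rightarrow> 'a) set" where
  "FD = FAut G <#>\<^bsub>AG\<^esub> Delta"

lemma subgroup_FD: "subgroup FD AG" and FAut_subset_FD: "FAut G \<subseteq> FD" and Delta_subset_FD: "Delta \<subseteq> FD"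
proof -
  interpret P: second_isomorphism_grp "FAut G" AG Delta
    using normal_FAut subgroup_Delta
    by (simp add: second_isomorphism_grp_def second_isomorphism_grp_axioms_def)
  show "subgroup FD AG" unfolding FD_def by (rule P.normal_set_mult_subgroup)
  show "FAut G \<subseteq> FD" "Delta \<subseteq> FD"
    unfolding FD_def by (rule P.H_contained_in_set_mult P.S_contained_in_set_mult)+
qed

lemma PAut_FAut_Delta: "PAut G <#>\<^bsub>AG\<^esub> FAut G <#>\<^bsub>AG\<^esub> Delta = PAut G <#>\<^bsub>AG\<^esub> FD"
  unfolding FD_def using group.set_mult_assoc[OF group_AG] subgroup.subset[OF subgroup_PAut]
    subgroup.subset[OF subgroup_FAut] subgroup.subset[OF subgroup_Delta] by blast

lemma subgroup_PAut_FD: "subgroup (PAut G <#>\<^bsub>AG\<^esub> FD) AG"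
  and PAut_subset: "PAut G \<subseteq> PAut G <#>\<^bsub>AG\<^esub> FD" and FD_subset: "FD \<subseteq> PAut G <#>\<^bsub>AG\<^esub> FD"
proof -
  interpret P: second_isomorphism_grp "PAut G" AG FD
    using normal_PAut subgroup_FD
    by (simp add: second_isomorphism_grp_def second_isomorphism_grp_axioms_def)
  show "subgroup (PAut G <#>\<^bsub>AG\<^esub> FD) AG" by (rule P.normal_set_mult_subgroup)
  show "PAut G \<subseteq> PAut G <#>\<^bsub>AG\<^esub> FD" "FD \<subseteq> PAut G <#>\<^bsub>AG\<^esub> FD"
    by (rule P.H_contained_in_set_mult P.S_contained_in_set_mult)+
qed

text \<open>Only primes dividing the order of an element of \<open>F\<close> are exceptional. By
  \<open>inertial_primary\<close> the restriction of \<open>f\<close> to each of them lies in the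
  product; composing these finitely many restrictions gives \<open>g\<close>, and the quotient of
  \<open>f\<close> by \<open>g\<close> acts by powers on every component.\<close>

lemma inertial_in_PAut_FD:
  assumes f: "inertial G f"
  shows "f \<in> PAut G <#>\<^bsub>AG\<^esub> FD"
proof -
  let ?W = "PAut G <#>\<^bsub>AG\<^esub> FD"
  note W = subgroup_PAut_FD
  have FDsub: "FAut G \<subseteq> ?W" "Delta \<subseteq> ?W" "PAut G \<subseteq> ?W"
    using FAut_subset_FD Delta_subset_FD FD_subset PAut_subset by blast+
  have Wa: "g \<in> auto G" if "g \<in> ?W" for g using subgroup.mem_carrier[OF W that] by simp
  have fa: "f \<in> auto G" using f by (simp add: inertial_def)
  have fh: "f \<in> hom G G" using fa by (rule autoD)
  have local: "restrict_pp {p} f \<in> ?W" if p: "prime p" for p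
  proof -
    obtain \<alpha> \<epsilon> where ae: "\<alpha> \<in> PAut G" "\<epsilon> \<in> Delta"
      "\<And>x. x \<in> pp (primes - {p}) \<Longrightarrow> \<alpha> x = x" "\<And>x. x \<in> pp (primes - {p}) \<Longrightarrow> \<epsilon> x = x"
      "finite ((\<lambda>y. f y \<otimes> inv (\<alpha> (\<epsilon> y))) ` pp {p})" using inertial_primary[OF f p] by blast
    have aa: "\<alpha> \<in> auto G" "\<epsilon> \<in> auto G" using ae PAut_auto Delta_auto by auto
    define g where "g = restrict_pp {p} f"
    have g: "g \<in> auto G" unfolding g_def by (rule restrict_pp(1)[OF fa])
    define \<beta> where "\<beta> = \<alpha> \<otimes>\<^bsub>AG\<^esub> \<epsilon>"
    have \<beta>: "\<beta> \<in> auto G" unfolding \<beta>_def using aa by (rule AG_mult_closed)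
    have \<beta>W: "\<beta> \<in> ?W" unfolding \<beta>_def using subgroup.m_closed[OF W] ae(1,2) FDsub by blast
    note c = pp_complementary[of "{p}"]
    \<comment> \<open>Both \<open>g\<close> and \<beta> are the identity off \<open>pp {p}\<close>,
      so every value already occurs on the p-component.\<close>
    have "(\<lambda>x. g x \<otimes> inv (\<beta> x)) ` carrier G \<subseteq> (\<lambda>y. f y \<otimes> inv (\<alpha> (\<epsilon> y))) ` pp {p}"
    proof
      fix z assume "z \<in> (\<lambda>x. g x \<otimes> inv (\<beta> x)) ` carrier G"
      then obtain x where x: "x \<in> carrier G" "z = g x \<otimes> inv (\<beta> x)" by blast
      define u where "u = eP p x"
      define v where "v = proj (pp (primes - {p})) (pp {p}) x"
      have uv: "u \<in> pp {p}" "v \<in> pp (primes - {p})" "x = u \<otimes> v"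
        unfolding u_def v_def using decompose[OF c x(1)] by auto
      have uc: "u \<in> carrier G" "v \<in> carrier G" using uv pp_carrier by auto
      have gx: "g x = f u \<otimes> v"
        using endo_mult[OF autoD(1)[OF g] uc] restrict_pp(2)[OF fa uv(1)] restrict_pp(3)[OF fa uv(2)]
        by (simp add: uv(3) g_def)
      have "\<beta> v = v" unfolding \<beta>_def using AG_mult_apply[OF aa uc(2)] ae(3,4) uv(2) by simp
      moreover have "\<beta> u = \<alpha> (\<epsilon> u)" unfolding \<beta>_def using AG_mult_apply[OF aa uc(1)] .
      ultimately have bx: "\<beta> x = \<alpha> (\<epsilon> u) \<otimes> v"
        unfolding uv(3) endo_mult[OF autoD(1)[OF \<beta>] uc] by simp
      have cl: "f u \<in> carrier G" "\<alpha> (\<epsilon> u) \<in> carrier G"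
        using auto_closed[OF fa uc(1)] auto_closed[OF aa(1) auto_closed[OF aa(2) uc(1)]] by auto
      have "z = f u \<otimes> inv (\<alpha> (\<epsilon> u))"
        unfolding x(2) gx bx using cl uc(2) by algebra
      then show "z \<in> (\<lambda>y. f y \<otimes> inv (\<alpha> (\<epsilon> y))) ` pp {p}" using uv(1) by blast
    qed
    then have "finite ((\<lambda>x. g x \<otimes> inv (\<beta> x)) ` carrier G)" using ae(5) finite_subset by blast
    then have \<phi>: "g \<otimes>\<^bsub>AG\<^esub> inv\<^bsub>AG\<^esub> \<beta> \<in> FAut G" by (rule FAutI_quotient[OF g \<beta>])
    have "g = (g \<otimes>\<^bsub>AG\<^esub> inv\<^bsub>AG\<^esub> \<beta>) \<otimes>\<^bsub>AG\<^esub> \<beta>"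
      using group.inv_solve_right'[OF group_AG, of "g \<otimes>\<^bsub>AG\<^esub> inv\<^bsub>AG\<^esub> \<beta>" g \<beta>] g \<beta>
        AG_mult_closed[OF g AG_inv_closed[OF \<beta>]] by simp
    moreover have "(g \<otimes>\<^bsub>AG\<^esub> inv\<^bsub>AG\<^esub> \<beta>) \<otimes>\<^bsub>AG\<^esub> \<beta> \<in> ?W"
      using subgroup.m_closed[OF W] \<phi> \<beta>W FDsub(1) by blast
    ultimately show ?thesis unfolding g_def by simp
  qed
  have many: "\<exists>g\<in>?W. (\<forall>p\<in>P. \<forall>x\<in>pp {p}. g x = f x) \<and> (\<forall>q x. prime q \<longrightarrow> q \<notin> P \<longrightarrow> x \<in> pp {q} \<longrightarrow> g x = x)"
    if "finite P" "\<And>p. p \<in> P \<Longrightarrow> prime p" for P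
    using that
  proof (induction P)
    case empty
    have "\<one>\<^bsub>AG\<^esub> \<in> ?W" using subgroup.one_closed[OF W] .
    then show ?case using AG_one_apply pp_carrier by blast
  next
    case (insert p P)
    then obtain g where g: "g \<in> ?W" "\<And>p x. p \<in> P \<Longrightarrow> x \<in> pp {p} \<Longrightarrow> g x = f x"
      "\<And>q x. prime q \<Longrightarrow> q \<notin> P \<Longrightarrow> x \<in> pp {q} \<Longrightarrow> g x = x" by blast
    define k where "k = restrict_pp {p} f"
    have pr: "prime p" using insert.prems by simp
    have k: "k \<in> ?W" unfolding k_def by (rule local[OF pr])
    have ka: "k \<in> auto G" "g \<in> auto G" using Wa k g(1) by auto
    have app: "(k \<otimes>\<^bsub>AG\<^esub> g) x = k (g x)" if "x \<in> pp {q}" for x q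
      using AG_mult_apply[OF ka pp_carrier[OF that]] .
    have kq: "k x = x" if "prime q" "q \<noteq> p" "x \<in> pp {q}" for q x
      unfolding k_def using restrict_pp(3)[OF fa] other_prime[OF that(1), of "{p}"] that by blast
    have "k \<otimes>\<^bsub>AG\<^esub> g \<in> ?W" using subgroup.m_closed[OF W k g(1)] .
    moreover have "(k \<otimes>\<^bsub>AG\<^esub> g) x = f x" if q: "q \<in> insert p P" "x \<in> pp {q}" for q x
    proof (cases "q = p")
      case True
      then have "g x = x" using g(3)[OF pr insert.hyps(2)] q by blast
      then show ?thesis using app[OF q(2)] True q(2) restrict_pp(2)[OF fa] by (simp add: k_def)
    next
      case False
      then have "g x = f x" using g(2) q by blast
      moreover have "prime q" using insert.prems q by blast
      ultimately show ?thesis using app[OF q(2)] kq[OF _ False pp_endo[OF fh q(2)]] by simp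
    qed
    moreover have "(k \<otimes>\<^bsub>AG\<^esub> g) x = x" if q: "prime q" "q \<notin> insert p P" "x \<in> pp {q}" for q x
      using app[OF q(3)] g(3)[OF q(1) _ q(3)] kq[OF q(1) _ q(3)] q(2) by simp
    ultimately show ?case by blast
  qed
  obtain F where F: "subgroup F G" "finite F"
    "\<And>x. x \<in> carrier G \<Longrightarrow> avoids x F \<Longrightarrow> \<exists>k::int. f x \<otimes> inv (x [^] k) \<in> F"
    using inertial_almost_power[OF f] unfolding almost_power_def by blast
  define P where "P = (\<Union>x\<in>F. {p. prime p \<and> p dvd ord x})"
  have "finite {p. prime p \<and> p dvd ord x}" if "x \<in> F" for x
    using ord_pos[OF subgroup.mem_carrier[OF F(1) that]] finite_divisors_nat[of "ord x"]
    by (auto intro: finite_subset[rotated])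
  then have finP: "finite P" unfolding P_def using F(2) by blast
  have trivF: "x = \<one>" if "x \<in> F" "x \<in> pp {q}" "prime q" "q \<notin> P" for x q
  proof -
    have "x \<in> pp (- {q})" using that pp_carrier by (auto simp: mem_pp_iff P_def)
    then show ?thesis using pp_disjoint[OF that(2), of "- {q}"] by blast
  qed
  have off: "\<exists>k::int. f x = x [^] k" if q: "prime q" "q \<notin> P" and x: "x \<in> pp {q}" for q x
  proof -
    have xc: "x \<in> carrier G" using x pp_carrier by blast
    have "avoids x F"
      unfolding avoids_def using trivF[OF _ subgroup_int_pow_closed[OF subgroup_pp x] q] by blast
    then obtain k :: int where k: "f x \<otimes> inv (x [^] k) \<in> F" using F(3)[OF xc] by blast
    have "f x \<otimes> inv (x [^] k) \<in> pp {q}"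
      using pp_endo[OF fh x] subgroup_int_pow_closed[OF subgroup_pp x] subgroup_pp
      by (simp add: subgroup.m_closed subgroup.m_inv_closed)
    then have "f x \<otimes> inv (x [^] k) = \<one>" using trivF[OF k _ q] by blast
    then show ?thesis using eq_iff_quotient[OF auto_closed[OF fa xc] int_pow_closed[OF xc]] by blast
  qed
  have "prime p" if "p \<in> P" for p using that by (auto simp: P_def)
  from many[OF finP this] obtain g where g: "g \<in> ?W" "\<And>p x. p \<in> P \<Longrightarrow> x \<in> pp {p} \<Longrightarrow> g x = f x"
    "\<And>q x. prime q \<Longrightarrow> q \<notin> P \<Longrightarrow> x \<in> pp {q} \<Longrightarrow> g x = x"
    by blast
  have ga: "g \<in> auto G" using Wa g(1) .
  define \<alpha> where "\<alpha> = inv\<^bsub>AG\<^esub> g \<otimes>\<^bsub>AG\<^esub> f"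
  have \<alpha>a: "\<alpha> \<in> auto G" unfolding \<alpha>_def using AG_mult_closed[OF AG_inv_closed[OF ga] fa] .
  have "\<alpha> \<in> PAut G"
  proof (rule PAutI[OF autoD(1,2)[OF \<alpha>a]])
    show "x = \<one>" if "x \<in> carrier G" "\<alpha> x = \<one>" for x
      using inj_onD[OF autoD(4)[OF \<alpha>a], of x \<one>] that endo_one[OF autoD(1)[OF \<alpha>a]] by simp
    show "\<exists>k::int. \<alpha> x = x [^] k" if q: "prime q" "x \<in> pp {q}" for q x
    proof -
      have xc: "x \<in> carrier G" using q pp_carrier by blast
      have app: "\<alpha> x = (inv\<^bsub>AG\<^esub> g) (f x)" unfolding \<alpha>_def using AG_mult_apply[OF AG_inv_closed[OF ga] fa xc] .
      show ?thesis
      proof (cases "q \<in> P")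
        case True
        then have "\<alpha> x = x [^] (1::int)" using app g(2)[OF True q(2)] AG_inv_left[OF ga xc] xc by simp
        then show ?thesis by blast
      next
        case False
        have "g (f x) = f x" using g(3)[OF q(1) False pp_endo[OF fh q(2)]] .
        then have "(inv\<^bsub>AG\<^esub> g) (f x) = f x" using AG_inv_left[OF ga auto_closed[OF fa xc]] by simp
        then show ?thesis using off[OF q(1) False q(2)] app by simp
      qed
    qed
  qed
  then have "\<alpha> \<in> ?W" using FDsub(3) by blast
  moreover have "f = g \<otimes>\<^bsub>AG\<^esub> \<alpha>"
    unfolding \<alpha>_def using group.inv_solve_left[OF group_AG, of "inv\<^bsub>AG\<^esub> g \<otimes>\<^bsub>AG\<^esub> f" g f] fa ga \<alpha>a
    by (simp add: \<alpha>_def)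
  ultimately show ?thesis using subgroup.m_closed[OF W g(1)] by simp
qed

lemma subgroup_IAut: "subgroup (IAut G) AG"
  unfolding IAut_def by (rule group.generate_is_subgroup[OF group_AG]) (auto simp: inertial_def)

lemma inertial_subset_IAut: "inertial G f \<Longrightarrow> f \<in> IAut G"
  unfolding IAut_def by (simp add: generate.incl)

lemma Delta_subset_IAut: "Delta \<subseteq> IAut G"
  using Delta_generated[OF subgroup_IAut] inertial_Delta_at inertial_subset_IAut by blast

lemma FD_subset_IAut: "FD \<subseteq> IAut G"
  unfolding FD_def set_mult_def
  using inertial_subset_IAut[OF inertial_FAut] Delta_subset_IAut subgroup.m_closed[OF subgroup_IAut] by blast

lemma IAut_eq: "IAut G = PAut G <#>\<^bsub>AG\<^esub> FAut G <#>\<^bsub>AG\<^esub> Delta"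
proof -
  have "PAut G <#>\<^bsub>AG\<^esub> FD \<subseteq> IAut G"
    unfolding set_mult_def
    using inertial_subset_IAut[OF inertial_PAut] FD_subset_IAut subgroup.m_closed[OF subgroup_IAut] by blast
  moreover have "IAut G \<subseteq> PAut G <#>\<^bsub>AG\<^esub> FD"
    unfolding IAut_def using inertial_in_PAut_FD
    by (intro group.generate_subgroup_incl[OF group_AG _ subgroup_PAut_FD]) auto
  ultimately show ?thesis unfolding PAut_FAut_Delta by blast
qed

end

section \<open>The group \<open>\<Delta>\<close> as a direct product\<close>

context periodic_comm_group
begin

lemma auto_eq_on_parts:
  assumes f: "f \<in> auto G" and g: "g \<in> auto G"
    and 1: "\<And>x. x \<in> pp \<pi> \<Longrightarrow> f x = g x" and 2: "\<And>x. x \<in> pp (primes - \<pi>) \<Longrightarrow> f x = g x"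
  shows "f = g"
proof (rule AG_eqI[OF f g])
  fix x assume x: "x \<in> carrier G"
  note d = decompose[OF pp_complementary[of \<pi>] x]
  have "f (proj (pp \<pi>) (pp (primes - \<pi>)) x \<otimes> proj (pp (primes - \<pi>)) (pp \<pi>) x)
      = g (proj (pp \<pi>) (pp (primes - \<pi>)) x \<otimes> proj (pp (primes - \<pi>)) (pp \<pi>) x)"
    using 1[OF d(1)] 2[OF d(2)] pp_carrier[OF d(1)] pp_carrier[OF d(2)]
    by (simp add: endo_mult[OF autoD(1)[OF f]] endo_mult[OF autoD(1)[OF g]])
  then show "f x = g x" using d(3) by simp
qed

lemma restrict_pp_eqI:
  assumes f: "f \<in> auto G" and g: "g \<in> auto G"
    and 1: "\<And>x. x \<in> pp \<pi> \<Longrightarrow> g x = f x" and 2: "\<And>x. x \<in> pp (primes - \<pi>) \<Longrightarrow> g x = x"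
  shows "restrict_pp \<pi> f = g"
  using auto_eq_on_parts[OF restrict_pp(1)[OF f, of \<pi>] g, of \<pi>] 1 2 restrict_pp(2,3)[OF f] by simp

lemma restrict_pp_mult:
  assumes f: "f \<in> auto G" and g: "g \<in> auto G"
  shows "restrict_pp \<pi> (f \<otimes>\<^bsub>AG\<^esub> g) = restrict_pp \<pi> f \<otimes>\<^bsub>AG\<^esub> restrict_pp \<pi> g"
proof (rule restrict_pp_eqI)
  note r = restrict_pp[OF f, where \<pi> = \<pi>] restrict_pp[OF g, where \<pi> = \<pi>]
  show "f \<otimes>\<^bsub>AG\<^esub> g \<in> auto G" "restrict_pp \<pi> f \<otimes>\<^bsub>AG\<^esub> restrict_pp \<pi> g \<in> auto G"
    using f g r by (auto intro: AG_mult_closed)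
  fix x
  show "(restrict_pp \<pi> f \<otimes>\<^bsub>AG\<^esub> restrict_pp \<pi> g) x = (f \<otimes>\<^bsub>AG\<^esub> g) x" if x: "x \<in> pp \<pi>"
    using AG_mult_apply[OF r(1,4) pp_carrier[OF x]] AG_mult_apply[OF f g pp_carrier[OF x]]
      r(5)[OF x] r(2)[OF pp_endo[OF autoD(1)[OF g] x]] by simp
  show "(restrict_pp \<pi> f \<otimes>\<^bsub>AG\<^esub> restrict_pp \<pi> g) x = x" if x: "x \<in> pp (primes - \<pi>)"
    using AG_mult_apply[OF r(1,4) pp_carrier[OF x]] r(6)[OF x] r(3)[OF x] by simp
qed

end

context critical_setting
begin

lemma subgroup_Delta_at: "subgroup (Delta_at p) AG"
  unfolding Delta_at_def by (rule AG_subgroup_fixing[OF subgroup_Delta subgroup.subset[OF subgroup_pp]])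

lemma comm_group_in_Delta:
  assumes "subgroup S AG" "S \<subseteq> Delta"
  shows "comm_group (AG\<lparr>carrier := S\<rparr>)"
  using group.group_comm_groupI[OF subgroup.subgroup_is_group[OF assms(1) group_AG]]
    Delta_commute assms(2) by (auto simp: subset_iff)

text \<open>An element is determined by its exponent modulo a bound \<open>p ^ m\<close> for
  \<open>B \<inter> pp {p}\<close>.\<close>

lemma finite_Delta_at:
  assumes p: "p \<in> critical"
  shows "finite (Delta_at p)"
proof -
  have pr: "prime p" using p by (rule critical_prime)
  obtain m where m: "\<And>b. b \<in> B \<inter> pp {p} \<Longrightarrow> b [^] (p ^ m) = \<one>" using B_bounded[OF p] by blast
  have "\<exists>r\<in>{0..<int (p ^ m)}. \<forall>b\<in>B \<inter> pp {p}. \<epsilon> b = b [^] r" if e: "\<epsilon> \<in> Delta_at p" for \<epsilon>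
  proof -
    have "\<epsilon> \<in> Delta" using e by (simp add: Delta_at_def)
    then obtain r :: int where r: "\<And>b. b \<in> B \<inter> pp {p} \<Longrightarrow> \<epsilon> b = b [^] r" using Delta_scales p by blast
    have "\<epsilon> b = b [^] (r mod int (p ^ m))" if b: "b \<in> B \<inter> pp {p}" for b
      unfolding r[OF b] using b B_carrier
      by (intro int_pow_cong[OF _ m[OF b]]) (auto simp: minus_mod_eq_mult_div)
    moreover have "r mod int (p ^ m) \<in> {0..<int (p ^ m)}" using pr by (simp add: prime_gt_0_nat)
    ultimately show ?thesis by blast
  qed
  then obtain s where s: "\<And>\<epsilon>. \<epsilon> \<in> Delta_at p \<Longrightarrow> s \<epsilon> \<in> {0..<int (p ^ m)}"
    "\<And>\<epsilon> b. \<epsilon> \<in> Delta_at p \<Longrightarrow> b \<in> B \<inter> pp {p} \<Longrightarrow> \<epsilon> b = b [^] s \<epsilon>" by metis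
  have "finite (s ` Delta_at p)"
    by (rule finite_subset[of _ "{0..<int (p ^ m)}"]) (use s(1) in auto)
  moreover have "inj_on s (Delta_at p)"
  proof (rule inj_onI)
    fix f g assume f: "f \<in> Delta_at p" and g: "g \<in> Delta_at p" and eq: "s f = s g"
    have fg: "f \<in> Delta" "g \<in> Delta" using f g by (auto simp: Delta_at_def)
    show "f = g"
    proof (rule Delta_eqI[OF Delta_auto[OF fg(1)] Delta_auto[OF fg(2)]])
      show "f x = g x" if "x \<in> D" for x using fg that by (simp add: Delta_def)
      show "f x = g x" if "x \<in> pp (primes - critical)" for x using fg that by (simp add: Delta_def)
      show "f b = g b" if q: "q \<in> critical" "b \<in> B \<inter> pp {q}" for q b
      proof (cases "q = p")
        case True
        then show ?thesis using s(2)[OF f] s(2)[OF g] q eq by simp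
      next
        case False
        then have "b \<in> pp (primes - {p})" using other_prime[OF critical_prime[OF q(1)], of "{p}"] q by blast
        then show ?thesis using f g by (simp add: Delta_at_def)
      qed
    qed
  qed
  ultimately show ?thesis by (rule finite_imageD)
qed

lemma restrict_Delta_at_self:
  assumes "f \<in> Delta_at p"
  shows "restrict_pp {p} f = f"
  using restrict_pp_eqI[of f f "{p}"] assms Delta_auto by (simp add: Delta_at_def)

lemma restrict_Delta_at_other:
  assumes p: "p \<in> critical" and q: "q \<in> critical" "q \<noteq> p" and f: "f \<in> Delta_at p"
  shows "restrict_pp {q} f = \<one>\<^bsub>AG\<^esub>"
proof (rule restrict_pp_eqI[OF _ AG_one_closed])
  show "f \<in> auto G" using f Delta_auto by (simp add: Delta_at_def)
  show "\<one>\<^bsub>AG\<^esub> x = f x" if x: "x \<in> pp {q}" for x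
  proof -
    have "x \<in> pp (primes - {p})" using other_prime[OF critical_prime[OF q(1)], of "{p}"] q(2) x by blast
    then show ?thesis using f AG_one_apply[OF pp_carrier[OF x]] by (simp add: Delta_at_def)
  qed
  show "\<one>\<^bsub>AG\<^esub> x = x" if "x \<in> pp (primes - {q})" for x using AG_one_apply[OF pp_carrier[OF that]] .
qed

text \<open>Distinct primes may give the same group \<open>Delta_at p\<close> (the trivial one), so the factors are
  indexed by the sets of constant maps with values in the primary components instead.\<close>

lemma direct_product_Delta: "direct_product_of_finite_abelian (AG\<lparr>carrier := Delta\<rparr>)"
proof -
  define key :: "nat \<Rightarrow> ('a \<Rightarrow> 'a) set" where "key p = (\<lambda>x _. x) ` pp {p}" for p
  \<comment> \<open>Distinct components meet trivially, and at a critical prime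
    \<open>pp {p}\<close> is nontrivial because it contains
    \<open>D \<inter> pp {p}\<close>.\<close>
  have key_inj: "inj_on key critical"
  proof (rule inj_onI, rule ccontr)
    fix p q assume p: "p \<in> critical" and q: "q \<in> critical" and k: "key p = key q" and ne: "p \<noteq> q"
    have "pp {p} \<subseteq> pp {q}"
    proof
      fix x assume "x \<in> pp {p}"
      then have "(\<lambda>_. x) \<in> key q" using k unfolding key_def by blast
      then obtain y where "y \<in> pp {q}" "(\<lambda>_::'a. x) = (\<lambda>_. y)" unfolding key_def by blast
      then show "x \<in> pp {q}" by (metis (no_types))
    qed
    then have "x = \<one>" if "x \<in> pp {p}" for x using pp_disjoint[OF that, of "{q}"] that ne by auto
    then have "D \<inter> pp {p} = {\<one>}"
      using subgroup.one_closed[OF D_subgroup] subgroup.one_closed[OF subgroup_pp] by blast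
    then show False using D_primary[OF p] by blast
  qed
  define I where "I = key ` critical"
  define pr where "pr = inv_into critical key"
  have pr: "pr i \<in> critical" if "i \<in> I" for i using that inv_into_into[of i key critical] by (simp add: I_def pr_def)
  have pr_key: "pr (key p) = p" if "p \<in> critical" for p using that key_inj by (simp add: pr_def)
  have key_pr: "key (pr i) = i" if "i \<in> I" for i using that by (simp add: I_def pr_def f_inv_into_f)
  define F where "F i = AG\<lparr>carrier := Delta_at (pr i)\<rparr>" for i
  have F: "comm_group (F i)" "group (F i)" if "i \<in> I" for i
  proof -
    show "comm_group (F i)"
      unfolding F_def by (rule comm_group_in_Delta[OF subgroup_Delta_at]) (auto simp: Delta_at_def)
    then show "group (F i)" by (simp add: comm_group_def)
  qed
  have cs: "carrier (sum_group I F) = {x \<in> \<Pi>\<^sub>E i\<in>I. Delta_at (pr i). finite {i \<in> I. x i \<noteq> \<one>\<^bsub>AG\<^esub>}}"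
    using carrier_sum_group[of I F] F(2) by (simp add: F_def)
  define \<Phi> where "\<Phi> \<epsilon> = (\<lambda>i\<in>I. restrict_pp {pr i} \<epsilon>)" for \<epsilon>
  have \<Phi>c: "\<Phi> \<epsilon> \<in> carrier (sum_group I F)" if e: "\<epsilon> \<in> Delta" for \<epsilon>
  proof -
    have "{i \<in> I. \<Phi> \<epsilon> i \<noteq> \<one>\<^bsub>AG\<^esub>} \<subseteq> key ` moved \<epsilon>"
    proof
      fix i assume i: "i \<in> {i \<in> I. \<Phi> \<epsilon> i \<noteq> \<one>\<^bsub>AG\<^esub>}"
      then have ip: "pr i \<in> critical" "key (pr i) = i" and ne: "restrict_pp {pr i} \<epsilon> \<noteq> \<one>\<^bsub>AG\<^esub>"
        using pr key_pr by (auto simp: \<Phi>_def)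
      have "pr i \<in> moved \<epsilon>"
      proof (rule ccontr)
        assume nm: "pr i \<notin> moved \<epsilon>"
        have "restrict_pp {pr i} \<epsilon> = \<one>\<^bsub>AG\<^esub>"
        proof (rule Delta_eqI[OF _ AG_one_closed])
          have ra: "restrict_pp {pr i} \<epsilon> \<in> Delta_at (pr i)" by (rule restrict_Delta[OF e ip(1)])
          then have rd: "restrict_pp {pr i} \<epsilon> \<in> Delta" by (simp add: Delta_at_def)
          show "restrict_pp {pr i} \<epsilon> \<in> auto G" using rd by (rule Delta_auto)
          show "restrict_pp {pr i} \<epsilon> x = \<one>\<^bsub>AG\<^esub> x" if "x \<in> D" for x
            using rd that AG_one_apply[OF D_carrier[OF that]] by (simp add: Delta_def)
          show "restrict_pp {pr i} \<epsilon> x = \<one>\<^bsub>AG\<^esub> x" if "x \<in> pp (primes - critical)" for x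
            using rd that AG_one_apply[OF pp_carrier[OF that]] by (simp add: Delta_def)
          show "restrict_pp {pr i} \<epsilon> b = \<one>\<^bsub>AG\<^esub> b" if q: "q \<in> critical" "b \<in> B \<inter> pp {q}" for q b
          proof (cases "q = pr i")
            case True
            then have "restrict_pp {pr i} \<epsilon> b = \<epsilon> b" using restrict_pp(2)[OF Delta_auto[OF e]] q by simp
            also have "\<dots> = b" using nm q True by (auto simp: moved_def)
            finally show ?thesis using AG_one_apply q B_carrier by simp
          next
            case False
            then have "b \<in> pp (primes - {pr i})"
              using other_prime[OF critical_prime[OF q(1)], of "{pr i}"] q by blast
            then show ?thesis using ra AG_one_apply q B_carrier by (simp add: Delta_at_def)
          qed
        qed
        then show False using ne by simp
      qed
      then show "i \<in> key ` moved \<epsilon>" using ip(2) by blast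
    qed
    then have "finite {i \<in> I. \<Phi> \<epsilon> i \<noteq> \<one>\<^bsub>AG\<^esub>}"
      by (rule finite_subset) (use e in \<open>simp add: Delta_def\<close>)
    moreover have "\<Phi> \<epsilon> \<in> (\<Pi>\<^sub>E i\<in>I. Delta_at (pr i))" using restrict_Delta[OF e pr] by (auto simp: \<Phi>_def)
    ultimately show ?thesis unfolding cs by simp
  qed
  \<comment> \<open>A family with finite support \<open>T\<close> is realized by multiplying its
    members one prime at a time; restricting to one prime erases the other factors.\<close>
  have surj: "\<exists>\<epsilon>\<in>Delta. (\<forall>p\<in>T. restrict_pp {p} \<epsilon> = y p) \<and> (\<forall>q\<in>critical - T. restrict_pp {q} \<epsilon> = \<one>\<^bsub>AG\<^esub>)"
    if "finite T" "T \<subseteq> critical" "\<And>p. p \<in> T \<Longrightarrow> y p \<in> Delta_at p" for T y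
    using that
  proof (induction T)
    case empty
    have "restrict_pp {q} \<one>\<^bsub>AG\<^esub> = \<one>\<^bsub>AG\<^esub>" for q
      using restrict_Delta_at_self[OF subgroup.one_closed[OF subgroup_Delta_at]] .
    then show ?case using subgroup.one_closed[OF subgroup_Delta] by blast
  next
    case (insert p T)
    then obtain \<epsilon> where e: "\<epsilon> \<in> Delta" "\<And>q. q \<in> T \<Longrightarrow> restrict_pp {q} \<epsilon> = y q"
      "\<And>q. q \<in> critical - T \<Longrightarrow> restrict_pp {q} \<epsilon> = \<one>\<^bsub>AG\<^esub>" by auto
    have pc: "p \<in> critical" and yp: "y p \<in> Delta_at p" using insert.prems by auto
    have ypD: "y p \<in> Delta" using yp by (simp add: Delta_at_def)
    have a: "y p \<in> auto G" "\<epsilon> \<in> auto G" using ypD e(1) Delta_auto by auto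
    have m: "restrict_pp {q} (y p \<otimes>\<^bsub>AG\<^esub> \<epsilon>) = restrict_pp {q} (y p) \<otimes>\<^bsub>AG\<^esub> restrict_pp {q} \<epsilon>" for q
      by (rule restrict_pp_mult[OF a])
    note mon = group.is_monoid[OF group_AG]
    have "y p \<otimes>\<^bsub>AG\<^esub> \<epsilon> \<in> Delta" using subgroup.m_closed[OF subgroup_Delta ypD e(1)] .
    moreover have "restrict_pp {q} (y p \<otimes>\<^bsub>AG\<^esub> \<epsilon>) = y q" if q: "q \<in> insert p T" for q
    proof (cases "q = p")
      case True
      then show ?thesis
        using m[of p] restrict_Delta_at_self[OF yp] e(3)[of p] pc insert.hyps(2) monoid.r_one[OF mon] a by simp
    next
      case False
      then have qT: "q \<in> T" using q by blast
      then have qc: "q \<in> critical" "y q \<in> Delta_at q" using insert.prems by auto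
      have "y q \<in> auto G" using qc(2) Delta_auto by (simp add: Delta_at_def)
      then show ?thesis
        using m[of q] restrict_Delta_at_other[OF pc qc(1) False yp] e(2)[OF qT] monoid.l_one[OF mon] by simp
    qed
    moreover have "restrict_pp {q} (y p \<otimes>\<^bsub>AG\<^esub> \<epsilon>) = \<one>\<^bsub>AG\<^esub>" if q: "q \<in> critical - insert p T" for q
      using m[of q] restrict_Delta_at_other[OF pc _ _ yp, of q] e(3)[of q] q monoid.l_one[OF mon] AG_one_closed
      by simp
    ultimately show ?case by blast
  qed
  have "\<Phi> \<in> iso (AG\<lparr>carrier := Delta\<rparr>) (sum_group I F)"
  proof (rule isoI)
    show "\<Phi> \<in> hom (AG\<lparr>carrier := Delta\<rparr>) (sum_group I F)"
    proof (rule homI)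
      show "\<Phi> \<epsilon> \<in> carrier (sum_group I F)" if "\<epsilon> \<in> carrier (AG\<lparr>carrier := Delta\<rparr>)" for \<epsilon>
        using \<Phi>c that by simp
      show "\<Phi> (\<epsilon> \<otimes>\<^bsub>AG\<lparr>carrier := Delta\<rparr>\<^esub> \<delta>) = \<Phi> \<epsilon> \<otimes>\<^bsub>sum_group I F\<^esub> \<Phi> \<delta>"
        if "\<epsilon> \<in> carrier (AG\<lparr>carrier := Delta\<rparr>)" "\<delta> \<in> carrier (AG\<lparr>carrier := Delta\<rparr>)" for \<epsilon> \<delta>
        using that restrict_pp_mult[OF Delta_auto Delta_auto] by (auto simp: \<Phi>_def F_def)
    qed
    have "inj_on \<Phi> Delta"
    proof (rule inj_onI)
      fix \<epsilon> \<delta> assume e: "\<epsilon> \<in> Delta" and d: "\<delta> \<in> Delta" and eq: "\<Phi> \<epsilon> = \<Phi> \<delta>"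
      show "\<epsilon> = \<delta>"
      proof (rule Delta_eqI[OF Delta_auto[OF e] Delta_auto[OF d]])
        show "\<epsilon> x = \<delta> x" if "x \<in> D" for x using e d that by (simp add: Delta_def)
        show "\<epsilon> x = \<delta> x" if "x \<in> pp (primes - critical)" for x using e d that by (simp add: Delta_def)
        show "\<epsilon> b = \<delta> b" if q: "q \<in> critical" "b \<in> B \<inter> pp {q}" for q b
        proof -
          have "\<Phi> \<epsilon> (key q) = \<Phi> \<delta> (key q)" using eq by simp
          then have "restrict_pp {q} \<epsilon> b = restrict_pp {q} \<delta> b"
            using q(1) pr_key by (simp add: \<Phi>_def I_def)
          then show ?thesis
            using restrict_pp(2)[OF Delta_auto[OF e]] restrict_pp(2)[OF Delta_auto[OF d]] q(2) by simp
        qed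
      qed
    qed
    moreover have "\<Phi> ` Delta = carrier (sum_group I F)"
    proof
      show "\<Phi> ` Delta \<subseteq> carrier (sum_group I F)" using \<Phi>c by blast
      show "carrier (sum_group I F) \<subseteq> \<Phi> ` Delta"
      proof
        fix x assume "x \<in> carrier (sum_group I F)"
        then have x: "x \<in> (\<Pi>\<^sub>E i\<in>I. Delta_at (pr i))" "finite {i \<in> I. x i \<noteq> \<one>\<^bsub>AG\<^esub>}"
          unfolding cs by auto
        define T where "T = pr ` {i \<in> I. x i \<noteq> \<one>\<^bsub>AG\<^esub>}"
        have T: "finite T" "T \<subseteq> critical" unfolding T_def using x(2) pr by auto
        have "x (key p) \<in> Delta_at p" if "p \<in> T" for p
        proof -
          have "p \<in> critical" using that T by blast
          then show ?thesis using x(1) pr_key[of p] by (metis I_def PiE_mem imageI)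
        qed
        then obtain \<epsilon> where e: "\<epsilon> \<in> Delta" "\<And>p. p \<in> T \<Longrightarrow> restrict_pp {p} \<epsilon> = x (key p)"
          "\<And>q. q \<in> critical - T \<Longrightarrow> restrict_pp {q} \<epsilon> = \<one>\<^bsub>AG\<^esub>"
          using surj[OF T, of "\<lambda>p. x (key p)"] by blast
        have "\<Phi> \<epsilon> i = x i" for i
        proof (cases "i \<in> I")
          case True
          show ?thesis
          proof (cases "x i = \<one>\<^bsub>AG\<^esub>")
            case x1: True
            have "pr i \<notin> T"
            proof
              assume "pr i \<in> T"
              then obtain j where j: "j \<in> I" "x j \<noteq> \<one>\<^bsub>AG\<^esub>" "pr i = pr j" by (auto simp: T_def)
              have "i = key (pr i)" using key_pr[OF True] ..
              also have "\<dots> = j" unfolding j(3) by (rule key_pr[OF j(1)])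
              finally show False using j(2) x1 by simp
            qed
            then show ?thesis using e(3)[of "pr i"] pr[OF True] True x1 by (simp add: \<Phi>_def)
          next
            case False
            then have "pr i \<in> T" using True by (auto simp: T_def)
            then show ?thesis using e(2)[of "pr i"] key_pr[OF True] True by (simp add: \<Phi>_def)
          qed
        next
          case False
          then show ?thesis using PiE_arb[OF x(1) False] by (simp add: \<Phi>_def)
        qed
        then have "\<Phi> \<epsilon> = x" by (rule ext)
        then show "x \<in> \<Phi> ` Delta" using e(1) by (metis imageI)
      qed
    qed
    ultimately show "bij_betw \<Phi> (carrier (AG\<lparr>carrier := Delta\<rparr>)) (carrier (sum_group I F))"
      by (simp add: bij_betw_def)
  qed
  then have "AG\<lparr>carrier := Delta\<rparr> \<cong> sum_group I F" by (rule is_isoI)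
  moreover have "\<forall>i\<in>I. comm_group (F i) \<and> finite (carrier (F i))"
    using F(1) finite_Delta_at pr by (simp add: F_def)
  ultimately show ?thesis unfolding direct_product_of_finite_abelian_def by blast
qed

end

section \<open>The groups \<open>\<Sigma>\<close> and \<open>\<Psi>\<close>\<close>

lemma (in group) normal_in_subgroupI:
  assumes L: "subgroup L G" and N: "subgroup N G" "N \<subseteq> L"
    and conj: "\<And>g n. g \<in> L \<Longrightarrow> n \<in> N \<Longrightarrow> g \<otimes> n \<otimes> inv g \<in> N"
  shows "N \<lhd> G\<lparr>carrier := L\<rparr>"
proof -
  interpret L: group "G\<lparr>carrier := L\<rparr>" using subgroup.subgroup_is_group[OF L is_group] .
  have "subgroup N (G\<lparr>carrier := L\<rparr>)" using subgroup_incl[OF N(1) L N(2)] .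
  moreover have "g \<otimes>\<^bsub>G\<lparr>carrier := L\<rparr>\<^esub> n \<otimes>\<^bsub>G\<lparr>carrier := L\<rparr>\<^esub> inv\<^bsub>G\<lparr>carrier := L\<rparr>\<^esub> g \<in> N" if "g \<in> L" "n \<in> N" for g n
    using conj[OF that] m_inv_consistent[OF L that(1)] by simp
  ultimately show ?thesis unfolding L.normal_inv_iff by simp
qed

lemma (in group) conj_conj:
  "g \<in> carrier G \<Longrightarrow> h \<in> carrier G \<Longrightarrow> x \<in> carrier G \<Longrightarrow>
    g \<otimes> (h \<otimes> x \<otimes> inv h) \<otimes> inv g = (g \<otimes> h) \<otimes> x \<otimes> inv (g \<otimes> h)"
  by (simp add: m_assoc inv_mult_group)

lemma (in group) quotient_cancel_right:
  assumes "a \<in> carrier G" "b \<in> carrier G" "c \<in> carrier G"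
  shows "(a \<otimes> c) \<otimes> inv (b \<otimes> c) = a \<otimes> inv b"
proof -
  have "(a \<otimes> c) \<otimes> inv (b \<otimes> c) = a \<otimes> (c \<otimes> inv c) \<otimes> inv b"
    using assms by (simp only: inv_mult_group m_assoc m_closed inv_closed)
  then show ?thesis using assms by simp
qed

context critical_setting
begin

text \<open>The product \<open>N\<close> of the orders of the finitely many displacements kills the
  image of the displacement homomorphism, and every element of \<open>D\<close> is an N-th power of
  an element of \<open>D\<close>.\<close>

lemma FAut_fixes_D:
  assumes f: "f \<in> FAut G" and x: "x \<in> D"
  shows "f x = x"
proof -
  have a: "f \<in> auto G" using f by (rule FAut_auto)
  define \<delta> where "\<delta> x = f x \<otimes> inv x" for x
  have h: "\<delta> \<in> hom G G"
    unfolding \<delta>_def[abs_def] by (rule hom_quotient[OF autoD(1)[OF a]]) (simp add: hom_def)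
  define T where "T = \<delta> ` carrier G"
  have T: "finite T" "T \<subseteq> carrier G"
    unfolding T_def using FAutD(2)[OF f] endo_closed[OF h] by (auto simp: \<delta>_def[abs_def])
  define N where "N = (\<Prod>t\<in>T. ord t)"
  have "N > 0" unfolding N_def using ord_pos T(2) by (intro prod_pos) blast
  then obtain y where y: "y \<in> D" "y [^] N = x" using D_divisible x by blast
  have yc: "y \<in> carrier G" using y D_carrier by blast
  have "\<delta> y \<in> T" unfolding T_def using yc by blast
  then have "ord (\<delta> y) dvd N" unfolding N_def using T(1) by (rule dvd_prodI[rotated])
  then have "\<delta> x = \<one>"
    using y endo_nat_pow[OF h yc, of N] pow_eq_id[OF endo_closed[OF h yc]] by simp
  then show ?thesis
    using eq_iff_quotient[OF auto_closed[OF a D_carrier[OF x]] D_carrier[OF x]] by (simp add: \<delta>_def)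
qed

lemma FD_auto: "f \<in> FD \<Longrightarrow> f \<in> auto G"
  using subgroup.mem_carrier[OF subgroup_FD] by simp

lemma FD_split:
  assumes "f \<in> FD"
  obtains \<phi> \<epsilon> where "\<phi> \<in> FAut G" "\<epsilon> \<in> Delta" "f = \<phi> \<otimes>\<^bsub>AG\<^esub> \<epsilon>"
  using assms unfolding FD_def set_mult_def by blast

lemma FD_fixes_D:
  assumes f: "f \<in> FD" and x: "x \<in> D"
  shows "f x = x"
proof -
  obtain \<phi> \<epsilon> where s: "\<phi> \<in> FAut G" "\<epsilon> \<in> Delta" "f = \<phi> \<otimes>\<^bsub>AG\<^esub> \<epsilon>" using FD_split[OF f] by blast
  have "\<epsilon> x = x" using s(2) x by (simp add: Delta_def)
  then show ?thesis
    unfolding s(3) using AG_mult_apply[OF FAut_auto[OF s(1)] Delta_auto[OF s(2)] D_carrier[OF x]]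
      FAut_fixes_D[OF s(1) x] by simp
qed

abbreviation noncrit :: "nat set" where "noncrit \<equiv> primes - critical"

lemma critical_eq: "primes - noncrit = critical"
  using critical_prime by (auto simp: primes_def)

text \<open>Since finitary maps fix \<open>D\<close>, the displacement of such an element vanishes
  on \<open>D\<close> and on the noncritical components; it amounts to a homomorphism of finite
  image from the critical part of \<open>B\<close> into \<open>D\<close>.\<close>

definition Sig :: "('a \<Rightarrow> 'a) set" where
  "Sig = {\<sigma> \<in> FAut G. (\<forall>x\<in>pp noncrit. \<sigma> x = x) \<and> (\<forall>x\<in>carrier G. \<sigma> x \<otimes> inv x \<in> D)}"

definition Psi :: "('a \<Rightarrow> 'a) set" where
  "Psi = {\<psi> \<in> FD. (\<forall>x\<in>pp noncrit. \<psi> x = x) \<and> (\<forall>b\<in>B. \<psi> b \<in> B)}"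

text \<open>An intrinsic description of the semidirect factor, the product of \<open>Sig\<close> and
  \<open>Psi\<close>; see \<open>FD_crit_eq\<close>.\<close>

definition FD_crit :: "('a \<Rightarrow> 'a) set" where
  "FD_crit = {f \<in> FD. \<forall>x\<in>pp noncrit. f x = x}"

text \<open>The group FAut of the noncritical part, embedded by the identity on the critical part;
  see \<open>FAut_part_noncrit\<close>.\<close>

definition FAut_noncrit :: "('a \<Rightarrow> 'a) set" where
  "FAut_noncrit = {f \<in> FAut G. \<forall>x\<in>pp critical. f x = x}"

definition \<theta> :: "('a \<Rightarrow> 'a) \<Rightarrow> 'a \<Rightarrow> 'a" where
  "\<theta> \<sigma> x = \<sigma> x \<otimes> inv x"

lemma Sigma_FAut: "\<sigma> \<in> Sig \<Longrightarrow> \<sigma> \<in> FAut G" and Sigma_auto: "\<sigma> \<in> Sig \<Longrightarrow> \<sigma> \<in> auto G"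
  by (auto simp: Sig_def FAut_auto)

lemma \<theta>_hom: "\<sigma> \<in> auto G \<Longrightarrow> \<theta> \<sigma> \<in> hom G G"
  unfolding \<theta>_def[abs_def] by (rule hom_quotient[OF autoD(1)]) (assumption, simp add: hom_def)

lemma \<theta>_D: "\<sigma> \<in> Sig \<Longrightarrow> x \<in> carrier G \<Longrightarrow> \<theta> \<sigma> x \<in> D"
  by (simp add: Sig_def \<theta>_def)

lemma \<theta>_of_D: "\<sigma> \<in> Sig \<Longrightarrow> x \<in> D \<Longrightarrow> \<theta> \<sigma> x = \<one>"
  using FAut_fixes_D[OF Sigma_FAut, of \<sigma> x] D_carrier[of x] by (simp add: \<theta>_def)

lemma \<theta>_apply: "\<sigma> \<in> auto G \<Longrightarrow> x \<in> carrier G \<Longrightarrow> \<sigma> x = x \<otimes> \<theta> \<sigma> x"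
  unfolding \<theta>_def using auto_closed[of \<sigma> x] inv_cancel1[of x "\<sigma> x"] by (simp add: m_comm)

lemma \<theta>_finite: "\<sigma> \<in> Sig \<Longrightarrow> finite (\<theta> \<sigma> ` carrier G)"
  using FAutD(2)[OF Sigma_FAut] by (simp add: \<theta>_def[abs_def])

text \<open>Elements of \<open>FD\<close> fix \<open>D\<close>, which contains the values of
  \<open>\<theta> \<sigma>\<close>; so conjugation affects only the argument.\<close>

lemma Sigma_conj:
  assumes s: "\<sigma> \<in> Sig" and g: "g \<in> FD"
  shows "g \<otimes>\<^bsub>AG\<^esub> \<sigma> \<otimes>\<^bsub>AG\<^esub> inv\<^bsub>AG\<^esub> g \<in> Sig"
    and "x \<in> carrier G \<Longrightarrow> (g \<otimes>\<^bsub>AG\<^esub> \<sigma> \<otimes>\<^bsub>AG\<^esub> inv\<^bsub>AG\<^esub> g) x = x \<otimes> \<theta> \<sigma> ((inv\<^bsub>AG\<^esub> g) x)"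
proof -
  have sa: "\<sigma> \<in> auto G" using s by (rule Sigma_auto)
  have ga: "g \<in> auto G" using g by (rule FD_auto)
  have gh: "g \<in> hom G G" using ga by (rule autoD)
  let ?c = "g \<otimes>\<^bsub>AG\<^esub> \<sigma> \<otimes>\<^bsub>AG\<^esub> inv\<^bsub>AG\<^esub> g"
  have app: "?c x = x \<otimes> \<theta> \<sigma> ((inv\<^bsub>AG\<^esub> g) x)" if x: "x \<in> carrier G" for x
  proof -
    define y where "y = (inv\<^bsub>AG\<^esub> g) x"
    have y: "y \<in> carrier G" "g y = x"
      unfolding y_def using x ga by (simp_all add: AG_inv_right auto_closed AG_inv_closed)
    have "?c x = g (y \<otimes> \<theta> \<sigma> y)" using AG_conj_apply[OF sa ga x] \<theta>_apply[OF sa y(1)] by (simp add: y_def)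
    also have "\<dots> = x \<otimes> \<theta> \<sigma> y"
      using endo_mult[OF gh y(1) D_carrier[OF \<theta>_D[OF s y(1)]]] FD_fixes_D[OF g \<theta>_D[OF s y(1)]] y by simp
    finally show ?thesis by (simp add: y_def)
  qed
  show "x \<in> carrier G \<Longrightarrow> ?c x = x \<otimes> \<theta> \<sigma> ((inv\<^bsub>AG\<^esub> g) x)" using app .
  have "?c x = x" if x: "x \<in> pp noncrit" for x
  proof -
    have xc: "x \<in> carrier G" using x pp_carrier by blast
    have ig: "(inv\<^bsub>AG\<^esub> g) x \<in> pp noncrit" using pp_endo[OF autoD(1)[OF AG_inv_closed[OF ga]] x] .
    have "\<theta> \<sigma> ((inv\<^bsub>AG\<^esub> g) x) = \<one>" using s ig pp_carrier by (simp add: Sig_def \<theta>_def)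
    then show ?thesis using app[OF xc] xc by simp
  qed
  moreover have "?c x \<otimes> inv x \<in> D" if x: "x \<in> carrier G" for x
  proof -
    have "\<theta> \<sigma> ((inv\<^bsub>AG\<^esub> g) x) \<in> D" using \<theta>_D[OF s] auto_closed[OF AG_inv_closed[OF ga] x] by blast
    moreover from this have "?c x \<otimes> inv x = \<theta> \<sigma> ((inv\<^bsub>AG\<^esub> g) x)"
      unfolding app[OF x] using x D_carrier[of "\<theta> \<sigma> ((inv\<^bsub>AG\<^esub> g) x)"] by (metis inv_cancel2 inv_closed m_assoc m_closed m_comm)
    ultimately show ?thesis by simp
  qed
  ultimately show "?c \<in> Sig" using FAut_conj[OF Sigma_FAut[OF s] ga] by (simp add: Sig_def)
qed

lemma subgroup_Sigma: "subgroup Sig AG"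
proof (rule AG_subgroupI)
  show "Sig \<subseteq> auto G" using Sigma_auto by blast
  show "\<one>\<^bsub>AG\<^esub> \<in> Sig"
    using subgroup.one_closed[OF subgroup_FAut] subgroup.one_closed[OF D_subgroup] AG_one_apply pp_carrier
    by (simp add: Sig_def)
next
  fix f assume f: "f \<in> Sig"
  have a: "f \<in> auto G" using f by (rule Sigma_auto)
  have "(inv\<^bsub>AG\<^esub> f) x \<otimes> inv x \<in> D" if x: "x \<in> carrier G" for x
  proof -
    define y where "y = (inv\<^bsub>AG\<^esub> f) x"
    have y: "y \<in> carrier G" "f y = x"
      unfolding y_def using x a by (simp_all add: AG_inv_right auto_closed AG_inv_closed)
    have "y \<otimes> inv x = inv (\<theta> f y)"
      unfolding \<theta>_def using x y by (simp add: inv_mult m_comm)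
    then show ?thesis using subgroup.m_inv_closed[OF D_subgroup \<theta>_D[OF f y(1)]] by (simp add: y_def)
  qed
  then show "inv\<^bsub>AG\<^esub> f \<in> Sig"
    using f subgroup.m_inv_closed[OF subgroup_FAut] AG_inv_fixes[OF a] pp_carrier by (simp add: Sig_def)
next
  fix f g assume f: "f \<in> Sig" and g: "g \<in> Sig"
  have a: "f \<in> auto G" "g \<in> auto G" using f g by (auto intro: Sigma_auto)
  have "(f \<otimes>\<^bsub>AG\<^esub> g) x \<otimes> inv x \<in> D" if x: "x \<in> carrier G" for x
  proof -
    have gx: "g x \<in> carrier G" "f (g x) \<in> carrier G" using auto_closed[OF a(2) x] auto_closed[OF a(1)] by auto
    have "f (g x) \<otimes> inv x = \<theta> f (g x) \<otimes> \<theta> g x"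
      unfolding \<theta>_def using gx x by algebra
    then show ?thesis
      using AG_mult_apply[OF a x] subgroup.m_closed[OF D_subgroup \<theta>_D[OF f gx(1)] \<theta>_D[OF g x]] by simp
  qed
  then show "f \<otimes>\<^bsub>AG\<^esub> g \<in> Sig"
    using f g subgroup.m_closed[OF subgroup_FAut] AG_mult_apply[OF a] pp_carrier by (simp add: Sig_def)
qed

lemma \<theta>_compose: "f \<in> Sig \<Longrightarrow> x \<in> carrier G \<Longrightarrow> y \<in> D \<Longrightarrow> \<theta> f (x \<otimes> y) = \<theta> f x"
  using \<theta>_of_D[of f y] D_carrier[of y] D_carrier[OF \<theta>_D[of f x]]
  by (simp add: endo_mult[OF \<theta>_hom[OF Sigma_auto]])

text \<open>\<open>\<theta> f\<close> kills the values of \<open>\<theta> g\<close>, as these lie in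
  \<open>D\<close>; so composition becomes multiplication of the homomorphisms, whence
  \<open>Sig\<close> is abelian and its powers can be computed pointwise.\<close>

lemma Sigma_mult_apply:
  assumes f: "f \<in> Sig" and g: "g \<in> Sig" and x: "x \<in> carrier G"
  shows "(f \<otimes>\<^bsub>AG\<^esub> g) x = x \<otimes> (\<theta> f x \<otimes> \<theta> g x)"
proof -
  have a: "f \<in> auto G" "g \<in> auto G" using f g by (auto intro: Sigma_auto)
  have tc: "\<theta> f x \<in> carrier G" "\<theta> g x \<in> carrier G" using \<theta>_D f g x D_carrier by auto
  have gx: "g x = x \<otimes> \<theta> g x" using \<theta>_apply[OF a(2) x] .
  have "\<theta> f (g x) = \<theta> f x" unfolding gx by (rule \<theta>_compose[OF f x \<theta>_D[OF g x]])
  then have "f (g x) = (x \<otimes> \<theta> g x) \<otimes> \<theta> f x"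
    using \<theta>_apply[OF a(1) auto_closed[OF a(2) x]] gx by simp
  then show ?thesis using AG_mult_apply[OF a x] x tc by (simp add: m_ac)
qed

abbreviation SG :: "('a \<Rightarrow> 'a) monoid" where
  "SG \<equiv> AG\<lparr>carrier := Sig\<rparr>"

lemma comm_group_SG: "comm_group SG"
proof (rule group.group_comm_groupI[OF subgroup.subgroup_is_group[OF subgroup_Sigma group_AG]])
  fix f g assume "f \<in> carrier SG" "g \<in> carrier SG"
  then have f: "f \<in> Sig" and g: "g \<in> Sig" by auto
  have a: "f \<in> auto G" "g \<in> auto G" using f g by (auto intro: Sigma_auto)
  have "f \<otimes>\<^bsub>AG\<^esub> g = g \<otimes>\<^bsub>AG\<^esub> f"
  proof (rule AG_eqI)
    show "f \<otimes>\<^bsub>AG\<^esub> g \<in> auto G" "g \<otimes>\<^bsub>AG\<^esub> f \<in> auto G" using a by (auto intro: AG_mult_closed)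
    show "(f \<otimes>\<^bsub>AG\<^esub> g) x = (g \<otimes>\<^bsub>AG\<^esub> f) x" if x: "x \<in> carrier G" for x
      using Sigma_mult_apply[OF f g x] Sigma_mult_apply[OF g f x] D_carrier[OF \<theta>_D[OF f x]]
        D_carrier[OF \<theta>_D[OF g x]] by (simp add: m_comm)
  qed
  then show "f \<otimes>\<^bsub>SG\<^esub> g = g \<otimes>\<^bsub>SG\<^esub> f" by simp
qed

lemma SG_one_iff: "f \<in> Sig \<Longrightarrow> f = \<one>\<^bsub>SG\<^esub> \<longleftrightarrow> (\<forall>x\<in>carrier G. \<theta> f x = \<one>)"
proof
  assume f: "f \<in> Sig"
  show "\<forall>x\<in>carrier G. \<theta> f x = \<one>" if "f = \<one>\<^bsub>SG\<^esub>" using that AG_one_apply by (simp add: \<theta>_def)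
  show "f = \<one>\<^bsub>SG\<^esub>" if "\<forall>x\<in>carrier G. \<theta> f x = \<one>"
  proof -
    have "f = \<one>\<^bsub>AG\<^esub>"
      using that \<theta>_apply[OF Sigma_auto[OF f]] AG_one_apply
      by (intro AG_eqI[OF Sigma_auto[OF f] AG_one_closed]) simp
    then show ?thesis by simp
  qed
qed

lemma SG_nat_pow:
  assumes f: "f \<in> Sig"
  shows "f [^]\<^bsub>SG\<^esub> (n::nat) \<in> Sig \<and> (\<forall>x\<in>carrier G. \<theta> (f [^]\<^bsub>SG\<^esub> n) x = \<theta> f x [^] n)"
proof (induction n)
  case 0
  then show ?case using subgroup.one_closed[OF subgroup_Sigma] AG_one_apply by (simp add: \<theta>_def)
next
  case (Suc n)
  let ?g = "f [^]\<^bsub>SG\<^esub> n"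
  have g: "?g \<in> Sig" using Suc by blast
  have eq: "f [^]\<^bsub>SG\<^esub> Suc n = ?g \<otimes>\<^bsub>AG\<^esub> f" by simp
  have "\<theta> (?g \<otimes>\<^bsub>AG\<^esub> f) x = \<theta> f x [^] Suc n" if x: "x \<in> carrier G" for x
  proof -
    have tc: "\<theta> f x \<in> carrier G" using \<theta>_D[OF f x] D_carrier by blast
    have "\<theta> (?g \<otimes>\<^bsub>AG\<^esub> f) x = x \<otimes> (\<theta> f x [^] n \<otimes> \<theta> f x) \<otimes> inv x"
      unfolding \<theta>_def[of "?g \<otimes>\<^bsub>AG\<^esub> f"] Sigma_mult_apply[OF g f x] using Suc x by simp
    also have "\<dots> = \<theta> f x [^] n \<otimes> \<theta> f x"
      using x tc nat_pow_closed[OF tc, of n] by algebra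
    finally show ?thesis by simp
  qed
  then show ?case unfolding eq using subgroup.m_closed[OF subgroup_Sigma g f] by blast
qed

lemma SG_int_pow:
  assumes f: "f \<in> Sig" and x: "x \<in> carrier G"
  shows "f [^]\<^bsub>SG\<^esub> (k::int) \<in> Sig" "\<theta> (f [^]\<^bsub>SG\<^esub> k) x = \<theta> f x [^] k"
proof -
  interpret S: comm_group SG by (rule comm_group_SG)
  have tc: "\<theta> f x \<in> carrier G" using \<theta>_D[OF f x] D_carrier by blast
  show c: "f [^]\<^bsub>SG\<^esub> k \<in> Sig" using S.int_pow_closed[of f k] f by simp
  show "\<theta> (f [^]\<^bsub>SG\<^esub> k) x = \<theta> f x [^] k"
  proof (cases k rule: int_cases2)
    case (nonneg n)
    then show ?thesis using SG_nat_pow[OF f, of n] x by (simp add: int_pow_int)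
  next
    case (nonpos n)
    let ?g = "f [^]\<^bsub>SG\<^esub> n" and ?h = "f [^]\<^bsub>SG\<^esub> k"
    have g: "?g \<in> Sig" "\<theta> ?g x = \<theta> f x [^] n" using SG_nat_pow[OF f, of n] x by auto
    have "?h \<otimes>\<^bsub>SG\<^esub> ?g = \<one>\<^bsub>SG\<^esub>"
      using S.int_pow_mult[of f k "int n"] f nonpos by (simp add: int_pow_int)
    then have "(?h \<otimes>\<^bsub>AG\<^esub> ?g) x = x" using AG_one_apply[OF x] by simp
    then have "x \<otimes> (\<theta> ?h x \<otimes> \<theta> ?g x) = x" using Sigma_mult_apply[OF c g(1) x] by simp
    then have "\<theta> ?h x \<otimes> \<theta> ?g x = \<one>"
      using x D_carrier[OF \<theta>_D[OF c x]] D_carrier[OF \<theta>_D[OF g(1) x]] by simp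
    then have "\<theta> ?h x = inv (\<theta> f x [^] n)"
      using inv_equality[of "\<theta> ?h x" "\<theta> ?g x"] D_carrier[OF \<theta>_D[OF c x]] D_carrier[OF \<theta>_D[OF g(1) x]] g(2)
      by simp
    then show ?thesis using nonpos tc by (simp add: int_pow_neg int_pow_int)
  qed
qed

lemma Sigma_exponent:
  assumes f: "f \<in> Sig"
  obtains N :: nat where "N > 0" "f [^]\<^bsub>SG\<^esub> N = \<one>\<^bsub>SG\<^esub>" "\<And>p. prime p \<Longrightarrow> p dvd N \<Longrightarrow> p \<in> critical"
proof -
  define T where "T = \<theta> f ` carrier G"
  have T: "finite T" "T \<subseteq> D" unfolding T_def using \<theta>_finite[OF f] \<theta>_D[OF f] by auto
  define N where "N = (\<Prod>t\<in>T. ord t)"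
  have "N > 0" unfolding N_def using ord_pos T(2) D_carrier by (intro prod_pos) blast
  moreover have "f [^]\<^bsub>SG\<^esub> N = \<one>\<^bsub>SG\<^esub>"
  proof -
    have "\<theta> f x [^] N = \<one>" if x: "x \<in> carrier G" for x
    proof -
      have t: "\<theta> f x \<in> T" unfolding T_def using x by blast
      then have "ord (\<theta> f x) dvd N" unfolding N_def using T(1) by (rule dvd_prodI[rotated])
      then show ?thesis using pow_eq_id T(2) D_carrier t by blast
    qed
    then show ?thesis using SG_nat_pow[OF f, of N] SG_one_iff by simp
  qed
  moreover have "p \<in> critical" if p: "prime p" "p dvd N" for p
  proof -
    obtain t where "t \<in> T" "p dvd ord t"
      using p T(1) unfolding N_def by (auto simp: prime_dvd_prod_iff)
    then show ?thesis using T(2) D_pp p(1) by (auto simp: mem_pp_iff)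
  qed
  ultimately show thesis using that by blast
qed

lemma periodic_SG: "periodic_comm_group SG"
proof -
  interpret S: comm_group SG by (rule comm_group_SG)
  have "S.ord f \<noteq> 0" if f: "f \<in> Sig" for f
  proof -
    obtain N :: nat where N: "N > 0" "f [^]\<^bsub>SG\<^esub> N = \<one>\<^bsub>SG\<^esub>" using Sigma_exponent[OF f] by metis
    then show ?thesis using S.ord_eq_0[of f] f by auto
  qed
  then show ?thesis by unfold_locales (simp add: periodic_def)
qed

lemma pi_group_SG: "pi_group critical SG"
proof -
  interpret S: periodic_comm_group SG by (rule periodic_SG)
  have "p \<in> critical" if f: "f \<in> Sig" and p: "prime p" "p dvd S.ord f" for f p
  proof -
    obtain N :: nat where N: "f [^]\<^bsub>SG\<^esub> N = \<one>\<^bsub>SG\<^esub>" "\<And>p. prime p \<Longrightarrow> p dvd N \<Longrightarrow> p \<in> critical"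
      using Sigma_exponent[OF f] by metis
    have "S.ord f dvd N" using N(1) S.pow_eq_id[of f N] f by simp
    then show ?thesis using N(2) p dvd_trans by blast
  qed
  then show ?thesis using S.ord_pos by (simp add: pi_group_def)
qed

lemma SG_primary_values:
  assumes f: "f \<in> pi_part SG {p}" and x: "x \<in> carrier G"
  shows "f \<in> Sig" "\<theta> f x \<in> pp {p}"
proof -
  interpret S: periodic_comm_group SG by (rule periodic_SG)
  show fs: "f \<in> Sig" using S.pp_carrier[OF f] by simp
  have "f [^]\<^bsub>SG\<^esub> S.ord f = \<one>\<^bsub>SG\<^esub>" using S.pow_ord_eq_1[of f] fs by simp
  then have "\<theta> f x [^] S.ord f = \<one>"
    using SG_nat_pow[OF fs, of "S.ord f"] SG_one_iff x by (metis)
  then show "\<theta> f x \<in> pp {p}"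
    using pp_of_pow[OF D_carrier[OF \<theta>_D[OF fs x]]] f by (auto simp: S.mem_pp_iff)
qed

text \<open>On the p-component the \<open>D\<close>-part contributes nothing and agreement on
  \<open>B\<close> is assumed. On a q-component with \<open>q \<noteq> p\<close> both maps vanish,
  since their values are at once p- and q-primary.\<close>

lemma SG_primary_eqI:
  assumes f: "f \<in> pi_part SG {p}" and g: "\<theta>' \<in> hom G G" "\<And>x. x \<in> carrier G \<Longrightarrow> \<theta>' x \<in> pp {p}"
    "\<And>x. x \<in> D \<Longrightarrow> \<theta>' x = \<one>"
    and h: "h \<in> hom G G" "\<And>x. x \<in> carrier G \<Longrightarrow> h x \<in> pp {p}" "\<And>x. x \<in> D \<Longrightarrow> h x = \<one>"
    and p: "prime p" and B: "\<And>b. b \<in> B \<inter> pp {p} \<Longrightarrow> \<theta>' b = h b" and x: "x \<in> carrier G"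
  shows "\<theta>' x = h x"
proof (rule hom_eq_primary[OF g(1) h(1) _ x])
  fix q x assume q: "prime (q::nat)" and x: "x \<in> pp {q}"
  have xc: "x \<in> carrier G" using x pp_carrier by blast
  show "\<theta>' x = h x"
  proof (cases "q = p")
    case True
    have "eB x \<in> B \<inter> pp {p}" using eB[OF xc] eB_pp[OF x] True by blast
    then have "\<theta>' (eD x \<otimes> eB x) = h (eD x \<otimes> eB x)"
      using B g h eD[OF xc] eB[OF xc] by (simp add: endo_mult D_carrier B_carrier)
    then show ?thesis using eDB[OF xc] by simp
  next
    case False
    have "\<theta>' x = \<one>" "h x = \<one>"
      using pp_disjoint[OF g(2)[OF xc] pp_endo[OF g(1) x]] pp_disjoint[OF h(2)[OF xc] pp_endo[OF h(1) x]] False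
      by auto
    then show ?thesis by simp
  qed
qed

text \<open>At a critical prime an exponent of \<open>B \<inter> pp {p}\<close> kills
  \<open>\<theta> f\<close> there and hence, by \<open>SG_primary_eqI\<close>, everywhere. At
  another prime the values of \<open>\<theta> f\<close> lie in the trivial group
  \<open>D \<inter> pp {p}\<close>.\<close>

lemma bounded_SG: "bounded_primary_components SG"
  unfolding bounded_primary_components_def
proof
  fix p assume p: "p \<in> primes"
  interpret S: periodic_comm_group SG by (rule periodic_SG)
  have pr: "prime p" using p by (simp add: primes_def)
  have "\<exists>n::nat. n > 0 \<and> (\<forall>f\<in>pi_part SG {p}. f [^]\<^bsub>SG\<^esub> n = \<one>\<^bsub>SG\<^esub>)"
  proof (cases "p \<in> critical")
    case True
    obtain m where m: "\<And>b. b \<in> B \<inter> pp {p} \<Longrightarrow> b [^] (p ^ m) = \<one>" using B_bounded[OF True] by blast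
    have "f [^]\<^bsub>SG\<^esub> (p ^ m) = \<one>\<^bsub>SG\<^esub>" if f: "f \<in> pi_part SG {p}" for f
    proof -
      have fs: "f \<in> Sig" using S.pp_carrier[OF f] by simp
      have th: "\<theta> f \<in> hom G G" by (rule \<theta>_hom[OF Sigma_auto[OF fs]])
      have "\<theta> f x [^] (p ^ m) = \<one>" if x: "x \<in> carrier G" for x
      proof (rule SG_primary_eqI[OF f, where h = "\<lambda>_. \<one>" and \<theta>' = "\<lambda>x. \<theta> f x [^] (p ^ m)"])
        show "(\<lambda>x. \<theta> f x [^] (p ^ m)) \<in> hom G G" by (rule endo_comp[OF hom_nat_power th])
        show "\<theta> f x [^] (p ^ m) \<in> pp {p}" if "x \<in> carrier G" for x
          using nat_pow_mem[OF subgroup_pp SG_primary_values(2)[OF f that]] .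
        show "\<theta> f x [^] (p ^ m) = \<one>" if "x \<in> D" for x using \<theta>_of_D[OF fs that] by simp
        show "\<theta> f b [^] (p ^ m) = \<one>" if "b \<in> B \<inter> pp {p}" for b
          using m[OF that] endo_nat_pow[OF th, of b "p ^ m"] endo_one[OF th] B_carrier that by simp
      qed (use pr x subgroup.one_closed[OF subgroup_pp] in \<open>auto simp: hom_def\<close>)
      then show ?thesis using SG_nat_pow[OF fs, of "p ^ m"] SG_one_iff by simp
    qed
    moreover have "p ^ m > 0" using pr by (simp add: prime_gt_0_nat)
    ultimately show ?thesis by blast
  next
    case False
    have "f [^]\<^bsub>SG\<^esub> (1::nat) = \<one>\<^bsub>SG\<^esub>" if f: "f \<in> pi_part SG {p}" for f
    proof -
      have fs: "f \<in> Sig" using S.pp_carrier[OF f] by simp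
      have "\<theta> f x = \<one>" if x: "x \<in> carrier G" for x
        using pp_disjoint[OF SG_primary_values(2)[OF f x], of critical] \<theta>_D[OF fs x] D_pp False by blast
      then have "f = \<one>\<^bsub>SG\<^esub>" using SG_one_iff[OF fs] by blast
      then show ?thesis using S.nat_pow_one by blast
    qed
    then show ?thesis by (intro exI[of _ 1]) blast
  qed
  then show "bounded_group (SG\<lparr>carrier := pi_part SG {p}\<rparr>)"
    unfolding bounded_group_def by (simp flip: monoid.nat_pow_consistent[OF group.is_monoid[OF group_AG]])
qed

section \<open>The group \<Psi> and the factorization of the product of \<open>FAut\<close> and
  \<Delta>\<close>

lemma Delta_preserves_B:
  assumes e: "\<epsilon> \<in> Delta" and b: "b \<in> B"
  shows "\<epsilon> b \<in> B"
proof -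
  have "b \<in> B \<longrightarrow> \<epsilon> b \<in> B" using B_carrier[OF b]
  proof (induction b rule: primary_induct)
    case (primary p x)
    show ?case
    proof (cases "p \<in> critical")
      case True
      then show ?thesis using Delta_B[OF e True] primary by blast
    next
      case False
      then have "\<epsilon> x = x" using other_prime[OF primary(1) False] primary(2) e by (auto simp: Delta_def)
      then show ?thesis by simp
    qed
  next
    case (split x k)
    show ?case
    proof
      assume x: "x \<in> B"
      then have "\<epsilon> (x [^] k) \<otimes> \<epsilon> (x [^] (1 - k)) \<in> B"
        using split subgroup_int_pow_closed[OF B_subgroup x] by (intro subgroup.m_closed[OF B_subgroup]) auto
      moreover have "\<epsilon> (x [^] k) \<otimes> \<epsilon> (x [^] (1 - k)) = \<epsilon> x"
        using split(1) autoD(1)[OF Delta_auto[OF e]] by (simp flip: endo_mult int_pow_mult)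
      ultimately show "\<epsilon> x \<in> B" by simp
    qed
  qed
  then show ?thesis using b by blast
qed

lemma Delta_subset_Psi: "Delta \<subseteq> Psi"
  using Delta_subset_FD Delta_preserves_B by (auto simp: Psi_def Delta_def)

lemma subgroup_Psi: "subgroup Psi AG"
proof (rule AG_subgroupI)
  show "Psi \<subseteq> auto G" using FD_auto by (auto simp: Psi_def)
  show "\<one>\<^bsub>AG\<^esub> \<in> Psi" using subgroup.one_closed[OF subgroup_Delta] Delta_subset_Psi by blast
next
  fix f assume f: "f \<in> Psi"
  then have fd: "f \<in> FD" and a: "f \<in> auto G" using FD_auto by (auto simp: Psi_def)
  have "(inv\<^bsub>AG\<^esub> f) x \<in> B" if x: "x \<in> B" for x
  proof -
    define y where "y = (inv\<^bsub>AG\<^esub> f) x"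
    have y: "y \<in> carrier G" "f y = x"
      unfolding y_def using B_carrier[OF x] a by (simp_all add: AG_inv_right auto_closed AG_inv_closed)
    have c: "eD y \<in> carrier G" "eB y \<in> carrier G" "f (eB y) \<in> carrier G"
      using eD[OF y(1)] eB[OF y(1)] D_carrier B_carrier auto_closed[OF a] by auto
    have fb: "f (eB y) \<in> B" using f eB[OF y(1)] by (simp add: Psi_def)
    \<comment> \<open>As \<open>f\<close> fixes \<open>D\<close> and maps \<open>B\<close> into
      itself, \<open>y\<close> and \<open>x = f y\<close> have the same \<open>D\<close>-part, and
      that of \<open>x\<close> is trivial.\<close>
    have "x = f (eD y \<otimes> eB y)" using y eDB[OF y(1)] by simp
    then have xe: "x = eD y \<otimes> f (eB y)"
      using endo_mult[OF autoD(1)[OF a] c(1,2)] FD_fixes_D[OF fd eD[OF y(1)]] by simp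
    have "eD y = proj D B x" unfolding xe using proj_eq[OF compl eD[OF y(1)] fb] by simp
    also have "\<dots> = \<one>" using proj_on_right[OF compl x] .
    finally have "y = eB y" using eDB[OF y(1)] c by simp
    then show ?thesis using eB[OF y(1)] by (simp add: y_def)
  qed
  then show "inv\<^bsub>AG\<^esub> f \<in> Psi"
    using f subgroup.m_inv_closed[OF subgroup_FD] AG_inv_fixes[OF a] pp_carrier by (simp add: Psi_def)
next
  fix f g assume f: "f \<in> Psi" and g: "g \<in> Psi"
  then have a: "f \<in> auto G" "g \<in> auto G" using FD_auto by (auto simp: Psi_def)
  show "f \<otimes>\<^bsub>AG\<^esub> g \<in> Psi"
    using f g subgroup.m_closed[OF subgroup_FD] AG_mult_apply[OF a] pp_carrier B_carrier by (simp add: Psi_def)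
qed

lemma subgroup_FD_crit: "subgroup FD_crit AG"
  unfolding FD_crit_def by (rule AG_subgroup_fixing[OF subgroup_FD subgroup.subset[OF subgroup_pp]])

lemma subgroup_FAut_noncrit: "subgroup FAut_noncrit AG"
  unfolding FAut_noncrit_def by (rule AG_subgroup_fixing[OF subgroup_FAut subgroup.subset[OF subgroup_pp]])

lemma conj_fixes_pp:
  assumes f: "f \<in> auto G" and g: "g \<in> auto G" and fixed: "\<And>x. x \<in> pp \<pi> \<Longrightarrow> f x = x" and x: "x \<in> pp \<pi>"
  shows "(g \<otimes>\<^bsub>AG\<^esub> f \<otimes>\<^bsub>AG\<^esub> inv\<^bsub>AG\<^esub> g) x = x"
  using AG_conj_apply[OF f g pp_carrier[OF x]] fixed[OF pp_endo[OF autoD(1)[OF AG_inv_closed[OF g]] x]]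
    AG_inv_right[OF g pp_carrier[OF x]] by simp

lemma Sigma_subset: "Sig \<subseteq> FD_crit" and Psi_subset: "Psi \<subseteq> FD_crit"
  and FAut_noncrit_subset: "FAut_noncrit \<subseteq> FD" and FD_crit_subset: "FD_crit \<subseteq> FD"
  using FAut_subset_FD by (auto simp: Sig_def Psi_def FD_crit_def FAut_noncrit_def)

text \<open>\<phi> fixes \<open>D\<close> pointwise and so acts on the quotient by \<open>D\<close>,
  which is isomorphic to \<open>B\<close>. This action, extended by the identity on
  \<open>D\<close>, is \<rho>; its displacements are the \<open>B\<close>-parts of displacements of
  \<phi>.\<close>

lemma FAut_B_part:
  assumes f: "\<phi> \<in> FAut G"
  obtains \<rho> where "\<rho> \<in> FAut G" "\<And>x. x \<in> D \<Longrightarrow> \<rho> x = x" "\<And>b. b \<in> B \<Longrightarrow> \<rho> b = eB (\<phi> b)"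
proof -
  have a: "\<phi> \<in> auto G" using f by (rule FAut_auto)
  have h: "\<phi> \<in> hom G G" using a by (rule autoD)
  have ifa: "inv\<^bsub>AG\<^esub> \<phi> \<in> FAut G" using subgroup.m_inv_closed[OF subgroup_FAut f] .
  have ih: "inv\<^bsub>AG\<^esub> \<phi> \<in> hom G G" using FAut_auto[OF ifa] by (rule autoD)
  \<comment> \<open>This says that \<open>g\<close> induces a map on the quotient by
    \<open>D\<close>, so the compressions of \<phi> and of its inverse to \<open>B\<close> are
    mutually inverse.\<close>
  have cancel: "eB (g (eB y)) = eB (g y)" if g: "g \<in> FAut G" and y: "y \<in> carrier G" for g y
  proof -
    have gh: "g \<in> hom G G" using FAut_auto[OF g] by (rule autoD)
    have c: "eD y \<in> carrier G" "eB y \<in> carrier G" using eD[OF y] eB[OF y] D_carrier B_carrier by auto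
    have "g y = g (eD y \<otimes> eB y)" using eDB[OF y] by simp
    then have "g y = eD y \<otimes> g (eB y)" using endo_mult[OF gh c] FAut_fixes_D[OF g eD[OF y]] by simp
    then have "eB (g y) = eB (eD y) \<otimes> eB (g (eB y))"
      using proj_mult[OF compl' c(1) endo_closed[OF gh c(2)]] by simp
    then show ?thesis
      using proj_on_right[OF compl' eD[OF y]] proj_closed[OF compl' endo_closed[OF gh c(2)]] by simp
  qed
  define k where "k b = eB (\<phi> b)" for b
  have bij: "bij_betw k B B"
  proof (rule bij_betw_byWitness[where f' = "\<lambda>b. eB ((inv\<^bsub>AG\<^esub> \<phi>) b)"])
    show "\<forall>b\<in>B. eB ((inv\<^bsub>AG\<^esub> \<phi>) (k b)) = b"
      unfolding k_def using cancel[OF ifa] auto_closed[OF a] AG_inv_left[OF a] proj_on_left[OF compl'] B_carrier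
      by simp
    show "\<forall>b\<in>B. k (eB ((inv\<^bsub>AG\<^esub> \<phi>) b)) = b"
      unfolding k_def using cancel[OF f] endo_closed[OF ih] AG_inv_right[OF a] proj_on_left[OF compl'] B_carrier
      by simp
    show "k ` B \<subseteq> B" unfolding k_def using eB[OF auto_closed[OF a B_carrier]] by blast
    show "(\<lambda>b. eB ((inv\<^bsub>AG\<^esub> \<phi>) b)) ` B \<subseteq> B" using eB[OF endo_closed[OF ih B_carrier]] by blast
  qed
  have km: "k (x \<otimes> y) = k x \<otimes> k y" if "x \<in> B" "y \<in> B" for x y
    unfolding k_def using that B_carrier endo_mult[OF h] proj_mult[OF compl'] endo_closed[OF h] by simp
  have kc: "k \<in> B \<rightarrow> carrier G" unfolding k_def using eB[OF auto_closed[OF a B_carrier]] B_carrier by blast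
  have idc: "(\<lambda>x. x) \<in> D \<rightarrow> carrier G" using D_carrier by blast
  define \<rho> where "\<rho> = glue D B (\<lambda>x. x) k"
  have \<rho>a: "\<rho> \<in> auto G"
    unfolding \<rho>_def by (rule glue_auto[OF compl _ idc km kc bij_betw_id[unfolded id_def] bij]) auto
  have \<rho>D: "\<rho> x = x" if "x \<in> D" for x
    unfolding \<rho>_def by (rule glue_left[OF compl _ idc km kc that]) auto
  have \<rho>B: "\<rho> b = eB (\<phi> b)" if "b \<in> B" for b
  proof -
    have "\<rho> b = k b" unfolding \<rho>_def by (rule glue_right[OF compl _ idc km kc that]) auto
    then show ?thesis by (simp add: k_def)
  qed
  have "(\<lambda>x. \<rho> x \<otimes> inv x) ` carrier G \<subseteq> eB ` (\<lambda>x. \<phi> x \<otimes> inv x) ` carrier G"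
  proof
    fix z assume "z \<in> (\<lambda>x. \<rho> x \<otimes> inv x) ` carrier G"
    then obtain x where x: "x \<in> carrier G" "z = \<rho> x \<otimes> inv x" by blast
    define d b where "d = eD x" and "b = eB x"
    have db: "d \<in> D" "b \<in> B" "x = d \<otimes> b" unfolding d_def b_def using eD eB eDB x(1) by auto
    have c: "d \<in> carrier G" "b \<in> carrier G" "\<phi> b \<in> carrier G" using db D_carrier B_carrier auto_closed[OF a] by auto
    have ec: "eB (\<phi> b) \<in> carrier G" using proj_closed[OF compl' c(3)] .
    have "\<rho> x = d \<otimes> eB (\<phi> b)"
      using endo_mult[OF autoD(1)[OF \<rho>a] c(1,2)] \<rho>D[OF db(1)] \<rho>B[OF db(2)] db(3) by simp
    then have "z = eB (\<phi> b) \<otimes> inv b" unfolding x(2) db(3) using c ec by (simp only:) algebra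
    also have "\<dots> = eB (\<phi> b \<otimes> inv b)"
      using proj_mult[OF compl' c(3) inv_closed[OF c(2)]] endo_inv[OF proj_hom[OF compl'] c(2)]
        proj_on_left[OF compl' db(2)] by simp
    finally show "z \<in> eB ` (\<lambda>x. \<phi> x \<otimes> inv x) ` carrier G" using c(2) by blast
  qed
  then have "finite ((\<lambda>x. \<rho> x \<otimes> inv x) ` carrier G)" using FAutD(2)[OF f] finite_subset by blast
  then have "\<rho> \<in> FAut G" by (rule FAutI[OF \<rho>a])
  then show thesis using that \<rho>D \<rho>B by blast
qed

text \<open>For \<open>f = \<phi> \<otimes> \<epsilon>\<close> the factor in \<open>Psi\<close> is
  \<open>\<rho> \<otimes> \<epsilon>\<close>, with \<rho> the compression of \<phi> to
  \<open>B\<close>. The remaining factor is \<phi> times the inverse of \<rho>: finitary, since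
  \<Delta> cancels, and with displacements in \<open>D\<close>, since \<phi> and \<rho> agree modulo
  \<open>D\<close>.\<close>

lemma FD_crit_eq: "FD_crit = Sig <#>\<^bsub>AG\<^esub> Psi"
proof
  show "Sig <#>\<^bsub>AG\<^esub> Psi \<subseteq> FD_crit"
    unfolding set_mult_def using Sigma_subset Psi_subset subgroup.m_closed[OF subgroup_FD_crit] by blast
  show "FD_crit \<subseteq> Sig <#>\<^bsub>AG\<^esub> Psi"
  proof
    fix f assume f: "f \<in> FD_crit"
    then have fd: "f \<in> FD" and fn: "\<And>x. x \<in> pp noncrit \<Longrightarrow> f x = x" by (auto simp: FD_crit_def)
    have fa: "f \<in> auto G" using fd by (rule FD_auto)
    obtain \<phi> \<epsilon> where s: "\<phi> \<in> FAut G" "\<epsilon> \<in> Delta" "f = \<phi> \<otimes>\<^bsub>AG\<^esub> \<epsilon>" using FD_split[OF fd] by blast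
    have a: "\<phi> \<in> auto G" "\<epsilon> \<in> auto G" using s FAut_auto Delta_auto by auto
    obtain \<rho> where \<rho>: "\<rho> \<in> FAut G" "\<And>x. x \<in> D \<Longrightarrow> \<rho> x = x" "\<And>b. b \<in> B \<Longrightarrow> \<rho> b = eB (\<phi> b)"
      using FAut_B_part[OF s(1)] by blast
    have \<rho>a: "\<rho> \<in> auto G" using \<rho>(1) by (rule FAut_auto)
    define \<psi> where "\<psi> = \<rho> \<otimes>\<^bsub>AG\<^esub> \<epsilon>"
    have \<psi>app: "\<psi> x = \<rho> (\<epsilon> x)" if "x \<in> carrier G" for x
      unfolding \<psi>_def using AG_mult_apply[OF \<rho>a a(2) that] .
    have \<psi>FD: "\<psi> \<in> FD"
      unfolding \<psi>_def using subgroup.m_closed[OF subgroup_FD] \<rho>(1) s(2) FAut_subset_FD Delta_subset_FD by blast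
    have "\<psi> x = x" if x: "x \<in> pp noncrit" for x
    proof -
      have xc: "x \<in> carrier G" and xB: "x \<in> B" using x pp_carrier noncritical by auto
      have ex: "\<epsilon> x = x" using s(2) x by (simp add: Delta_def)
      then have "\<phi> x = x" using fn[OF x] AG_mult_apply[OF a xc] s(3) by simp
      then show ?thesis using \<psi>app[OF xc] ex \<rho>(3)[OF xB] proj_on_left[OF compl' xB] by simp
    qed
    moreover have "\<psi> b \<in> B" if b: "b \<in> B" for b
    proof -
      have "\<epsilon> b \<in> B" by (rule Delta_preserves_B[OF s(2) b])
      then show ?thesis
        using \<psi>app[OF B_carrier[OF b]] \<rho>(3) eB[OF auto_closed[OF a(1) B_carrier]] by simp
    qed
    ultimately have \<psi>: "\<psi> \<in> Psi" using \<psi>FD by (simp add: Psi_def)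
    have \<psi>a: "\<psi> \<in> auto G" using \<psi>FD by (rule FD_auto)
    define \<sigma> where "\<sigma> = f \<otimes>\<^bsub>AG\<^esub> inv\<^bsub>AG\<^esub> \<psi>"
    interpret X: group AG by (rule group_AG)
    have "\<sigma> = \<phi> \<otimes>\<^bsub>AG\<^esub> inv\<^bsub>AG\<^esub> \<rho>"
      unfolding \<sigma>_def \<psi>_def s(3) using a \<rho>a by (intro X.quotient_cancel_right) simp_all
    then have \<sigma>F: "\<sigma> \<in> FAut G"
      using subgroup.m_closed[OF subgroup_FAut s(1) subgroup.m_inv_closed[OF subgroup_FAut \<rho>(1)]] by simp
    have \<sigma>eq: "\<sigma> = \<phi> \<otimes>\<^bsub>AG\<^esub> inv\<^bsub>AG\<^esub> \<rho>" by fact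
    have "\<sigma> x = x" if x: "x \<in> pp noncrit" for x
      unfolding \<sigma>_def
      using AG_mult_apply[OF fa AG_inv_closed[OF \<psi>a] pp_carrier[OF x]]
        AG_inv_fixes[OF \<psi>a pp_carrier[OF x]] fn[OF x] \<psi> x by (simp add: Psi_def)
    moreover have "\<sigma> x \<otimes> inv x \<in> D" if x: "x \<in> carrier G" for x
    proof -
      define y where "y = (inv\<^bsub>AG\<^esub> \<rho>) x"
      have y: "y \<in> carrier G" "\<rho> y = x"
        unfolding y_def using x \<rho>a by (simp_all add: AG_inv_right auto_closed AG_inv_closed)
      define d b where "d = eD y" and "b = eB y"
      have db: "d \<in> D" "b \<in> B" "y = d \<otimes> b" unfolding d_def b_def using eD eB eDB y(1) by auto
      have c: "d \<in> carrier G" "b \<in> carrier G" "\<phi> b \<in> carrier G" using db D_carrier B_carrier auto_closed[OF a(1)] by auto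
      have ec: "eB (\<phi> b) \<in> carrier G" "eD (\<phi> b) \<in> D" "eD (\<phi> b) \<in> carrier G"
        using proj_closed[OF compl' c(3)] eD[OF c(3)] D_carrier by auto
      have "\<sigma> x = \<phi> y" unfolding \<sigma>eq y_def using AG_mult_apply[OF a(1) AG_inv_closed[OF \<rho>a] x] .
      also have "\<dots> = d \<otimes> \<phi> b"
        unfolding db(3) using endo_mult[OF autoD(1)[OF a(1)] c(1,2)] FAut_fixes_D[OF s(1) db(1)] by simp
      also have "\<phi> b = eD (\<phi> b) \<otimes> eB (\<phi> b)" using eDB[OF c(3)] .
      finally have 1: "\<sigma> x = d \<otimes> (eD (\<phi> b) \<otimes> eB (\<phi> b))" .
      have 2: "x = d \<otimes> eB (\<phi> b)"
        using y(2) endo_mult[OF autoD(1)[OF \<rho>a] c(1,2)] \<rho>(2)[OF db(1)] \<rho>(3)[OF db(2)] db(3) by simp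
      have "\<sigma> x \<otimes> inv x = d \<otimes> (eD (\<phi> b) \<otimes> eB (\<phi> b)) \<otimes> inv x" by (simp only: 1)
      also have "\<dots> = d \<otimes> (eD (\<phi> b) \<otimes> eB (\<phi> b)) \<otimes> inv (d \<otimes> eB (\<phi> b))" by (simp only: 2)
      also have "\<dots> = eD (\<phi> b)" using c ec by algebra
      finally have "\<sigma> x \<otimes> inv x = eD (\<phi> b)" .
      then show ?thesis using ec by simp
    qed
    ultimately have "\<sigma> \<in> Sig" using \<sigma>F by (simp add: Sig_def)
    moreover have "f = \<sigma> \<otimes>\<^bsub>AG\<^esub> \<psi>" unfolding \<sigma>_def
      using fa \<psi>a AG_inv_closed[OF \<psi>a] X.m_assoc[of f "inv\<^bsub>AG\<^esub> \<psi>" \<psi>] by simp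
    ultimately show "f \<in> Sig <#>\<^bsub>AG\<^esub> Psi" using \<psi> unfolding set_mult_def by blast
  qed
qed

lemma Sigma_inter_Psi: "Sig \<inter> Psi = {\<one>\<^bsub>AG\<^esub>}"
proof -
  have "f = \<one>\<^bsub>AG\<^esub>" if f: "f \<in> Sig" "f \<in> Psi" for f
  proof (rule AG_eqI[OF Sigma_auto[OF f(1)] AG_one_closed])
    have a: "f \<in> auto G" using f(1) by (rule Sigma_auto)
    fix x assume x: "x \<in> carrier G"
    have b: "eB x \<in> B" and bc: "eB x \<in> carrier G" "eD x \<in> carrier G" using eB[OF x] eD[OF x] B_carrier D_carrier by auto
    have "f (eB x) \<otimes> inv (eB x) \<in> D" using f(1) bc by (simp add: Sig_def)
    moreover have "f (eB x) \<otimes> inv (eB x) \<in> B"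
      using f(2) b subgroup.m_closed[OF B_subgroup _ subgroup.m_inv_closed[OF B_subgroup b]] by (simp add: Psi_def)
    ultimately have "f (eB x) \<otimes> inv (eB x) = \<one>" by (rule DB_trivial)
    then have "f (eB x) = eB x" using eq_iff_quotient[OF auto_closed[OF a bc(1)] bc(1)] by blast
    moreover have "f (eD x) = eD x" using FAut_fixes_D[OF Sigma_FAut[OF f(1)] eD[OF x]] .
    ultimately have "f (eD x \<otimes> eB x) = eD x \<otimes> eB x" using endo_mult[OF autoD(1)[OF a] bc(2,1)] by simp
    then show "f x = \<one>\<^bsub>AG\<^esub> x" using eDB[OF x] AG_one_apply[OF x] by simp
  qed
  then show ?thesis using subgroup.one_closed[OF subgroup_Sigma] subgroup.one_closed[OF subgroup_Psi] by blast
qed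

lemma Sigma_Psi_semidirect_product: "internal_semidirect_product AG (Sig <#>\<^bsub>AG\<^esub> Psi) Sig Psi"
proof -
  have "Sig \<lhd> AG\<lparr>carrier := FD_crit\<rparr>"
    using group.normal_in_subgroupI[OF group_AG subgroup_FD_crit subgroup_Sigma Sigma_subset]
      Sigma_conj(1) FD_crit_subset by blast
  moreover have "subgroup Psi (AG\<lparr>carrier := FD_crit\<rparr>)"
    using group.subgroup_incl[OF group_AG subgroup_Psi subgroup_FD_crit Psi_subset] .
  ultimately show ?thesis
    unfolding internal_semidirect_product_def FD_crit_eq[symmetric]
    using subgroup_FD_crit Sigma_inter_Psi FD_crit_eq by blast
qed

text \<open>\<Delta> is trivial on noncritical components, so there \<open>f\<close> agrees with its
  finitary factor \<phi>; the restriction of \<phi> to them can be divided off.\<close>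

lemma FD_eq: "FD = FAut_noncrit <#>\<^bsub>AG\<^esub> FD_crit"
proof
  show "FAut_noncrit <#>\<^bsub>AG\<^esub> FD_crit \<subseteq> FD"
    unfolding set_mult_def using FAut_noncrit_subset FD_crit_subset subgroup.m_closed[OF subgroup_FD] by blast
  show "FD \<subseteq> FAut_noncrit <#>\<^bsub>AG\<^esub> FD_crit"
  proof
    fix f assume f: "f \<in> FD"
    have fa: "f \<in> auto G" using f by (rule FD_auto)
    obtain \<phi> \<epsilon> where s: "\<phi> \<in> FAut G" "\<epsilon> \<in> Delta" "f = \<phi> \<otimes>\<^bsub>AG\<^esub> \<epsilon>" using FD_split[OF f] by blast
    have a: "\<phi> \<in> auto G" "\<epsilon> \<in> auto G" using s FAut_auto Delta_auto by auto
    define \<tau> where "\<tau> = restrict_pp noncrit \<phi>"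
    note r = restrict_pp[OF a(1), where \<pi> = noncrit, folded \<tau>_def, unfolded critical_eq]
    note c = pp_complementary[of noncrit, unfolded critical_eq]
    have "(\<lambda>x. \<tau> x \<otimes> inv x) ` carrier G \<subseteq> (\<lambda>x. \<phi> x \<otimes> inv x) ` carrier G"
    proof
      fix z assume "z \<in> (\<lambda>x. \<tau> x \<otimes> inv x) ` carrier G"
      then obtain x where x: "x \<in> carrier G" "z = \<tau> x \<otimes> inv x" by blast
      define u v where "u = proj (pp noncrit) (pp critical) x" and "v = proj (pp critical) (pp noncrit) x"
      have uv: "u \<in> pp noncrit" "v \<in> pp critical" "x = u \<otimes> v" unfolding u_def v_def using decompose[OF c x(1)] by auto
      have uc: "u \<in> carrier G" "v \<in> carrier G" "\<phi> u \<in> carrier G" using uv pp_carrier auto_closed[OF a(1)] by auto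
      have tx: "\<tau> x = \<phi> u \<otimes> v" using endo_mult[OF autoD(1)[OF r(1)] uc(1,2)] r(2)[OF uv(1)] r(3)[OF uv(2)] uv(3) by simp
      have "z = \<phi> u \<otimes> inv u" unfolding x(2) tx unfolding uv(3) using uc by algebra
      then show "z \<in> (\<lambda>x. \<phi> x \<otimes> inv x) ` carrier G" using uc(1) by blast
    qed
    then have "finite ((\<lambda>x. \<tau> x \<otimes> inv x) ` carrier G)" using FAutD(2)[OF s(1)] finite_subset by blast
    then have \<tau>F: "\<tau> \<in> FAut G" by (rule FAutI[OF r(1)])
    then have \<tau>: "\<tau> \<in> FAut_noncrit" using r(3) by (simp add: FAut_noncrit_def)
    define \<kappa> where "\<kappa> = inv\<^bsub>AG\<^esub> \<tau> \<otimes>\<^bsub>AG\<^esub> f"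
    have "\<kappa> x = x" if x: "x \<in> pp noncrit" for x
    proof -
      have xc: "x \<in> carrier G" using x pp_carrier by blast
      have "f x = \<tau> x" using s(2,3) AG_mult_apply[OF a xc] r(2)[OF x] x by (simp add: Delta_def)
      then show ?thesis
        unfolding \<kappa>_def using AG_mult_apply[OF AG_inv_closed[OF r(1)] fa xc] AG_inv_left[OF r(1) xc] by simp
    qed
    moreover have "\<kappa> \<in> FD"
      unfolding \<kappa>_def
      using subgroup.m_closed[OF subgroup_FD subgroup.m_inv_closed[OF subgroup_FD] f] \<tau> FAut_noncrit_subset by blast
    ultimately have "\<kappa> \<in> FD_crit" by (simp add: FD_crit_def)
    interpret X: group AG by (rule group_AG)
    have "f = \<tau> \<otimes>\<^bsub>AG\<^esub> \<kappa>"
      unfolding \<kappa>_def using fa r(1) AG_inv_closed[OF r(1)] X.m_assoc[of \<tau> "inv\<^bsub>AG\<^esub> \<tau>" f] by simp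
    then show "f \<in> FAut_noncrit <#>\<^bsub>AG\<^esub> FD_crit" using \<tau> \<open>\<kappa> \<in> FD_crit\<close> unfolding set_mult_def by blast
  qed
qed

text \<open>Every automorphism preserves the critical and the noncritical part, so being trivial on
  one of them survives conjugation; a map trivial on both is the identity.\<close>

lemma FD_direct_product: "internal_direct_product AG FD FAut_noncrit FD_crit"
proof -
  have "FAut_noncrit \<lhd> AG\<lparr>carrier := FD\<rparr>"
  proof (rule group.normal_in_subgroupI[OF group_AG subgroup_FD subgroup_FAut_noncrit FAut_noncrit_subset])
    fix g f assume g: "g \<in> FD" and f: "f \<in> FAut_noncrit"
    then have fF: "f \<in> FAut G" "\<And>x. x \<in> pp critical \<Longrightarrow> f x = x" by (auto simp: FAut_noncrit_def)
    show "g \<otimes>\<^bsub>AG\<^esub> f \<otimes>\<^bsub>AG\<^esub> inv\<^bsub>AG\<^esub> g \<in> FAut_noncrit"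
      using FAut_conj[OF fF(1) FD_auto[OF g]] conj_fixes_pp[OF FAut_auto[OF fF(1)] FD_auto[OF g] fF(2)]
      by (simp add: FAut_noncrit_def)
  qed
  moreover have "FD_crit \<lhd> AG\<lparr>carrier := FD\<rparr>"
  proof (rule group.normal_in_subgroupI[OF group_AG subgroup_FD subgroup_FD_crit FD_crit_subset])
    fix g f assume g: "g \<in> FD" and f: "f \<in> FD_crit"
    then have fF: "f \<in> FD" "\<And>x. x \<in> pp noncrit \<Longrightarrow> f x = x" by (auto simp: FD_crit_def)
    then have "g \<otimes>\<^bsub>AG\<^esub> f \<otimes>\<^bsub>AG\<^esub> inv\<^bsub>AG\<^esub> g \<in> FD"
      using subgroup.m_closed[OF subgroup_FD subgroup.m_closed[OF subgroup_FD g fF(1)]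
          subgroup.m_inv_closed[OF subgroup_FD g]] by blast
    then show "g \<otimes>\<^bsub>AG\<^esub> f \<otimes>\<^bsub>AG\<^esub> inv\<^bsub>AG\<^esub> g \<in> FD_crit"
      using conj_fixes_pp[OF FD_auto[OF fF(1)] FD_auto[OF g] fF(2)] by (simp add: FD_crit_def)
  qed
  moreover have "FAut_noncrit \<inter> FD_crit = {\<one>\<^bsub>AG\<^esub>}"
  proof -
    have "f = \<one>\<^bsub>AG\<^esub>" if f: "f \<in> FAut_noncrit" "f \<in> FD_crit" for f
    proof (rule auto_eq_on_parts[OF _ AG_one_closed, where \<pi> = noncrit])
      show "f \<in> auto G" using f FAut_auto by (auto simp: FAut_noncrit_def)
      show "f x = \<one>\<^bsub>AG\<^esub> x" if "x \<in> pp noncrit" for x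
        using f that AG_one_apply[OF pp_carrier[OF that]] by (simp add: FD_crit_def)
      show "f x = \<one>\<^bsub>AG\<^esub> x" if "x \<in> pp (primes - noncrit)" for x
        using f that AG_one_apply[OF pp_carrier[OF that]] unfolding critical_eq by (simp add: FAut_noncrit_def)
    qed
    then show ?thesis
      using subgroup.one_closed[OF subgroup_FAut_noncrit] subgroup.one_closed[OF subgroup_FD_crit] by blast
  qed
  ultimately show ?thesis unfolding internal_direct_product_def using subgroup_FD FD_eq by blast
qed

end

section \<open>The action of \<open>\<Psi>\<close> on \<open>\<Sigma>\<close>\<close>

context critical_setting
begin

lemma Psi_FD: "\<psi> \<in> Psi \<Longrightarrow> \<psi> \<in> FD"
  by (simp add: Psi_def)

lemma conj_action_apply:
  "g \<in> FD \<Longrightarrow> s \<in> Sig \<Longrightarrow> conj_action AG Sig g s = g \<otimes>\<^bsub>AG\<^esub> s \<otimes>\<^bsub>AG\<^esub> inv\<^bsub>AG\<^esub> g"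
  by (simp add: conj_action_def)

lemma conj_action_mem: "g \<in> FD \<Longrightarrow> s \<in> Sig \<Longrightarrow> conj_action AG Sig g s \<in> Sig"
  by (simp add: conj_action_apply Sigma_conj(1))

lemma \<theta>_conj_action:
  assumes g: "g \<in> FD" and s: "s \<in> Sig" and x: "x \<in> carrier G"
  shows "\<theta> (conj_action AG Sig g s) x = \<theta> s ((inv\<^bsub>AG\<^esub> g) x)"
proof -
  have "\<theta> s ((inv\<^bsub>AG\<^esub> g) x) \<in> carrier G"
    using D_carrier[OF \<theta>_D[OF s auto_closed[OF AG_inv_closed[OF FD_auto[OF g]] x]]] .
  then have "x \<otimes> \<theta> s ((inv\<^bsub>AG\<^esub> g) x) \<otimes> inv x = \<theta> s ((inv\<^bsub>AG\<^esub> g) x)"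
    using x by algebra
  then show ?thesis
    unfolding conj_action_apply[OF g s] \<theta>_def[of "g \<otimes>\<^bsub>AG\<^esub> s \<otimes>\<^bsub>AG\<^esub> inv\<^bsub>AG\<^esub> g"] Sigma_conj(2)[OF s g x] .
qed

lemma Sigma_eqI:
  assumes "f \<in> Sig" "g \<in> Sig" "\<And>x. x \<in> carrier G \<Longrightarrow> \<theta> f x = \<theta> g x"
  shows "f = g"
proof (rule AG_eqI[OF Sigma_auto[OF assms(1)] Sigma_auto[OF assms(2)]])
  fix x assume x: "x \<in> carrier G"
  show "f x = g x"
    using \<theta>_apply[OF Sigma_auto[OF assms(1)] x] \<theta>_apply[OF Sigma_auto[OF assms(2)] x] assms(3)[OF x] by simp
qed

lemma conj_action_compose:
  assumes g: "g \<in> FD" and h: "h \<in> FD" and s: "s \<in> Sig"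
  shows "conj_action AG Sig g (conj_action AG Sig h s) = conj_action AG Sig (g \<otimes>\<^bsub>AG\<^esub> h) s"
  using group.conj_conj[OF group_AG, of g h s] subgroup.m_closed[OF subgroup_FD g h]
  by (simp add: conj_action_apply g h s Sigma_conj(1) FD_auto Sigma_auto)

lemma conj_action_one: "s \<in> Sig \<Longrightarrow> conj_action AG Sig \<one>\<^bsub>AG\<^esub> s = s"
  using subgroup.one_closed[OF subgroup_FD] AG_inv_fixes[OF AG_one_closed] AG_one_apply
  by (intro Sigma_eqI) (simp_all add: conj_action_mem \<theta>_conj_action)

lemma conj_action_bij:
  assumes g: "g \<in> FD"
  shows "bij_betw (conj_action AG Sig g) Sig Sig"
proof (rule bij_betw_byWitness[where f' = "conj_action AG Sig (inv\<^bsub>AG\<^esub> g)"])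
  have ig: "inv\<^bsub>AG\<^esub> g \<in> FD" using subgroup.m_inv_closed[OF subgroup_FD g] .
  interpret X: group AG by (rule group_AG)
  have gc: "g \<in> carrier AG" using FD_auto[OF g] by simp
  show "\<forall>s\<in>Sig. conj_action AG Sig (inv\<^bsub>AG\<^esub> g) (conj_action AG Sig g s) = s"
    using conj_action_compose[OF ig g] conj_action_one X.l_inv[OF gc] by simp
  show "\<forall>s\<in>Sig. conj_action AG Sig g (conj_action AG Sig (inv\<^bsub>AG\<^esub> g) s) = s"
    using conj_action_compose[OF g ig] conj_action_one X.r_inv[OF gc] by simp
  show "conj_action AG Sig g ` Sig \<subseteq> Sig" "conj_action AG Sig (inv\<^bsub>AG\<^esub> g) ` Sig \<subseteq> Sig"
    using conj_action_mem[OF g] conj_action_mem[OF ig] by auto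
qed

lemma conj_action_auto:
  assumes g: "g \<in> FD"
  shows "conj_action AG Sig g \<in> auto SG"
proof -
  have "conj_action AG Sig g \<in> hom SG SG"
  proof (rule homI)
    show "conj_action AG Sig g s \<in> carrier SG" if "s \<in> carrier SG" for s
      using conj_action_mem[OF g] that by simp
    show "conj_action AG Sig g (s \<otimes>\<^bsub>SG\<^esub> t) = conj_action AG Sig g s \<otimes>\<^bsub>SG\<^esub> conj_action AG Sig g t"
      if "s \<in> carrier SG" "t \<in> carrier SG" for s t
    proof -
      have st: "s \<in> Sig" "t \<in> Sig" "s \<otimes>\<^bsub>AG\<^esub> t \<in> Sig"
        using that subgroup.m_closed[OF subgroup_Sigma] by auto
      let ?c = "conj_action AG Sig g"
      have c: "?c s \<in> Sig" "?c t \<in> Sig" using conj_action_mem[OF g] st by auto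
      have th: "\<theta> (u \<otimes>\<^bsub>AG\<^esub> v) x = \<theta> u x \<otimes> \<theta> v x" if uv: "u \<in> Sig" "v \<in> Sig" and x: "x \<in> carrier G" for u v x
      proof -
        have "\<theta> u x \<in> carrier G" "\<theta> v x \<in> carrier G" using \<theta>_D uv x D_carrier by auto
        then show ?thesis
          unfolding \<theta>_def[of "u \<otimes>\<^bsub>AG\<^esub> v"] Sigma_mult_apply[OF uv x] using x by algebra
      qed
      have "?c (s \<otimes>\<^bsub>AG\<^esub> t) = ?c s \<otimes>\<^bsub>AG\<^esub> ?c t"
      proof (rule Sigma_eqI)
        show "?c (s \<otimes>\<^bsub>AG\<^esub> t) \<in> Sig" using conj_action_mem[OF g st(3)] .
        show "?c s \<otimes>\<^bsub>AG\<^esub> ?c t \<in> Sig" using subgroup.m_closed[OF subgroup_Sigma c] .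
        fix x assume x: "x \<in> carrier G"
        have gx: "(inv\<^bsub>AG\<^esub> g) x \<in> carrier G" using auto_closed[OF AG_inv_closed[OF FD_auto[OF g]] x] .
        show "\<theta> (?c (s \<otimes>\<^bsub>AG\<^esub> t)) x = \<theta> (?c s \<otimes>\<^bsub>AG\<^esub> ?c t) x"
          unfolding th[OF c x] \<theta>_conj_action[OF g st(3) x] \<theta>_conj_action[OF g st(1) x]
            \<theta>_conj_action[OF g st(2) x] by (rule th[OF st(1,2) gx])
      qed
      then show ?thesis by simp
    qed
  qed
  moreover have "conj_action AG Sig g \<in> Bij (carrier SG)"
    using conj_action_bij[OF g] by (simp add: Bij_def conj_action_def)
  ultimately show ?thesis by (simp add: auto_def)
qed

text \<open>On the p-component of \<open>Sig\<close> the homomorphism \<open>\<theta> s\<close> is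
  determined on \<open>B \<inter> pp {p}\<close>, where the inverse of \<epsilon> is a fixed power;
  the same exponent describes the conjugation. At a noncritical prime it is 1.\<close>

lemma Delta_conj_power:
  assumes e: "\<epsilon> \<in> Delta"
  shows "conj_action AG Sig \<epsilon> \<in> PAut SG"
proof -
  interpret S: periodic_comm_group SG by (rule periodic_SG)
  have fd: "\<epsilon> \<in> FD" using e Delta_subset_FD by blast
  have ie: "inv\<^bsub>AG\<^esub> \<epsilon> \<in> Delta" using Delta_inv[OF e] .
  let ?c = "conj_action AG Sig \<epsilon>" and ?d = "inv\<^bsub>AG\<^esub> \<epsilon>"
  have ca: "?c \<in> auto SG" using conj_action_auto[OF fd] .
  have dh: "?d \<in> hom G G" using Delta_auto[OF ie] by (rule autoD)
  show ?thesis
  proof (rule S.PAutI[OF S.autoD(1,2)[OF ca]])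
    show "s = \<one>\<^bsub>SG\<^esub>" if "s \<in> carrier SG" "?c s = \<one>\<^bsub>SG\<^esub>" for s
      using inj_onD[OF S.autoD(4)[OF ca], of s "\<one>\<^bsub>SG\<^esub>"] that S.endo_one[OF S.autoD(1)[OF ca]]
        S.one_closed by simp
    show "\<exists>k::int. ?c s = s [^]\<^bsub>SG\<^esub> k" if p: "prime p" and s: "s \<in> pi_part SG {p}" for p s
    proof -
      have ss: "s \<in> Sig" using S.pp_carrier[OF s] by simp
      have th: "\<theta> s \<in> hom G G" by (rule \<theta>_hom[OF Sigma_auto[OF ss]])
      obtain k :: int where k: "\<And>b. b \<in> B \<inter> pp {p} \<Longrightarrow> \<theta> s (?d b) = \<theta> s b [^] k"
      proof (cases "p \<in> critical")
        case True
        obtain r :: int where r: "\<And>b. b \<in> B \<inter> pp {p} \<Longrightarrow> ?d b = b [^] r" using Delta_scales[OF ie True] by blast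
        have "\<theta> s (?d b) = \<theta> s b [^] r" if b: "b \<in> B \<inter> pp {p}" for b
          unfolding r[OF b] using endo_int_pow[OF th] b B_carrier by blast
        then show thesis using that by blast
      next
        case False
        have "\<theta> s (?d b) = \<theta> s b [^] (1::int)" if b: "b \<in> B \<inter> pp {p}" for b
        proof -
          have "?d b = b" using other_prime[OF p False] b ie by (auto simp: Delta_def)
          then show ?thesis using D_carrier[OF \<theta>_D[OF ss]] B_carrier b by simp
        qed
        then show thesis using that by blast
      qed
      have "?c s = s [^]\<^bsub>SG\<^esub> k"
      proof (rule Sigma_eqI[OF conj_action_mem[OF fd ss]])
        show "s [^]\<^bsub>SG\<^esub> k \<in> Sig" using SG_int_pow(1)[OF ss one_closed] .
        fix x assume x: "x \<in> carrier G"
        have "\<theta> s (?d x) = \<theta> s x [^] k"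
        proof (rule SG_primary_eqI[OF s endo_comp[OF th dh] _ _ endo_comp[OF hom_int_power th] _ _ p k x])
          show "\<theta> s (?d y) \<in> pp {p}" if "y \<in> carrier G" for y
            using SG_primary_values(2)[OF s endo_closed[OF dh that]] .
          show "\<theta> s (?d y) = \<one>" if "y \<in> D" for y
            using \<theta>_of_D[OF ss that] ie that by (simp add: Delta_def)
          show "\<theta> s y [^] k \<in> pp {p}" if "y \<in> carrier G" for y
            using subgroup_int_pow_closed[OF subgroup_pp SG_primary_values(2)[OF s that]] .
          show "\<theta> s y [^] k = \<one>" if "y \<in> D" for y using \<theta>_of_D[OF ss that] by simp
        qed
        then show "\<theta> (?c s) x = \<theta> (s [^]\<^bsub>SG\<^esub> k) x"
          using \<theta>_conj_action[OF fd ss x] SG_int_pow(2)[OF ss x] by simp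
      qed
      then show ?thesis by blast
    qed
  qed
qed

lemma FAut_conj_finite:
  assumes f: "\<phi> \<in> FAut G"
  shows "finite ((\<lambda>s. conj_action AG Sig \<phi> s \<otimes>\<^bsub>SG\<^esub> inv\<^bsub>SG\<^esub> s) ` Sig)"
proof -
  interpret S: periodic_comm_group SG by (rule periodic_SG)
  have fd: "\<phi> \<in> FD" using f FAut_subset_FD by blast
  have a: "\<phi> \<in> auto G" using f by (rule FAut_auto)
  let ?d = "inv\<^bsub>AG\<^esub> \<phi>" and ?c = "conj_action AG Sig \<phi>"
  have df: "?d \<in> FAut G" using subgroup.m_inv_closed[OF subgroup_FAut f] .
  have da: "?d \<in> auto G" using df by (rule FAut_auto)
  define W where "W = (\<lambda>x. ?d x \<otimes> inv x) ` carrier G"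
  have W: "finite W" "W \<subseteq> carrier G"
    unfolding W_def using FAutD(2)[OF df] auto_closed[OF da] by auto
  define N where "N = (\<Prod>w\<in>W. ord w)"
  have N0: "N > 0" unfolding N_def using ord_pos W(2) by (intro prod_pos) blast
  \<comment> \<open>\<open>N\<close> kills \<open>W\<close>, so the values of
    \<open>\<theta> s\<close> on \<open>W\<close> lie in the finite N-torsion of \<open>D\<close>.
    This leaves finitely many possible restrictions to \<open>W\<close>.\<close>
  define V where "V = {d \<in> D. d [^] N = \<one>}"
  have V: "finite V" unfolding V_def by (rule D_finite_torsion[OF N0])
  \<comment> \<open>The quotient of \<open>s\<^sup>\<phi>\<close> by \<open>s\<close> is determined by the restriction of \<open>\<theta> s\<close> to the finite set \<open>W\<close>.\<close>
  define res where "res s = (\<lambda>w\<in>W. \<theta> s w)" for s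
  have "res s \<in> W \<rightarrow>\<^sub>E V" if s: "s \<in> Sig" for s
  proof -
    have "\<theta> s w \<in> V" if w: "w \<in> W" for w
    proof -
      have wc: "w \<in> carrier G" using w W(2) by blast
      have th: "\<theta> s \<in> hom G G" by (rule \<theta>_hom[OF Sigma_auto[OF s]])
      have "ord w dvd N" unfolding N_def using W(1) w by (rule dvd_prodI)
      then have "w [^] N = \<one>" using wc pow_eq_id by blast
      then have "\<theta> s w [^] N = \<one>" using endo_nat_pow[OF th wc, of N] endo_one[OF th] by simp
      then show ?thesis using \<theta>_D[OF s wc] by (simp add: V_def)
    qed
    then show ?thesis by (auto simp: res_def)
  qed
  then have "finite (res ` Sig)"
    using finite_subset[of "res ` Sig" "W \<rightarrow>\<^sub>E V"] finite_PiE[OF W(1), of "\<lambda>_. V"] V by blast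
  then show ?thesis
  proof (rule finite_image_factor)
    fix s t assume s: "s \<in> Sig" and t: "t \<in> Sig" and eq: "res s = res t"
    have key: "(?c u \<otimes>\<^bsub>SG\<^esub> inv\<^bsub>SG\<^esub> u) \<in> Sig \<and>
        (\<forall>x\<in>carrier G. \<theta> (?c u \<otimes>\<^bsub>SG\<^esub> inv\<^bsub>SG\<^esub> u) x = \<theta> u (?d x \<otimes> inv x))" if u: "u \<in> Sig" for u
    proof -
      have th: "\<theta> u \<in> hom G G" by (rule \<theta>_hom[OF Sigma_auto[OF u]])
      have iu: "inv\<^bsub>SG\<^esub> u = u [^]\<^bsub>SG\<^esub> (-1::int)" using S.int_pow_neg[of u 1] u by simp
      have ius: "inv\<^bsub>SG\<^esub> u \<in> Sig" using S.inv_closed[of u] u by simp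
      have cu: "?c u \<in> Sig" using conj_action_mem[OF fd u] .
      have m: "?c u \<otimes>\<^bsub>SG\<^esub> inv\<^bsub>SG\<^esub> u \<in> Sig" using S.m_closed[of "?c u" "inv\<^bsub>SG\<^esub> u"] cu ius by simp
      have "\<theta> (?c u \<otimes>\<^bsub>SG\<^esub> inv\<^bsub>SG\<^esub> u) x = \<theta> u (?d x \<otimes> inv x)" if x: "x \<in> carrier G" for x
      proof -
        have dx: "?d x \<in> carrier G" using auto_closed[OF da x] .
        have c: "\<theta> (?c u) x \<in> carrier G" "\<theta> u x \<in> carrier G" using \<theta>_D cu u x D_carrier by auto
        have i: "\<theta> (inv\<^bsub>SG\<^esub> u) x = inv (\<theta> u x)"
          unfolding iu SG_int_pow(2)[OF u x] using c int_pow_neg[of "\<theta> u x" 1] by simp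
        have "\<theta> (?c u \<otimes>\<^bsub>SG\<^esub> inv\<^bsub>SG\<^esub> u) x = x \<otimes> (\<theta> (?c u) x \<otimes> \<theta> (inv\<^bsub>SG\<^esub> u) x) \<otimes> inv x"
          using Sigma_mult_apply[OF cu ius x] by (simp add: \<theta>_def[of "?c u \<otimes>\<^bsub>AG\<^esub> _"])
        also have "\<dots> = \<theta> (?c u) x \<otimes> inv (\<theta> u x)" unfolding i using x c by algebra
        also have "\<theta> (?c u) x = \<theta> u (?d x)" by (rule \<theta>_conj_action[OF fd u x])
        also have "\<theta> u (?d x) \<otimes> inv (\<theta> u x) = \<theta> u (?d x \<otimes> inv x)"
          using dx x by (simp add: endo_mult[OF th] endo_inv[OF th])
        finally show ?thesis .
      qed
      then show ?thesis using m by blast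
    qed
    show "?c s \<otimes>\<^bsub>SG\<^esub> inv\<^bsub>SG\<^esub> s = ?c t \<otimes>\<^bsub>SG\<^esub> inv\<^bsub>SG\<^esub> t"
    proof (rule Sigma_eqI)
      show "?c s \<otimes>\<^bsub>SG\<^esub> inv\<^bsub>SG\<^esub> s \<in> Sig" "?c t \<otimes>\<^bsub>SG\<^esub> inv\<^bsub>SG\<^esub> t \<in> Sig" using key[OF s] key[OF t] by auto
      fix x assume x: "x \<in> carrier G"
      have w: "?d x \<otimes> inv x \<in> W" unfolding W_def using x by blast
      have "\<theta> s (?d x \<otimes> inv x) = \<theta> t (?d x \<otimes> inv x)"
        using fun_cong[OF eq, of "?d x \<otimes> inv x"] w by (simp add: res_def)
      then show "\<theta> (?c s \<otimes>\<^bsub>SG\<^esub> inv\<^bsub>SG\<^esub> s) x = \<theta> (?c t \<otimes>\<^bsub>SG\<^esub> inv\<^bsub>SG\<^esub> t) x"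
        using key[OF s] key[OF t] x by simp
    qed
  qed
qed

text \<open>For \<open>\<psi> = \<phi> \<otimes> \<epsilon>\<close> the factor \<epsilon> maps each
  subgroup \<open>H\<close> onto itself, acting as a power automorphism, and \<phi> changes an
  element only by a factor from the finite set of \<open>FAut_conj_finite\<close>.\<close>

lemma inertial_conj_action:
  assumes p: "\<psi> \<in> FD"
  shows "inertial SG (conj_action AG Sig \<psi>)"
proof -
  interpret S: periodic_comm_group SG by (rule periodic_SG)
  obtain \<phi> \<epsilon> where s: "\<phi> \<in> FAut G" "\<epsilon> \<in> Delta" "\<psi> = \<phi> \<otimes>\<^bsub>AG\<^esub> \<epsilon>" using FD_split[OF p] by blast
  have fd: "\<phi> \<in> FD" "\<epsilon> \<in> FD" using s FAut_subset_FD Delta_subset_FD by auto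
  have fin: "finite ((\<lambda>h. H #>\<^bsub>SG\<^esub> conj_action AG Sig \<psi> h) ` H)" if H: "subgroup H SG" for H
  proof (rule finite_subset)
    let ?Y = "(\<lambda>s. conj_action AG Sig \<phi> s \<otimes>\<^bsub>SG\<^esub> inv\<^bsub>SG\<^esub> s) ` Sig"
    show "(\<lambda>h. H #>\<^bsub>SG\<^esub> conj_action AG Sig \<psi> h) ` H \<subseteq> (\<lambda>y. H #>\<^bsub>SG\<^esub> y) ` ?Y"
    proof
      fix X assume "X \<in> (\<lambda>h. H #>\<^bsub>SG\<^esub> conj_action AG Sig \<psi> h) ` H"
      then obtain h where h: "h \<in> H" "X = H #>\<^bsub>SG\<^esub> conj_action AG Sig \<psi> h" by blast
      have hs: "h \<in> Sig" using subgroup.mem_carrier[OF H h(1)] by simp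
      define k where "k = conj_action AG Sig \<epsilon> h"
      have "conj_action AG Sig \<epsilon> ` H = H" using Delta_conj_power[OF s(2)] H by (simp add: PAut_def)
      then have kH: "k \<in> H" unfolding k_def using h(1) by blast
      have ks: "k \<in> Sig" unfolding k_def by (rule conj_action_mem[OF fd(2) hs])
      have c: "conj_action AG Sig \<phi> k \<in> Sig" by (rule conj_action_mem[OF fd(1) ks])
      have eq: "conj_action AG Sig \<psi> h = conj_action AG Sig \<phi> k"
        unfolding k_def s(3) by (rule conj_action_compose[OF fd hs, symmetric])
      let ?y = "conj_action AG Sig \<phi> k \<otimes>\<^bsub>SG\<^esub> inv\<^bsub>SG\<^esub> k"
      have cc: "conj_action AG Sig \<phi> k \<in> carrier SG" "k \<in> carrier SG" using c ks by auto
      have "conj_action AG Sig \<phi> k \<otimes>\<^bsub>SG\<^esub> inv\<^bsub>SG\<^esub> ?y = k"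
        using cc by (metis S.inv_closed S.inv_inv S.inv_mult S.inv_cancel1)
      then have "H #>\<^bsub>SG\<^esub> conj_action AG Sig \<phi> k = H #>\<^bsub>SG\<^esub> ?y"
        using S.r_coset_eq_iff[OF H cc(1) S.m_closed[OF cc(1) S.inv_closed[OF cc(2)]]] kH by simp
      then have "X = H #>\<^bsub>SG\<^esub> ?y" using h(2) eq by simp
      moreover have "?y \<in> ?Y" by (rule image_eqI[where x = k]) (use ks in simp_all)
      ultimately show "X \<in> (\<lambda>y. H #>\<^bsub>SG\<^esub> y) ` ?Y" by (rule image_eqI)
    qed
  qed (use FAut_conj_finite[OF s(1)] in blast)
  then show ?thesis using S.inertial_iff conj_action_auto[OF p] by blast
qed

text \<open>A complement of \<open>D\<close> containing \<open>c \<otimes> d\<close>, where \<open>d \<in> D\<close> has order \<open>p\<close>, yields a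
  projection onto \<open>D\<close> that maps \<open>c\<close> to \<open>inv d\<close>.\<close>

lemma Sigma_separates:
  assumes p: "p \<in> critical" and c: "c \<in> B \<inter> pp {p}" "c \<noteq> \<one>"
  shows "\<exists>\<sigma>\<in>Sig. \<theta> \<sigma> c \<noteq> \<one>"
proof -
  have pr: "prime p" using p by (rule critical_prime)
  have cc: "c \<in> carrier G" using c B_carrier by blast
  obtain d where d: "d \<in> D" "d \<in> pp {p}" "ord d = p ^ Suc 0" using D_element_of_order[OF p, of 0] by blast
  have dc: "d \<in> carrier G" using d D_carrier by blast
  obtain l where "ord c = p ^ Suc l" using nontrivial_ord[OF pr, of c] c by blast
  then have pc: "p dvd ord c" by simp
  define C where "C = generate G {c \<otimes> d}"
  have C: "subgroup C G" unfolding C_def using cc dc by (simp add: subgroup_cyclic)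
  \<comment> \<open>A power of \<open>c \<otimes> d\<close> that lies in \<open>D\<close> has
    trivial \<open>B\<close>-factor \<open>c [^] j\<close>; then \<open>ord c\<close> divides
    \<open>j\<close>, and so does its divisor \<open>p\<close>, the order of
    \<open>d\<close>.\<close>
  have "C \<inter> D \<subseteq> {\<one>}"
  proof
    fix y assume y: "y \<in> C \<inter> D"
    then obtain j :: int where j: "y = (c \<otimes> d) [^] j" using cc dc by (auto simp: C_def mem_generate_iff)
    have yj: "y = c [^] j \<otimes> d [^] j" using j cc dc by (simp add: int_pow_distrib)
    have dj: "d [^] j \<in> D" using subgroup_int_pow_closed[OF D_subgroup d(1)] .
    have "c [^] j = y \<otimes> inv (d [^] j)" unfolding yj using cc dc by (simp add: m_assoc)
    also have "\<dots> \<in> D" using y dj subgroup.m_closed[OF D_subgroup _ subgroup.m_inv_closed[OF D_subgroup dj]] by blast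
    finally have cj: "c [^] j = \<one>" using DB_trivial subgroup_int_pow_closed[OF B_subgroup] c(1) by blast
    then have "int (ord c) dvd j" using int_pow_eq_id[OF cc] by blast
    then have "int (ord d) dvd j" using pc d(3) by (metis dvd_trans int_dvd_int_iff power_one_right One_nat_def)
    then have "d [^] j = \<one>" using int_pow_eq_id[OF dc] by blast
    then show "y \<in> {\<one>}" using yj cj by simp
  qed
  then obtain B' where B': "C \<subseteq> B'" "complementary D B'"
    using divisible_complement[OF ord_pos D_subgroup D_divisible C] by blast
  define e where "e = proj D B'"
  have eh: "e \<in> hom G G" unfolding e_def by (rule proj_hom[OF B'(2)])
  have "e c = inv d"
  proof -
    have "e (c \<otimes> d) = \<one>"
      unfolding e_def using proj_on_right[OF B'(2)] B'(1) cyclic_self[of "c \<otimes> d"] cc dc by (auto simp: C_def)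
    moreover have "e d = d" unfolding e_def by (rule proj_on_left[OF B'(2) d(1)])
    ultimately have "e c \<otimes> d = \<one>" using endo_mult[OF eh cc dc] by simp
    then show ?thesis using inv_equality[OF _ dc endo_closed[OF eh cc]] by simp
  qed
  moreover have "d \<noteq> \<one>" using d(3) pr ord_id by (metis One_nat_def not_prime_1 power_one_right)
  ultimately have ec: "e c \<noteq> \<one>" using dc by simp
  \<comment> \<open>Passing through \<open>bpart\<close> makes the map vanish on \<open>D\<close>
    and off \<open>p\<close>, and gives it finite image: its values are killed by
    \<open>p ^ m\<close>, and \<open>D\<close> has finite torsion.\<close>
  define \<eta> where "\<eta> x = e (bpart p x)" for x
  have \<eta>h: "\<eta> \<in> hom G G" unfolding \<eta>_def[abs_def] by (rule endo_comp[OF eh bpart_hom])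
  have \<eta>c: "\<eta> x \<in> carrier G" if "x \<in> carrier G" for x using endo_closed[OF \<eta>h that] .
  have \<eta>mem: "\<eta> x \<in> D" if "x \<in> carrier G" for x
    unfolding \<eta>_def e_def by (rule decompose(1)[OF B'(2) bpart_closed[OF that]])
  have \<eta>D: "\<eta> x = \<one>" if "x \<in> D" for x unfolding \<eta>_def using bpart_D[OF that] endo_one[OF eh] by simp
  have \<eta>\<eta>: "\<eta> (x \<otimes> y) = \<eta> x" if "x \<in> carrier G" "y \<in> D" for x y
    using endo_mult[OF \<eta>h that(1) D_carrier[OF that(2)]] \<eta>D[OF that(2)] \<eta>c[OF that(1)] by simp
  \<comment> \<open>\<eta> takes values in \<open>D\<close> and vanishes on \<open>D\<close>, so its
    square is trivial and changing its sign gives the inverse map \<tau>.\<close>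
  define \<sigma> where "\<sigma> = (\<lambda>x\<in>carrier G. x \<otimes> \<eta> x)"
  define \<tau> where "\<tau> = (\<lambda>x\<in>carrier G. x \<otimes> inv (\<eta> x))"
  have "(\<lambda>x. x \<otimes> \<eta> x) \<in> hom G G" by (rule hom_product[OF _ \<eta>h]) (simp add: hom_def)
  then have \<sigma>h: "\<sigma> \<in> hom G G" by (auto simp: \<sigma>_def hom_def)
  have "bij_betw \<sigma> (carrier G) (carrier G)"
  proof (rule bij_betw_byWitness[where f' = \<tau>])
    have 1: "\<tau> (\<sigma> x) = x" if x: "x \<in> carrier G" for x
      using x \<eta>c[OF x] \<eta>\<eta>[OF x \<eta>mem[OF x]] by (simp add: \<sigma>_def \<tau>_def m_assoc)
    then show "\<forall>x\<in>carrier G. \<tau> (\<sigma> x) = x" by blast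
    have 2: "\<sigma> (\<tau> x) = x" if x: "x \<in> carrier G" for x
      using x \<eta>c[OF x] \<eta>\<eta>[OF x subgroup.m_inv_closed[OF D_subgroup \<eta>mem[OF x]]]
      by (simp add: \<sigma>_def \<tau>_def m_assoc)
    then show "\<forall>x\<in>carrier G. \<sigma> (\<tau> x) = x" by blast
    show "\<sigma> ` carrier G \<subseteq> carrier G" "\<tau> ` carrier G \<subseteq> carrier G" using \<eta>c by (auto simp: \<sigma>_def \<tau>_def)
  qed
  then have \<sigma>a: "\<sigma> \<in> auto G" using \<sigma>h by (auto simp: auto_def Bij_def \<sigma>_def)
  have \<theta>\<sigma>: "\<theta> \<sigma> x = \<eta> x" if x: "x \<in> carrier G" for x
  proof -
    have "x \<otimes> \<eta> x \<otimes> inv x = \<eta> x" using x \<eta>c[OF x] by algebra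
    then show ?thesis using x by (simp add: \<theta>_def \<sigma>_def)
  qed
  obtain m where m: "\<And>b. b \<in> B \<inter> pp {p} \<Longrightarrow> b [^] (p ^ m) = \<one>" using B_bounded[OF p] by blast
  have "(\<lambda>x. \<sigma> x \<otimes> inv x) ` carrier G \<subseteq> {x \<in> D. x [^] (p ^ m) = \<one>}"
  proof
    fix z assume "z \<in> (\<lambda>x. \<sigma> x \<otimes> inv x) ` carrier G"
    then obtain x where x: "x \<in> carrier G" "z = \<eta> x" using \<theta>\<sigma> by (auto simp: \<theta>_def)
    have "\<eta> x [^] (p ^ m) = \<one>"
      unfolding \<eta>_def using endo_nat_pow[OF eh bpart_closed[OF x(1)], of p "p ^ m"] m[OF bpart_mem[OF x(1)]]
        endo_one[OF eh] by simp
    then show "z \<in> {x \<in> D. x [^] (p ^ m) = \<one>}" using x \<eta>mem by simp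
  qed
  moreover have "finite {x \<in> D. x [^] (p ^ m) = \<one>}" using D_finite_torsion[of "p ^ m"] pr by (simp add: prime_gt_0_nat)
  ultimately have "\<sigma> \<in> FAut G" using FAutI[OF \<sigma>a] finite_subset by blast
  moreover have "\<sigma> x = x" if x: "x \<in> pp noncrit" for x
  proof -
    have "pp noncrit \<subseteq> pp (primes - {p})" using p by (intro pp_mono) auto
    then have "bpart p x = \<one>" using bpart_off x by blast
    then show ?thesis using pp_carrier[OF x] endo_one[OF eh] by (simp add: \<sigma>_def \<eta>_def)
  qed
  moreover have "\<sigma> x \<otimes> inv x \<in> D" if x: "x \<in> carrier G" for x
    using \<theta>\<sigma>[OF x] \<eta>mem[OF x] by (simp add: \<theta>_def)
  ultimately have "\<sigma> \<in> Sig" by (simp add: Sig_def)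
  moreover have "\<theta> \<sigma> c \<noteq> \<one>" using \<theta>\<sigma>[OF cc] ec bpart_id[OF c(1)] by (simp add: \<eta>_def)
  ultimately show ?thesis by blast
qed

text \<open>The quotient of \<open>f b\<close> by \<open>g b\<close> lies in
  \<open>B \<inter> pp {p}\<close> and is killed by every \<open>\<theta> s\<close>, so
  \<open>Sigma_separates\<close> makes it trivial.\<close>

lemma Psi_determined:
  assumes f: "f \<in> Psi" and g: "g \<in> Psi"
    and eq: "\<And>s x. s \<in> Sig \<Longrightarrow> x \<in> carrier G \<Longrightarrow> \<theta> s (f x) = \<theta> s (g x)"
  shows "f = g"
proof -
  have a: "f \<in> auto G" "g \<in> auto G" using f g Psi_FD FD_auto by auto
  show ?thesis
  proof (rule Delta_eqI[OF a])
    show "f x = g x" if "x \<in> D" for x using FD_fixes_D[OF Psi_FD[OF f] that] FD_fixes_D[OF Psi_FD[OF g] that] by simp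
    show "f x = g x" if "x \<in> pp noncrit" for x using f g that by (simp add: Psi_def)
    fix p b assume p: "p \<in> critical" and b: "b \<in> B \<inter> pp {p}"
    have bc: "b \<in> carrier G" using b B_carrier by blast
    have fg: "f b \<in> B" "g b \<in> B" "f b \<in> pp {p}" "g b \<in> pp {p}"
      using f g b pp_endo[OF autoD(1)[OF a(1)]] pp_endo[OF autoD(1)[OF a(2)]] by (auto simp: Psi_def)
    have fgc: "f b \<in> carrier G" "g b \<in> carrier G" using fg B_carrier by auto
    define c where "c = f b \<otimes> inv (g b)"
    have c: "c \<in> B \<inter> pp {p}"
      unfolding c_def using fg subgroup.m_closed[OF B_subgroup fg(1) subgroup.m_inv_closed[OF B_subgroup fg(2)]]
        subgroup.m_closed[OF subgroup_pp fg(3) subgroup.m_inv_closed[OF subgroup_pp fg(4)]] by blast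
    have "\<theta> s c = \<one>" if s: "s \<in> Sig" for s
    proof -
      have th: "\<theta> s \<in> hom G G" by (rule \<theta>_hom[OF Sigma_auto[OF s]])
      show ?thesis
        unfolding c_def using fgc eq[OF s bc] endo_closed[OF th fgc(2)] by (simp add: endo_mult[OF th] endo_inv[OF th])
    qed
    then have "c = \<one>" using Sigma_separates[OF p c] by blast
    then show "f b = g b" using eq_iff_quotient[OF fgc] by (simp add: c_def)
  qed
qed

lemma faithful_conj_action: "faithful_action (AG\<lparr>carrier := Psi\<rparr>) Sig (conj_action AG Sig)"
proof -
  interpret X: group AG by (rule group_AG)
  have gP: "group (AG\<lparr>carrier := Psi\<rparr>)" using subgroup.subgroup_is_group[OF subgroup_Psi group_AG] .
  have bij: "conj_action AG Sig g \<in> Bij Sig" if "g \<in> Psi" for g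
    using conj_action_bij[OF Psi_FD[OF that]] by (simp add: Bij_def conj_action_def)
  have "conj_action AG Sig \<in> hom (AG\<lparr>carrier := Psi\<rparr>) (BijGroup Sig)"
  proof (rule homI)
    show "conj_action AG Sig g \<in> carrier (BijGroup Sig)" if "g \<in> carrier (AG\<lparr>carrier := Psi\<rparr>)" for g
      using bij that by (simp add: BijGroup_def)
    fix g h assume "g \<in> carrier (AG\<lparr>carrier := Psi\<rparr>)" "h \<in> carrier (AG\<lparr>carrier := Psi\<rparr>)"
    then have gh: "g \<in> Psi" "h \<in> Psi" by auto
    have "conj_action AG Sig (g \<otimes>\<^bsub>AG\<^esub> h) = compose Sig (conj_action AG Sig g) (conj_action AG Sig h)"
    proof
      fix s show "conj_action AG Sig (g \<otimes>\<^bsub>AG\<^esub> h) s = compose Sig (conj_action AG Sig g) (conj_action AG Sig h) s"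
      proof (cases "s \<in> Sig")
        case True
        then show ?thesis
          using conj_action_compose[OF Psi_FD[OF gh(1)] Psi_FD[OF gh(2)] True] by (simp add: compose_eq)
      next
        case False
        then show ?thesis by (simp add: conj_action_def compose_def)
      qed
    qed
    then show "conj_action AG Sig (g \<otimes>\<^bsub>AG\<lparr>carrier := Psi\<rparr>\<^esub> h)
        = conj_action AG Sig g \<otimes>\<^bsub>BijGroup Sig\<^esub> conj_action AG Sig h"
      using bij gh by (simp add: BijGroup_def)
  qed
  then have "group_action (AG\<lparr>carrier := Psi\<rparr>) Sig (conj_action AG Sig)"
    using gP group_BijGroup by (simp add: group_action_def group_hom_def group_hom_axioms_def)
  moreover have "inj_on (conj_action AG Sig) Psi"
  proof (rule inj_onI)
    fix g h assume g: "g \<in> Psi" and h: "h \<in> Psi" and eq: "conj_action AG Sig g = conj_action AG Sig h"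
    \<comment> \<open>The conjugation action is composition with the inverse, so
      \<open>Psi_determined\<close> applies to the inverses.\<close>
    have "inv\<^bsub>AG\<^esub> g = inv\<^bsub>AG\<^esub> h"
    proof (rule Psi_determined)
      show "inv\<^bsub>AG\<^esub> g \<in> Psi" "inv\<^bsub>AG\<^esub> h \<in> Psi"
        using subgroup.m_inv_closed[OF subgroup_Psi] g h by auto
      show "\<theta> s ((inv\<^bsub>AG\<^esub> g) x) = \<theta> s ((inv\<^bsub>AG\<^esub> h) x)" if "s \<in> Sig" "x \<in> carrier G" for s x
        using \<theta>_conj_action[OF Psi_FD[OF g] that] \<theta>_conj_action[OF Psi_FD[OF h] that] eq by simp
    qed
    then show "g = h" using X.inv_inv FD_auto[OF Psi_FD[OF g]] FD_auto[OF Psi_FD[OF h]] by (metis carrier_AG)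
  qed
  ultimately show ?thesis
    by (simp add: faithful_action_def faithful_action_axioms_def)
qed

text \<open>The noncritical part is interpreted as a periodic abelian group of its own, so that
  finite displacement characterizes finitary maps on both sides. The displacements coincide because
  those of the critical part are trivial.\<close>

lemma FAut_part_noncrit: "FAut_part G noncrit = FAut_noncrit"
proof -
  define K where "K = G\<lparr>carrier := pp noncrit\<rparr>"
  have K: "comm_group K"
    unfolding K_def using subgroup.subgroup_is_group[OF subgroup_pp is_group]
    by (rule group.group_comm_groupI) (simp add: m_comm pp_carrier)
  interpret K: comm_group K by (rule K)
  interpret K: periodic_comm_group K
    using ord_subgroup[OF subgroup_pp, of noncrit] ord_pos pp_carrier
    by unfold_locales (auto simp: periodic_def K_def)
  have Kc [simp]: "carrier K = pp noncrit" "(\<otimes>\<^bsub>K\<^esub>) = (\<otimes>)" "\<one>\<^bsub>K\<^esub> = \<one>" by (simp_all add: K_def)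
  have Kinv: "inv\<^bsub>K\<^esub> x = inv x" if "x \<in> pp noncrit" for x
    unfolding K_def by (rule m_inv_consistent[OF subgroup_pp that])
  note c = pp_complementary[of noncrit, unfolded critical_eq]
  show ?thesis
  proof
    show "FAut_part G noncrit \<subseteq> FAut_noncrit"
    proof
      fix f assume "f \<in> FAut_part G noncrit"
      then obtain \<phi> where f: "f \<in> auto G" "\<phi> \<in> FAut K"
        "\<And>a b. a \<in> pp noncrit \<Longrightarrow> b \<in> pp critical \<Longrightarrow> f (a \<otimes> b) = \<phi> a \<otimes> b"
        unfolding FAut_part_def critical_eq K_def by blast
      have \<phi>a: "\<phi> \<in> auto K" using f(2) by (simp add: FAut_def)
      have \<phi>c: "\<phi> a \<in> pp noncrit" if "a \<in> pp noncrit" for a using K.auto_closed[OF \<phi>a] that by simp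
      have one: "\<one> \<in> pp noncrit" "\<one> \<in> pp critical" using subgroup.one_closed[OF subgroup_pp] by auto
      have fixd: "f x = x" if x: "x \<in> pp critical" for x
        using f(3)[OF one(1) x] K.endo_one[OF K.autoD(1)[OF \<phi>a]] pp_carrier[OF x] by simp
      have "(\<lambda>x. f x \<otimes> inv x) ` carrier G \<subseteq> (\<lambda>x. \<phi> x \<otimes>\<^bsub>K\<^esub> inv\<^bsub>K\<^esub> x) ` carrier K"
      proof
        fix z assume "z \<in> (\<lambda>x. f x \<otimes> inv x) ` carrier G"
        then obtain x where x: "x \<in> carrier G" "z = f x \<otimes> inv x" by blast
        define u v where "u = proj (pp noncrit) (pp critical) x" and "v = proj (pp critical) (pp noncrit) x"
        have uv: "u \<in> pp noncrit" "v \<in> pp critical" "x = u \<otimes> v" unfolding u_def v_def using decompose[OF c x(1)] by auto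
        have uc: "u \<in> carrier G" "v \<in> carrier G" "\<phi> u \<in> carrier G" using uv \<phi>c pp_carrier by auto
        have "z = (\<phi> u \<otimes> v) \<otimes> inv (u \<otimes> v)" unfolding x(2) uv(3) f(3)[OF uv(1,2)] ..
        also have "\<dots> = \<phi> u \<otimes> inv u" using uc by algebra
        finally show "z \<in> (\<lambda>x. \<phi> x \<otimes>\<^bsub>K\<^esub> inv\<^bsub>K\<^esub> x) ` carrier K" using uv(1) Kinv by auto
      qed
      then have "finite ((\<lambda>x. f x \<otimes> inv x) ` carrier G)" using K.FAutD(2)[OF f(2)] by (rule finite_subset)
      then have "f \<in> FAut G" by (rule FAutI[OF f(1)])
      then show "f \<in> FAut_noncrit" using fixd by (simp add: FAut_noncrit_def)
    qed
    show "FAut_noncrit \<subseteq> FAut_part G noncrit"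
    proof
      fix f assume "f \<in> FAut_noncrit"
      then have f: "f \<in> FAut G" "\<And>x. x \<in> pp critical \<Longrightarrow> f x = x" by (auto simp: FAut_noncrit_def)
      have a: "f \<in> auto G" using f(1) by (rule FAut_auto)
      have h: "f \<in> hom G G" using a by (rule autoD)
      define \<phi> where "\<phi> = restrict f (pp noncrit)"
      have fp: "f x \<in> pp noncrit" if "x \<in> pp noncrit" for x using pp_endo[OF h that] .
      have "\<phi> \<in> hom K K"
        using fp endo_mult[OF h] pp_carrier subgroup.m_closed[OF subgroup_pp] by (auto simp: \<phi>_def hom_def)
      moreover have "bij_betw f (pp noncrit) (pp noncrit)"
      proof (rule bij_betw_imageI)
        show "inj_on f (pp noncrit)" using inj_on_subset[OF autoD(4)[OF a]] pp_carrier by blast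
        show "f ` pp noncrit = pp noncrit"
        proof
          show "f ` pp noncrit \<subseteq> pp noncrit" using fp by blast
          show "pp noncrit \<subseteq> f ` pp noncrit"
          proof
            fix y assume y: "y \<in> pp noncrit"
            have "(inv\<^bsub>AG\<^esub> f) y \<in> pp noncrit" using pp_endo[OF autoD(1)[OF AG_inv_closed[OF a]] y] .
            then show "y \<in> f ` pp noncrit" using AG_inv_right[OF a pp_carrier[OF y]] by (metis imageI)
          qed
        qed
      qed
      then have "bij_betw \<phi> (pp noncrit) (pp noncrit)" by (simp add: \<phi>_def)
      ultimately have \<phi>a: "\<phi> \<in> auto K" by (simp add: auto_def Bij_def \<phi>_def)
      have "\<phi> \<in> FAut K"
      proof (rule K.FAutI[OF \<phi>a])
        have "(\<lambda>x. \<phi> x \<otimes>\<^bsub>K\<^esub> inv\<^bsub>K\<^esub> x) ` carrier K \<subseteq> (\<lambda>x. f x \<otimes> inv x) ` carrier G"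
          using Kinv pp_carrier by (auto simp: \<phi>_def)
        then show "finite ((\<lambda>x. \<phi> x \<otimes>\<^bsub>K\<^esub> inv\<^bsub>K\<^esub> x) ` carrier K)" using FAutD(2)[OF f(1)] by (rule finite_subset)
      qed
      moreover have "\<forall>a\<in>pp noncrit. \<forall>b\<in>pp critical. f (a \<otimes> b) = \<phi> a \<otimes> b"
        using endo_mult[OF h] f(2) pp_carrier by (simp add: \<phi>_def)
      ultimately show "f \<in> FAut_part G noncrit"
        unfolding FAut_part_def critical_eq K_def using a by blast
    qed
  qed
qed

text \<open>If \<open>D\<close> is trivial there are no critical primes, since each of them
  contributes a nontrivial \<open>D \<inter> pp {p}\<close>; an element of \<Delta> then has nothing
  left to move.\<close>

lemma Delta_reduced:
  assumes "reduced G"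
  shows "Delta = {\<one>\<^bsub>AG\<^esub>}"
proof -
  have "D \<subseteq> {\<one>}" using assms D_max by (simp add: reduced_def)
  then have D1: "D = {\<one>}" using subgroup.one_closed[OF D_subgroup] by blast
  have "critical = {}"
  proof (rule ccontr)
    assume "critical \<noteq> {}"
    then obtain p where "p \<in> critical" by blast
    moreover have "D \<inter> pp {p} = {\<one>}" using D1 subgroup.one_closed[OF subgroup_pp] by blast
    ultimately show False using D_primary by blast
  qed
  moreover have "\<epsilon> = \<one>\<^bsub>AG\<^esub>" if e: "\<epsilon> \<in> Delta" and cr: "critical = {}" for \<epsilon>
  proof (rule Delta_eqI[OF Delta_auto[OF e] AG_one_closed])
    show "\<epsilon> x = \<one>\<^bsub>AG\<^esub> x" if "x \<in> D" for x
      using e that AG_one_apply[OF D_carrier[OF that]] by (simp add: Delta_def)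
    show "\<epsilon> x = \<one>\<^bsub>AG\<^esub> x" if "x \<in> pp noncrit" for x
      using e that AG_one_apply[OF pp_carrier[OF that]] by (simp add: Delta_def)
  qed (use cr in simp)
  ultimately show ?thesis using subgroup.one_closed[OF subgroup_Delta] by blast
qed

end

theorem theoremA:
  fixes A :: "('a, 'b) monoid_scheme"
  assumes "comm_group A" and "periodic A"
  shows "\<exists>\<Delta>. subgroup \<Delta> (AutoGroup A\<lparr>carrier := IAut A\<rparr>) \<and>
    direct_product_of_finite_abelian (AutoGroup A\<lparr>carrier := \<Delta>\<rparr>) \<and>
    IAut A = PAut A <#>\<^bsub>AutoGroup A\<^esub> FAut A <#>\<^bsub>AutoGroup A\<^esub> \<Delta> \<and>
    (reduced A \<longrightarrow> \<Delta> = {\<one>\<^bsub>AutoGroup A\<^esub>}) \<and>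
    (\<exists>\<pi> \<Sigma> \<Psi>. \<pi> \<subseteq> primes \<and>
      subgroup \<Sigma> (AutoGroup A\<lparr>carrier := IAut A\<rparr>) \<and>
      subgroup \<Psi> (AutoGroup A\<lparr>carrier := IAut A\<rparr>) \<and>
      comm_group (AutoGroup A\<lparr>carrier := \<Sigma>\<rparr>) \<and>
      pi_group (primes - \<pi>) (AutoGroup A\<lparr>carrier := \<Sigma>\<rparr>) \<and>
      bounded_primary_components (AutoGroup A\<lparr>carrier := \<Sigma>\<rparr>) \<and>
      internal_semidirect_product (AutoGroup A) (\<Sigma> <#>\<^bsub>AutoGroup A\<^esub> \<Psi>) \<Sigma> \<Psi> \<and>
      internal_direct_product (AutoGroup A)
        (FAut A <#>\<^bsub>AutoGroup A\<^esub> \<Delta>) (FAut_part A \<pi>) (\<Sigma> <#>\<^bsub>AutoGroup A\<^esub> \<Psi>) \<and>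
      (\<forall>\<psi>\<in>\<Psi>. inertial (AutoGroup A\<lparr>carrier := \<Sigma>\<rparr>) (conj_action (AutoGroup A) \<Sigma> \<psi>)) \<and>
      faithful_action (AutoGroup A\<lparr>carrier := \<Psi>\<rparr>) \<Sigma> (conj_action (AutoGroup A) \<Sigma>))"
  (is "?goal")
proof -
  interpret periodic_comm_group A
    using assms by (simp add: periodic_comm_group_def periodic_comm_group_axioms_def)
  obtain D B where "critical_setting A D B" using critical_setting_exists by blast
  then interpret C: critical_setting A D B .
  have in_IAut: "subgroup S (AutoGroup A\<lparr>carrier := IAut A\<rparr>)" if "subgroup S AG" "S \<subseteq> C.FD" for S
    using group.subgroup_incl[OF group_AG that(1) C.subgroup_IAut] that(2) C.FD_subset_IAut by blast
  have FD: "C.FD = FAut A <#>\<^bsub>AG\<^esub> C.Delta" by (rule C.FD_def)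
  have Sig: "C.Sig \<subseteq> C.FD" and Psi: "C.Psi \<subseteq> C.FD"
    using C.Sigma_subset C.Psi_subset C.FD_crit_subset by auto
  show ?goal
  proof (intro exI conjI impI)
    show "subgroup C.Delta (AG\<lparr>carrier := IAut A\<rparr>)" by (rule in_IAut[OF C.subgroup_Delta C.Delta_subset_FD])
    show "direct_product_of_finite_abelian (AG\<lparr>carrier := C.Delta\<rparr>)" by (rule C.direct_product_Delta)
    show "IAut A = PAut A <#>\<^bsub>AG\<^esub> FAut A <#>\<^bsub>AG\<^esub> C.Delta" by (rule C.IAut_eq)
    show "C.Delta = {\<one>\<^bsub>AG\<^esub>}" if "reduced A" by (rule C.Delta_reduced[OF that])
    show "primes - critical \<subseteq> primes" by blast
    show "subgroup C.Sig (AG\<lparr>carrier := IAut A\<rparr>)" by (rule in_IAut[OF C.subgroup_Sigma Sig])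
    show "subgroup C.Psi (AG\<lparr>carrier := IAut A\<rparr>)" by (rule in_IAut[OF C.subgroup_Psi Psi])
    show "comm_group (AG\<lparr>carrier := C.Sig\<rparr>)" by (rule C.comm_group_SG)
    show "pi_group (primes - (primes - critical)) (AG\<lparr>carrier := C.Sig\<rparr>)"
      unfolding C.critical_eq by (rule C.pi_group_SG)
    show "bounded_primary_components (AG\<lparr>carrier := C.Sig\<rparr>)" by (rule C.bounded_SG)
    show "internal_semidirect_product AG (C.Sig <#>\<^bsub>AG\<^esub> C.Psi) C.Sig C.Psi" by (rule C.Sigma_Psi_semidirect_product)
    show "internal_direct_product AG (FAut A <#>\<^bsub>AG\<^esub> C.Delta) (FAut_part A (primes - critical))
        (C.Sig <#>\<^bsub>AG\<^esub> C.Psi)"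
      using C.FD_direct_product unfolding FD C.FAut_part_noncrit C.FD_crit_eq .
    show "\<forall>\<psi>\<in>C.Psi. inertial (AG\<lparr>carrier := C.Sig\<rparr>) (conj_action AG C.Sig \<psi>)"
      by (intro ballI C.inertial_conj_action C.Psi_FD)
    show "faithful_action (AG\<lparr>carrier := C.Psi\<rparr>) C.Sig (conj_action AG C.Sig)"
      by (rule C.faithful_conj_action)
  qed
qed

end
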